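(* Let $\tilde f\in\mathcal GC_\mu(\Gamma)$ with $\operatorname{ind}_\Gamma\tilde f=0$. Then $\tilde f$ admits an $M$-special $\Sigma$-factorization if and only if $$\beta_{\tilde f}=2(n+1)K\bmod L,\qquad\text{where } n=\operatorname{ind}_1\tilde f=-\operatorname{ind}_2\tilde f .$$
   Context: Fix $k_0>1$, $\mu\in(0,1)$. $\Sigma$ is the compact Riemann surface of genus $1$ obtained from the curve $\tau^2=\mathfrak p(\xi)=(1+\xi^2)(k_0^2+\xi^2)$ in $\mathbb C^2$ by adding two points at infinity; $\Pi(\xi,\tau)=\xi$; functions of $\xi$ are regarded as functions on $\Sigma$ via $\Pi$. $\rho$ is the branch of $\sqrt{\mathfrak p}$, analytic off $[-ik_0,-i]\cup[i,ik_0]$, positive on $\mathbb R$. $\dot{\mathbb R}=\mathbb R\cup\{\infty\}$, $\Sigma^\pm=\Pi^{-1}(\mathbb C^\pm)$, $\Gamma=\Pi^{-1}(\dot{\mathbb R})=\Gamma_1\cup\Gamma_2$, with $\Gamma_1$ (resp. $\Gamma_2$) the closure of $\{(\xi,\rho(\xi)):\xi\in\mathbb R\}$ (resp. $\{(\xi,-\rho(\xi))\}$), both oriented by increasing $\xi$, so $\int_\Gamma\frac{h}{\tau}d\xi=\int_{\mathbb R}\frac{h|_{\Gamma_1}-h|_{\Gamma_2}}{\rho}d\xi$. $\infty_j$ is the point at infinity on $\Gamma_j$. $C_\mu(\dot{\mathbb R})$: continuous functions on $\dot{\mathbb R}$ satisfying a Hölder condition of exponent $\mu$ (Hölder after transplanting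 to the unit circle by $\xi\mapsto(\xi-i)/(\xi+i)$). $C_\mu(\Gamma)$: functions on $\Gamma$ whose restrictions to $\Gamma_1,\Gamma_2$, viewed via $\Pi$ on $\dot{\mathbb R}$, are in $C_\mu(\dot{\mathbb R})$. $C_\mu^\pm(\Gamma)$: elements of $C_\mu(\Gamma)$ extending continuously to $\Sigma^\pm\cup\Gamma$ and analytically to $\Sigma^\pm$. $\mathcal G\mathcal A$: invertible elements of $\mathcal A$. $\operatorname{ind}_jf$: winding number about $0$ of $f|_{\Gamma_j}$; $\operatorname{ind}_\Gamma f=\operatorname{ind}_1f+\operatorname{ind}_2f$. $K=\int_0^1\frac{dx}{\sqrt{(1-x^2)(1-x^2/k_0^2)}}$, $K'=\int_1^{k_0}\frac{dx}{\sqrt{(x^2-1)(1-x^2/k_0^2)}}$, $L=4K\mathbb Z+2iK'\mathbb Z$. $\beta_f=\frac{k_0}{2\pi}\int_\Gamma\frac{\log f}{\tau}d\xi$, where $\log f$ is a branch continuous on each $\Gamma_j\setminus\{\infty_j\}$; $\beta_f$ is well defined mod $L$. $\alpha_+(\xi,\tau)=C+\frac{\tau}{(\xi-i)\rho_+}$, $\alpha_-(\xi,\tau)=C+\frac{\tau}{(\xi+i)\rho_-}$, $C=\sqrt{(1+k_0)/2}$, where $\rho_+$ is the branch of $\sqrt{(\xi+i)(\xi+ik_0)}$ analytic off $[-ik_0,-i]$ with value $i\sqrt{k_0}$ at $0$, and $\rho_-$ the branch of $\sqrt{(\xi-i)(\xi-ik_0)}$ analytic off $[i,ik_0]$ with value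 $-i\sqrt{k_0}$ at $0$. An $M$-special $\Sigma$-factorization of $f$ is a representation $f=(F_+\alpha_+)(\alpha_-F_-)$ with $F_\pm\in\mathcal GC_\mu^\pm(\Gamma)$. *)

theory Defs
  imports "HOL-Complex_Analysis.Complex_Analysis"
begin

section \<open>The elliptic curve\<close>

definition curve_poly :: "real \<Rightarrow> complex \<Rightarrow> complex" where
  "curve_poly k \<xi> = (1 + \<xi>\<^sup>2) * ((of_real k)\<^sup>2 + \<xi>\<^sup>2)"

text \<open>
  The reversed polynomial: in the coordinates u = 1/\<xi>, v = \<tau>/\<xi>^2 the curve reads v^2 = curve_poly_rev k u,
  and its two points over u = 0 are (0, 1) and (0, -1).
\<close>
definition curve_poly_rev :: "real \<Rightarrow> complex \<Rightarrow> complex" where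
  "curve_poly_rev k u = (1 + u\<^sup>2) * (1 + (of_real k)\<^sup>2 * u\<^sup>2)"

datatype sheet = S1 | S2

fun sheet_sign :: "sheet \<Rightarrow> complex" where
  "sheet_sign S1 = 1"
| "sheet_sign S2 = -1"

datatype curve_point = Aff complex complex | Infty sheet

definition affine_curve :: "real \<Rightarrow> (complex \<times> complex) set" where
  "affine_curve k = {(\<xi>, \<tau>). \<tau>\<^sup>2 = curve_poly k \<xi>}"

definition infinity_curve :: "real \<Rightarrow> (complex \<times> complex) set" where
  "infinity_curve k = {(u, v). v\<^sup>2 = curve_poly_rev k u}"

definition aff_point :: "complex \<times> complex \<Rightarrow> curve_point" where
  "aff_point z = Aff (fst z) (snd z)"

text \<open>
  The branch of the square root that is positive on the real axis satisfies \<rho>(\<xi>)/\<xi>^2 \<rightarrow> 1,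
  so the point (0, 1) of the chart at infinity belongs to the first sheet.
\<close>
definition inf_point :: "complex \<times> complex \<Rightarrow> curve_point" where
  "inf_point w = (let u = fst w; v = snd w in
     if u \<noteq> 0 then Aff (1 / u) (v / u\<^sup>2) else Infty (if v = 1 then S1 else S2))"

definition surface :: "real \<Rightarrow> curve_point set" where
  "surface k = aff_point ` affine_curve k \<union> range Infty"

text \<open>The surface carries the topology glued from the two affine curves.\<close>
definition surface_open :: "real \<Rightarrow> curve_point set \<Rightarrow> bool" where
  "surface_open k U \<longleftrightarrow> U \<subseteq> surface k
     \<and> openin (top_of_set (affine_curve k)) {z \<in> affine_curve k. aff_point z \<in> U}
     \<and> openin (top_of_set (infinity_curve k)) {w \<in> infinity_curve k. inf_point w \<in> U}"

definition surface_top :: "real \<Rightarrow> curve_point topology" where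
  "surface_top k = topology (surface_open k)"

lemma istopology_surface_open: "istopology (surface_open k)"
  unfolding istopology_def
proof (intro conjI allI impI)
  fix S T assume "surface_open k S" "surface_open k T"
  moreover have "{z \<in> A. f z \<in> S \<inter> T} = {z \<in> A. f z \<in> S} \<inter> {z \<in> A. f z \<in> T}"
    for A and f :: "complex \<times> complex \<Rightarrow> curve_point" by auto
  ultimately show "surface_open k (S \<inter> T)"
    unfolding surface_open_def by (auto intro: openin_Int)
next
  fix \<K> assume K: "\<forall>K\<in>\<K>. surface_open k K"
  have "{z \<in> A. f z \<in> \<Union>\<K>} = \<Union> ((\<lambda>K. {z \<in> A. f z \<in> K}) ` \<K>)"
    for A and f :: "complex \<times> complex \<Rightarrow> curve_point" by auto
  with K show "surface_open k (\<Union>\<K>)"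
    unfolding surface_open_def by (auto intro!: openin_Union)
qed

lemma openin_surface_top: "openin (surface_top k) U \<longleftrightarrow> surface_open k U"
  unfolding surface_top_def using istopology_surface_open by (simp add: topology_inverse')

text \<open>
  The complex structure: the local coordinate is \<xi> away from the branch points,
  \<tau> at the branch points, and 1/\<xi> at the points at infinity.  In each case the
  local inverse of the coordinate is a function \<open>s\<close>.
\<close>
fun analytic_at_point :: "real \<Rightarrow> (curve_point \<Rightarrow> complex) \<Rightarrow> curve_point \<Rightarrow> bool" where
  "analytic_at_point k F (Aff \<xi>0 \<tau>0) =
     (if \<tau>0 \<noteq> 0 then
        \<exists>U s. open U \<and> \<xi>0 \<in> U \<and> s holomorphic_on U \<and> s \<xi>0 = \<tau>0
          \<and> (\<forall>\<xi>\<in>U. (s \<xi>)\<^sup>2 = curve_poly k \<xi>)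
          \<and> (\<lambda>\<xi>. F (Aff \<xi> (s \<xi>))) holomorphic_on U
      else
        \<exists>U s. open U \<and> 0 \<in> U \<and> s holomorphic_on U \<and> s 0 = \<xi>0
          \<and> (\<forall>\<tau>\<in>U. \<tau>\<^sup>2 = curve_poly k (s \<tau>))
          \<and> (\<lambda>\<tau>. F (Aff (s \<tau>) \<tau>)) holomorphic_on U)"
| "analytic_at_point k F (Infty j) =
     (\<exists>U s. open U \<and> 0 \<in> U \<and> s holomorphic_on U \<and> s 0 = sheet_sign j
        \<and> (\<forall>u\<in>U. (s u)\<^sup>2 = curve_poly_rev k u)
        \<and> (\<lambda>u. F (inf_point (u, s u))) holomorphic_on U)"

definition analytic_on_surface ::
    "real \<Rightarrow> curve_point set \<Rightarrow> (curve_point \<Rightarrow> complex) \<Rightarrow> bool" where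
  "analytic_on_surface k D F \<longleftrightarrow> (\<forall>P\<in>D. analytic_at_point k F P)"

definition surface_plus :: "real \<Rightarrow> curve_point set" where
  "surface_plus k = {Aff \<xi> \<tau> |\<xi> \<tau>. (\<xi>, \<tau>) \<in> affine_curve k \<and> Im \<xi> > 0}"

definition surface_minus :: "real \<Rightarrow> curve_point set" where
  "surface_minus k = {Aff \<xi> \<tau> |\<xi> \<tau>. (\<xi>, \<tau>) \<in> affine_curve k \<and> Im \<xi> < 0}"


section \<open>The branches of the square roots\<close>

definition upper_slit :: "real \<Rightarrow> complex set" where
  "upper_slit k = closed_segment \<i> (\<i> * of_real k)"

definition lower_slit :: "real \<Rightarrow> complex set" where
  "lower_slit k = closed_segment (- \<i> * of_real k) (- \<i>)"

definition is_rho :: "real \<Rightarrow> (complex \<Rightarrow> complex) \<Rightarrow> bool" where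
  "is_rho k r \<longleftrightarrow> r holomorphic_on - (lower_slit k \<union> upper_slit k)
     \<and> (\<forall>\<xi> \<in> - (lower_slit k \<union> upper_slit k). (r \<xi>)\<^sup>2 = curve_poly k \<xi>)
     \<and> (\<forall>x::real. \<exists>y>0. r (of_real x) = of_real y)"

definition is_rho_plus :: "real \<Rightarrow> (complex \<Rightarrow> complex) \<Rightarrow> bool" where
  "is_rho_plus k r \<longleftrightarrow> r holomorphic_on - lower_slit k
     \<and> (\<forall>\<xi> \<in> - lower_slit k. (r \<xi>)\<^sup>2 = (\<xi> + \<i>) * (\<xi> + \<i> * of_real k))
     \<and> r 0 = \<i> * of_real (sqrt k)"

definition is_rho_minus :: "real \<Rightarrow> (complex \<Rightarrow> complex) \<Rightarrow> bool" where
  "is_rho_minus k r \<longleftrightarrow> r holomorphic_on - upper_slit k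
     \<and> (\<forall>\<xi> \<in> - upper_slit k. (r \<xi>)\<^sup>2 = (\<xi> - \<i>) * (\<xi> - \<i> * of_real k))
     \<and> r 0 = - \<i> * of_real (sqrt k)"

text \<open>These exist and are unique off the slits; their values on the slits are irrelevant below.\<close>
definition rho :: "real \<Rightarrow> complex \<Rightarrow> complex" where
  "rho k = (SOME r. is_rho k r)"

definition rho_plus :: "real \<Rightarrow> complex \<Rightarrow> complex" where
  "rho_plus k = (SOME r. is_rho_plus k r)"

definition rho_minus :: "real \<Rightarrow> complex \<Rightarrow> complex" where
  "rho_minus k = (SOME r. is_rho_minus k r)"


section \<open>The contour and function spaces on it\<close>

definition contour :: "real \<Rightarrow> sheet \<Rightarrow> curve_point set" where
  "contour k j = surface_top k closure_of
     range (\<lambda>x::real. Aff (of_real x) (sheet_sign j * rho k (of_real x)))"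

definition Gamma_curve :: "real \<Rightarrow> curve_point set" where
  "Gamma_curve k = contour k S1 \<union> contour k S2"

text \<open>The one-point compactification of the real line is \<open>real option\<close>, with \<open>None\<close> as infinity.\<close>
fun contour_point :: "real \<Rightarrow> sheet \<Rightarrow> real option \<Rightarrow> curve_point" where
  "contour_point k j None = Infty j"
| "contour_point k j (Some x) = Aff (of_real x) (sheet_sign j * rho k (of_real x))"

fun cayley :: "real option \<Rightarrow> complex" where
  "cayley None = 1"
| "cayley (Some x) = (of_real x - \<i>) / (of_real x + \<i>)"

text \<open>Continuity on the compactified line is implied by the Hoelder condition, as \<open>\<mu> > 0\<close>.\<close>
definition holder_line :: "real \<Rightarrow> (real option \<Rightarrow> complex) set" where
  "holder_line \<mu> = {g. \<exists>M. \<forall>x y. norm (g x - g y) \<le> M * norm (cayley x - cayley y) powr \<mu>}"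

text \<open>
  Functions on the contour are represented by functions on all points; only their values on
  the contour matter, and identities between them are understood on the contour.
\<close>
definition holder_Gamma :: "real \<Rightarrow> real \<Rightarrow> (curve_point \<Rightarrow> complex) set" where
  "holder_Gamma k \<mu> = {f. \<forall>j. (\<lambda>x. f (contour_point k j x)) \<in> holder_line \<mu>}"

definition extendable :: "real \<Rightarrow> real \<Rightarrow> curve_point set \<Rightarrow> (curve_point \<Rightarrow> complex) set" where
  "extendable k \<mu> D = {f \<in> holder_Gamma k \<mu>. \<exists>F.
      (\<forall>P\<in>Gamma_curve k. F P = f P)
      \<and> continuous_map (subtopology (surface_top k) (D \<union> Gamma_curve k)) euclidean F
      \<and> analytic_on_surface k D F}"

definition holder_plus :: "real \<Rightarrow> real \<Rightarrow> (curve_point \<Rightarrow> complex) set" where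
  "holder_plus k \<mu> = extendable k \<mu> (surface_plus k)"

definition holder_minus :: "real \<Rightarrow> real \<Rightarrow> (curve_point \<Rightarrow> complex) set" where
  "holder_minus k \<mu> = extendable k \<mu> (surface_minus k)"

definition invertibles ::
    "real \<Rightarrow> (curve_point \<Rightarrow> complex) set \<Rightarrow> (curve_point \<Rightarrow> complex) set" where
  "invertibles k A = {f \<in> A. \<exists>g\<in>A. \<forall>P\<in>Gamma_curve k. f P * g P = 1}"


section \<open>Index, periods and the class of the integral of the logarithm\<close>

text \<open>
  A parametrisation of the compactified line by the unit interval, increasing in \<xi>;
  the Cayley transform maps it to exp(2 \<pi> i t).
\<close>
definition line_loop :: "real \<Rightarrow> real option" where
  "line_loop t = (if 0 < t \<and> t < 1 then Some (- cot (pi * t)) else None)"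

definition ind_contour :: "real \<Rightarrow> sheet \<Rightarrow> (curve_point \<Rightarrow> complex) \<Rightarrow> complex" where
  "ind_contour k j f = winding_number (\<lambda>t. f (contour_point k j (line_loop t))) 0"

definition ind_Gamma :: "real \<Rightarrow> (curve_point \<Rightarrow> complex) \<Rightarrow> complex" where
  "ind_Gamma k f = ind_contour k S1 f + ind_contour k S2 f"

definition ell_K :: "real \<Rightarrow> real" where
  "ell_K k = integral {0..1} (\<lambda>x. 1 / sqrt ((1 - x\<^sup>2) * (1 - x\<^sup>2 / k\<^sup>2)))"

definition ell_K' :: "real \<Rightarrow> real" where
  "ell_K' k = integral {1..k} (\<lambda>x. 1 / sqrt ((x\<^sup>2 - 1) * (1 - x\<^sup>2 / k\<^sup>2)))"

definition period_lattice :: "real \<Rightarrow> complex set" where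
  "period_lattice k = {4 * of_real (ell_K k) * of_int m + 2 * \<i> * of_real (ell_K' k) * of_int n |
     m n. True}"

definition mod_lattice :: "real \<Rightarrow> complex \<Rightarrow> complex set" where
  "mod_lattice k z = (\<lambda>w. z + w) ` period_lattice k"

text \<open>The integral of \<open>h / \<tau>\<close> along the contour.\<close>
definition Gamma_integral :: "real \<Rightarrow> (curve_point \<Rightarrow> complex) \<Rightarrow> complex" where
  "Gamma_integral k h = integral UNIV (\<lambda>x::real.
     (h (contour_point k S1 (Some x)) - h (contour_point k S2 (Some x))) / rho k (of_real x))"

definition log_branch ::
    "real \<Rightarrow> (curve_point \<Rightarrow> complex) \<Rightarrow> (curve_point \<Rightarrow> complex) \<Rightarrow> bool" where
  "log_branch k f l \<longleftrightarrow> (\<forall>j.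
     continuous_map (subtopology (surface_top k) (contour k j - {Infty j})) euclidean l
     \<and> (\<forall>P \<in> contour k j - {Infty j}. exp (l P) = f P))"

text \<open>
  An element of the quotient of the complex numbers by the period lattice, given as a coset.
  All branches of the logarithm yield the same coset, so the union is that coset.
\<close>
definition beta_class :: "real \<Rightarrow> (curve_point \<Rightarrow> complex) \<Rightarrow> complex set" where
  "beta_class k f =
     (\<Union>l\<in>{l. log_branch k f l}. mod_lattice k (of_real (k / (2 * pi)) * Gamma_integral k l))"


section \<open>Special factorizations\<close>

definition alpha_const :: "real \<Rightarrow> complex" where
  "alpha_const k = of_real (sqrt ((1 + k) / 2))"

text \<open>
  Both square roots are asymptotic to \<xi> at infinity, which gives the values of the
  continuous extensions at the points at infinity.
\<close>
fun alpha_plus :: "real \<Rightarrow> curve_point \<Rightarrow> complex" where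
  "alpha_plus k (Aff \<xi> \<tau>) = alpha_const k + \<tau> / ((\<xi> - \<i>) * rho_plus k \<xi>)"
| "alpha_plus k (Infty j) = alpha_const k + sheet_sign j"

fun alpha_minus :: "real \<Rightarrow> curve_point \<Rightarrow> complex" where
  "alpha_minus k (Aff \<xi> \<tau>) = alpha_const k + \<tau> / ((\<xi> + \<i>) * rho_minus k \<xi>)"
| "alpha_minus k (Infty j) = alpha_const k + sheet_sign j"

definition M_special_factorization ::
    "real \<Rightarrow> real \<Rightarrow> (curve_point \<Rightarrow> complex) \<Rightarrow> (curve_point \<Rightarrow> complex)
      \<Rightarrow> (curve_point \<Rightarrow> complex) \<Rightarrow> bool" where
  "M_special_factorization k \<mu> f Fp Fm \<longleftrightarrow>
     Fp \<in> invertibles k (holder_plus k \<mu>) \<and> Fm \<in> invertibles k (holder_minus k \<mu>)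
     \<and> (\<forall>P\<in>Gamma_curve k. f P = (Fp P * alpha_plus k P) * (alpha_minus k P * Fm P))"


section \<open>Consistency of the definitions\<close>

lemma lower_slit_Im: "k > 1 \<Longrightarrow> z \<in> lower_slit k \<Longrightarrow> Im z \<le> -1"
  using closed_segment_subset[of "- \<i> * of_real k" "{z. Im z \<le> -1}" "- \<i>"]
    convex_halfspace_Im_le[of "-1"] by (auto simp: lower_slit_def)

lemma upper_slit_Im: "k > 1 \<Longrightarrow> z \<in> upper_slit k \<Longrightarrow> Im z \<ge> 1"
  using closed_segment_subset[of "\<i>" "{z. Im z \<ge> 1}" "\<i> * of_real k"]
    convex_halfspace_Im_ge[of "1"] by (auto simp: upper_slit_def)

lemma csqrt_quotient_branch:
  fixes a b :: complex
  defines "r \<equiv> \<lambda>z. (z - b) * csqrt ((z - a) / (z - b))"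
  shows "r holomorphic_on - closed_segment b a"
    and "z \<noteq> b \<Longrightarrow> (r z)\<^sup>2 = (z - a) * (z - b)"
proof -
  have seg: "z \<in> closed_segment b a" if z: "z \<noteq> b" and n: "(z - a) / (z - b) \<in> \<real>\<^sub>\<le>\<^sub>0" for z
  proof -
    from n obtain t where t: "(z - a) / (z - b) = of_real t" "t \<le> 0"
      by (auto elim: nonpos_Reals_cases)
    define u where "u = 1 / (1 - t)"
    have u: "0 \<le> u" "u \<le> 1" "u * (1 - t) = 1" using t by (auto simp: u_def)
    have "z - a = of_real t * (z - b)" using t(1) z by (simp add: field_simps)
    hence e: "z * of_real (1 - t) = a - of_real t * b" by (simp add: algebra_simps)
    have "z = z * of_real (1 - t) * of_real u"
      by (metis u(3) mult.assoc mult.commute mult_1_right of_real_1 of_real_mult)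
    also have "\<dots> = of_real u * a - of_real (t * u) * b" unfolding e by (simp add: algebra_simps)
    also have "t * u = u - 1" using u(3) by (simp add: algebra_simps)
    finally have "z = (1 - u) *\<^sub>R b + u *\<^sub>R a" by (simp add: scaleR_conv_of_real algebra_simps)
    thus ?thesis using u by (auto simp: closed_segment_def)
  qed
  show "r holomorphic_on - closed_segment b a"
    unfolding r_def by (intro holomorphic_intros) (use seg in force)+
  show "(r z)\<^sup>2 = (z - a) * (z - b)" if "z \<noteq> b"
  proof -
    have "(r z)\<^sup>2 = (z - b)\<^sup>2 * ((z - a) / (z - b))" by (simp add: r_def power_mult_distrib)
    thus ?thesis using that by (simp add: power2_eq_square)
  qed
qed

definition rho_plus_expl :: "real \<Rightarrow> complex \<Rightarrow> complex" where
  "rho_plus_expl k z = (z + \<i> * of_real k) * csqrt ((z + \<i>) / (z + \<i> * of_real k))"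

definition rho_minus_expl :: "real \<Rightarrow> complex \<Rightarrow> complex" where
  "rho_minus_expl k z = (z - \<i> * of_real k) * csqrt ((z - \<i>) / (z - \<i> * of_real k))"

lemma csqrt_inverse_k:
  assumes "k > 1"
  shows "of_real k * csqrt (1 / of_real k) = of_real (sqrt k)"
proof -
  have "csqrt (1 / of_real k) = of_real (sqrt (1 / k))"
    using assms csqrt_of_real_nonneg[of "1 / k"] by simp
  moreover have "k * sqrt (1 / k) = sqrt k"
    using assms by (simp add: real_sqrt_divide real_div_sqrt)
  ultimately show ?thesis by (metis of_real_mult)
qed

lemma is_rho_plus_expl:
  assumes "k > 1"
  shows "is_rho_plus k (rho_plus_expl k)"
  unfolding is_rho_plus_def
proof (intro conjI ballI)
  have e: "rho_plus_expl k =
      (\<lambda>z. (z - (- \<i> * of_real k)) * csqrt ((z - (- \<i>)) / (z - (- \<i> * of_real k))))"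
    by (rule ext) (simp add: rho_plus_expl_def)
  show "rho_plus_expl k holomorphic_on - lower_slit k"
    unfolding e lower_slit_def by (rule csqrt_quotient_branch(1))
  fix z assume "z \<in> - lower_slit k"
  hence "z \<noteq> - \<i> * of_real k" unfolding lower_slit_def by auto
  from csqrt_quotient_branch(2)[OF this, of "- \<i>"]
  show "(rho_plus_expl k z)\<^sup>2 = (z + \<i>) * (z + \<i> * of_real k)" unfolding e by simp
next
  show "rho_plus_expl k 0 = \<i> * of_real (sqrt k)"
    using csqrt_inverse_k[OF assms] assms by (simp add: rho_plus_expl_def)
qed

lemma is_rho_minus_expl:
  assumes "k > 1"
  shows "is_rho_minus k (rho_minus_expl k)"
  unfolding is_rho_minus_def
proof (intro conjI ballI)
  show "rho_minus_expl k holomorphic_on - upper_slit k"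
    using csqrt_quotient_branch(1)[of "\<i> * of_real k" \<i>]
    unfolding rho_minus_expl_def[abs_def] upper_slit_def by (simp add: closed_segment_commute)
  fix z assume "z \<in> - upper_slit k"
  hence "z \<noteq> \<i> * of_real k" unfolding upper_slit_def by auto
  from csqrt_quotient_branch(2)[OF this, of "\<i>"]
  show "(rho_minus_expl k z)\<^sup>2 = (z - \<i>) * (z - \<i> * of_real k)"
    unfolding rho_minus_expl_def by simp
next
  show "rho_minus_expl k 0 = - \<i> * of_real (sqrt k)"
    using csqrt_inverse_k[OF assms] assms by (simp add: rho_minus_expl_def)
qed

lemma curve_poly_factor:
  "((z + \<i>) * (z + \<i> * of_real k)) * ((z - \<i>) * (z - \<i> * of_real k)) = curve_poly k z"
proof -
  have "((z + \<i>) * (z + \<i> * of_real k)) * ((z - \<i>) * (z - \<i> * of_real k))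
      = ((z + \<i>) * (z - \<i>)) * ((z + \<i> * of_real k) * (z - \<i> * of_real k))"
    by (simp only: mult_ac)
  also have "(z + \<i>) * (z - \<i>) = 1 + z\<^sup>2"
    by (simp add: algebra_simps power2_eq_square)
  also have "(z + \<i> * of_real k) * (z - \<i> * of_real k) = (of_real k)\<^sup>2 + z\<^sup>2"
    using i_squared by (simp add: algebra_simps power2_eq_square)
  finally show ?thesis by (simp add: curve_poly_def)
qed

lemma is_rho_expl:
  assumes "k > 1"
  shows "is_rho k (\<lambda>z. rho_plus_expl k z * rho_minus_expl k z)"
  unfolding is_rho_def
proof (intro conjI ballI allI)
  note p = is_rho_plus_expl[OF assms, unfolded is_rho_plus_def]
  note m = is_rho_minus_expl[OF assms, unfolded is_rho_minus_def]
  show "(\<lambda>z. rho_plus_expl k z * rho_minus_expl k z) holomorphic_on - (lower_slit k \<union> upper_slit k)"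
    using p m by (intro holomorphic_on_mult) (auto elim: holomorphic_on_subset)
  show "(rho_plus_expl k z * rho_minus_expl k z)\<^sup>2 = curve_poly k z"
    if "z \<in> - (lower_slit k \<union> upper_slit k)" for z
    using p m that curve_poly_factor[of z k] by (simp add: power_mult_distrib)
  fix x :: real
  define w where "w = (of_real x + \<i>) / (of_real x + \<i> * of_real k)"
  have nz: "of_real x + \<i> * of_real k \<noteq> 0" "of_real x + \<i> \<noteq> 0"
    using assms by (auto simp: complex_eq_iff)
  have Rew: "Re w > 0"
  proof -
    have n: "x\<^sup>2 + k\<^sup>2 > 0" using assms by (simp add: add_nonneg_pos)
    have "Re w = (x * x + k) / (x\<^sup>2 + k\<^sup>2)" by (simp add: w_def Re_divide)
    thus "Re w > 0" using n assms by (simp add: add_nonneg_pos)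
  qed
  have c: "(of_real x - \<i>) / (of_real x - \<i> * of_real k) = cnj w" by (simp add: w_def)
  have nn: "w \<notin> \<real>\<^sub>\<le>\<^sub>0" using Rew by (auto simp: complex_nonpos_Reals_iff)
  have "rho_plus_expl k (of_real x) * rho_minus_expl k (of_real x) =
      ((of_real x + \<i> * of_real k) * cnj (of_real x + \<i> * of_real k)) * (csqrt w * cnj (csqrt w))"
    unfolding rho_plus_expl_def rho_minus_expl_def c w_def[symmetric] cnj_csqrt[OF nn]
    by (simp add: mult_ac)
  also have "\<dots> = of_real ((norm (of_real x + \<i> * of_real k))\<^sup>2 * (norm (csqrt w))\<^sup>2)"
    by (simp only: of_real_mult complex_norm_square)
  finally show "\<exists>y>0. rho_plus_expl k (of_real x) * rho_minus_expl k (of_real x) = of_real y"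
    using nz nn by (intro exI[of _ "(norm (of_real x + \<i> * of_real k))\<^sup>2 * (norm (csqrt w))\<^sup>2"] conjI)
      (auto intro!: mult_pos_pos)
qed

lemma is_rho_rho: "k > 1 \<Longrightarrow> is_rho k (rho k)"
  unfolding rho_def by (rule someI[where P = "is_rho k"], rule is_rho_expl)

lemma is_rho_plus_rho_plus: "k > 1 \<Longrightarrow> is_rho_plus k (rho_plus k)"
  unfolding rho_plus_def by (rule someI[where P = "is_rho_plus k"], rule is_rho_plus_expl)

lemma is_rho_minus_rho_minus: "k > 1 \<Longrightarrow> is_rho_minus k (rho_minus k)"
  unfolding rho_minus_def by (rule someI[where P = "is_rho_minus k"], rule is_rho_minus_expl)

lemma square_roots_agree:
  fixes f g :: "complex \<Rightarrow> complex"
  assumes "connected S" "continuous_on S f" "continuous_on S g"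
    and sq: "\<And>z. z \<in> S \<Longrightarrow> (f z)\<^sup>2 = (g z)\<^sup>2" and nz: "\<And>z. z \<in> S \<Longrightarrow> g z \<noteq> 0"
    and "z0 \<in> S" "f z0 = g z0" "z \<in> S"
  shows "f z = g z"
proof -
  have "(\<lambda>z. f z / g z) ` S \<subseteq> {1, -1}"
  proof
    fix w assume "w \<in> (\<lambda>z. f z / g z) ` S"
    then obtain z where z: "z \<in> S" "w = f z / g z" by auto
    hence "w\<^sup>2 = 1" using sq[of z] nz[of z] by (simp add: power_divide)
    thus "w \<in> {1, -1}" by (simp add: power2_eq_1_iff)
  qed
  hence "finite ((\<lambda>z. f z / g z) ` S)" by (rule finite_subset) simp
  hence "(\<lambda>z. f z / g z) constant_on S"
    using assms by (intro continuous_finite_range_constant continuous_intros) auto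
  then obtain c where c: "\<And>z. z \<in> S \<Longrightarrow> f z / g z = c" by (auto simp: constant_on_def)
  from c[of z0] c[of z] show ?thesis using assms nz[of z0] nz[of z] by (simp add: field_simps)
qed

lemma connected_compl_segment: "connected (- closed_segment a (b::complex))"
  by (rule connected_complement_bounded_convex) (auto simp: bounded_closed_segment)

lemma rho_plus_unique:
  assumes k: "k > 1" and r: "is_rho_plus k r" and z: "z \<notin> lower_slit k"
  shows "r z = rho_plus_expl k z"
proof (rule square_roots_agree[where f = r and g = "rho_plus_expl k" and S = "- lower_slit k" and ?z0.0 = 0])
  show "connected (- lower_slit k)"
    unfolding lower_slit_def by (rule connected_compl_segment)
  show "0 \<in> - lower_slit k" using lower_slit_Im[OF k, of 0] by auto
  fix w assume w: "w \<in> - lower_slit k"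
  note e = is_rho_plus_expl[OF k, unfolded is_rho_plus_def]
  show "(r w)\<^sup>2 = (rho_plus_expl k w)\<^sup>2" using r e w by (simp add: is_rho_plus_def)
  have "w \<noteq> - \<i>" "w \<noteq> - \<i> * of_real k" using w by (auto simp: lower_slit_def)
  hence "(w + \<i>) * (w + \<i> * of_real k) \<noteq> 0" by (auto simp: add_eq_0_iff2 add_eq_0_iff)
  thus "rho_plus_expl k w \<noteq> 0" using e w by (metis power_zero_numeral)
qed (use r z is_rho_plus_expl[OF k] in \<open>auto simp: is_rho_plus_def intro: holomorphic_on_imp_continuous_on\<close>)

lemma rho_minus_unique:
  assumes k: "k > 1" and r: "is_rho_minus k r" and z: "z \<notin> upper_slit k"
  shows "r z = rho_minus_expl k z"
proof (rule square_roots_agree[where f = r and g = "rho_minus_expl k" and S = "- upper_slit k" and ?z0.0 = 0])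
  show "connected (- upper_slit k)"
    unfolding upper_slit_def by (rule connected_compl_segment)
  show "0 \<in> - upper_slit k" using upper_slit_Im[OF k, of 0] by auto
  fix w assume w: "w \<in> - upper_slit k"
  note e = is_rho_minus_expl[OF k, unfolded is_rho_minus_def]
  show "(r w)\<^sup>2 = (rho_minus_expl k w)\<^sup>2" using r e w by (simp add: is_rho_minus_def)
  have "w \<noteq> \<i>" "w \<noteq> \<i> * of_real k" using w by (auto simp: upper_slit_def)
  hence "(w - \<i>) * (w - \<i> * of_real k) \<noteq> 0" by auto
  thus "rho_minus_expl k w \<noteq> 0" using e w by (metis power_zero_numeral)
qed (use r z is_rho_minus_expl[OF k] in \<open>auto simp: is_rho_minus_def intro: holomorphic_on_imp_continuous_on\<close>)

lemma is_rho_of_real: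
  assumes k: "k > 1" and r: "is_rho k r"
  shows "r (of_real x) = of_real (sqrt ((1 + x\<^sup>2) * (k\<^sup>2 + x\<^sup>2)))"
proof -
  obtain y where y: "y > 0" "r (of_real x) = of_real y"
    using r unfolding is_rho_def by blast
  have "of_real x \<notin> lower_slit k \<union> upper_slit k"
    using lower_slit_Im[OF k, of "of_real x"] upper_slit_Im[OF k, of "of_real x"] by auto
  hence "(r (of_real x))\<^sup>2 = curve_poly k (of_real x)"
    using r unfolding is_rho_def by blast
  hence "complex_of_real (y\<^sup>2) = of_real ((1 + x\<^sup>2) * (k\<^sup>2 + x\<^sup>2))"
    by (simp add: y curve_poly_def)
  hence "y\<^sup>2 = (1 + x\<^sup>2) * (k\<^sup>2 + x\<^sup>2)" using of_real_eq_iff by blast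
  thus ?thesis using y by (metis order_less_imp_le real_sqrt_unique)
qed

lemmas rho_of_real = is_rho_of_real[OF _ is_rho_rho]

lemma curve_poly_rev_inverse: "u \<noteq> 0 \<Longrightarrow> curve_poly k (1 / u) = curve_poly_rev k u / u ^ 4"
  by (simp add: curve_poly_def curve_poly_rev_def field_simps power2_eq_square power4_eq_xxxx)

lemma inf_point_in_surface:
  assumes "w \<in> infinity_curve k"
  shows "inf_point w \<in> surface k"
proof (cases "fst w = 0")
  case False
  with assms have "(1 / fst w, snd w / (fst w)\<^sup>2) \<in> affine_curve k"
    using curve_poly_rev_inverse[of "fst w" k]
    by (auto simp: affine_curve_def infinity_curve_def power_divide simp flip: power_mult)
  thus ?thesis using False unfolding inf_point_def surface_def aff_point_def Let_def by force
qed (auto simp: inf_point_def surface_def)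

lemma topspace_surface_top [simp]: "topspace (surface_top k) = surface k"
proof -
  have "{z \<in> affine_curve k. aff_point z \<in> surface k} = affine_curve k"
    by (auto simp: surface_def)
  moreover have "{w \<in> infinity_curve k. inf_point w \<in> surface k} = infinity_curve k"
    using inf_point_in_surface by auto
  ultimately have "surface_open k (surface k)" by (simp add: surface_open_def)
  moreover have "U \<subseteq> surface k" if "surface_open k U" for U
    using that by (simp add: surface_open_def)
  ultimately show ?thesis unfolding topspace_def openin_surface_top by blast
qed

lemma sheet_sign_square [simp]: "(sheet_sign j)\<^sup>2 = 1"
  by (cases j) auto

lemma sheet_sign_eq_iff [simp]: "sheet_sign i = sheet_sign j \<longleftrightarrow> i = j"
  by (cases i; cases j) auto

lemma rho_of_real_square:
  assumes k: "k > 1"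
  shows "(rho k (of_real x))\<^sup>2 = curve_poly k (of_real x)"
proof -
  have "(rho k (of_real x))\<^sup>2 = of_real ((1 + x\<^sup>2) * (k\<^sup>2 + x\<^sup>2))"
    unfolding rho_of_real[OF k k] of_real_power[symmetric] by simp
  thus ?thesis by (simp add: curve_poly_def)
qed

lemma contour_point_in_surface: "k > 1 \<Longrightarrow> contour_point k j x \<in> surface k"
proof (cases x)
  case (Some y)
  assume "k > 1"
  hence "(of_real y, sheet_sign j * rho k (of_real y)) \<in> affine_curve k"
    by (simp add: affine_curve_def power_mult_distrib rho_of_real_square)
  thus ?thesis using Some unfolding surface_def aff_point_def by force
qed (simp add: surface_def)

definition contour_aff :: "real \<Rightarrow> sheet \<Rightarrow> (complex \<times> complex) set" where
  "contour_aff k j = {z. Im (fst z) = 0 \<and>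
     snd z = sheet_sign j * of_real (sqrt ((1 + (Re (fst z))\<^sup>2) * (k\<^sup>2 + (Re (fst z))\<^sup>2)))}"

definition contour_inf :: "real \<Rightarrow> sheet \<Rightarrow> (complex \<times> complex) set" where
  "contour_inf k j = {w. Im (fst w) = 0 \<and>
     snd w = sheet_sign j * of_real (sqrt ((1 + (Re (fst w))\<^sup>2) * (1 + k\<^sup>2 * (Re (fst w))\<^sup>2)))}"

lemma closed_contour_aff: "closed (contour_aff k j)"
  unfolding contour_aff_def
  by (intro closed_Collect_conj closed_Collect_eq continuous_intros)

lemma closed_contour_inf: "closed (contour_inf k j)"
  unfolding contour_inf_def
  by (intro closed_Collect_conj closed_Collect_eq continuous_intros)

lemma aff_point_in_contour_iff:
  assumes "k > 1"
  shows "aff_point z \<in> range (contour_point k j) \<longleftrightarrow> z \<in> contour_aff k j"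
proof
  assume "aff_point z \<in> range (contour_point k j)"
  then obtain x where x: "aff_point z = contour_point k j x" by auto
  then obtain y where "x = Some y" by (cases x) (auto simp: aff_point_def)
  with x show "z \<in> contour_aff k j"
    by (simp add: aff_point_def contour_aff_def rho_of_real[OF assms assms])
next
  assume z: "z \<in> contour_aff k j"
  hence "of_real (Re (fst z)) = fst z" by (simp add: contour_aff_def complex_eq_iff)
  hence "aff_point z = contour_point k j (Some (Re (fst z)))"
    using z rho_of_real[OF assms assms, of "Re (fst z)"] by (simp add: aff_point_def contour_aff_def)
  thus "aff_point z \<in> range (contour_point k j)" by (metis rangeI)
qed

lemma sqrt_rev:
  assumes "u \<noteq> 0"
  shows "sqrt ((1 + (1/u)\<^sup>2) * (k\<^sup>2 + (1/u)\<^sup>2)) = sqrt ((1 + u\<^sup>2) * (1 + k\<^sup>2 * u\<^sup>2)) / u\<^sup>2"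
proof -
  have "(1 + (1/u)\<^sup>2) * (k\<^sup>2 + (1/u)\<^sup>2) = (1 + u\<^sup>2) * (1 + k\<^sup>2 * u\<^sup>2) / (u\<^sup>2)\<^sup>2"
    using assms by (simp add: field_simps power2_eq_square)
  thus ?thesis by (simp only: real_sqrt_divide real_sqrt_abs abs_power2)
qed

lemma inf_point_in_contour_iff:
  assumes k: "k > 1" and w: "w \<in> infinity_curve k"
  shows "inf_point w \<in> range (contour_point k j) \<longleftrightarrow> w \<in> contour_inf k j"
proof (cases "fst w = 0")
  case True
  have "(snd w)\<^sup>2 = 1" using w True by (auto simp: infinity_curve_def curve_poly_rev_def)
  hence v: "snd w = 1 \<or> snd w = -1" by (simp add: power2_eq_1_iff)
  have "Infty i \<in> range (contour_point k j) \<longleftrightarrow> i = j" for i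
  proof
    assume "Infty i \<in> range (contour_point k j)"
    then obtain x where "Infty i = contour_point k j x" by auto
    thus "i = j" by (cases x) auto
  next
    assume "i = j"
    hence "Infty i = contour_point k j None" by simp
    thus "Infty i \<in> range (contour_point k j)" by (metis rangeI)
  qed
  thus ?thesis using True v
    by (cases j) (auto simp: inf_point_def contour_inf_def)
next
  case False
  have i: "inf_point w = aff_point (1 / fst w, snd w / (fst w)\<^sup>2)"
    using False by (simp add: inf_point_def aff_point_def Let_def)
  have re: "Im (1 / fst w) = 0 \<longleftrightarrow> Im (fst w) = 0"
  proof -
    have "Im (1 / fst w) = - Im (fst w) / (norm (fst w))\<^sup>2"
      using complex_inverse[of "Re (fst w)" "Im (fst w)"]
      by (simp add: inverse_eq_divide[symmetric] cmod_power2)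
    thus ?thesis using False by simp
  qed
  show ?thesis
  proof (cases "Im (fst w) = 0")
    case im: True
    define u where "u = Re (fst w)"
    define q where "q = sheet_sign j * complex_of_real (sqrt ((1 + u\<^sup>2) * (1 + k\<^sup>2 * u\<^sup>2)))"
    have u: "fst w = of_real u" "u \<noteq> 0" using im False by (auto simp: u_def complex_eq_iff)
    have r: "Re (1 / fst w) = 1 / u" unfolding u(1) by (metis Re_complex_of_real of_real_1 of_real_divide)
    have "snd w / (fst w)\<^sup>2 = sheet_sign j * of_real (sqrt ((1 + (1/u)\<^sup>2) * (k\<^sup>2 + (1/u)\<^sup>2)))
        \<longleftrightarrow> snd w / (of_real u)\<^sup>2 = q / (of_real u)\<^sup>2"
      unfolding sqrt_rev[OF u(2)] u(1) q_def by simp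
    also have "\<dots> \<longleftrightarrow> snd w = q" using u(2) by simp
    finally show ?thesis
      unfolding i aff_point_in_contour_iff[OF k] contour_aff_def contour_inf_def q_def
      by (simp only: mem_Collect_eq fst_conv snd_conv re im r u_def[symmetric])
  next
    case False
    thus ?thesis unfolding i aff_point_in_contour_iff[OF k] contour_aff_def contour_inf_def
      by (simp only: mem_Collect_eq fst_conv re) simp
  qed
qed

lemma contour_eq:
  assumes k: "k > 1"
  shows "contour k j = range (contour_point k j)"
proof
  let ?R = "range (\<lambda>x::real. Aff (of_real x) (sheet_sign j * rho k (of_real x)))"
  have sub: "?R \<subseteq> range (contour_point k j)"
    by (auto simp flip: contour_point.simps(2))
  have "openin (surface_top k) (surface k - range (contour_point k j))"
    unfolding openin_surface_top surface_open_def
  proof (intro conjI)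
    have "{z \<in> affine_curve k. aff_point z \<in> surface k - range (contour_point k j)}
        = affine_curve k \<inter> - contour_aff k j"
      using aff_point_in_contour_iff[OF k] by (auto simp: surface_def)
    thus "openin (top_of_set (affine_curve k))
        {z \<in> affine_curve k. aff_point z \<in> surface k - range (contour_point k j)}"
      using closed_contour_aff by (auto intro!: openin_open_Int)
    have "{w \<in> infinity_curve k. inf_point w \<in> surface k - range (contour_point k j)}
        = infinity_curve k \<inter> - contour_inf k j"
      using inf_point_in_contour_iff[OF k] inf_point_in_surface by auto
    thus "openin (top_of_set (infinity_curve k))
        {w \<in> infinity_curve k. inf_point w \<in> surface k - range (contour_point k j)}"
      using closed_contour_inf by (auto intro!: openin_open_Int)
  qed auto
  hence "closedin (surface_top k) (range (contour_point k j))"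
    unfolding closedin_def using contour_point_in_surface[OF k] by auto
  with sub show "contour k j \<subseteq> range (contour_point k j)"
    unfolding contour_def by (rule closure_of_minimal)
next
  show "range (contour_point k j) \<subseteq> contour k j"
  proof
    let ?R = "range (\<lambda>x::real. Aff (of_real x) (sheet_sign j * rho k (of_real x)))"
    fix P assume "P \<in> range (contour_point k j)"
    then obtain x where x: "P = contour_point k j x" by auto
    have "\<exists>y. y \<in> ?R \<and> y \<in> T" if P: "P \<in> T" and T: "openin (surface_top k) T" for T
    proof (cases x)
      case (Some y)
      thus ?thesis using x P by auto
    next
      case None
      define g where "g n = (complex_of_real (1 / Suc n),
        sheet_sign j * of_real (sqrt ((1 + (1 / Suc n)\<^sup>2) * (1 + k\<^sup>2 * (1 / Suc n)\<^sup>2))))" for n :: nat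
      have g: "g n \<in> infinity_curve k" for n
      proof -
        have "(snd (g n))\<^sup>2 = of_real ((1 + (1 / Suc n)\<^sup>2) * (1 + k\<^sup>2 * (1 / Suc n)\<^sup>2))"
          by (simp add: g_def power_mult_distrib flip: of_real_power)
        also have "\<dots> = curve_poly_rev k (fst (g n))"
          by (simp add: g_def curve_poly_rev_def)
        finally show ?thesis by (simp add: infinity_curve_def case_prod_unfold)
      qed
      have lim0: "(\<lambda>n. 1 / real (Suc n)) \<longlonglongrightarrow> 0"
        using LIMSEQ_inverse_real_of_nat by (simp add: inverse_eq_divide)
      have "g \<longlonglongrightarrow> (complex_of_real 0,
          sheet_sign j * of_real (sqrt ((1 + 0\<^sup>2) * (1 + k\<^sup>2 * 0\<^sup>2))))"
        unfolding g_def by (intro tendsto_intros lim0)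
      hence lim: "g \<longlonglongrightarrow> (0, sheet_sign j)" by simp
      have 0: "(0, sheet_sign j) \<in> infinity_curve k"
        by (simp add: infinity_curve_def curve_poly_rev_def)
      have "inf_point (0, sheet_sign j) = Infty j" by (cases j) (auto simp: inf_point_def)
      hence P0: "inf_point (0, sheet_sign j) \<in> T" using P x None by simp
      from T obtain V where V: "open V"
          "{w \<in> infinity_curve k. inf_point w \<in> T} = infinity_curve k \<inter> V"
        unfolding openin_surface_top surface_open_def by (auto simp: openin_open)
      have "(0, sheet_sign j) \<in> V" using V(2) P0 0 by blast
      with lim V(1) have "eventually (\<lambda>n. g n \<in> V) sequentially" by (simp add: topological_tendstoD)
      then obtain n where "g n \<in> V" by (auto simp: eventually_sequentially)
      hence nT: "inf_point (g n) \<in> T" using V(2) g by blast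
      have "g n \<in> contour_inf k j" by (simp add: g_def contour_inf_def)
      hence "inf_point (g n) \<in> range (contour_point k j)"
        using inf_point_in_contour_iff[OF k g] by blast
      then obtain y where y: "inf_point (g n) = contour_point k j y" by auto
      have "fst (g n) \<noteq> 0" unfolding g_def by (simp del: of_nat_Suc)
      then obtain z where "y = Some z"
        using y by (cases y) (auto simp: inf_point_def Let_def)
      thus ?thesis using y nT by (intro exI[of _ "inf_point (g n)"]) auto
    qed
    thus "P \<in> contour k j"
      unfolding contour_def in_closure_of topspace_surface_top
      using x contour_point_in_surface[OF k] by auto
  qed
qed

text \<open>The contour is the preimage of the compactified real line.\<close>
lemma Gamma_curve_eq:
  assumes k: "k > 1"
  shows "Gamma_curve k = {Aff \<xi> \<tau> |\<xi> \<tau>. (\<xi>, \<tau>) \<in> affine_curve k \<and> \<xi> \<in> \<real>} \<union> range Infty"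
proof -
  have "Aff \<xi> \<tau> \<in> Gamma_curve k \<longleftrightarrow> (\<xi>, \<tau>) \<in> affine_curve k \<and> \<xi> \<in> \<real>" for \<xi> \<tau>
  proof
    assume "Aff \<xi> \<tau> \<in> Gamma_curve k"
    then obtain j x where "Aff \<xi> \<tau> = contour_point k j x"
      by (auto simp: Gamma_curve_def contour_eq[OF k])
    thus "(\<xi>, \<tau>) \<in> affine_curve k \<and> \<xi> \<in> \<real>"
      by (cases x) (auto simp: affine_curve_def power_mult_distrib rho_of_real_square[OF k])
  next
    assume a: "(\<xi>, \<tau>) \<in> affine_curve k \<and> \<xi> \<in> \<real>"
    then obtain x where x: "\<xi> = of_real x" by (auto elim: Reals_cases)
    have "\<tau>\<^sup>2 = (rho k (of_real x))\<^sup>2" using a x by (simp add: affine_curve_def rho_of_real_square[OF k])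
    hence "\<tau> = rho k (of_real x) \<or> \<tau> = - rho k (of_real x)" by (simp add: power2_eq_iff)
    hence "Aff \<xi> \<tau> = contour_point k S1 (Some x) \<or> Aff \<xi> \<tau> = contour_point k S2 (Some x)"
      by (simp add: x)
    thus "Aff \<xi> \<tau> \<in> Gamma_curve k" unfolding Gamma_curve_def contour_eq[OF k] by blast
  qed
  moreover have "Infty j \<in> Gamma_curve k" for j
  proof -
    have "Infty j = contour_point k j None" by simp
    thus ?thesis unfolding Gamma_curve_def contour_eq[OF k] by (cases j) blast+
  qed
  ultimately have "P \<in> Gamma_curve k \<longleftrightarrow>
      P \<in> {Aff \<xi> \<tau> |\<xi> \<tau>. (\<xi>, \<tau>) \<in> affine_curve k \<and> \<xi> \<in> \<real>} \<union> range Infty" for P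
    by (cases P) auto
  thus ?thesis by blast
qed

lemma cayley_line_loop:
  assumes "0 \<le> t" "t \<le> 1"
  shows "cayley (line_loop t) = exp (2 * of_real pi * \<i> * of_real t)"
proof (cases "0 < t \<and> t < 1")
  case True
  define s c where "s = complex_of_real (sin (pi * t))" and "c = complex_of_real (cos (pi * t))"
  have "sin (pi * t) > 0" using True by (intro sin_gt_zero) auto
  hence s: "s \<noteq> 0" by (simp add: s_def)
  have "cis (pi * t) = c + \<i> * s" "cis (- (pi * t)) = c - \<i> * s"
    by (simp_all add: s_def c_def complex_eq_iff)
  hence "cis (pi * t) / cis (- (pi * t)) = (c + \<i> * s) / (c - \<i> * s)" by simp
  hence e: "cis (2 * pi * t) = (c + \<i> * s) / (c - \<i> * s)" by (simp add: cis_divide mult.assoc)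
  have "cayley (line_loop t) = (- (c / s) - \<i>) / (- (c / s) + \<i>)"
    using True by (simp add: line_loop_def cot_def s_def c_def)
  also have "- (c / s) - \<i> = - (c + \<i> * s) / s" using s by (simp add: field_simps)
  also have "- (c / s) + \<i> = - (c - \<i> * s) / s" using s by (simp add: field_simps)
  also have "(- (c + \<i> * s) / s) / (- (c - \<i> * s) / s) = cis (2 * pi * t)"
  proof -
    have "(- p / s) / (- q / s) = p / q" for p q
      using s by (metis divide_divide_times_eq minus_divide_divide mult.commute nonzero_mult_divide_mult_cancel_left)
    thus ?thesis unfolding e .
  qed
  finally show ?thesis by (simp add: cis_conv_exp mult_ac)
next
  case False
  hence "t = 0 \<or> t = 1" using assms by auto
  thus ?thesis by (auto simp: line_loop_def exp_two_pi_i)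
qed

text \<open>The values of the multipliers at the points at infinity are the limits along the contour.\<close>
lemma alpha_tendsto:
  assumes k: "k > 1" and F: "filterlim complex_of_real at_infinity F"
  shows "((\<lambda>x. alpha_plus k (contour_point k j (Some x))) \<longlongrightarrow> alpha_plus k (Infty j)) F"
    and "((\<lambda>x. alpha_minus k (contour_point k j (Some x))) \<longlongrightarrow> alpha_minus k (Infty j)) F"
proof -
  have nr: "rho k (of_real x) = rho_plus_expl k (of_real x) * rho_minus_expl k (of_real x)" for x
    using is_rho_of_real[OF k is_rho_expl[OF k]] rho_of_real[OF k k] by simp
  have pl: "rho_plus k (of_real x) = rho_plus_expl k (of_real x)" for x
    using rho_plus_unique[OF k is_rho_plus_rho_plus[OF k]] lower_slit_Im[OF k, of "of_real x"] by auto
  have mi: "rho_minus k (of_real x) = rho_minus_expl k (of_real x)" for x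
    using rho_minus_unique[OF k is_rho_minus_rho_minus[OF k]] upper_slit_Im[OF k, of "of_real x"] by auto
  have "rho k (of_real x) \<noteq> 0" for x
    using is_rho_rho[OF k] unfolding is_rho_def by (metis less_irrefl of_real_eq_0_iff)
  hence nz: "rho_plus_expl k (of_real x) \<noteq> 0" "rho_minus_expl k (of_real x) \<noteq> 0" for x
    using nr by (metis mult_zero_left, metis mult_zero_right)
  have inv: "((\<lambda>x. inverse (complex_of_real x)) \<longlongrightarrow> 0) F"
    using F by (rule filterlim_compose[OF tendsto_inverse_0])
  have ev: "eventually (\<lambda>x. x \<noteq> 0) F"
    using filterlim_at_infinity_imp_eventually_ne[OF F, of 0] by simp
  have quot: "((\<lambda>x. (complex_of_real x + a) / (of_real x + b)) \<longlongrightarrow> 1) F" for a b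
  proof -
    have "((\<lambda>x. (1 + a * inverse (complex_of_real x)) / (1 + b * inverse (of_real x)))
        \<longlongrightarrow> (1 + a * 0) / (1 + b * 0)) F"
      by (intro tendsto_intros inv) auto
    moreover have "eventually (\<lambda>x. (1 + a * inverse (complex_of_real x)) / (1 + b * inverse (of_real x))
        = (of_real x + a) / (of_real x + b)) F"
      using ev
    proof eventually_elim
      case (elim x)
      have "1 + c * inverse (complex_of_real x) = (of_real x + c) / of_real x" for c
        using elim by (simp add: field_simps)
      thus ?case using elim by simp
    qed
    ultimately have "((\<lambda>x. (complex_of_real x + a) / (of_real x + b))
        \<longlongrightarrow> (1 + a * 0) / (1 + b * 0)) F"
      by (rule Lim_transform_eventually)
    thus ?thesis by simp
  qed
  have sq: "((\<lambda>x. csqrt ((complex_of_real x + a) / (of_real x + b))) \<longlongrightarrow> 1) F" for a b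
    using isCont_tendsto_compose[OF continuous_at_csqrt quot, of a b] by simp
  have "((\<lambda>x. alpha_const k + sheet_sign j * ((of_real x + - (\<i> * of_real k)) / (of_real x + - \<i>)
      * csqrt ((of_real x + - \<i>) / (of_real x + - (\<i> * of_real k)))))
      \<longlongrightarrow> alpha_const k + sheet_sign j * (1 * 1)) F"
    by (intro tendsto_intros quot sq)
  moreover have "alpha_plus k (contour_point k j (Some x)) =
      alpha_const k + sheet_sign j * ((of_real x + - (\<i> * of_real k)) / (of_real x + - \<i>)
      * csqrt ((of_real x + - \<i>) / (of_real x + - (\<i> * of_real k))))" for x
    using nz(1)[of x] by (simp add: nr pl) (simp add: rho_minus_expl_def)
  ultimately show "((\<lambda>x. alpha_plus k (contour_point k j (Some x))) \<longlongrightarrow> alpha_plus k (Infty j)) F"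
    by simp
  have "((\<lambda>x. alpha_const k + sheet_sign j * ((of_real x + \<i> * of_real k) / (of_real x + \<i>)
      * csqrt ((of_real x + \<i>) / (of_real x + \<i> * of_real k))))
      \<longlongrightarrow> alpha_const k + sheet_sign j * (1 * 1)) F"
    by (intro tendsto_intros quot sq)
  moreover have "alpha_minus k (contour_point k j (Some x)) =
      alpha_const k + sheet_sign j * ((of_real x + \<i> * of_real k) / (of_real x + \<i>)
      * csqrt ((of_real x + \<i>) / (of_real x + \<i> * of_real k)))" for x
    using nz(2)[of x] by (simp add: nr mi) (simp add: rho_plus_expl_def)
  ultimately show "((\<lambda>x. alpha_minus k (contour_point k j (Some x))) \<longlongrightarrow> alpha_minus k (Infty j)) F"
    by simp
qed

end

theory Submission
  imports Defs
begin

text \<open>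
  With \<zeta> = (\<xi> - i)/(\<xi> + i) and q = (k - 1)/(k + 1) the branch points i and ik in the
  upper half-plane become 0 and q, so the upper half of the surface is a double cover of the unit
  disc on which \<surd>(\<zeta>(\<zeta> - q)) is single valued, and the contour lies over the unit
  circle. There the multipliers are constants times 1 \<plusminus> \<surd>(1 - q/\<zeta>) and 1
  \<plusminus> \<surd>(1 - q\<zeta>), and the form d\<xi>/\<rho> is the arc length with the weight
  1/|1 - q\<zeta>|. The substitution \<zeta> = -q sinh^2 z unfolds the cover: z ranges over a simply
  connected strip |sinh z|^2 < 1/q, z \<mapsto> -z exchanges the sheets and z \<mapsto> z + \<pi>i
  is the deck translation. The boundary curve \<open>circle_path\<close> runs once over the circle
  while z gains \<pi>i. The reflection \<xi> \<mapsto> -\<xi>, that is \<zeta> \<mapsto> 1/\<zeta>,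
  reduces the lower half to the upper one.

  For the necessity, let F be invertible on the upper half, with boundary values F1 and F2 on the
  two components. Its logarithm \<Lambda> on the strip increases by 2\<pi>ia under the translation,
  so \<Lambda>(z) - \<Lambda>(-z) - 4az is odd and periodic, and so is its quotient by \<surd>(1 -
  q\<zeta>), whose integral over dz is its weighted mean. An odd function has an even primitive, and
  the increment of an even function over the symmetric segment from -\<pi>i/2 to \<pi>i/2 vanishes.
  Hence F1/F2 = exp(D + 4ac), where c is the boundary curve and D is a closed path of weighted mean
  zero (lemma \<open>invertible_ratio\<close>). Both multipliers have the ratio -exp(2c), the second
  one with c run backwards. Altogether the difference of the logarithms of the given function on the
  two components is D + (4a+2)c + (the same for the lower half, with an integer b, run backwards) +
  2\<pi>ip. Comparing the end points gives a - b = n, the index on the first component. The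
  normalised weighted mean of c is K/2 and that of \<pi>i is iK' (lemma
  \<open>weighted_integral_of_logarithm\<close>), so the class \<beta> is represented by 2(a + b +
  1)K + 2iK'p = 2(n + 1)K + 4bK + 2iK'p.

  For the sufficiency, the congruence supplies b and p; put a = n + b. After removing the multiples
  of c, the half sum E and the half difference d of the logarithms are closed Hoelder functions on
  the circle and d has weighted mean zero (lemma \<open>closed_logarithms_on_circle\<close>). The
  Plemelj--Privalov theorem splits E and d/(\<surd>(1 - q\<zeta>)\<surd>(1 - q/\<zeta>)) into parts
  holomorphic inside and outside the disc. The odd functions on the upper half are those of the form
  \<surd>(\<zeta>(\<zeta> - q)) g(\<zeta>), so the two parts of the second function must be
  divisible by \<zeta> and by 1/\<zeta>; this is exactly the vanishing of the mean. Exponentials of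
  these parts, times powers of the unit exp(2z), are the factors (lemmas
  \<open>factor_with_sides\<close> and \<open>beta_imp_factorization\<close>).
\<close>

section \<open>Hoelder functions\<close>

definition hoelder_on :: "real \<Rightarrow> complex set \<Rightarrow> (complex \<Rightarrow> complex) \<Rightarrow> bool" where
  "hoelder_on \<mu> S \<phi> \<longleftrightarrow> (\<exists>M. \<forall>x\<in>S. \<forall>y\<in>S. norm (\<phi> x - \<phi> y) \<le> M * norm (x - y) powr \<mu>)"

lemma hoelder_onI:
  "(\<And>x y. x \<in> S \<Longrightarrow> y \<in> S \<Longrightarrow> norm (\<phi> x - \<phi> y) \<le> M * norm (x - y) powr \<mu>) \<Longrightarrow> hoelder_on \<mu> S \<phi>"
  unfolding hoelder_on_def by blast

lemma hoelder_onE: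
  assumes "hoelder_on \<mu> S \<phi>"
  obtains M where "M \<ge> 0" "\<And>x y. x \<in> S \<Longrightarrow> y \<in> S \<Longrightarrow> norm (\<phi> x - \<phi> y) \<le> M * norm (x - y) powr \<mu>"
proof -
  from assms obtain M where M: "\<And>x y. x \<in> S \<Longrightarrow> y \<in> S \<Longrightarrow> norm (\<phi> x - \<phi> y) \<le> M * norm (x - y) powr \<mu>"
    unfolding hoelder_on_def by blast
  show ?thesis
  proof
    show "norm (\<phi> x - \<phi> y) \<le> max M 0 * norm (x - y) powr \<mu>" if "x \<in> S" "y \<in> S" for x y
      using M[OF that] by (meson dual_order.trans max.cobounded1 mult_right_mono powr_ge_zero)
  qed simp
qed

lemma hoelder_on_subset: "hoelder_on \<mu> S \<phi> \<Longrightarrow> T \<subseteq> S \<Longrightarrow> hoelder_on \<mu> T \<phi>"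
  unfolding hoelder_on_def by blast

lemma hoelder_on_cong: "(\<And>x. x \<in> S \<Longrightarrow> \<phi> x = \<psi> x) \<Longrightarrow> hoelder_on \<mu> S \<phi> \<longleftrightarrow> hoelder_on \<mu> S \<psi>"
  unfolding hoelder_on_def by simp

lemma hoelder_on_continuous:
  assumes "hoelder_on \<mu> S \<phi>" "\<mu> > 0"
  shows "continuous_on S \<phi>"
proof -
  obtain M where M: "M \<ge> 0" "\<And>x y. x \<in> S \<Longrightarrow> y \<in> S \<Longrightarrow> norm (\<phi> x - \<phi> y) \<le> M * norm (x - y) powr \<mu>"
    by (rule hoelder_onE[OF assms(1)]) blast
  show ?thesis unfolding continuous_on_def
  proof
    fix x assume x: "x \<in> S"
    have "((\<lambda>y. M * norm (y - x) powr \<mu>) \<longlongrightarrow> M * norm (x - x) powr \<mu>) (at x within S)"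
      using assms(2) by (intro tendsto_intros) auto
    hence "((\<lambda>y. M * norm (y - x) powr \<mu>) \<longlongrightarrow> 0) (at x within S)" using assms(2) by simp
    moreover have "eventually (\<lambda>y. norm (\<phi> y - \<phi> x) \<le> M * norm (y - x) powr \<mu>) (at x within S)"
      unfolding eventually_at_filter by (rule always_eventually) (use M(2) x in blast)
    ultimately have "((\<lambda>y. \<phi> y - \<phi> x) \<longlongrightarrow> 0) (at x within S)" by (rule Lim_null_comparison[rotated])
    thus "(\<phi> \<longlongrightarrow> \<phi> x) (at x within S)" by (rule LIM_zero_cancel)
  qed
qed

lemma hoelder_on_bounded:
  assumes "hoelder_on \<mu> S \<phi>" "bounded S" "\<mu> > 0"
  obtains B where "B > 0" "\<And>x. x \<in> S \<Longrightarrow> norm (\<phi> x) \<le> B"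
proof (cases "S = {}")
  case False
  then obtain x0 where x0: "x0 \<in> S" by auto
  obtain M where M: "M \<ge> 0" "\<And>x y. x \<in> S \<Longrightarrow> y \<in> S \<Longrightarrow> norm (\<phi> x - \<phi> y) \<le> M * norm (x - y) powr \<mu>"
    by (rule hoelder_onE[OF assms(1)]) blast
  obtain D where D: "\<And>x. x \<in> S \<Longrightarrow> norm x \<le> D" using assms(2) unfolding bounded_iff by blast
  show ?thesis
  proof (rule that[of "norm (\<phi> x0) + M * (2 * D) powr \<mu> + 1"])
    show "0 < norm (\<phi> x0) + M * (2 * D) powr \<mu> + 1" using M(1) by (simp add: add_nonneg_pos)
    fix x assume x: "x \<in> S"
    have "norm (x - x0) \<le> 2 * D" using D[OF x] D[OF x0] norm_triangle_ineq4[of x x0] by linarith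
    hence "norm (x - x0) powr \<mu> \<le> (2 * D) powr \<mu>" using assms(3) by (intro powr_mono2) auto
    hence "norm (\<phi> x - \<phi> x0) \<le> M * (2 * D) powr \<mu>"
      using M(2)[OF x x0] M(1) by (meson mult_left_mono order_trans)
    thus "norm (\<phi> x) \<le> norm (\<phi> x0) + M * (2 * D) powr \<mu> + 1"
      using norm_triangle_sub[of "\<phi> x" "\<phi> x0"] by linarith
  qed
qed (use that[of 1] in auto)

lemma hoelder_on_const: "hoelder_on \<mu> S (\<lambda>_. c)"
  by (rule hoelder_onI[where M = 0]) simp

lemma hoelder_on_add:
  assumes "hoelder_on \<mu> S \<phi>" "hoelder_on \<mu> S \<psi>"
  shows "hoelder_on \<mu> S (\<lambda>x. \<phi> x + \<psi> x)"
proof -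
  obtain M where M: "\<And>x y. x \<in> S \<Longrightarrow> y \<in> S \<Longrightarrow> norm (\<phi> x - \<phi> y) \<le> M * norm (x - y) powr \<mu>"
    by (rule hoelder_onE[OF assms(1)]) blast
  obtain N where N: "\<And>x y. x \<in> S \<Longrightarrow> y \<in> S \<Longrightarrow> norm (\<psi> x - \<psi> y) \<le> N * norm (x - y) powr \<mu>"
    by (rule hoelder_onE[OF assms(2)]) blast
  show ?thesis
  proof (rule hoelder_onI[where M = "M + N"])
    fix x y assume xy: "x \<in> S" "y \<in> S"
    have "norm (\<phi> x + \<psi> x - (\<phi> y + \<psi> y)) \<le> norm (\<phi> x - \<phi> y) + norm (\<psi> x - \<psi> y)"
      by (rule norm_diff_triangle_ineq)
    thus "norm (\<phi> x + \<psi> x - (\<phi> y + \<psi> y)) \<le> (M + N) * norm (x - y) powr \<mu>"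
      using M[OF xy] N[OF xy] by (simp add: distrib_right)
  qed
qed

lemma hoelder_on_mult:
  assumes h: "hoelder_on \<mu> S \<phi>" "hoelder_on \<mu> S \<psi>" and S: "bounded S" "\<mu> > 0"
  shows "hoelder_on \<mu> S (\<lambda>x. \<phi> x * \<psi> x)"
proof -
  obtain M where M: "\<And>x y. x \<in> S \<Longrightarrow> y \<in> S \<Longrightarrow> norm (\<phi> x - \<phi> y) \<le> M * norm (x - y) powr \<mu>"
    by (rule hoelder_onE[OF h(1)]) blast
  obtain N where N: "\<And>x y. x \<in> S \<Longrightarrow> y \<in> S \<Longrightarrow> norm (\<psi> x - \<psi> y) \<le> N * norm (x - y) powr \<mu>"
    by (rule hoelder_onE[OF h(2)]) blast
  obtain B where B: "B > 0" "\<And>x. x \<in> S \<Longrightarrow> norm (\<phi> x) \<le> B"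
    by (rule hoelder_on_bounded[OF h(1) S]) blast
  obtain C where C: "C > 0" "\<And>x. x \<in> S \<Longrightarrow> norm (\<psi> x) \<le> C"
    by (rule hoelder_on_bounded[OF h(2) S]) blast
  show ?thesis
  proof (rule hoelder_onI[where M = "M * C + B * N"])
    fix x y assume xy: "x \<in> S" "y \<in> S"
    have "\<phi> x * \<psi> x - \<phi> y * \<psi> y = (\<phi> x - \<phi> y) * \<psi> x + \<phi> y * (\<psi> x - \<psi> y)" by (simp add: algebra_simps)
    hence "norm (\<phi> x * \<psi> x - \<phi> y * \<psi> y) \<le> norm (\<phi> x - \<phi> y) * norm (\<psi> x) + norm (\<phi> y) * norm (\<psi> x - \<psi> y)"
      by (metis norm_mult norm_triangle_ineq)
    also have "\<dots> \<le> (M * norm (x - y) powr \<mu>) * C + B * (N * norm (x - y) powr \<mu>)"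
      using M[OF xy] N[OF xy] B C xy by (intro add_mono mult_mono) (auto intro: order_trans[OF norm_ge_zero])
    finally show "norm (\<phi> x * \<psi> x - \<phi> y * \<psi> y) \<le> (M * C + B * N) * norm (x - y) powr \<mu>"
      by (simp add: algebra_simps)
  qed
qed

lemma hoelder_on_compose_lipschitz:
  assumes h: "hoelder_on \<mu> S \<phi>" and im: "\<phi> ` S \<subseteq> K" and L: "L-lipschitz_on K \<psi>"
  shows "hoelder_on \<mu> S (\<lambda>x. \<psi> (\<phi> x))"
proof -
  obtain M where M: "\<And>x y. x \<in> S \<Longrightarrow> y \<in> S \<Longrightarrow> norm (\<phi> x - \<phi> y) \<le> M * norm (x - y) powr \<mu>"
    by (rule hoelder_onE[OF h]) blast
  show ?thesis
  proof (rule hoelder_onI[where M = "L * M"])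
    fix x y assume xy: "x \<in> S" "y \<in> S"
    have "norm (\<psi> (\<phi> x) - \<psi> (\<phi> y)) \<le> L * norm (\<phi> x - \<phi> y)"
      using lipschitz_onD[OF L, of "\<phi> x" "\<phi> y"] im xy by (auto simp: dist_norm)
    also have "\<dots> \<le> L * (M * norm (x - y) powr \<mu>)"
      using M[OF xy] lipschitz_on_nonneg[OF L] by (intro mult_left_mono) auto
    finally show "norm (\<psi> (\<phi> x) - \<psi> (\<phi> y)) \<le> L * M * norm (x - y) powr \<mu>" by (simp add: mult.assoc)
  qed
qed

lemma lipschitz_imp_hoelder_on:
  assumes L: "L-lipschitz_on S \<psi>" and S: "bounded S" "0 < \<mu>" "\<mu> \<le> 1"
  shows "hoelder_on \<mu> S \<psi>"
proof -
  obtain D where D: "\<And>x. x \<in> S \<Longrightarrow> norm x \<le> D" using S(1) unfolding bounded_iff by blast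
  show ?thesis
  proof (rule hoelder_onI[where M = "L * (2 * D) powr (1 - \<mu>)"])
    fix x y assume xy: "x \<in> S" "y \<in> S"
    have d: "norm (x - y) \<le> 2 * D" using D[OF xy(1)] D[OF xy(2)] norm_triangle_ineq4[of x y] by linarith
    have "norm (x - y) = norm (x - y) powr (1 - \<mu>) * norm (x - y) powr \<mu>"
      by (cases "x = y") (simp_all add: S flip: powr_add)
    also have "\<dots> \<le> (2 * D) powr (1 - \<mu>) * norm (x - y) powr \<mu>"
      using d S by (intro mult_right_mono powr_mono2) auto
    finally have "L * norm (x - y) \<le> L * ((2 * D) powr (1 - \<mu>) * norm (x - y) powr \<mu>)"
      using lipschitz_on_nonneg[OF L] by (rule mult_left_mono)
    thus "norm (\<psi> x - \<psi> y) \<le> L * (2 * D) powr (1 - \<mu>) * norm (x - y) powr \<mu>"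
      using lipschitz_onD[OF L xy] by (simp add: dist_norm mult.assoc)
  qed
qed

lemma holomorphic_imp_lipschitz_on:
  assumes "\<psi> holomorphic_on V" "open V" "K \<subseteq> V" "compact K" "convex K"
  obtains L where "L-lipschitz_on K \<psi>"
proof -
  have "continuous_on K (deriv \<psi>)"
    using assms by (meson continuous_on_subset holomorphic_deriv holomorphic_on_imp_continuous_on)
  hence "bounded (deriv \<psi> ` K)" using assms compact_continuous_image compact_imp_bounded by blast
  then obtain B where B: "\<And>x. x \<in> K \<Longrightarrow> norm (deriv \<psi> x) \<le> B" "B > 0"
    by (metis bounded_pos imageI)
  have "norm (\<psi> x - \<psi> y) \<le> B * norm (x - y)" if "x \<in> K" "y \<in> K" for x y
  proof (rule field_differentiable_bound[OF assms(5) _ _ that])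
    show "norm (deriv \<psi> z) \<le> B" if "z \<in> K" for z using B(1)[OF that] .
  next
    fix z assume "z \<in> K"
    thus "(\<psi> has_field_derivative deriv \<psi> z) (at z within K)"
      using assms by (meson DERIV_subset holomorphic_derivI subsetD top_greatest)
  qed
  hence "B-lipschitz_on K \<psi>" using B(2) by (intro lipschitz_onI) (auto simp: dist_norm)
  thus ?thesis by (rule that)
qed

lemma hoelder_on_exp:
  assumes h: "hoelder_on \<mu> S \<phi>" and S: "bounded S" "\<mu> > 0"
  shows "hoelder_on \<mu> S (\<lambda>x. exp (\<phi> x))"
proof -
  obtain B where B: "B > 0" "\<And>x. x \<in> S \<Longrightarrow> norm (\<phi> x) \<le> B"
    by (rule hoelder_on_bounded[OF h S]) blast
  obtain L where "L-lipschitz_on (cball 0 B) (exp :: complex \<Rightarrow> complex)"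
    by (rule holomorphic_imp_lipschitz_on[of exp UNIV "cball 0 B"]) (auto intro: holomorphic_intros)
  thus ?thesis by (intro hoelder_on_compose_lipschitz[OF h, of "cball 0 B"]) (use B in auto)
qed

section \<open>Cauchy integrals of Hoelder functions on the circle\<close>

text \<open>
  Jordan's inequality, in a form that measures the distance to the nearest of the zeros -1, 0, 1.
\<close>
lemma sin_pi_lower_bound:
  fixes x :: real
  assumes "\<bar>x\<bar> \<le> 1"
  shows "\<exists>j\<in>{-1, 0, 1}. 2 * \<bar>x - j\<bar> \<le> \<bar>sin (pi * x)\<bar>"
proof -
  have A: "2 * y \<le> sin (pi * y)" if "0 \<le> y" "y \<le> 1/2" for y :: real
  proof -
    have cv: "convex_on {0..pi/2} (\<lambda>x. - sin x)"
    proof (rule f''_ge0_imp_convex[where f' = "\<lambda>x. - cos x" and f'' = "\<lambda>x. sin x"])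
      fix x :: real assume "x \<in> {0..pi/2}"
      thus "0 \<le> sin x" by (intro sin_ge_zero) (auto intro: order_trans[of _ "pi/2"])
    qed (auto intro!: derivative_eq_intros)
    have "- sin ((1 - 2*y) *\<^sub>R 0 + (2*y) *\<^sub>R (pi/2)) \<le> (1 - 2*y) * (- sin 0) + (2*y) * (- sin (pi/2))"
      using that by (intro convex_onD[OF cv]) auto
    thus ?thesis by (simp add: mult_ac)
  qed
  show ?thesis
  proof (cases "\<bar>x\<bar> \<le> 1/2")
    case True
    have "2 * \<bar>x\<bar> \<le> sin (pi * \<bar>x\<bar>)" using A[of "\<bar>x\<bar>"] True by simp
    also have "\<dots> \<le> \<bar>sin (pi * x)\<bar>" by (cases "x \<ge> 0") auto
    finally show ?thesis by auto
  next
    case False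
    have "2 * (1 - \<bar>x\<bar>) \<le> sin (pi * (1 - \<bar>x\<bar>))" using A[of "1 - \<bar>x\<bar>"] False assms by simp
    also have "\<dots> = sin (pi * \<bar>x\<bar>)" by (simp add: algebra_simps)
    also have "\<dots> \<le> \<bar>sin (pi * x)\<bar>" by (cases "x \<ge> 0") auto
    finally have "2 * \<bar>x - sgn x\<bar> \<le> \<bar>sin (pi * x)\<bar>"
      using assms by (cases "x > 0"; cases "x = 0") (auto simp: sgn_if abs_if split: if_splits)
    moreover have "sgn x \<in> {-1, 0, 1}" by (auto simp: sgn_if)
    ultimately show ?thesis by blast
  qed
qed

abbreviation circ :: "real \<Rightarrow> complex" where
  "circ t \<equiv> exp (2 * of_real pi * \<i> * of_real t)"

lemma circ_cis: "circ t = cis (2 * pi * t)"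
  by (simp add: cis_conv_exp mult_ac)

lemma norm_circ [simp]: "norm (circ t) = 1"
  by (simp only: circ_cis norm_cis)

lemma norm_circ_diff: "norm (circ s - circ t) = 2 * \<bar>sin (pi * (s - t))\<bar>"
proof -
  have "circ s - circ t = cis (pi * (s + t)) * (2 * \<i> * of_real (sin (pi * (s - t))))"
  proof -
    have "cis (pi * (s + t)) * (cis (pi * (s - t)) - cis (- (pi * (s - t)))) = circ s - circ t"
      unfolding circ_cis right_diff_distrib cis_mult by (simp add: algebra_simps)
    moreover have "cis (pi * (s - t)) - cis (- (pi * (s - t))) = 2 * \<i> * of_real (sin (pi * (s - t)))"
      by (simp add: complex_eq_iff)
    ultimately show ?thesis by simp
  qed
  thus ?thesis by (simp add: norm_mult)
qed

text \<open>
  The bound is uniform in p: the exponent \<mu> - 2 is below -1, so the integral over the whole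
  line is already finite and scales like \<delta>^(\<mu> - 1).
\<close>
lemma integral_abs_powr_bound:
  fixes \<delta> \<mu> p :: real
  assumes d: "\<delta> > 0" and m: "\<mu> < 1"
  shows "(\<lambda>t. (\<delta> + 2 * \<bar>t - p\<bar>) powr (\<mu> - 2)) integrable_on {0..1}"
    and "integral {0..1} (\<lambda>t. (\<delta> + 2 * \<bar>t - p\<bar>) powr (\<mu> - 2)) \<le> \<delta> powr (\<mu> - 1) / (1 - \<mu>)"
proof -
  define c where "c = 2 * (1 - \<mu>)"
  have c: "c > 0" using m by (simp add: c_def)
  \<comment> \<open>The two branches of the primitive are normalised to agree at p.\<close>
  define G where "G t = (if t \<ge> p then - ((\<delta> + 2 * (t - p)) powr (\<mu> - 1)) / c
     else (- 2 * \<delta> powr (\<mu> - 1) + (\<delta> + 2 * (p - t)) powr (\<mu> - 1)) / c)" for t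
  have cont: "continuous_on {0..1} G"
  proof -
    have "continuous_on UNIV G"
    proof -
      have "continuous_on ({p..} \<union> {..p}) G" unfolding G_def
      proof (rule continuous_on_cases)
        show "continuous_on {p..} (\<lambda>t. - ((\<delta> + 2 * (t - p)) powr (\<mu> - 1)) / c)"
          using d c by (intro continuous_intros) (auto simp: add_pos_nonneg less_imp_neq)
        show "continuous_on {..p} (\<lambda>t. (- 2 * \<delta> powr (\<mu> - 1) + (\<delta> + 2 * (p - t)) powr (\<mu> - 1)) / c)"
          using d c by (intro continuous_intros) (auto simp: add_pos_nonneg less_imp_neq)
      qed auto
      moreover have "{p..} \<union> {..p} = UNIV" by auto
      ultimately show ?thesis by simp
    qed
    thus ?thesis by (rule continuous_on_subset) simp
  qed
  have der: "(G has_vector_derivative (\<delta> + 2 * \<bar>t - p\<bar>) powr (\<mu> - 2)) (at t)" if "t \<in> {0<..<1} - {p}" for t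
  proof (cases "t > p")
    case True
    have "((\<lambda>t. - ((\<delta> + 2 * (t - p)) powr (\<mu> - 1)) / c) has_real_derivative
        - ((\<mu> - 1) * (\<delta> + 2 * (t - p)) powr (\<mu> - 1 - 1) * 2) / c) (at t)"
      using True d c by (auto intro!: derivative_eq_intros simp: add_pos_pos)
    also have "- ((\<mu> - 1) * (\<delta> + 2 * (t - p)) powr (\<mu> - 1 - 1) * 2) / c = (\<delta> + 2 * \<bar>t - p\<bar>) powr (\<mu> - 2)"
      using True m by (simp add: c_def field_simps)
    finally have "((\<lambda>t. - ((\<delta> + 2 * (t - p)) powr (\<mu> - 1)) / c) has_real_derivative (\<delta> + 2 * \<bar>t - p\<bar>) powr (\<mu> - 2)) (at t)" .
    hence "(G has_real_derivative (\<delta> + 2 * \<bar>t - p\<bar>) powr (\<mu> - 2)) (at t)"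
      by (rule has_field_derivative_transform_within_open[where S = "{p<..}"]) (use True in \<open>auto simp: G_def\<close>)
    thus ?thesis by (simp add: has_real_derivative_iff_has_vector_derivative)
  next
    case False
    hence t: "t < p" using that by auto
    have "((\<lambda>t. (- 2 * \<delta> powr (\<mu> - 1) + (\<delta> + 2 * (p - t)) powr (\<mu> - 1)) / c) has_real_derivative
        ((\<mu> - 1) * (\<delta> + 2 * (p - t)) powr (\<mu> - 1 - 1) * (-2)) / c) (at t)"
      using t d c by (auto intro!: derivative_eq_intros simp: add_pos_pos)
    also have "((\<mu> - 1) * (\<delta> + 2 * (p - t)) powr (\<mu> - 1 - 1) * (-2)) / c = (\<delta> + 2 * \<bar>t - p\<bar>) powr (\<mu> - 2)"
      using t m by (simp add: c_def field_simps)
    finally have "((\<lambda>t. (- 2 * \<delta> powr (\<mu> - 1) + (\<delta> + 2 * (p - t)) powr (\<mu> - 1)) / c) has_real_derivative (\<delta> + 2 * \<bar>t - p\<bar>) powr (\<mu> - 2)) (at t)" .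
    hence "(G has_real_derivative (\<delta> + 2 * \<bar>t - p\<bar>) powr (\<mu> - 2)) (at t)"
      by (rule has_field_derivative_transform_within_open[where S = "{..<p}"]) (use t in \<open>auto simp: G_def\<close>)
    thus ?thesis by (simp add: has_real_derivative_iff_has_vector_derivative)
  qed
  have hi: "((\<lambda>t. (\<delta> + 2 * \<bar>t - p\<bar>) powr (\<mu> - 2)) has_integral (G 1 - G 0)) {0..1}"
    by (rule fundamental_theorem_of_calculus_interior_strong[of "{p}"]) (use cont der in auto)
  thus "(\<lambda>t. (\<delta> + 2 * \<bar>t - p\<bar>) powr (\<mu> - 2)) integrable_on {0..1}" by blast
  have mono: "(\<delta> + 2 * y) powr (\<mu> - 1) \<le> \<delta> powr (\<mu> - 1)" if "y \<ge> 0" for y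
    using d m that by (intro powr_mono2') auto
  have up: "G t \<le> 0" for t
  proof (cases "t \<ge> p")
    case True
    thus ?thesis using c unfolding G_def by (auto simp: zero_le_divide_iff)
  next
    case False
    hence "- 2 * \<delta> powr (\<mu> - 1) + (\<delta> + 2 * (p - t)) powr (\<mu> - 1) \<le> 0"
      using mono[of "p - t"] powr_ge_zero[of \<delta> "\<mu> - 1"] by linarith
    thus ?thesis using c False unfolding G_def by (simp add: divide_nonpos_pos)
  qed
  have lo: "- 2 * \<delta> powr (\<mu> - 1) / c \<le> G t" for t
  proof -
    have "- 2 * \<delta> powr (\<mu> - 1) \<le> - ((\<delta> + 2 * (t - p)) powr (\<mu> - 1))" if "t \<ge> p"
      using mono[of "t - p"] powr_ge_zero[of \<delta> "\<mu> - 1"] that by linarith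
    hence "- 2 * \<delta> powr (\<mu> - 1) \<le> (if t \<ge> p then - ((\<delta> + 2 * (t - p)) powr (\<mu> - 1))
        else - 2 * \<delta> powr (\<mu> - 1) + (\<delta> + 2 * (p - t)) powr (\<mu> - 1))" by simp
    hence "- 2 * \<delta> powr (\<mu> - 1) / c \<le> \<dots> / c" using c by (intro divide_right_mono) auto
    thus ?thesis by (simp add: G_def split: if_splits)
  qed
  have "G 1 - G 0 \<le> 2 * \<delta> powr (\<mu> - 1) / c" using up[of 1] lo[of 0] by linarith
  also have "\<dots> = \<delta> powr (\<mu> - 1) / (1 - \<mu>)" unfolding c_def by (rule mult_divide_mult_cancel_left) simp
  finally show "integral {0..1} (\<lambda>t. (\<delta> + 2 * \<bar>t - p\<bar>) powr (\<mu> - 2)) \<le> \<delta> powr (\<mu> - 1) / (1 - \<mu>)"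
    using integral_unique[OF hi] by simp
qed

lemma norm_radial_le:
  fixes u w :: complex
  assumes "norm u = 1" "norm w = 1" "0 \<le> r" "r < 1"
  shows "1 - r \<le> norm (u - of_real r * w)" and "norm (u - w) \<le> 2 * norm (u - of_real r * w)"
proof -
  have "norm (of_real r * w) = r" using assms by (simp add: norm_mult)
  thus 1: "1 - r \<le> norm (u - of_real r * w)" using norm_triangle_ineq2[of u "of_real r * w"] assms by simp
  have "norm (of_real r * w - w) = 1 - r"
  proof -
    have "of_real r * w - w = - (of_real (1 - r) * w)" by (simp add: algebra_simps)
    thus ?thesis using assms by (simp add: norm_mult del: of_real_diff)
  qed
  moreover have "norm (u - w) \<le> norm (u - of_real r * w) + norm (of_real r * w - w)"
    using norm_triangle_ineq[of "u - of_real r * w" "of_real r * w - w"] by simp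
  ultimately show "norm (u - w) \<le> 2 * norm (u - of_real r * w)" using 1 by simp
qed

lemma ex_circ:
  assumes "norm w = 1" obtains s where "0 \<le> s" "s \<le> 1" "w = circ s"
proof (rule that[of "Arg2pi w / (2 * pi)"])
  show "0 \<le> Arg2pi w / (2 * pi)" using Arg2pi_ge_0[of w] by simp
  show "Arg2pi w / (2 * pi) \<le> 1" using Arg2pi_lt_2pi[of w] by simp
  show "w = circ (Arg2pi w / (2 * pi))" using Arg2pi_eq[of w] assms by (simp add: mult_ac)
qed

lemma kernel_integral_bound:
  assumes r: "0 \<le> r" "r < 1" and w: "norm w = 1" and m: "\<mu> < 1" "0 < \<mu>"
  shows "(\<lambda>t. norm (circ t - of_real r * w) powr (\<mu> - 2)) integrable_on {0..1}"
    and "integral {0..1} (\<lambda>t. norm (circ t - of_real r * w) powr (\<mu> - 2))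
       \<le> 12 / (1 - \<mu>) * (1 - r) powr (\<mu> - 1)"
proof -
  obtain s where s: "0 \<le> s" "s \<le> 1" "w = circ s" by (rule ex_circ[OF w])
  define \<delta> where "\<delta> = 1 - r"
  have d: "\<delta> > 0" using r by (simp add: \<delta>_def)
  have nz: "norm (circ t - of_real r * w) > 0" for t
    using norm_radial_le(1)[OF norm_circ w r, of t] d unfolding \<delta>_def by linarith
  have "continuous_on {0..1} (\<lambda>t. norm (circ t - of_real r * w) powr (\<mu> - 2))"
    using nz by (intro continuous_intros) (auto simp: less_imp_neq)
  thus int: "(\<lambda>t. norm (circ t - of_real r * w) powr (\<mu> - 2)) integrable_on {0..1}"
    by (rule integrable_continuous_real)
  let ?h = "\<lambda>p t. (\<delta> + 2 * \<bar>t - p\<bar>) powr (\<mu> - 2)"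
  \<comment> \<open>The sine vanishes for t - s in {-1, 0, 1}: the circle is closed up by three copies of the
    singularity.\<close>
  have bd: "norm (circ t - of_real r * w) powr (\<mu> - 2) \<le> 4 * (?h (s - 1) t + ?h s t + ?h (s + 1) t)"
    if t: "t \<in> {0..1}" for t
  proof -
    have "\<bar>t - s\<bar> \<le> 1" using t s by auto
    then obtain j where j: "j \<in> {-1, 0, 1}" "2 * \<bar>t - s - j\<bar> \<le> \<bar>sin (pi * (t - s))\<bar>"
      using sin_pi_lower_bound by blast
    have n: "norm (circ t) = 1" "norm (circ s) = 1" by (rule norm_circ)+
    have "2 * \<bar>sin (pi * (t - s))\<bar> \<le> 2 * norm (circ t - of_real r * w)"
      using norm_radial_le(2)[OF n r] unfolding s(3)[symmetric] norm_circ_diff[symmetric] using s(3) by simp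
    moreover have "\<delta> \<le> norm (circ t - of_real r * w)"
      using norm_radial_le(1)[OF n(1) w r] by (simp add: \<delta>_def)
    ultimately have ge: "(\<delta> + 2 * \<bar>t - (s + j)\<bar>) / 2 \<le> norm (circ t - of_real r * w)"
      using j(2) by (simp add: diff_diff_eq)
    have "norm (circ t - of_real r * w) powr (\<mu> - 2) \<le> ((\<delta> + 2 * \<bar>t - (s + j)\<bar>) / 2) powr (\<mu> - 2)"
      using ge d m by (intro powr_mono2') (auto intro: add_pos_nonneg)
    also have "\<dots> = ?h (s + j) t / 2 powr (\<mu> - 2)"
      using d by (simp add: powr_divide)
    also have "\<dots> = 2 powr (2 - \<mu>) * ?h (s + j) t"
      using powr_minus_divide[of 2 "\<mu> - 2"] by simp
    also have "\<dots> \<le> 4 * ?h (s + j) t"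
    proof (rule mult_right_mono)
      have "2 powr (2 - \<mu>) \<le> 2 powr (2::real)" using m by (intro powr_mono) auto
      thus "2 powr (2 - \<mu>) \<le> 4" by simp
    qed simp
    also have "\<dots> \<le> 4 * (?h (s - 1) t + ?h s t + ?h (s + 1) t)"
    proof -
      have "?h (s - 1) t \<ge> 0" "?h s t \<ge> 0" "?h (s + 1) t \<ge> 0" by simp_all
      thus ?thesis using j(1) by (elim insertE) (auto simp del: powr_ge_zero)
    qed
    finally show ?thesis .
  qed
  have i: "?h p integrable_on {0..1}" and b: "integral {0..1} (?h p) \<le> \<delta> powr (\<mu> - 1) / (1 - \<mu>)" for p
    using integral_abs_powr_bound[OF d m(1)] by auto
  have "integral {0..1} (\<lambda>t. norm (circ t - of_real r * w) powr (\<mu> - 2))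
      \<le> integral {0..1} (\<lambda>t. 4 * (?h (s - 1) t + ?h s t + ?h (s + 1) t))"
    by (intro integral_le int integrable_on_mult_right integrable_add i bd)
  also have "\<dots> = 4 * (integral {0..1} (?h (s - 1)) + integral {0..1} (?h s) + integral {0..1} (?h (s + 1)))"
    by (simp add: integral_add i integrable_add)
  also have "\<dots> \<le> 12 / (1 - \<mu>) * \<delta> powr (\<mu> - 1)"
    using b[of "s - 1"] b[of s] b[of "s + 1"] by simp
  finally show "integral {0..1} (\<lambda>t. norm (circ t - of_real r * w) powr (\<mu> - 2))
       \<le> 12 / (1 - \<mu>) * (1 - r) powr (\<mu> - 1)" by (simp add: \<delta>_def)
qed

lemma norm_one_minus_mult:
  assumes "0 \<le> t" "t \<le> 1"
  shows "norm ((1 - complex_of_real t) * z) = (1 - t) * norm z"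
proof -
  have "norm (1 - complex_of_real t) = norm (complex_of_real (1 - t))" by simp
  also have "\<dots> = 1 - t" using assms by (simp only: norm_of_real)
  finally show ?thesis by (simp add: norm_mult)
qed

text \<open>
  The Hardy--Littlewood criterion: move both points inwards along their radii by half their
  distance, where the derivative is small enough for the mean value inequality; the radial steps
  integrate the singular bound.
\<close>
lemma hoelder_on_from_derivative_bound:
  fixes f :: "complex \<Rightarrow> complex"
  assumes hol: "f holomorphic_on ball 0 1" and B: "B \<ge> 0"
    and bd: "\<And>z::complex. z \<in> ball 0 1 \<Longrightarrow> norm (deriv f z) \<le> B * (1 - norm z) powr (\<mu> - 1)"
    and m: "0 < \<mu>" "\<mu> < 1"
  shows "hoelder_on \<mu> (ball 0 1) f"
proof (rule hoelder_onI[where M = "2 * B / \<mu> + 2 * B"])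
  have radial: "norm (f ((1 - of_real d) * z) - f z) \<le> B / \<mu> * d powr \<mu>"
    if z: "z \<in> ball 0 1" and d: "0 < d" "d \<le> 1" for z :: complex and d
  proof -
    define g where "g t = f ((1 - of_real t) * z)" for t :: real
    define \<phi> where "\<phi> t = B / \<mu> * t powr \<mu>" for t :: real
    have inb: "(1 - of_real t) * z \<in> ball 0 1" if "0 \<le> t" "t \<le> 1" for t
    proof -
      have "norm ((1 - complex_of_real t) * z) = (1 - t) * norm z" using that by (intro norm_one_minus_mult) auto
      also have "\<dots> \<le> 1 * norm z" using that by (intro mult_right_mono) auto
      finally show ?thesis using z by simp
    qed
    have "norm (g d - g 0) \<le> \<phi> d - \<phi> 0"
    proof (rule differentiable_bound_general[OF d(1), where f = g and \<phi> = \<phi> and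
          f' = "\<lambda>t. - z * deriv f ((1 - of_real t) * z)" and \<phi>' = "\<lambda>t. B * t powr (\<mu> - 1)"])
      show "continuous_on {0..d} \<phi>" unfolding \<phi>_def
        using m by (intro continuous_on_mult_left continuous_on_powr' continuous_intros) auto
      show "continuous_on {0..d} g" unfolding g_def
        by (rule continuous_on_compose2[OF holomorphic_on_imp_continuous_on[OF hol]])
          (use inb d in \<open>auto intro!: continuous_intros\<close>)
      fix t assume t: "0 < t" "t < d"
      show "(\<phi> has_vector_derivative B * t powr (\<mu> - 1)) (at t)"
        unfolding \<phi>_def has_real_derivative_iff_has_vector_derivative[symmetric]
        using t m by (auto intro!: derivative_eq_intros)
      have "(f has_field_derivative deriv f ((1 - of_real t) * z)) (at ((1 - of_real t) * z))"
        by (rule holomorphic_derivI[OF hol]) (use inb[of t] t d in auto)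
      moreover have "((\<lambda>t. (1 - complex_of_real t) * z) has_vector_derivative (- z)) (at t)"
        by (auto intro!: derivative_eq_intros)
      ultimately show "(g has_vector_derivative - z * deriv f ((1 - of_real t) * z)) (at t)"
        using field_vector_diff_chain_at[of "\<lambda>t. (1 - complex_of_real t) * z" "- z" t f] unfolding g_def o_def by blast
      have "norm ((1 - complex_of_real t) * z) = (1 - t) * norm z" using t d by (intro norm_one_minus_mult) auto
      also have "\<dots> \<le> (1 - t) * 1" using z t d by (intro mult_left_mono) auto
      finally have le: "t \<le> 1 - norm ((1 - complex_of_real t) * z)" by simp
      have "norm (deriv f ((1 - of_real t) * z)) \<le> B * (1 - norm ((1 - complex_of_real t) * z)) powr (\<mu> - 1)"
        by (rule bd) (use inb[of t] t d in auto)
      also have "\<dots> \<le> B * t powr (\<mu> - 1)"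
        using le t m B by (intro mult_left_mono powr_mono2') auto
      finally have "norm (deriv f ((1 - of_real t) * z)) \<le> B * t powr (\<mu> - 1)" .
      moreover have "norm z * norm (deriv f ((1 - of_real t) * z)) \<le> 1 * norm (deriv f ((1 - of_real t) * z))"
        using z by (intro mult_right_mono) auto
      ultimately show "norm (- z * deriv f ((1 - of_real t) * z)) \<le> B * t powr (\<mu> - 1)"
        by (simp add: norm_mult)
    qed
    thus ?thesis using m by (simp add: g_def \<phi>_def)
  qed
  fix x y :: complex assume xy: "x \<in> ball 0 1" "y \<in> ball 0 1"
  show "norm (f x - f y) \<le> (2 * B / \<mu> + 2 * B) * norm (x - y) powr \<mu>"
  proof (cases "x = y")
    case False
    define D where "D = norm (x - y)"
    \<comment> \<open>Half the distance: at most 1, so that the points can be moved inwards by d.\<close>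
    define d where "d = D / 2"
    have D: "0 < D" "D < 2"
      using False xy norm_triangle_ineq4[of x y] by (auto simp: D_def)
    hence d: "0 < d" "d \<le> 1" by (auto simp: d_def)
    have dD: "d powr \<mu> \<le> D powr \<mu>" using D m by (intro powr_mono2) (auto simp: d_def)
    let ?x = "(1 - of_real d) * x" and ?y = "(1 - of_real d) * y"
    have "norm (f ?x - f ?y) \<le> (B * d powr (\<mu> - 1)) * norm (?x - ?y)"
    proof (cases "d = 1")
      case False
      hence d1: "d < 1" using d by simp
      have n: "norm ((1 - complex_of_real d) * z) \<le> 1 - d" if "z \<in> ball 0 1" for z
      proof -
        have "norm ((1 - complex_of_real d) * z) = (1 - d) * norm z" using d by (intro norm_one_minus_mult) auto
        also have "\<dots> \<le> (1 - d) * 1" using that d by (intro mult_left_mono) auto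
        finally show ?thesis by simp
      qed
      show ?thesis
      proof (rule field_differentiable_bound[of "cball 0 (1 - d)" f "deriv f"])
        fix z :: complex assume z: "z \<in> cball 0 (1 - d)"
        hence zb: "z \<in> ball 0 1" using d by auto
        show "(f has_field_derivative deriv f z) (at z within cball 0 (1 - d))"
          using holomorphic_derivI[OF hol open_ball zb] by (rule has_field_derivative_at_within)
        have "norm (deriv f z) \<le> B * (1 - norm z) powr (\<mu> - 1)" by (rule bd[OF zb])
        also have "\<dots> \<le> B * d powr (\<mu> - 1)"
          using z d m B by (intro mult_left_mono powr_mono2') auto
        finally show "norm (deriv f z) \<le> B * d powr (\<mu> - 1)" .
      qed (use n xy in auto)
    qed simp
    also have "norm (?x - ?y) = (1 - d) * D"
    proof -
      have "?x - ?y = of_real (1 - d) * (x - y)" by (simp add: algebra_simps)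
      thus ?thesis using d by (simp add: norm_mult D_def del: of_real_diff)
    qed
    also have "(B * d powr (\<mu> - 1)) * ((1 - d) * D) \<le> (B * d powr (\<mu> - 1)) * (1 * D)"
      using B d D by (intro mult_left_mono mult_right_mono) auto
    also have "\<dots> = 2 * B * d powr \<mu>"
    proof -
      have "d powr \<mu> = d powr (\<mu> - 1) * d powr 1" by (subst powr_add[symmetric]) simp
      thus ?thesis using d by (simp add: d_def)
    qed
    finally have mid: "norm (f ?x - f ?y) \<le> 2 * B * d powr \<mu>" .
    have "norm (f x - f y) \<le> norm (f ?x - f x) + norm (f ?x - f ?y) + norm (f ?y - f y)"
    proof -
      have "f x - f y = (f ?x - f ?y) + (f ?y - f y) - (f ?x - f x)" by simp
      thus ?thesis using norm_triangle_ineq4[of "(f ?x - f ?y) + (f ?y - f y)" "f ?x - f x"]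
          norm_triangle_ineq[of "f ?x - f ?y" "f ?y - f y"] by simp
    qed
    also have "\<dots> \<le> B / \<mu> * d powr \<mu> + 2 * B * d powr \<mu> + B / \<mu> * d powr \<mu>"
      by (intro add_mono radial[OF xy(1) d] radial[OF xy(2) d] mid)
    also have "\<dots> = (2 * B / \<mu>) * d powr \<mu> + 2 * B * d powr \<mu>" by (simp add: algebra_simps)
    also have "\<dots> \<le> (2 * B / \<mu>) * D powr \<mu> + 2 * B * D powr \<mu>"
      using dD B m by (intro add_mono mult_left_mono) auto
    finally show ?thesis by (simp add: D_def algebra_simps)
  qed (simp add: B m)
qed
text \<open>
  A Hoelder function is uniformly continuous, so it extends to the closed disc; the inequality
  passes to the limit along radii.
\<close>
lemma hoelder_on_ball_extend:
  assumes h: "hoelder_on \<mu> (ball 0 1) f" and m: "0 < \<mu>"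
  obtains g where "hoelder_on \<mu> (cball 0 1) g" "\<And>z. z \<in> ball 0 1 \<Longrightarrow> g z = f z"
proof -
  obtain M where M: "M \<ge> 0" "\<And>x y. x \<in> ball 0 1 \<Longrightarrow> y \<in> ball 0 1 \<Longrightarrow> norm (f x - f y) \<le> M * norm (x - y) powr \<mu>"
    by (rule hoelder_onE[OF h]) blast
  have "uniformly_continuous_on (ball 0 1) f"
    unfolding uniformly_continuous_on_def
  proof (intro allI impI)
    fix e :: real assume e: "e > 0"
    have "((\<lambda>t. M * t powr \<mu>) \<longlongrightarrow> M * 0 powr \<mu>) (at_right 0)"
      using m by (intro tendsto_intros) (auto simp: eventually_at_filter)
    hence "eventually (\<lambda>t. M * t powr \<mu> < e) (at_right 0)"
      using e m by (intro order_tendstoD(2)[of _ "M * 0 powr \<mu>"]) auto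
    then obtain b where b: "b > 0" "\<And>t. 0 < t \<Longrightarrow> t < b \<Longrightarrow> M * t powr \<mu> < e"
      unfolding eventually_at_right_field by auto
    show "\<exists>d>0. \<forall>x\<in>ball 0 1. \<forall>x'\<in>ball 0 1. dist x' x < d \<longrightarrow> dist (f x') (f x) < e"
    proof (intro exI conjI ballI impI)
      fix x x' :: complex assume x: "x \<in> ball 0 1" "x' \<in> ball 0 1" "dist x' x < b"
      show "dist (f x') (f x) < e"
      proof (cases "x = x'")
        case False
        thus ?thesis using M(2)[OF x(2,1)] b(2)[of "norm (x' - x)"] x(3) by (simp add: dist_norm)
      qed (use e in simp)
    qed (rule b)
  qed
  then obtain g where g: "uniformly_continuous_on (closure (ball 0 1)) g" "\<And>x. x \<in> ball 0 1 \<Longrightarrow> f x = g x"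
    by (rule uniformly_continuous_on_extension_on_closure) blast
  hence gc: "continuous_on (cball 0 1) g" by (simp add: uniformly_continuous_imp_continuous)
  show ?thesis
  proof (rule that)
    show "hoelder_on \<mu> (cball 0 1) g"
    proof (rule hoelder_onI[where M = M])
      fix x y :: complex assume xy: "x \<in> cball 0 1" "y \<in> cball 0 1"
      have sc: "of_real r * z \<in> ball 0 1" if "0 < r" "r < 1" "z \<in> cball 0 1" for r and z :: complex
      proof -
        have "norm (complex_of_real r * z) \<le> r * 1" unfolding norm_mult using that by (intro mult_mono) auto
        thus ?thesis using that by simp
      qed
      have lim: "((\<lambda>r. g (of_real r * z)) \<longlongrightarrow> g z) (at_left 1)" if z: "z \<in> cball 0 1" for z
      proof (rule continuous_on_tendsto_compose[OF gc _ z])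
        have "((\<lambda>r. complex_of_real r * z) \<longlongrightarrow> of_real 1 * z) (at_left 1)" by (intro tendsto_intros)
        thus "((\<lambda>r. complex_of_real r * z) \<longlongrightarrow> z) (at_left 1)" by simp
        show "eventually (\<lambda>r. complex_of_real r * z \<in> cball 0 1) (at_left 1)"
          using eventually_at_left_real[of 0 1, OF zero_less_one]
        proof eventually_elim
          case (elim r)
          hence "of_real r * z \<in> ball 0 1" using z by (intro sc) auto
          thus ?case using ball_subset_cball by blast
        qed
      qed
      show "norm (g x - g y) \<le> M * norm (x - y) powr \<mu>"
      proof (rule tendsto_upperbound)
        show "((\<lambda>r. norm (g (of_real r * x) - g (of_real r * y))) \<longlongrightarrow> norm (g x - g y)) (at_left 1)"
          by (intro tendsto_intros lim xy)
        show "eventually (\<lambda>r. norm (g (of_real r * x) - g (of_real r * y)) \<le> M * norm (x - y) powr \<mu>) (at_left 1)"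
          using eventually_at_left_real[of 0 1, OF zero_less_one]
        proof eventually_elim
          case (elim r)
          hence r: "0 < r" "r < 1" by auto
          have "norm (of_real r * x - of_real r * y) = r * norm (x - y)"
            using r by (simp add: norm_mult flip: right_diff_distrib)
          also have "\<dots> \<le> norm (x - y)" using r by (simp add: mult_left_le_one_le)
          finally have "M * norm (of_real r * x - of_real r * y) powr \<mu> \<le> M * norm (x - y) powr \<mu>"
            using M(1) m by (intro mult_left_mono powr_mono2) auto
          thus ?case using M(2)[OF sc[OF r xy(1)] sc[OF r xy(2)]] g(2) sc[OF r] xy by force
        qed
      qed simp
    qed
  qed (use g in auto)
qed

definition cauchy_transform :: "(complex \<Rightarrow> complex) \<Rightarrow> complex \<Rightarrow> complex" where
  "cauchy_transform \<phi> z = integral {0..1} (\<lambda>t. \<phi> (circ t) * circ t / (circ t - z))"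

lemma circlepath_0_1: "circlepath 0 1 t = circ t"
  by (simp add: circlepath)

lemma circ_contour_integral:
  assumes "continuous_on (sphere 0 1) g"
  shows "(g has_contour_integral 2 * of_real pi * \<i> * integral {0..1} (\<lambda>t. g (circ t) * circ t)) (circlepath 0 1)"
    and "(\<lambda>t. g (circ t) * circ t) integrable_on {0..1}"
proof -
  have "continuous_on {0..1} (\<lambda>t. g (circ t) * circ t)"
    by (intro continuous_on_mult continuous_on_compose2[OF assms]) (auto intro!: continuous_intros)
  thus i: "(\<lambda>t. g (circ t) * circ t) integrable_on {0..1}" by (rule integrable_continuous_real)
  have "((\<lambda>t. 2 * of_real pi * \<i> * (g (circ t) * circ t)) has_integral
      2 * of_real pi * \<i> * integral {0..1} (\<lambda>t. g (circ t) * circ t)) {0..1}"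
    by (intro has_integral_mult_right integrable_integral i)
  thus "(g has_contour_integral 2 * of_real pi * \<i> * integral {0..1} (\<lambda>t. g (circ t) * circ t)) (circlepath 0 1)"
    unfolding has_contour_integral_def
  proof (rule has_integral_eq[rotated])
    fix t :: real assume "t \<in> {0..1}"
    hence "vector_derivative (circlepath 0 1) (at t within {0..1}) = 2 * of_real pi * \<i> * circ t"
      by (subst vector_derivative_circlepath01) auto
    thus "2 * of_real pi * \<i> * (g (circ t) * circ t)
        = g (circlepath 0 1 t) * vector_derivative (circlepath 0 1) (at t within {0..1})"
      by (simp only: circlepath_0_1 mult_ac)
  qed
qed

lemma ball_circ_neq: "z \<in> ball 0 1 \<Longrightarrow> w \<in> sphere 0 1 \<Longrightarrow> w - z \<noteq> (0::complex)"
  by auto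

lemma cauchy_transform_const:
  assumes "z \<in> ball 0 1"
  shows "cauchy_transform (\<lambda>_. c) z = c"
proof -
  have "continuous_on (sphere 0 1) (\<lambda>w. c / (w - z))"
    using ball_circ_neq[OF assms] by (intro continuous_intros) auto
  from circ_contour_integral(1)[OF this]
  have "((\<lambda>w. c / (w - z)) has_contour_integral 2 * of_real pi * \<i> * cauchy_transform (\<lambda>_. c) z) (circlepath 0 1)"
    by (simp add: cauchy_transform_def)
  moreover have "((\<lambda>w. c / (w - z)) has_contour_integral 2 * of_real pi * \<i> * c) (circlepath 0 1)"
    using Cauchy_integral_circlepath_simple[of "\<lambda>_. c" 0 1 z] assms by (simp add: dist_norm)
  ultimately have "2 * of_real pi * \<i> * cauchy_transform (\<lambda>_. c) z = 2 * of_real pi * \<i> * c"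
    by (rule has_contour_integral_unique)
  thus ?thesis by simp
qed

lemma cauchy_transform_integrable:
  assumes "continuous_on (sphere 0 1) \<phi>" "z \<in> ball 0 1"
  shows "(\<lambda>t. \<phi> (circ t) * circ t / (circ t - z)) integrable_on {0..1}"
proof -
  have "continuous_on (sphere 0 1) (\<lambda>w. \<phi> w / (w - z))"
    using ball_circ_neq[OF assms(2)] assms(1) by (intro continuous_intros) auto
  from circ_contour_integral(2)[OF this] show ?thesis by simp
qed

lemma cauchy_transform_diff_const:
  assumes "continuous_on (sphere 0 1) \<phi>" "z \<in> ball 0 1"
  shows "cauchy_transform (\<lambda>w. \<phi> w - c) z = cauchy_transform \<phi> z - c"
proof -
  have "cauchy_transform (\<lambda>w. \<phi> w - c) z = cauchy_transform \<phi> z - cauchy_transform (\<lambda>_. c) z"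
    unfolding cauchy_transform_def
    by (subst integral_diff[symmetric])
      (use assms in \<open>auto intro!: cauchy_transform_integrable integral_cong simp: diff_divide_distrib left_diff_distrib\<close>)
  thus ?thesis using cauchy_transform_const[OF assms(2)] by simp
qed

lemma cauchy_transform_deriv:
  assumes c: "continuous_on (sphere 0 1) \<phi>" and z: "z \<in> ball 0 1"
  shows "(cauchy_transform \<phi> has_field_derivative
           integral {0..1} (\<lambda>t. \<phi> (circ t) * circ t / (circ t - z)\<^sup>2)) (at z)"
    and "(\<lambda>t. \<phi> (circ t) * circ t / (circ t - z)\<^sup>2) integrable_on {0..1}"
proof -
  let ?p = "2 * of_real pi * \<i> :: complex"
  have i: "((\<lambda>u. \<phi> u / (u - w) ^ 1) has_contour_integral ?p * cauchy_transform \<phi> w) (circlepath 0 1)"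
    if w: "w \<in> ball 0 1" for w
  proof -
    have "continuous_on (sphere 0 1) (\<lambda>u. \<phi> u / (u - w))"
      using ball_circ_neq[OF w] c by (intro continuous_intros) auto
    from circ_contour_integral(1)[OF this] show ?thesis by (simp add: cauchy_transform_def)
  qed
  have "continuous_on (path_image (circlepath 0 1)) \<phi>" using c by simp
  note d = Cauchy_next_derivative_circlepath(2)[OF this i _ z, simplified]
  have c2: "continuous_on (sphere 0 1) (\<lambda>u. \<phi> u / (u - z)\<^sup>2)"
    using ball_circ_neq[OF z] c by (intro continuous_intros) auto
  have e: "contour_integral (circlepath 0 1) (\<lambda>u. \<phi> u / (u - z)\<^sup>2)
      = ?p * integral {0..1} (\<lambda>t. \<phi> (circ t) * circ t / (circ t - z)\<^sup>2)"
    using contour_integral_unique[OF circ_contour_integral(1)[OF c2]] by simp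
  show "(\<lambda>t. \<phi> (circ t) * circ t / (circ t - z)\<^sup>2) integrable_on {0..1}"
    using circ_contour_integral(2)[OF c2] by simp
  have "((\<lambda>w. ?p * cauchy_transform \<phi> w / ?p) has_field_derivative
      (?p * integral {0..1} (\<lambda>t. \<phi> (circ t) * circ t / (circ t - z)\<^sup>2)) / ?p) (at z)"
    by (rule DERIV_cdivide) (use d e in \<open>simp add: power2_eq_square\<close>)
  thus "(cauchy_transform \<phi> has_field_derivative
           integral {0..1} (\<lambda>t. \<phi> (circ t) * circ t / (circ t - z)\<^sup>2)) (at z)" by simp
qed

text \<open>
  The zero of \<psi> of order \<mu> at the boundary point w lowers the singularity of the
  quadratic kernel to the exponent \<mu> - 2. This serves both the derivative of a Cauchy integral
  and the Poisson kernel.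
\<close>
lemma hoelder_kernel_integral_bound:
  fixes \<psi> :: "complex \<Rightarrow> complex" and k :: "real \<Rightarrow> complex"
  assumes r: "0 \<le> r" "r < 1" and w: "norm w = 1" and m: "0 < \<mu>" "\<mu> < 1"
    and M: "M \<ge> 0" "\<And>x. x \<in> sphere 0 1 \<Longrightarrow> norm (\<psi> x) \<le> M * norm (x - w) powr \<mu>"
    and k: "\<And>t. t \<in> {0..1} \<Longrightarrow> norm (k t) \<le> c * norm (\<psi> (circ t)) / (norm (circ t - of_real r * w))\<^sup>2"
    and c: "c \<ge> 0" and int: "k integrable_on {0..1}"
  shows "norm (integral {0..1} k) \<le> c * (24 * M / (1 - \<mu>)) * (1 - r) powr (\<mu> - 1)"
proof -
  have "norm (integral {0..1} k) \<le> integral {0..1} (\<lambda>t. c * (2 * M) * norm (circ t - of_real r * w) powr (\<mu> - 2))"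
  proof (rule integral_norm_bound_integral[OF int])
    show "(\<lambda>t. c * (2 * M) * norm (circ t - of_real r * w) powr (\<mu> - 2)) integrable_on {0..1}"
      by (intro integrable_on_mult_right kernel_integral_bound(1)[OF r w m(2,1)])
    fix t :: real assume t: "t \<in> {0..1}"
    define N where "N = norm (circ t - of_real r * w)"
    have N: "N > 0" using norm_radial_le(1)[OF norm_circ[of t] w r] r unfolding N_def by linarith
    have "norm (circ t - w) powr \<mu> \<le> (2 * N) powr \<mu>"
      using norm_radial_le(2)[OF norm_circ[of t] w r] m by (intro powr_mono2) (auto simp: N_def)
    also have "\<dots> = 2 powr \<mu> * N powr \<mu>" using N by (simp add: powr_mult)
    also have "\<dots> \<le> 2 * N powr \<mu>"
    proof (rule mult_right_mono)
      have "2 powr \<mu> \<le> 2 powr (1::real)" using m by (intro powr_mono) auto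
      thus "2 powr \<mu> \<le> 2" by simp
    qed simp
    finally have "norm (\<psi> (circ t)) \<le> M * (2 * N powr \<mu>)"
      using M(1) by (intro order_trans[OF M(2)[of "circ t"] mult_left_mono]) (auto simp del: norm_circ simp: norm_circ)
    hence "c * norm (\<psi> (circ t)) / N\<^sup>2 \<le> c * (M * (2 * N powr \<mu>)) / N\<^sup>2"
      using c by (intro divide_right_mono mult_left_mono) auto
    also have "\<dots> = c * (2 * M) * N powr (\<mu> - 2)"
      using N by (simp add: powr_diff)
    finally show "norm (k t) \<le> c * (2 * M) * norm (circ t - of_real r * w) powr (\<mu> - 2)"
      using k[OF t] by (simp add: N_def)
  qed
  also have "\<dots> = c * (2 * M) * integral {0..1} (\<lambda>t. norm (circ t - of_real r * w) powr (\<mu> - 2))"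
    by simp
  also have "\<dots> \<le> c * (2 * M) * (12 / (1 - \<mu>) * (1 - r) powr (\<mu> - 1))"
    using c M(1) by (intro mult_left_mono kernel_integral_bound(2)[OF r w m(2,1)]) auto
  finally show ?thesis by (simp add: algebra_simps)
qed

text \<open>
  Subtracting the value at the nearest boundary point does not change the derivative of the
  transform, and it makes the density vanish there to order \<mu>; the Hardy--Littlewood criterion
  applies.
\<close>
lemma cauchy_transform_hoelder:
  assumes h: "hoelder_on \<mu> (sphere 0 1) \<phi>" and m: "0 < \<mu>" "\<mu> < 1"
  obtains A where "A holomorphic_on ball 0 1" "hoelder_on \<mu> (cball 0 1) A"
    "\<And>z. z \<in> ball 0 1 \<Longrightarrow> A z = cauchy_transform \<phi> z"
proof -
  have c: "continuous_on (sphere 0 1) \<phi>" by (rule hoelder_on_continuous[OF h m(1)])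
  obtain M where M: "M \<ge> 0" "\<And>x y. x \<in> sphere 0 1 \<Longrightarrow> y \<in> sphere 0 1 \<Longrightarrow> norm (\<phi> x - \<phi> y) \<le> M * norm (x - y) powr \<mu>"
    by (rule hoelder_onE[OF h]) blast
  have hol: "cauchy_transform \<phi> holomorphic_on ball 0 1"
    using cauchy_transform_deriv(1)[OF c]
    by (auto simp: holomorphic_on_open intro!: exI)
  have "hoelder_on \<mu> (ball 0 1) (cauchy_transform \<phi>)"
  proof (rule hoelder_on_from_derivative_bound[OF hol _ _ m])
    show "0 \<le> 24 * M / (1 - \<mu>)" using M m by simp
    fix z :: complex assume z: "z \<in> ball 0 1"
    define r where "r = norm z"
    define w where "w = (if z = 0 then 1 else z / of_real r)"
    have w: "norm w = 1" "z = of_real r * w" by (auto simp: w_def r_def norm_divide)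
    have r: "0 \<le> r" "r < 1" using z by (auto simp: r_def)
    have ws: "w \<in> sphere 0 1" using w by simp
    let ?\<psi> = "\<lambda>u. \<phi> u - \<phi> w"
    have cc: "continuous_on (sphere 0 1) ?\<psi>" using c by (intro continuous_intros)
    let ?I = "integral {0..1} (\<lambda>t. ?\<psi> (circ t) * circ t / (circ t - z)\<^sup>2)"
    have "((\<lambda>x. cauchy_transform ?\<psi> x + \<phi> w) has_field_derivative ?I) (at z)"
      using cauchy_transform_deriv(1)[OF cc z] by (auto intro!: derivative_eq_intros)
    hence "(cauchy_transform \<phi> has_field_derivative ?I) (at z)"
      by (rule has_field_derivative_transform_within_open[OF _ open_ball z])
        (simp add: cauchy_transform_diff_const[OF c])
    hence "deriv (cauchy_transform \<phi>) z = ?I" by (rule DERIV_imp_deriv)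
    moreover have "norm ?I \<le> 1 * (24 * M / (1 - \<mu>)) * (1 - r) powr (\<mu> - 1)"
    proof (rule hoelder_kernel_integral_bound[OF r w(1) m M(1)])
      show "norm (?\<psi> x) \<le> M * norm (x - w) powr \<mu>" if "x \<in> sphere 0 1" for x by (rule M(2)[OF that ws])
      show "(\<lambda>t. ?\<psi> (circ t) * circ t / (circ t - z)\<^sup>2) integrable_on {0..1}"
        by (rule cauchy_transform_deriv(2)[OF cc z])
      show "norm (?\<psi> (circ t) * circ t / (circ t - z)\<^sup>2)
          \<le> 1 * norm (?\<psi> (circ t)) / (norm (circ t - of_real r * w))\<^sup>2" for t
        unfolding w(2)[symmetric] by (simp only: norm_mult norm_divide norm_power norm_circ mult_1_right mult_1_left)
    qed simp
    ultimately show "norm (deriv (cauchy_transform \<phi>) z) \<le> 24 * M / (1 - \<mu>) * (1 - norm z) powr (\<mu> - 1)"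
      by (simp add: r_def)
  qed
  from hoelder_on_ball_extend[OF this m(1)]
  obtain g where g: "hoelder_on \<mu> (cball 0 1) g" "\<And>z. z \<in> ball 0 1 \<Longrightarrow> g z = cauchy_transform \<phi> z" by blast
  have "g holomorphic_on ball 0 1" by (rule holomorphic_transform[OF hol]) (use g(2) in simp)
  thus ?thesis using g by (intro that[of g])
qed
lemma integral_flip01:
  fixes f :: "real \<Rightarrow> complex"
  assumes "f integrable_on {0..1}"
  shows "integral {0..1} (\<lambda>t. f (1 - t)) = integral {0..1} f" "(\<lambda>t. f (1 - t)) integrable_on {0..1}"
proof -
  have "((\<lambda>x. f (-1 * x + 1)) has_integral integral {0..1} f /\<^sub>R \<bar>-1\<bar> ^ DIM(real))
      ((\<lambda>x. (1 / -1) *\<^sub>R x + - ((1 / -1) *\<^sub>R 1)) ` cbox 0 1)"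
    using has_integral_affinity[of f "integral {0..1} f" 0 1 "-1" 1] assms by auto
  moreover have "(\<lambda>x. (1 / -1) *\<^sub>R x + - ((1 / -1) *\<^sub>R 1)) ` cbox 0 1 = {0..1::real}"
  proof -
    have "(\<lambda>x. (1 / -1) *\<^sub>R x + - ((1 / -1) *\<^sub>R 1)) = (\<lambda>x::real. 1 - x)" by auto
    thus ?thesis by (simp add: image_diff_atLeastAtMost)
  qed
  ultimately have "((\<lambda>t. f (1 - t)) has_integral integral {0..1} f) {0..1}" by simp
  thus "integral {0..1} (\<lambda>t. f (1 - t)) = integral {0..1} f" "(\<lambda>t. f (1 - t)) integrable_on {0..1}"
    by (auto simp: integral_unique)
qed

lemma circ_flip: "circ (1 - t) = 1 / circ t"
  unfolding circ_cis right_diff_distrib by (simp only: cis_divide[symmetric]) simp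

lemma norm_inverse_diff_circle:
  assumes "norm x = 1" "norm y = (1::real)"
  shows "norm (1 / x - 1 / y :: complex) = norm (x - y)"
proof -
  have "x \<noteq> 0" "y \<noteq> 0" using assms by auto
  hence "1 / x - 1 / y = (y - x) / (x * y)" by (simp add: field_simps)
  thus ?thesis using assms by (simp add: norm_divide norm_mult norm_minus_commute)
qed

lemma hoelder_on_circle_inverse:
  assumes "hoelder_on \<mu> (sphere 0 1) \<phi>"
  shows "hoelder_on \<mu> (sphere 0 1) (\<lambda>x. \<phi> (1 / x))"
proof -
  obtain M where M: "M \<ge> 0" "\<And>x y. x \<in> sphere 0 1 \<Longrightarrow> y \<in> sphere 0 1 \<Longrightarrow> norm (\<phi> x - \<phi> y) \<le> M * norm (x - y) powr \<mu>"
    by (rule hoelder_onE[OF assms]) blast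
  show ?thesis
  proof (rule hoelder_onI[where M = M])
    fix x y :: complex assume "x \<in> sphere 0 1" "y \<in> sphere 0 1"
    thus "norm (\<phi> (1 / x) - \<phi> (1 / y)) \<le> M * norm (x - y) powr \<mu>"
      using M(2)[of "1/x" "1/y"] norm_inverse_diff_circle[of x y] by (simp add: norm_divide)
  qed
qed

text \<open>
  The expression is the Poisson kernel, which arises as the sum of the inner and the reflected
  outer Cauchy kernel.
\<close>
lemma poisson_kernel_bound:
  fixes e w :: complex
  assumes e: "norm e = 1" and w: "norm w = 1" and r: "0 \<le> r" "r < 1"
  shows "norm (e / (e - of_real r * w) + (1 / e) / (1 / e - of_real r * (1 / w)) - 1)
    \<le> 2 * (1 - r) / (norm (e - of_real r * w))\<^sup>2"
proof -
  have nz: "e \<noteq> 0" "w \<noteq> 0" using e w by auto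
  have 1: "e - of_real r * w \<noteq> 0" using norm_radial_le(1)[OF e w r] r by auto
  have 2: "w - of_real r * e \<noteq> 0" using norm_radial_le(1)[OF w e r] r by auto
  have "(1 / e) / (1 / e - of_real r * (1 / w)) = w / (w - of_real r * e)"
    using nz 2 by (simp add: divide_simps)
  have "e / (e - of_real r * w) + (1 / e) / (1 / e - of_real r * (1 / w)) - 1
      = w * e * (1 - (of_real r)\<^sup>2) / ((e - of_real r * w) * (w - of_real r * e))"
  proof -
    have q: "a \<noteq> 0 \<Longrightarrow> b \<noteq> 0 \<Longrightarrow> e / a + w / b - 1 = (e * b + w * a - a * b) / (a * b)" for a b
      by (simp add: field_simps)
    have "e * (w - of_real r * e) + w * (e - of_real r * w) - (e - of_real r * w) * (w - of_real r * e)
        = w * e * (1 - (of_real r)\<^sup>2)" by (simp add: algebra_simps power2_eq_square)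
    thus ?thesis using q[OF 1 2] \<open>(1 / e) / (1 / e - of_real r * (1 / w)) = w / (w - of_real r * e)\<close> by simp
  qed
  also have "norm \<dots> = norm (1 - (complex_of_real r)\<^sup>2) / (norm (e - of_real r * w) * norm (w - of_real r * e))"
    by (simp add: norm_mult norm_divide e w)
  also have "norm (w - of_real r * e) = norm (e - of_real r * w)"
  proof -
    have c: "cnj e = 1 / e" "cnj w = 1 / w"
      using e w nz complex_norm_square[of e] complex_norm_square[of w] by (auto simp: field_simps)
    have "norm (w - of_real r * e) = norm (cnj (w - of_real r * e))" by (simp only: complex_mod_cnj)
    also have "cnj (w - of_real r * e) = (e - of_real r * w) / (w * e)"
      using nz by (simp add: c field_simps)
    finally show ?thesis using e w by (simp add: norm_divide norm_mult)
  qed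
  also have "norm (1 - (complex_of_real r)\<^sup>2) = 1 - r\<^sup>2"
  proof -
    have "1 - (complex_of_real r)\<^sup>2 = of_real (1 - r\<^sup>2)" by simp
    moreover have "1 - r\<^sup>2 \<ge> 0" using r by (simp add: power_le_one)
    ultimately show ?thesis by (simp only: norm_of_real abs_of_nonneg)
  qed
  also have "(1 - r\<^sup>2) / (norm (e - of_real r * w) * norm (e - of_real r * w))
      \<le> 2 * (1 - r) / (norm (e - of_real r * w) * norm (e - of_real r * w))"
  proof (rule divide_right_mono)
    have "(1 - r) * (1 + r) \<le> (1 - r) * 2" using r by (intro mult_left_mono) auto
    thus "1 - r\<^sup>2 \<le> 2 * (1 - r)" by (simp add: power2_eq_square algebra_simps)
  qed simp
  finally show ?thesis by (simp add: power2_eq_square)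
qed

text \<open>
  B is the Cauchy transform of the reflected function minus the mean. On the circle of radius r
  the sum of the two transforms is the Poisson integral of \<phi>; the kernel bound shows that it
  differs from \<phi> by O((1 - r)^\<mu>).
\<close>
lemma plemelj_privalov:
  assumes h: "hoelder_on \<mu> (sphere 0 1) \<phi>" and m: "0 < \<mu>" "\<mu> < 1"
  obtains A B where "A holomorphic_on ball 0 1" "hoelder_on \<mu> (cball 0 1) A"
    "B holomorphic_on ball 0 1" "hoelder_on \<mu> (cball 0 1) B"
    "A 0 = integral {0..1} (\<lambda>t. \<phi> (circ t))" "B 0 = 0"
    "\<And>w. w \<in> sphere 0 1 \<Longrightarrow> \<phi> w = A w + B (1 / w)"
proof -
  have cont: "continuous_on (sphere 0 1) \<phi>" by (rule hoelder_on_continuous[OF h m(1)])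
  define \<phi>' where "\<phi>' x = \<phi> (1 / x)" for x
  have h': "hoelder_on \<mu> (sphere 0 1) \<phi>'" unfolding \<phi>'_def by (rule hoelder_on_circle_inverse[OF h])
  have cont': "continuous_on (sphere 0 1) \<phi>'" by (rule hoelder_on_continuous[OF h' m(1)])
  obtain M where M: "M \<ge> 0" "\<And>x y. x \<in> sphere 0 1 \<Longrightarrow> y \<in> sphere 0 1 \<Longrightarrow> norm (\<phi> x - \<phi> y) \<le> M * norm (x - y) powr \<mu>"
    by (rule hoelder_onE[OF h]) blast
  define c where "c = integral {0..1} (\<lambda>t. \<phi> (circ t))"
  obtain A where A: "A holomorphic_on ball 0 1" "hoelder_on \<mu> (cball 0 1) A"
    "\<And>z. z \<in> ball 0 1 \<Longrightarrow> A z = cauchy_transform \<phi> z" by (rule cauchy_transform_hoelder[OF h m]) blast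
  obtain B where B: "B holomorphic_on ball 0 1" "hoelder_on \<mu> (cball 0 1) B"
    "\<And>z. z \<in> ball 0 1 \<Longrightarrow> B z = cauchy_transform \<phi>' z" by (rule cauchy_transform_hoelder[OF h' m]) blast
  have ic: "(\<lambda>t. \<psi> (circ t)) integrable_on {0..1}" if "continuous_on (sphere 0 1) \<psi>" for \<psi> :: "complex \<Rightarrow> complex"
    by (intro integrable_continuous_real continuous_on_compose2[OF that] continuous_intros) auto
  have jump: "\<phi> w = A w + (B (1 / w) - c)" if ws: "w \<in> sphere 0 1" for w
  proof -
    have w: "norm w = 1" using ws by simp
    define \<psi> where "\<psi> x = \<phi> x - \<phi> w" for x
    define \<psi>' where "\<psi>' x = \<phi>' x - \<phi> w" for x
    have cp: "continuous_on (sphere 0 1) \<psi>" "continuous_on (sphere 0 1) \<psi>'"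
      unfolding \<psi>_def \<psi>'_def by (intro continuous_intros cont cont')+
    have est: "norm (A (of_real r * w) + (B (of_real r * (1 / w)) - c) - \<phi> w)
        \<le> 2 * (1 - r) * (24 * M / (1 - \<mu>)) * (1 - r) powr (\<mu> - 1)" if r: "0 \<le> r" "r < 1" for r
    proof -
      have b: "of_real r * w \<in> ball 0 1" "of_real r * (1 / w) \<in> ball 0 1"
        using r w by (auto simp: norm_mult norm_divide)
      let ?f1 = "\<lambda>t. \<psi> (circ t) * circ t / (circ t - of_real r * w)"
      let ?f2 = "\<lambda>t. \<psi>' (circ t) * circ t / (circ t - of_real r * (1 / w))"
      let ?k = "\<lambda>t. \<psi> (circ t) * (circ t / (circ t - of_real r * w)
        + (1 / circ t) / (1 / circ t - of_real r * (1 / w)) - 1)"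
      have i1: "?f1 integrable_on {0..1}" by (rule cauchy_transform_integrable[OF cp(1) b(1)])
      have i2: "?f2 integrable_on {0..1}" by (rule cauchy_transform_integrable[OF cp(2) b(2)])
      have i3: "(\<lambda>t. \<psi> (circ t)) integrable_on {0..1}" by (rule ic[OF cp(1)])
      note f2 = integral_flip01[OF i2]
      have k: "?k = (\<lambda>t. ?f1 t + ?f2 (1 - t) - \<psi> (circ t))"
      proof
        fix t
        have "\<psi>' (1 / circ t) = \<psi> (circ t)" by (simp add: \<psi>'_def \<psi>_def \<phi>'_def)
        thus "?k t = ?f1 t + ?f2 (1 - t) - \<psi> (circ t)"
          unfolding circ_flip by (simp only:) (simp add: algebra_simps)
      qed
      have A1: "A (of_real r * w) - \<phi> w = integral {0..1} ?f1"
        unfolding A(3)[OF b(1)] cauchy_transform_diff_const[OF cont b(1), symmetric]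
        by (simp only: cauchy_transform_def \<psi>_def)
      have B1: "B (of_real r * (1 / w)) - \<phi> w = integral {0..1} ?f2"
        unfolding B(3)[OF b(2)] cauchy_transform_diff_const[OF cont' b(2), symmetric]
        by (simp only: cauchy_transform_def \<psi>'_def)
      have C1: "c - \<phi> w = integral {0..1} (\<lambda>t. \<psi> (circ t))"
        unfolding c_def \<psi>_def by (subst integral_diff) (auto intro: ic[OF cont])
      have "A (of_real r * w) + (B (of_real r * (1 / w)) - c) - \<phi> w
          = (A (of_real r * w) - \<phi> w) + (B (of_real r * (1 / w)) - \<phi> w) - (c - \<phi> w)" by simp
      also have "\<dots> = integral {0..1} ?k"
        unfolding A1 B1 C1 k f2(1)[symmetric]
        by (simp only: integral_diff[OF integrable_add[OF i1 f2(2)] i3] integral_add[OF i1 f2(2)])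
      also have "norm \<dots> \<le> 2 * (1 - r) * (24 * M / (1 - \<mu>)) * (1 - r) powr (\<mu> - 1)"
      proof (rule hoelder_kernel_integral_bound[OF r w m M(1)])
        show "norm (\<psi> x) \<le> M * norm (x - w) powr \<mu>" if "x \<in> sphere 0 1" for x
          unfolding \<psi>_def by (rule M(2)[OF that ws])
        show "norm (?k t) \<le> 2 * (1 - r) * norm (\<psi> (circ t)) / (norm (circ t - of_real r * w))\<^sup>2" for t
          unfolding norm_mult[of "\<psi> (circ t)"]
          using mult_left_mono[OF poisson_kernel_bound[OF norm_circ[of t] w r] norm_ge_zero[of "\<psi> (circ t)"]]
          by (simp only: times_divide_eq_right mult_ac)
        show "?k integrable_on {0..1}" unfolding k by (intro integrable_diff integrable_add i1 f2(2) i3)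
      qed (use r in simp)
      finally show ?thesis .
    qed
    have lim: "((\<lambda>r. g (of_real r * v)) \<longlongrightarrow> g v) (at_left 1)"
      if g: "hoelder_on \<mu> (cball 0 1) g" and v: "norm v = 1" for g v
    proof (rule continuous_on_tendsto_compose[OF hoelder_on_continuous[OF g m(1)]])
      have "((\<lambda>r. complex_of_real r * v) \<longlongrightarrow> of_real 1 * v) (at_left 1)" by (intro tendsto_intros)
      thus "((\<lambda>r. complex_of_real r * v) \<longlongrightarrow> v) (at_left 1)" by simp
      show "eventually (\<lambda>r. complex_of_real r * v \<in> cball 0 1) (at_left 1)"
        using eventually_at_left_real[of 0 1, OF zero_less_one]
        by eventually_elim (use v in \<open>auto simp: norm_mult\<close>)
    qed (use v in auto)
    have "((\<lambda>r. norm (A (of_real r * w) + (B (of_real r * (1 / w)) - c) - \<phi> w))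
        \<longlongrightarrow> norm (A w + (B (1 / w) - c) - \<phi> w)) (at_left 1)"
      using w by (intro tendsto_intros lim A(2) B(2)) (auto simp: norm_divide)
    moreover have "((\<lambda>r. 48 * M / (1 - \<mu>) * (1 - r) powr \<mu>) \<longlongrightarrow> 48 * M / (1 - \<mu>) * (1 - 1) powr \<mu>) (at_left 1)"
      using m by (intro tendsto_intros) (auto simp: eventually_at_filter)
    moreover have "eventually (\<lambda>r. norm (A (of_real r * w) + (B (of_real r * (1 / w)) - c) - \<phi> w)
        \<le> 48 * M / (1 - \<mu>) * (1 - r) powr \<mu>) (at_left 1)"
      using eventually_at_left_real[of 0 1, OF zero_less_one]
    proof eventually_elim
      case (elim r)
      hence r: "0 \<le> r" "r < 1" by auto
      define d N where "d = 1 - r" and "N = M / (1 - \<mu>)"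
      have "d powr \<mu> = d powr (\<mu> - 1) * d powr 1" by (subst powr_add[symmetric]) simp
      hence "d powr \<mu> = d powr (\<mu> - 1) * d" using r by (simp add: d_def)
      hence "2 * d * (24 * N) * d powr (\<mu> - 1) = 48 * N * d powr \<mu>" by simp
      hence "2 * (1 - r) * (24 * M / (1 - \<mu>)) * (1 - r) powr (\<mu> - 1) = 48 * M / (1 - \<mu>) * (1 - r) powr \<mu>"
        by (simp only: d_def N_def times_divide_eq_right)
      thus ?case using est[OF r] by (simp only:)
    qed
    ultimately have "norm (A w + (B (1 / w) - c) - \<phi> w) \<le> 48 * M / (1 - \<mu>) * (1 - 1) powr \<mu>"
      by (intro tendsto_le[of "at_left (1::real)"]) auto
    thus ?thesis by simp
  qed
  show ?thesis
  proof (rule that[of A "\<lambda>z. B z - c"])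
    show "(\<lambda>z. B z - c) holomorphic_on ball 0 1" by (intro holomorphic_intros B)
    show "hoelder_on \<mu> (cball 0 1) (\<lambda>z. B z - c)"
      using hoelder_on_add[OF B(2) hoelder_on_const[of \<mu> "cball 0 1" "- c"]] by simp
    show "A 0 = integral {0..1} (\<lambda>t. \<phi> (circ t))"
      using A(3)[of 0] by (simp add: cauchy_transform_def)
    have "B 0 = integral {0..1} (\<lambda>t. \<phi> (circ (1 - t)))"
      unfolding circ_flip using B(3)[of 0] by (simp add: cauchy_transform_def \<phi>'_def)
    also have "\<dots> = c" unfolding c_def by (rule integral_flip01(1)[OF ic[OF cont]])
    finally show "B 0 - c = 0" by simp
  qed (use A B jump in auto)
qed

section \<open>The uniformising strip\<close>

text \<open>The strip that uniformises the upper half of the surface, for R^2 = 1/q.\<close>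
definition sinh_strip :: "real \<Rightarrow> complex set" where
  "sinh_strip R = {z. norm (sinh z) < R}"

lemma sinh_of_real: "sinh (of_real x) = (of_real (sinh x) :: complex)"
  and cosh_of_real: "cosh (of_real x) = (of_real (cosh x) :: complex)"
  by (simp_all add: sinh_field_def cosh_field_def exp_of_real flip: of_real_minus)

lemma norm_sinh_squared: "(norm (sinh z))\<^sup>2 = (sinh (Re z))\<^sup>2 + (sin (Im z))\<^sup>2"
proof -
  have "(norm (sinh z))\<^sup>2 = (sinh (Re z) * cos (Im z))\<^sup>2 + (cosh (Re z) * sin (Im z))\<^sup>2"
  proof -
    have "sinh z = sinh (of_real (Re z) + \<i> * of_real (Im z))" by (simp flip: complex_eq)
    also have "\<dots> = of_real (sinh (Re z)) * of_real (cos (Im z)) + \<i> * (of_real (cosh (Re z)) * of_real (sin (Im z)))"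
      by (simp add: sinh_add sinh_conv_sin[of "\<i> * _"] cosh_conv_cos[of "\<i> * _"] sin_of_real cos_of_real
          flip: sinh_of_real cosh_of_real)
    finally show ?thesis by (simp add: cmod_power2)
  qed
  also have "\<dots> = (sinh (Re z))\<^sup>2 * ((cos (Im z))\<^sup>2 + (sin (Im z))\<^sup>2) + (sin (Im z))\<^sup>2"
    by (simp only: power_mult_distrib cosh_square_eq ring_distribs mult_1_left add.assoc)
  finally show ?thesis by simp
qed

text \<open>Used to contract the strip horizontally onto the imaginary axis.\<close>
lemma norm_sinh_contract:
  assumes "\<bar>x\<bar> \<le> \<bar>Re z\<bar>"
  shows "norm (sinh (Complex x (Im z))) \<le> norm (sinh z)"
proof -
  have "\<bar>sinh x\<bar> \<le> \<bar>sinh (Re z)\<bar>" using assms by (simp flip: sinh_real_abs)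
  hence "(sinh x)\<^sup>2 \<le> (sinh (Re z))\<^sup>2" by (rule abs_le_square_iff[THEN iffD1])
  hence "(norm (sinh (Complex x (Im z))))\<^sup>2 \<le> (norm (sinh z))\<^sup>2" by (simp add: norm_sinh_squared)
  thus ?thesis by (rule power2_le_imp_le) simp
qed

lemma norm_sinh_imaginary: "norm (sinh (Complex 0 y)) \<le> 1"
proof -
  have "(norm (sinh (Complex 0 y)))\<^sup>2 \<le> 1\<^sup>2" by (simp add: norm_sinh_squared abs_square_le_1)
  thus ?thesis by (rule power2_le_imp_le) simp
qed

text \<open>
  The imaginary axis is a deformation retract, because |sinh z| decreases when the real part of z
  shrinks.
\<close>
lemma sinh_strip_topology:
  assumes R: "R > 1"
  shows "open (sinh_strip R)" "simply_connected (sinh_strip R)" "connected (sinh_strip R)"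
    "locally path_connected (sinh_strip R)"
proof -
  show o: "open (sinh_strip R)"
    unfolding sinh_strip_def by (intro open_Collect_less continuous_intros)
  define T where "T = {z::complex. Re z = 0}"
  define r where "r z = Complex 0 (Im z)" for z
  have rS: "r z \<in> sinh_strip R" for z
    using norm_sinh_imaginary[of "Im z"] R by (simp add: r_def sinh_strip_def)
  have T: "T \<subseteq> sinh_strip R"
  proof
    fix z assume "z \<in> T"
    hence "r z = z" by (simp add: T_def r_def complex_eq_iff)
    thus "z \<in> sinh_strip R" using rS[of z] by simp
  qed
  have cont_r: "continuous_on A r" for A
    unfolding r_def Complex_eq by (intro continuous_intros)
  have "sinh_strip R homotopy_eqv T"
  proof (rule deformation_retract_imp_homotopy_eqv)
    show "homotopic_with_canon (\<lambda>x. True) (sinh_strip R) (sinh_strip R) id r"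
    proof (rule homotopic_with_linear)
      fix z assume z: "z \<in> sinh_strip R"
      show "closed_segment (id z) (r z) \<subseteq> sinh_strip R"
      proof
        fix w assume "w \<in> closed_segment (id z) (r z)"
        then obtain u where u: "0 \<le> u" "u \<le> 1" "w = (1 - u) *\<^sub>R z + u *\<^sub>R r z"
          by (auto simp: closed_segment_def)
        hence w: "w = Complex ((1 - u) * Re z) (Im z)" by (simp add: r_def complex_eq_iff algebra_simps)
        have "\<bar>(1 - u) * Re z\<bar> \<le> \<bar>Re z\<bar>" using u by (simp add: abs_mult mult_left_le_one_le)
        from norm_sinh_contract[OF this] show "w \<in> sinh_strip R" using z by (simp add: w sinh_strip_def)
      qed
    qed (auto intro: cont_r continuous_on_id)
    show "retraction (sinh_strip R) T r"
      unfolding retraction_def using T cont_r by (auto simp: T_def r_def complex_eq_iff)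
  qed
  moreover have "contractible T"
  proof (rule convex_imp_contractible)
    have "T = {z. inner 1 z = 0}" by (auto simp: T_def inner_complex_def)
    thus "convex T" using convex_hyperplane by metis
  qed
  moreover have "T \<noteq> {}" by (auto simp: T_def intro: exI[of _ 0])
  moreover have "sinh_strip R \<noteq> {}" using rS by auto
  ultimately have "contractible (sinh_strip R)"
    using homotopy_eqv_contractibility by blast
  thus s: "simply_connected (sinh_strip R)" by (rule contractible_imp_simply_connected)
  thus "connected (sinh_strip R)" by (rule simply_connected_imp_connected)
  show "locally path_connected (sinh_strip R)" by (rule open_imp_locally_path_connected[OF o])
qed

lemma sinh_plus_ipi [simp]: "sinh (z + \<i> * of_real pi) = - sinh (z::complex)"
  and cosh_plus_ipi [simp]: "cosh (z + \<i> * of_real pi) = - cosh (z::complex)"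
proof -
  have e: "exp (z + \<i> * of_real pi) = - exp z" for z :: complex by (simp add: exp_add exp_pi_i')
  have f: "exp (- (z + \<i> * of_real pi)) = - exp (- z)"
    for z :: complex unfolding exp_minus e by simp
  show "sinh (z + \<i> * of_real pi) = - sinh (z::complex)"
    unfolding sinh_field_def e f by (simp add: field_simps)
  show "cosh (z + \<i> * of_real pi) = - cosh (z::complex)"
    unfolding cosh_field_def e f by (simp add: field_simps)
qed

lemma sinh_strip_shift [simp]: "z + \<i> * of_real pi \<in> sinh_strip R \<longleftrightarrow> z \<in> sinh_strip R"
  and sinh_strip_minus [simp]: "- z \<in> sinh_strip R \<longleftrightarrow> z \<in> sinh_strip R"
  by (simp_all add: sinh_strip_def)

lemma zero_derivative_imp_const:
  assumes "open S" "connected S" "\<And>z. z \<in> S \<Longrightarrow> (f has_field_derivative 0) (at z)"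
    and "z \<in> S" "w \<in> S"
  shows "f z = (f w :: complex)"
proof -
  have "f constant_on S"
    by (rule has_field_derivative_0_imp_constant_on) (use assms in auto)
  thus ?thesis using assms(4,5) unfolding constant_on_def by metis
qed

text \<open>
  For a primitive G the difference G(z) - G(-z) has derivative zero, and it vanishes at the
  origin.
\<close>
lemma even_primitive:
  assumes R: "R > 1" and hol: "\<Omega> holomorphic_on sinh_strip R"
    and odd: "\<And>z. z \<in> sinh_strip R \<Longrightarrow> \<Omega> (- z) = - \<Omega> z"
  obtains G where "\<And>z. z \<in> sinh_strip R \<Longrightarrow> (G has_field_derivative \<Omega> z) (at z)"
    "\<And>z. z \<in> sinh_strip R \<Longrightarrow> G (- z) = G z"
proof -
  note top = sinh_strip_topology[OF R]
  from top(2) hol obtain G where G: "\<And>z. z \<in> sinh_strip R \<Longrightarrow> (G has_field_derivative \<Omega> z) (at z)"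
    using simply_connected_eq_global_primitive[OF top(1)] by blast
  have z0: "0 \<in> sinh_strip R" using R by (simp add: sinh_strip_def)
  have "G (- z) = G z" if z: "z \<in> sinh_strip R" for z
  proof -
    have "G z - G (- z) = G 0 - G (- 0)"
    proof (rule zero_derivative_imp_const[OF top(1,3) _ z z0])
      fix w assume w: "w \<in> sinh_strip R"
      have "((\<lambda>w. G (- w)) has_field_derivative \<Omega> (- w) * (- 1)) (at w)"
        by (rule DERIV_chain2[OF G]) (use w in \<open>auto intro!: derivative_eq_intros\<close>)
      hence "((\<lambda>w. G w - G (- w)) has_field_derivative \<Omega> w - \<Omega> (- w) * (- 1)) (at w)"
        by (intro DERIV_diff G w)
      thus "((\<lambda>w. G w - G (- w)) has_field_derivative 0) (at w)" using odd[OF w] by simp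
    qed
    thus ?thesis by simp
  qed
  thus ?thesis using G that by blast
qed

text \<open>
  The increment of a primitive under the translation is constant; evaluated at -\<pi>i/2 it
  compares two opposite points, where an even function agrees. Thus the oddness kills the only
  period of the strip modulo translation.
\<close>
lemma periodic_odd_primitive:
  assumes R: "R > 1" and hol: "\<Omega> holomorphic_on sinh_strip R"
    and odd: "\<And>z. z \<in> sinh_strip R \<Longrightarrow> \<Omega> (- z) = - \<Omega> z"
    and per: "\<And>z. z \<in> sinh_strip R \<Longrightarrow> \<Omega> (z + \<i> * of_real pi) = \<Omega> z"
  obtains G where "\<And>z. z \<in> sinh_strip R \<Longrightarrow> (G has_field_derivative \<Omega> z) (at z)"
    "\<And>z. z \<in> sinh_strip R \<Longrightarrow> G (z + \<i> * of_real pi) = G z"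
proof -
  note top = sinh_strip_topology[OF R]
  obtain G where G: "\<And>z. z \<in> sinh_strip R \<Longrightarrow> (G has_field_derivative \<Omega> z) (at z)"
    and even: "\<And>z. z \<in> sinh_strip R \<Longrightarrow> G (- z) = G z"
    by (rule even_primitive[OF R hol odd]) auto
  define p where "p = - (\<i> * of_real (pi / 2))"
  have pS: "p \<in> sinh_strip R" and mp: "p + \<i> * of_real pi = - p"
    using norm_sinh_imaginary[of "pi/2"] R
    by (auto simp: p_def sinh_strip_def Complex_eq)
  have "G (z + \<i> * of_real pi) = G z" if z: "z \<in> sinh_strip R" for z
  proof -
    have "G (z + \<i> * of_real pi) - G z = G (p + \<i> * of_real pi) - G p"
    proof (rule zero_derivative_imp_const[OF top(1,3) _ z pS])
      fix w assume w: "w \<in> sinh_strip R"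
      have "((\<lambda>w. G (w + \<i> * of_real pi)) has_field_derivative \<Omega> (w + \<i> * of_real pi) * 1) (at w)"
        by (rule DERIV_chain2[OF G]) (use w in \<open>auto intro!: derivative_eq_intros\<close>)
      hence "((\<lambda>w. G (w + \<i> * of_real pi) - G w) has_field_derivative \<Omega> (w + \<i> * of_real pi) * 1 - \<Omega> w) (at w)"
        by (intro DERIV_diff G w)
      thus "((\<lambda>w. G (w + \<i> * of_real pi) - G w) has_field_derivative 0) (at w)" using per[OF w] by simp
    qed
    thus ?thesis unfolding mp using even[OF pS] by simp
  qed
  thus ?thesis using G that by blast
qed

text \<open>
  A continuous function with values in a discrete set is constant on a connected set; this makes
  branches of logarithms differ by a single integer.
\<close>
lemma continuous_2pi_multiple_const:
  fixes f :: "'a::topological_space \<Rightarrow> complex"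
  assumes "connected S" "continuous_on S f" "\<And>x. x \<in> S \<Longrightarrow> exp (f x) = 1"
  obtains n :: int where "\<And>x. x \<in> S \<Longrightarrow> f x = of_int n * (2 * of_real pi * \<i>)"
proof (cases "S = {}")
  case False
  then obtain x0 where x0: "x0 \<in> S" by auto
  have ex: "\<exists>n::int. f x = of_int n * (2 * of_real pi * \<i>)" if "x \<in> S" for x
  proof -
    from assms(3)[OF that] obtain n where "Re (f x) = 0" "Im (f x) = of_int (2 * n) * pi"
      unfolding exp_eq_1 by blast
    thus ?thesis by (intro exI[of _ n]) (simp add: complex_eq_iff)
  qed
  have "f constant_on S"
  proof (rule continuous_discrete_range_constant[OF assms(1,2)])
    fix x assume x: "x \<in> S"
    show "\<exists>e>0. \<forall>y. y \<in> S \<and> f y \<noteq> f x \<longrightarrow> e \<le> norm (f y - f x)"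
    proof (intro exI[of _ "2 * pi"] conjI allI impI)
      fix y assume y: "y \<in> S \<and> f y \<noteq> f x"
      obtain n m :: int where nm: "f x = of_int n * (2 * of_real pi * \<i>)" "f y = of_int m * (2 * of_real pi * \<i>)"
        using ex x y by blast
      have "f y - f x = of_int (m - n) * (2 * of_real pi * \<i>)" unfolding nm by (simp add: algebra_simps)
      hence "norm (f y - f x) = norm (of_int (m - n) :: complex) * (2 * pi)"
        by (simp only: norm_mult) simp
      hence "norm (f y - f x) = \<bar>of_int (m - n)\<bar> * (2 * pi)" by (simp only: norm_of_int)
      moreover have "m \<noteq> n" using y nm by auto
      hence "(1::real) \<le> \<bar>of_int (m - n)\<bar>" by linarith
      hence "1 * (2 * pi) \<le> \<bar>of_int (m - n)\<bar> * (2 * pi)" by (rule mult_right_mono) simp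
      ultimately show "2 * pi \<le> norm (f y - f x)" by linarith
    qed simp
  qed
  moreover obtain n :: int where "f x0 = of_int n * (2 * of_real pi * \<i>)" using ex[OF x0] by blast
  ultimately show ?thesis using that x0 unfolding constant_on_def by metis
qed (use that in auto)

lemma periodic_holomorphic_log:
  assumes R: "R > 1" and hol: "\<Phi> holomorphic_on sinh_strip R"
    and nz: "\<And>z. z \<in> sinh_strip R \<Longrightarrow> \<Phi> z \<noteq> 0"
    and per: "\<And>z. z \<in> sinh_strip R \<Longrightarrow> \<Phi> (z + \<i> * of_real pi) = \<Phi> z"
  obtains \<Lambda> and a :: int where "\<Lambda> holomorphic_on sinh_strip R"
    "\<And>z. z \<in> sinh_strip R \<Longrightarrow> \<Phi> z = exp (\<Lambda> z)"
    "\<And>z. z \<in> sinh_strip R \<Longrightarrow> \<Lambda> (z + \<i> * of_real pi) = \<Lambda> z + of_int a * (2 * of_real pi * \<i>)"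
proof -
  note top = sinh_strip_topology[OF R]
  obtain \<Lambda> where L: "\<Lambda> holomorphic_on sinh_strip R" "\<And>z. z \<in> sinh_strip R \<Longrightarrow> \<Phi> z = exp (\<Lambda> z)"
    by (rule simply_connected_imp_holomorphic_log[OF hol top(2,4) nz]) blast+
  have "continuous_on (sinh_strip R) (\<lambda>z. \<Lambda> (z + \<i> * of_real pi) - \<Lambda> z)"
    by (intro continuous_intros continuous_on_compose2[OF holomorphic_on_imp_continuous_on[OF L(1)]]
        holomorphic_on_imp_continuous_on[OF L(1)]) auto
  moreover have "exp (\<Lambda> (z + \<i> * of_real pi) - \<Lambda> z) = 1" if z: "z \<in> sinh_strip R" for z
    using L(2)[OF z] L(2)[of "z + \<i> * of_real pi"] per[OF z] z nz[OF z] by (simp add: exp_diff)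
  ultimately obtain a :: int where
    "\<And>z. z \<in> sinh_strip R \<Longrightarrow> \<Lambda> (z + \<i> * of_real pi) - \<Lambda> z = of_int a * (2 * of_real pi * \<i>)"
    using continuous_2pi_multiple_const[OF top(3)] by blast
  hence "\<And>z. z \<in> sinh_strip R \<Longrightarrow> \<Lambda> (z + \<i> * of_real pi) = \<Lambda> z + of_int a * (2 * of_real pi * \<i>)"
    by (metis add_diff_cancel_left' diff_add_cancel add.commute)
  thus ?thesis using L that by blast
qed

text \<open>
  The maximum principle: modulo the translation the closed strip is compact. It transfers
  identities from the contour to the whole half surface.
\<close>
lemma periodic_boundary_zero:
  assumes R: "R > 1" and hol: "Q holomorphic_on sinh_strip R"
    and cont: "continuous_on {z :: complex. norm (sinh z) \<le> R} Q"
    and per: "\<And>z. Q (z + \<i> * of_real pi) = Q z"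
    and bdry: "\<And>z. norm (sinh z) = R \<Longrightarrow> Q z = 0"
    and z: "z \<in> sinh_strip R"
  shows "Q z = 0"
proof -
  note top = sinh_strip_topology[OF R]
  define C where "C = {z :: complex. norm (sinh z) \<le> R}"
  define K where "K = C \<inter> {z. 0 \<le> Im z \<and> Im z \<le> pi}"
  have "closed C" unfolding C_def by (intro closed_Collect_le continuous_intros)
  moreover have "closed {z :: complex. 0 \<le> Im z \<and> Im z \<le> pi}"
    by (intro closed_Collect_conj closed_Collect_le continuous_intros)
  ultimately have "closed K" unfolding K_def by (rule closed_Int)
  moreover have "bounded K" unfolding bounded_iff
  proof (intro exI ballI)
    fix w assume w: "w \<in> K"
    have "(sinh (Re w))\<^sup>2 \<le> (norm (sinh w))\<^sup>2" by (simp add: norm_sinh_squared)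
    hence "\<bar>sinh (Re w)\<bar> \<le> norm (sinh w)" by (simp add: abs_le_square_iff[of "sinh (Re w)" "norm (sinh w)", simplified, symmetric])
    hence "sinh \<bar>Re w\<bar> \<le> R" using w by (simp add: K_def C_def)
    hence "\<bar>Re w\<bar> \<le> R" using real_le_x_sinh[of "\<bar>Re w\<bar>"]
      by (simp add: sinh_field_def exp_minus)
    moreover have "\<bar>Im w\<bar> \<le> pi" using w by (auto simp: K_def)
    ultimately show "norm w \<le> R + pi" using cmod_le[of w] by linarith
  qed
  ultimately have "compact K" by (simp add: compact_eq_bounded_closed)
  have red: "\<exists>w'\<in>K. Q w' = Q w" if w: "w \<in> C" for w
  proof -
    have shift: "Q (w + of_int n * (\<i> * of_real pi)) = Q w \<and> norm (sinh (w + of_int n * (\<i> * of_real pi))) = norm (sinh w)" for n :: int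
    proof (induction n rule: int_induct[where k = 0])
      case (step1 i)
      have e: "w + of_int (i + 1) * (\<i> * of_real pi) = (w + of_int i * (\<i> * of_real pi)) + \<i> * of_real pi"
        by (simp add: algebra_simps)
      show ?case unfolding e using step1 per by simp
    next
      case (step2 i)
      have e: "w + of_int i * (\<i> * of_real pi) = (w + of_int (i - 1) * (\<i> * of_real pi)) + \<i> * of_real pi"
        by (simp add: algebra_simps)
      show ?case using step2(2) unfolding e using per by simp
    qed simp
    define n where "n = - \<lfloor>Im w / pi\<rfloor>"
    have f: "of_int \<lfloor>Im w / pi\<rfloor> \<le> Im w / pi" "Im w / pi < of_int \<lfloor>Im w / pi\<rfloor> + 1" by linarith+
    hence "of_int \<lfloor>Im w / pi\<rfloor> * pi \<le> Im w" "Im w < (of_int \<lfloor>Im w / pi\<rfloor> + 1) * pi"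
      by (simp_all only: pos_le_divide_eq[OF pi_gt_zero] pos_divide_less_eq[OF pi_gt_zero])
    hence "0 \<le> Im (w + of_int n * (\<i> * of_real pi))" "Im (w + of_int n * (\<i> * of_real pi)) \<le> pi"
      by (auto simp: n_def algebra_simps)
    thus ?thesis using shift[of n] w by (intro bexI[of _ "w + of_int n * (\<i> * of_real pi)"]) (auto simp: K_def C_def)
  qed
  have "K \<noteq> {}" using red[of z] z by (auto simp: C_def sinh_strip_def)
  have "continuous_on K (\<lambda>w. norm (Q w))"
    using cont by (intro continuous_intros) (auto simp: K_def C_def intro: continuous_on_subset)
  from continuous_attains_sup[OF \<open>compact K\<close> \<open>K \<noteq> {}\<close> this]
  obtain w0 where w0: "w0 \<in> K" "\<And>w. w \<in> K \<Longrightarrow> norm (Q w) \<le> norm (Q w0)" by blast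
  have max: "norm (Q w) \<le> norm (Q w0)" if "w \<in> C" for w using red[OF that] w0(2) by metis
  have "Q w0 = 0"
  proof (rule ccontr)
    assume n0: "Q w0 \<noteq> 0"
    have "norm (sinh w0) \<noteq> R" using bdry n0 by blast
    hence w0S: "w0 \<in> sinh_strip R" using w0(1) by (auto simp: K_def C_def sinh_strip_def)
    have "Q constant_on sinh_strip R"
      by (rule maximum_modulus_principle[OF hol top(1,3) top(1) order_refl w0S])
        (rule max, auto simp: C_def sinh_strip_def)
    then obtain c where c: "\<And>w. w \<in> sinh_strip R \<Longrightarrow> Q w = c" unfolding constant_on_def by blast
    hence cn: "c \<noteq> 0" using n0 w0S by auto
    define x where "x = arsinh R"
    have sx: "sinh (complex_of_real x) = of_real R"
      unfolding x_def by (simp add: sinh_of_real)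
    have xp: "x > 0" using R by (simp add: x_def)
    have Qx: "Q (of_real x) = 0" by (rule bdry) (use R sx in simp)
    have "((\<lambda>s. Q (of_real s)) \<longlongrightarrow> Q (of_real x)) (at_left x)"
    proof (rule continuous_on_tendsto_compose[OF cont])
      show "((\<lambda>s. complex_of_real s) \<longlongrightarrow> of_real x) (at_left x)" by (intro tendsto_intros)
      show "eventually (\<lambda>s. complex_of_real s \<in> {z. norm (sinh z) \<le> R}) (at_left x)"
        using eventually_at_left_real[OF xp]
      proof eventually_elim
        case (elim s)
        have "norm (sinh (complex_of_real s)) = \<bar>sinh s\<bar>" by (simp add: sinh_of_real)
        also have "\<dots> \<le> sinh x" using elim by simp
        finally show ?case by (simp add: x_def)
      qed
    qed (use R sx in auto)
    moreover have "eventually (\<lambda>s. Q (of_real s) = c) (at_left x)"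
      using eventually_at_left_real[OF xp]
    proof eventually_elim
      case (elim s)
      have "norm (sinh (complex_of_real s)) = \<bar>sinh s\<bar>" by (simp add: sinh_of_real)
      also have "\<dots> < sinh x" using elim by simp
      finally show ?case by (intro c) (simp add: x_def sinh_strip_def)
    qed
    ultimately have "((\<lambda>s. c) \<longlongrightarrow> Q (of_real x)) (at_left x)" using filterlim_cong[OF refl refl] tendsto_cong by fast
    hence "c = Q (of_real x)" by (simp add: tendsto_const_iff)
    thus False using cn Qx by simp
  qed
  thus ?thesis using max[of z] z by (simp add: C_def sinh_strip_def)
qed

section \<open>The boundary of the strip\<close>

definition root_in :: "real \<Rightarrow> complex \<Rightarrow> complex" where
  "root_in q \<zeta> = csqrt (1 - of_real q * \<zeta>)"

text \<open>
  The two roots are conjugate on the unit circle and are exchanged by \<zeta> \<mapsto> 1/\<zeta>;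
  the names tell where they are holomorphic, inside or outside of the disc.
\<close>
definition root_out :: "real \<Rightarrow> complex \<Rightarrow> complex" where
  "root_out q \<zeta> = csqrt (1 - of_real q / \<zeta>)"

text \<open>The density of d\<xi>/\<rho> on the circle, up to a constant factor.\<close>
definition weight :: "real \<Rightarrow> real \<Rightarrow> real" where
  "weight q t = 1 / norm (1 - of_real q * circ t)"

text \<open>
  The uniformising map; \<zeta> = 0 and \<zeta> = q are its critical values and correspond to the
  branch points.
\<close>
definition zeta_of :: "real \<Rightarrow> complex \<Rightarrow> complex" where
  "zeta_of q z = - of_real q * (sinh z)\<^sup>2"

text \<open>
  The explicit inverse of \<open>zeta_of\<close> along the circle of radius r: with \<sigma> =
  \<surd>(1 - q/\<zeta>) = coth z one has exp(2z) = -(\<zeta>/q)(1 + \<sigma>)^2, and the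
  logarithm of the right side is split so that only Ln(1 + \<sigma>), which has no monodromy,
  involves a root.
\<close>
definition circle_path :: "real \<Rightarrow> real \<Rightarrow> real \<Rightarrow> complex" where
  "circle_path q r t = of_real ((ln r - ln q) / 2) + \<i> * of_real pi * (of_real t - 1 / 2)
     + Ln (1 + root_out q (of_real r * circ t))"

lemma Re_one_minus_pos: "norm (x::complex) < 1 \<Longrightarrow> Re (1 - x) > 0"
  using complex_Re_le_cmod[of x] by simp

lemma Re_pos_not_nonpos: "Re x > 0 \<Longrightarrow> x \<notin> \<real>\<^sub>\<le>\<^sub>0"
  by (auto simp: complex_nonpos_Reals_iff)

lemma Re_csqrt_pos: "Re x > 0 \<Longrightarrow> Re (csqrt x) > 0"
  using csqrt_principal[of x] by (cases "x = 0") (auto simp: csqrt.simps add_pos_nonneg simp: complex_eq_iff)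

lemma continuous_on_csqrt':
  assumes "continuous_on S f" "\<And>z. z \<in> S \<Longrightarrow> f z \<notin> \<real>\<^sub>\<le>\<^sub>0"
  shows "continuous_on S (\<lambda>z. csqrt (f z))"
  by (rule continuous_on_compose2[OF _ assms(1), of "- \<real>\<^sub>\<le>\<^sub>0"])
    (use assms(2) in \<open>auto intro: holomorphic_on_imp_continuous_on holomorphic_on_csqrt\<close>)

lemma root_in_pos: "norm (of_real q * \<zeta>) < 1 \<Longrightarrow> Re (root_in q \<zeta>) > 0"
  unfolding root_in_def by (intro Re_csqrt_pos Re_one_minus_pos)

lemma root_out_pos: "norm (of_real q / \<zeta>) < 1 \<Longrightarrow> Re (root_out q \<zeta>) > 0"
  unfolding root_out_def by (intro Re_csqrt_pos Re_one_minus_pos)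

lemma root_in_square: "(root_in q \<zeta>)\<^sup>2 = 1 - of_real q * \<zeta>"
  by (simp add: root_in_def)

lemma root_out_square: "(root_out q \<zeta>)\<^sup>2 = 1 - of_real q / \<zeta>"
  by (simp add: root_out_def)

lemma root_in_holomorphic:
  assumes "\<And>z. z \<in> S \<Longrightarrow> norm (of_real q * f z) < 1" "f holomorphic_on S"
  shows "(\<lambda>z. root_in q (f z)) holomorphic_on S"
  unfolding root_in_def
  by (intro holomorphic_intros assms Re_pos_not_nonpos Re_one_minus_pos)

lemma root_in_continuous:
  assumes "\<And>z. z \<in> S \<Longrightarrow> norm (of_real q * f z) < 1" "continuous_on S f"
  shows "continuous_on S (\<lambda>z. root_in q (f z))"
  unfolding root_in_def
  by (intro continuous_on_csqrt' continuous_intros assms Re_pos_not_nonpos Re_one_minus_pos)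

lemma root_out_continuous:
  assumes "\<And>z. z \<in> S \<Longrightarrow> norm (of_real q / f z) < 1" "continuous_on S f" "\<And>z. z \<in> S \<Longrightarrow> f z \<noteq> 0"
  shows "continuous_on S (\<lambda>z. root_out q (f z))"
  unfolding root_out_def
  by (intro continuous_on_csqrt' continuous_intros ballI assms Re_pos_not_nonpos Re_one_minus_pos)

lemma root_in_out_circle:
  assumes q: "0 < q" "q < 1"
  shows "root_in q (circ t) * root_out q (circ t) = of_real (norm (1 - of_real q * circ t))"
proof -
  have "Re (1 - of_real q * circ t) > 0" using q by (intro Re_one_minus_pos) (simp add: norm_mult)
  hence "cnj (csqrt (1 - of_real q * circ t)) = csqrt (cnj (1 - of_real q * circ t))"
    by (intro cnj_csqrt Re_pos_not_nonpos)
  moreover have "cnj (1 - of_real q * circ t) = 1 - of_real q / circ t"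
    unfolding circ_cis by (simp add: cis_cnj cis_inverse divide_inverse)
  ultimately have "root_out q (circ t) = cnj (root_in q (circ t))" by (simp add: root_in_def root_out_def)
  hence "root_in q (circ t) * root_out q (circ t) = of_real ((norm (root_in q (circ t)))\<^sup>2)"
    by (simp only: complex_norm_square)
  also have "(norm (root_in q (circ t)))\<^sup>2 = norm (1 - of_real q * circ t)"
    by (simp only: norm_power[symmetric] root_in_square)
  finally show ?thesis .
qed

text \<open>
  This turns integrals with the weight into integrals of the holomorphic differential of the curve
  along \<open>circle_path\<close>.
\<close>
lemma weight_eq:
  assumes q: "0 < q" "q < 1"
  shows "of_real (weight q t) = 1 / (root_in q (circ t) * root_out q (circ t))"
  unfolding root_in_out_circle[OF q] weight_def by simp

lemma weight_continuous:
  assumes q: "0 < q" "q < 1"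
  shows "continuous_on S (weight q)"
proof -
  have "1 - of_real q * circ t \<noteq> 0" for t
  proof -
    have "Re (1 - of_real q * circ t) > 0" using q by (intro Re_one_minus_pos) (simp add: norm_mult)
    thus ?thesis by (metis less_irrefl zero_complex.sel(1))
  qed
  thus ?thesis unfolding weight_def by (intro continuous_intros) auto
qed

lemma weight_flip: "weight q (1 - t) = weight q t"
proof -
  have "norm (1 - of_real q * circ (1 - t)) = norm (cnj (1 - of_real q * circ t))"
    unfolding circ_flip unfolding circ_cis by (simp add: cis_cnj cis_inverse divide_inverse)
  also have "\<dots> = norm (1 - of_real q * circ t)" by (rule complex_mod_cnj)
  finally show ?thesis unfolding weight_def by simp
qed

context
  fixes q r :: real
  assumes q: "0 < q" and qr: "q < r" and r1: "r \<le> 1"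
begin

lemma circle_norm_lt: "norm (of_real q / (of_real r * circ t)) < 1"
  using q qr by (simp add: norm_divide norm_mult)

lemma circle_root_pos: "Re (root_out q (of_real r * circ t)) > 0"
  by (rule root_out_pos[OF circle_norm_lt])

lemma circle_path_exp:
  "exp (2 * circle_path q r t) = - (of_real r * circ t / of_real q) * (1 + root_out q (of_real r * circ t))\<^sup>2"
proof -
  define \<sigma> where "\<sigma> = root_out q (of_real r * circ t)"
  have "1 + \<sigma> \<noteq> 0" using circle_root_pos[of t] by (auto simp: \<sigma>_def complex_eq_iff)
  hence L: "exp (2 * Ln (1 + \<sigma>)) = (1 + \<sigma>)\<^sup>2" by (simp add: exp_double)
  have "2 * circle_path q r t = of_real (ln r - ln q) + (2 * of_real pi * \<i> * of_real t - \<i> * of_real pi) + 2 * Ln (1 + \<sigma>)"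
  proof -
    have "2 * complex_of_real (x / 2) = of_real x" for x by simp
    thus ?thesis unfolding circle_path_def \<sigma>_def distrib_left by (simp only:) (simp add: algebra_simps)
  qed
  also have "exp \<dots> = of_real (r / q) * (circ t * (- 1)) * (1 + \<sigma>)\<^sup>2"
  proof -
    have "exp (complex_of_real (ln r - ln q)) = of_real (r / q)"
      using q qr by (simp only: exp_of_real exp_diff) simp
    moreover have "exp (2 * of_real pi * \<i> * of_real t - \<i> * of_real pi) = circ t * (- 1)"
      by (simp only: exp_diff exp_pi_i') simp
    ultimately show ?thesis by (simp only: exp_add L)
  qed
  finally show ?thesis by (simp add: \<sigma>_def)
qed

lemma circle_path_sinh_cosh:
  "zeta_of q (circle_path q r t) = of_real r * circ t"
  "- of_real q * (sinh (circle_path q r t) * cosh (circle_path q r t))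
     = of_real r * circ t * root_out q (of_real r * circ t)"
proof -
  define z where "z = circle_path q r t"
  define \<zeta> where "\<zeta> = of_real r * circ t"
  define \<sigma> where "\<sigma> = root_out q \<zeta>"
  have nz: "\<zeta> \<noteq> 0" "complex_of_real q \<noteq> 0" using q qr by (auto simp: \<zeta>_def)
  have s2: "\<sigma>\<^sup>2 = 1 - of_real q / \<zeta>" by (simp add: \<sigma>_def root_out_square)
  define u where "u = - (\<zeta> / of_real q) * (1 + \<sigma>)\<^sup>2"
  define v where "v = - (\<zeta> / of_real q) * (1 - \<sigma>)\<^sup>2"
  have u: "exp (2 * z) = u" using circle_path_exp[of t] by (simp add: z_def u_def \<sigma>_def \<zeta>_def)
  have "u * v = (\<zeta> / of_real q)\<^sup>2 * (1 - \<sigma>\<^sup>2)\<^sup>2"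
  proof -
    have "(- p * (1 + \<sigma>)\<^sup>2) * (- p * (1 - \<sigma>)\<^sup>2) = p\<^sup>2 * (1 - \<sigma>\<^sup>2)\<^sup>2" for p
      by (simp add: algebra_simps power2_eq_square)
    thus ?thesis unfolding u_def v_def .
  qed
  also have "\<dots> = 1" using nz by (simp add: s2 power_divide)
  finally have "v = exp (- (2 * z))" unfolding exp_minus u[symmetric] by (metis inverse_unique)
  hence v: "exp (- (2 * z)) = v" by simp
  have "(sinh z)\<^sup>2 = (exp (2 * z) + exp (- (2 * z)) - 2) / 4"
    by (simp add: sinh_field_def power2_eq_square exp_add[symmetric] field_simps flip: mult_2)
  also have "\<dots> = (- (\<zeta> / of_real q) * (2 + 2 * \<sigma>\<^sup>2) - 2) / 4"
    unfolding u v u_def v_def by (simp add: algebra_simps power2_eq_square)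
  also have "\<dots> = - (\<zeta> / of_real q)" unfolding s2 using nz by (simp add: field_simps)
  finally show "zeta_of q (circle_path q r t) = of_real r * circ t"
    using nz by (simp add: zeta_of_def flip: z_def \<zeta>_def)
  have "sinh z * cosh z = (exp (2 * z) - exp (- (2 * z))) / 4"
    by (simp add: sinh_field_def cosh_field_def exp_add[symmetric] field_simps flip: mult_2)
  also have "\<dots> = - (\<zeta> / of_real q) * \<sigma>"
    unfolding u v u_def v_def by (simp add: algebra_simps power2_eq_square)
  finally show "- of_real q * (sinh (circle_path q r t) * cosh (circle_path q r t))
     = of_real r * circ t * root_out q (of_real r * circ t)"
    using nz by (simp flip: z_def \<zeta>_def \<sigma>_def)
qed

lemma circle_path_norm_sinh: "norm (sinh (circle_path q r t)) = sqrt (r / q)"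
proof -
  have "norm (zeta_of q (circle_path q r t)) = r"
    unfolding circle_path_sinh_cosh using q qr by (simp add: norm_mult)
  hence "q * (norm (sinh (circle_path q r t)))\<^sup>2 = r" using q by (simp add: zeta_of_def norm_mult norm_power)
  hence "(norm (sinh (circle_path q r t)))\<^sup>2 = r / q" using q by (simp add: field_simps)
  thus ?thesis by (metis norm_ge_zero real_sqrt_unique)
qed

lemma circle_path_deriv:
  "(circle_path q r has_vector_derivative \<i> * of_real pi / root_out q (of_real r * circ t)) (at t)"
proof -
  define \<zeta> where "\<zeta> = of_real r * circ t"
  define \<sigma> where "\<sigma> = root_out q \<zeta>"
  have nz: "\<zeta> \<noteq> 0" using q qr by (auto simp: \<zeta>_def)
  have sp: "Re \<sigma> > 0" using circle_root_pos[of t] by (simp add: \<sigma>_def \<zeta>_def)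
  hence s0: "\<sigma> \<noteq> 0" "1 + \<sigma> \<noteq> 0" by (auto simp: complex_eq_iff)
  have nn: "1 - of_real q / \<zeta> \<notin> \<real>\<^sub>\<le>\<^sub>0" "1 + \<sigma> \<notin> \<real>\<^sub>\<le>\<^sub>0"
    using circle_norm_lt[of t] sp by (auto intro!: Re_pos_not_nonpos Re_one_minus_pos simp: \<zeta>_def simp del: minus_complex.sel)
  have c: "((\<lambda>t. of_real r * circ t) has_vector_derivative 2 * of_real pi * \<i> * \<zeta>) (at t)"
  proof -
    have "((\<lambda>w. of_real r * exp (2 * of_real pi * \<i> * w)) has_field_derivative 2 * of_real pi * \<i> * \<zeta>) (at (of_real t))"
      by (auto intro!: derivative_eq_intros simp: \<zeta>_def)
    from has_vector_derivative_real_field[OF this] show ?thesis by simp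
  qed
  have "((\<lambda>w. 1 - of_real q / w) has_field_derivative of_real q / \<zeta>\<^sup>2) (at \<zeta>)"
    using nz by (auto intro!: derivative_eq_intros simp: power2_eq_square)
  from has_field_derivative_csqrt'[OF this nn(1)]
  have "((\<lambda>w. csqrt (1 - of_real q / w)) has_field_derivative of_real q / \<zeta>\<^sup>2 / (2 * \<sigma>)) (at \<zeta>)"
    by (simp only: \<sigma>_def root_out_def)
  from DERIV_add[OF DERIV_const this, of 1]
  have oc: "((\<lambda>w. 1 + csqrt (1 - of_real q / w)) has_field_derivative of_real q / \<zeta>\<^sup>2 / (2 * \<sigma>)) (at \<zeta>)"
    by (simp only: add_0_left)
  have nn2: "1 + csqrt (1 - of_real q / \<zeta>) \<notin> \<real>\<^sub>\<le>\<^sub>0" using nn(2) unfolding \<sigma>_def root_out_def .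
  from DERIV_chain2[where f = Ln and g = "\<lambda>w. 1 + csqrt (1 - of_real q / w)",
      OF has_field_derivative_Ln[OF nn2] oc]
  have f: "((\<lambda>w. Ln (1 + csqrt (1 - of_real q / w))) has_field_derivative
      (of_real q / \<zeta>\<^sup>2 / (2 * \<sigma>)) / (1 + \<sigma>)) (at \<zeta>)"
    unfolding \<sigma>_def root_out_def by (rule DERIV_cong) (metis divide_inverse mult.commute)
  have "((\<lambda>w. Ln (1 + csqrt (1 - of_real q / w))) \<circ> (\<lambda>t. of_real r * circ t) has_vector_derivative
      2 * of_real pi * \<i> * \<zeta> * ((of_real q / \<zeta>\<^sup>2 / (2 * \<sigma>)) / (1 + \<sigma>))) (at t)"
    by (rule field_vector_diff_chain_at[OF c]) (use f in \<open>simp only: \<zeta>_def\<close>)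
  hence "((\<lambda>t. Ln (1 + root_out q (of_real r * circ t))) has_vector_derivative
      2 * of_real pi * \<i> * \<zeta> * ((of_real q / \<zeta>\<^sup>2 / (2 * \<sigma>)) / (1 + \<sigma>))) (at t)"
    by (simp only: o_def root_out_def)
  moreover have "((\<lambda>t. of_real ((ln r - ln q) / 2) + \<i> * of_real pi * (of_real t - 1 / 2)) has_vector_derivative \<i> * of_real pi) (at t)"
    by (auto intro!: derivative_eq_intros)
  ultimately have "(circle_path q r has_vector_derivative
      \<i> * of_real pi + 2 * of_real pi * \<i> * \<zeta> * ((of_real q / \<zeta>\<^sup>2 / (2 * \<sigma>)) / (1 + \<sigma>))) (at t)"
    unfolding circle_path_def[abs_def] by (intro has_vector_derivative_add) (simp_all add: mult_ac)
  also have "2 * of_real pi * \<i> * \<zeta> * ((of_real q / \<zeta>\<^sup>2 / (2 * \<sigma>)) / (1 + \<sigma>)) = \<i> * of_real pi * ((1 - \<sigma>\<^sup>2) / (\<sigma> * (1 + \<sigma>)))"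
  proof -
    have "of_real q / \<zeta> = 1 - \<sigma>\<^sup>2" by (simp add: \<sigma>_def root_out_square)
    hence "of_real q = (1 - \<sigma>\<^sup>2) * \<zeta>" using nz by (simp add: field_simps)
    thus ?thesis using nz s0 by (simp add: power2_eq_square)
  qed
  also have "(1 - \<sigma>\<^sup>2) / (\<sigma> * (1 + \<sigma>)) = (1 - \<sigma>) / \<sigma>"
  proof -
    have "1 - \<sigma>\<^sup>2 = (1 - \<sigma>) * (1 + \<sigma>)" by (simp add: algebra_simps power2_eq_square)
    thus ?thesis using s0 by simp
  qed
  also have "\<i> * of_real pi + \<i> * of_real pi * ((1 - \<sigma>) / \<sigma>) = \<i> * of_real pi / \<sigma>"
    using s0 by (simp add: field_simps)
  finally show ?thesis by (simp add: \<sigma>_def \<zeta>_def)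
qed

lemma circle_path_period: "circle_path q r 1 = circle_path q r 0 + \<i> * of_real pi"
proof -
  have "circ 1 = circ 0" by simp
  thus ?thesis unfolding circle_path_def by (simp add: algebra_simps)
qed

end

lemma circle_path_continuous:
  assumes q: "0 < q" "q < r0"
  shows "continuous_on ({r0..1} \<times> {0..1}) (\<lambda>(r, t). circle_path q r t)"
proof -
  have "continuous_on ({r0..1} \<times> {0..1}) (\<lambda>x. root_out q (of_real (fst x) * circ (snd x)))"
    using q by (intro root_out_continuous continuous_intros) (auto intro!: circle_norm_lt)
  moreover have "1 + root_out q (of_real (fst x) * circ (snd x)) \<notin> \<real>\<^sub>\<le>\<^sub>0" if "x \<in> {r0..1} \<times> {0..1}" for x
  proof -
    have "Re (root_out q (of_real (fst x) * circ (snd x))) > 0" using that q by (intro circle_root_pos) auto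
    thus ?thesis by (intro Re_pos_not_nonpos) simp
  qed
  ultimately show ?thesis
    unfolding circle_path_def split_beta using q by (intro continuous_intros) auto
qed

text \<open>
  Since dz = (\<pi>i/\<surd>(1 - q/\<zeta>)) dt along the path, dividing by the outer root amounts
  to integrating \<Omega> dz.
\<close>
lemma path_integral_primitive:
  assumes q: "0 < q" "q < r" "r \<le> 1"
    and G: "\<And>t. t \<in> {0..1} \<Longrightarrow> (G has_field_derivative \<Omega> (circle_path q r t)) (at (circle_path q r t))"
  shows "((\<lambda>t. \<Omega> (circle_path q r t) / root_out q (of_real r * circ t)) has_integral
     (G (circle_path q r 1) - G (circle_path q r 0)) / (\<i> * of_real pi)) {0..1}"
proof -
  have "((\<lambda>t. \<i> * of_real pi / root_out q (of_real r * circ t) * \<Omega> (circle_path q r t)) has_integral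
     G (circle_path q r 1) - G (circle_path q r 0)) {0..1}"
  proof (rule fundamental_theorem_of_calculus)
    fix t :: real assume t: "t \<in> {0..1}"
    from field_vector_diff_chain_at[OF circle_path_deriv[OF q] G[OF t]]
    show "((\<lambda>t. G (circle_path q r t)) has_vector_derivative
        \<i> * of_real pi / root_out q (of_real r * circ t) * \<Omega> (circle_path q r t)) (at t within {0..1})"
      by (simp add: o_def has_vector_derivative_at_within)
  qed simp
  from has_integral_mult_right[OF this, of "1 / (\<i> * of_real pi)"]
  show ?thesis by (simp add: divide_simps mult_ac)
qed

lemma eq_zero_at_right_end:
  fixes f :: "real \<Rightarrow> complex"
  assumes "continuous_on {a..1} f" "a < 1" "\<And>r. a \<le> r \<Longrightarrow> r < 1 \<Longrightarrow> f r = 0"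
  shows "f 1 = 0"
proof -
  have "(f \<longlongrightarrow> f 1) (at_left 1)"
    using assms(1,2) by (simp add: continuous_on_Icc_at_leftD)
  moreover have "eventually (\<lambda>r. f r = 0) (at_left 1)"
    using eventually_at_left_real[OF assms(2)] by eventually_elim (use assms(3) in auto)
  ultimately have "((\<lambda>r. 0) \<longlongrightarrow> f 1) (at_left (1::real))" by (rule Lim_transform_eventually)
  thus ?thesis by (simp add: tendsto_const_iff)
qed

section \<open>The logarithm of an invertible function on the upper half of the surface\<close>

lemma sinh_bound_zeta:
  assumes q: "0 < q" and R: "R = 1 / sqrt q"
  shows "norm (sinh z) < R \<longleftrightarrow> norm (zeta_of q z) < 1" "norm (sinh z) \<le> R \<longleftrightarrow> norm (zeta_of q z) \<le> 1"
proof -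
  have n: "norm (zeta_of q z) = q * (norm (sinh z))\<^sup>2" using q by (simp add: zeta_of_def norm_mult norm_power)
  have R2: "R > 0" "q * R\<^sup>2 = 1" using q by (auto simp: R power_divide)
  have "norm (sinh z) < R \<longleftrightarrow> (norm (sinh z))\<^sup>2 < R\<^sup>2"
    using R2 by (metis norm_ge_zero order_less_imp_le power2_less_imp_less power_strict_mono zero_less_numeral)
  also have "\<dots> \<longleftrightarrow> q * (norm (sinh z))\<^sup>2 < q * R\<^sup>2" using q by simp
  finally show "norm (sinh z) < R \<longleftrightarrow> norm (zeta_of q z) < 1" by (simp add: n R2)
  have "norm (sinh z) \<le> R \<longleftrightarrow> (norm (sinh z))\<^sup>2 \<le> R\<^sup>2"
    using R2 by (metis norm_ge_zero order_less_imp_le power2_le_imp_le power_mono)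
  also have "\<dots> \<longleftrightarrow> q * (norm (sinh z))\<^sup>2 \<le> q * R\<^sup>2" using q by simp
  finally show "norm (sinh z) \<le> R \<longleftrightarrow> norm (zeta_of q z) \<le> 1" by (simp add: n R2)
qed

lemma zeta_of_minus [simp]: "zeta_of q (- z) = zeta_of q z"
  and zeta_of_shift [simp]: "zeta_of q (z + \<i> * of_real pi) = zeta_of q z"
  by (simp_all add: zeta_of_def)

lemma zeta_of_holomorphic: "zeta_of q holomorphic_on S"
  unfolding zeta_of_def sinh_field_def by (intro holomorphic_intros) auto

text \<open>
  The odd part of a logarithm of \<Phi>, corrected by a linear term to be periodic, integrates to
  zero against the holomorphic differential because the resulting differential has a periodic
  primitive.
\<close>
lemma ratio_logarithm:
  fixes \<Phi> :: "complex \<Rightarrow> complex"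
  assumes q: "0 < q" "q < 1"
    and hol: "\<Phi> holomorphic_on {z. norm (zeta_of q z) < 1}"
    and cont: "continuous_on {z. norm (zeta_of q z) \<le> 1} \<Phi>"
    and nz: "\<And>z. norm (zeta_of q z) \<le> 1 \<Longrightarrow> \<Phi> z \<noteq> 0"
    and per: "\<And>z. \<Phi> (z + \<i> * of_real pi) = \<Phi> z"
  obtains a :: int and D where "continuous_on {0..1} D" "D 0 = D 1"
    "integral {0..1} (\<lambda>t. D t * of_real (weight q t)) = 0"
    "\<And>t. t \<in> {0..1} \<Longrightarrow>
       \<Phi> (circle_path q 1 t) / \<Phi> (- circle_path q 1 t) = exp (D t + 4 * of_int a * circle_path q 1 t)"
proof -
  define R where "R = 1 / sqrt q"
  have R: "R > 1" using q by (simp add: R_def)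
  have S: "sinh_strip R = {z. norm (zeta_of q z) < 1}"
    unfolding sinh_strip_def sinh_bound_zeta(1)[OF q(1) R_def] ..
  have hol': "\<Phi> holomorphic_on sinh_strip R" using hol by (simp add: S)
  have nz': "\<Phi> z \<noteq> 0" if "z \<in> sinh_strip R" for z using that nz[of z] by (simp add: S)
  obtain \<Lambda> and a :: int where L: "\<Lambda> holomorphic_on sinh_strip R"
    "\<And>z. z \<in> sinh_strip R \<Longrightarrow> \<Phi> z = exp (\<Lambda> z)"
    "\<And>z. z \<in> sinh_strip R \<Longrightarrow> \<Lambda> (z + \<i> * of_real pi) = \<Lambda> z + of_int a * (2 * of_real pi * \<i>)"
    by (rule periodic_holomorphic_log[OF R hol' nz' per]) blast+
  \<comment> \<open>Both terms of the odd part contribute 2\<pi>ia under translation by \<pi>i; the linear term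
    removes 4\<pi>ia.\<close>
  define O' where "O' z = \<Lambda> z - \<Lambda> (- z) - 4 * of_int a * z" for z
  have "(\<Lambda> \<circ> uminus) holomorphic_on sinh_strip R"
    by (rule holomorphic_on_compose_gen[OF _ L(1)]) (auto intro: holomorphic_intros)
  hence Ohol: "O' holomorphic_on sinh_strip R"
    unfolding O'_def o_def by (intro holomorphic_intros L(1))
  have Oodd: "O' (- z) = - O' z" for z by (simp add: O'_def)
  have Oper: "O' (z + \<i> * of_real pi) = O' z" if z: "z \<in> sinh_strip R" for z
  proof -
    have "- z - \<i> * of_real pi \<in> sinh_strip R"
      using z sinh_strip_minus[of "z + \<i> * of_real pi" R] by simp
    from L(3)[OF this] have "\<Lambda> (- z) = \<Lambda> (- z - \<i> * of_real pi) + of_int a * (2 * of_real pi * \<i>)" by simp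
    thus ?thesis using L(3)[OF z] by (simp add: O'_def algebra_simps)
  qed
  define \<Omega> where "\<Omega> z = O' z / root_in q (zeta_of q z)" for z
  have small: "norm (of_real q * zeta_of q z) < 1" if "norm (zeta_of q z) \<le> 1" for z
  proof -
    have "norm (of_real q * zeta_of q z) \<le> q * 1" unfolding norm_mult using that q by (intro mult_mono) auto
    thus ?thesis using q by simp
  qed
  have ri0: "root_in q (zeta_of q z) \<noteq> 0" if "norm (zeta_of q z) \<le> 1" for z
    using root_in_pos[OF small[OF that]] by auto
  have "\<Omega> holomorphic_on sinh_strip R"
  proof -
    have "zeta_of q holomorphic_on sinh_strip R" by (rule zeta_of_holomorphic)
    thus ?thesis unfolding \<Omega>_def using ri0 small
      by (intro holomorphic_on_divide Ohol root_in_holomorphic) (auto simp: S)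
  qed
  then obtain G where G: "\<And>z. z \<in> sinh_strip R \<Longrightarrow> (G has_field_derivative \<Omega> z) (at z)"
    "\<And>z. z \<in> sinh_strip R \<Longrightarrow> G (z + \<i> * of_real pi) = G z"
    by (rule periodic_odd_primitive[OF R]) (auto simp: \<Omega>_def Oodd Oper)
  have zp: "zeta_of q (circle_path q r t) = of_real r * circ t" if "q < r" "r \<le> 1" for r t
    by (rule circle_path_sinh_cosh(1)[OF q(1) that])
  have zS: "circle_path q r t \<in> sinh_strip R" if "q < r" "r < 1" for r t
    using zp[of r t] that q by (simp add: S norm_mult)
  have int0: "((\<lambda>t. O' (circle_path q r t) * (1 / (root_in q (of_real r * circ t) * root_out q (of_real r * circ t)))) has_integral 0) {0..1}"
    if r: "q < r" "r < 1" for r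
  proof -
    have "((\<lambda>t. \<Omega> (circle_path q r t) / root_out q (of_real r * circ t)) has_integral
        (G (circle_path q r 1) - G (circle_path q r 0)) / (\<i> * of_real pi)) {0..1}"
      by (rule path_integral_primitive) (use q r zS G in auto)
    moreover have "G (circle_path q r 1) = G (circle_path q r 0)"
      unfolding circle_path_period[OF q(1) r(1) less_imp_le[OF r(2)]] by (rule G(2)[OF zS[OF r]])
    moreover have "\<Omega> (circle_path q r t) / root_out q (of_real r * circ t)
       = O' (circle_path q r t) * (1 / (root_in q (of_real r * circ t) * root_out q (of_real r * circ t)))" for t
      using zp[of r t] r by (simp add: \<Omega>_def)
    ultimately show ?thesis by simp
  qed
  \<comment> \<open>The function is only continuous up to the circle, so the identities are obtained for radii r
    < 1 and carried to r = 1 by a logarithm that is continuous on the whole rectangle of (r, t).\<close>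
  define r0 where "r0 = (1 + q) / 2"
  have r0: "q < r0" "r0 < 1" using q by (auto simp: r0_def)
  define T where "T = {r0..1} \<times> {0..1::real}"
  have zc: "continuous_on T (\<lambda>x. circle_path q (fst x) (snd x))"
    unfolding T_def using circle_path_continuous[OF q(1) r0(1)] by (simp add: split_beta)
  have zb: "norm (zeta_of q (circle_path q (fst x) (snd x))) \<le> 1" if "x \<in> T" for x
    using that zp[of "fst x" "snd x"] r0 q by (auto simp: T_def norm_mult)
  define E where "E x = \<Phi> (circle_path q (fst x) (snd x)) / \<Phi> (- circle_path q (fst x) (snd x))
      * exp (- 4 * of_int a * circle_path q (fst x) (snd x))" for x
  have "continuous_on T E"
    unfolding E_def using zb nz
    by (intro continuous_intros continuous_on_compose2[OF cont] zc) auto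
  moreover have "contractible T" unfolding T_def by (intro convex_imp_contractible convex_Times) auto
  moreover have "E x \<noteq> 0" if "x \<in> T" for x
    unfolding E_def using zb[OF that] nz by simp
  ultimately obtain g where g: "continuous_on T g" "\<And>x. x \<in> T \<Longrightarrow> E x = exp (g x)"
    by (rule continuous_logarithm_on_contractible) blast+
  define T' where "T' = {r0..<1} \<times> {0..1::real}"
  have T': "T' \<subseteq> T" by (auto simp: T_def T'_def)
  have zS': "circle_path q (fst x) (snd x) \<in> sinh_strip R" if "x \<in> T'" for x
    using that zS r0 by (auto simp: T'_def)
  have "connected T'" unfolding T'_def by (intro convex_connected convex_Times) auto
  moreover have "continuous_on T' (\<lambda>x. g x - O' (circle_path q (fst x) (snd x)))"
    by (intro continuous_intros continuous_on_compose2[OF holomorphic_on_imp_continuous_on[OF Ohol]]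
        continuous_on_subset[OF g(1) T'] continuous_on_subset[OF zc T']) (use zS' in auto)
  moreover have "exp (g x - O' (circle_path q (fst x) (snd x))) = 1" if x: "x \<in> T'" for x
  proof -
    let ?z = "circle_path q (fst x) (snd x)"
    have "exp (O' ?z) = exp (\<Lambda> ?z) / exp (\<Lambda> (- ?z)) * exp (- 4 * of_int a * ?z)"
      by (simp add: O'_def exp_diff exp_minus divide_inverse)
    also have "\<dots> = E x" unfolding E_def using L(2)[OF zS'[OF x]] L(2)[of "- ?z"] zS'[OF x] by simp
    finally show ?thesis using g(2)[of x] x T' by (auto simp: exp_diff)
  qed
  ultimately obtain n :: int where n: "\<And>x. x \<in> T' \<Longrightarrow> g x - O' (circle_path q (fst x) (snd x)) = of_int n * (2 * of_real pi * \<i>)"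
    by (rule continuous_2pi_multiple_const) blast+
  define h where "h r t = g (r, t) - of_int n * (2 * of_real pi * \<i>)" for r t
  have hO: "h r t = O' (circle_path q r t)" if "r0 \<le> r" "r < 1" "t \<in> {0..1}" for r t
    using n[of "(r, t)"] that by (simp add: h_def T'_def algebra_simps)
  have hc: "continuous_on T (\<lambda>x. h (fst x) (snd x))"
    unfolding h_def by (intro continuous_intros) (use g(1) in auto)
  define w where "w x = 1 / (root_in q (of_real (fst x) * circ (snd x)) * root_out q (of_real (fst x) * circ (snd x)))" for x
  have w1: "w (1, t) = of_real (weight q t)" for t using weight_eq[OF q] by (simp add: w_def)
  have wc: "continuous_on T w"
  proof -
    have s: "norm (of_real q * (of_real (fst x) * circ (snd x))) < 1"
      "norm (of_real q / (of_real (fst x) * circ (snd x))) < 1" "fst x \<noteq> 0" if "x \<in> T" for x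
    proof -
      have x: "r0 \<le> fst x" "fst x \<le> 1" using that by (auto simp: T_def)
      have "q * fst x \<le> q * 1" using x q by (intro mult_left_mono) auto
      hence "q * fst x < 1" using q by linarith
      thus "norm (of_real q * (of_real (fst x) * circ (snd x))) < 1" using x q r0 by (simp add: norm_mult)
      show "norm (of_real q / (of_real (fst x) * circ (snd x))) < 1" using x r0 q by (intro circle_norm_lt) auto
      show "fst x \<noteq> 0" using x r0 q by auto
    qed
    have "root_in q (of_real (fst x) * circ (snd x)) \<noteq> 0" "root_out q (of_real (fst x) * circ (snd x)) \<noteq> 0" if "x \<in> T" for x
      using root_in_pos[OF s(1)[OF that]] root_out_pos[OF s(2)[OF that]] by auto
    thus ?thesis unfolding w_def using s
      by (intro continuous_intros root_in_continuous root_out_continuous) auto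
  qed
  have "integral {0..1} (\<lambda>t. h 1 t * w (1, t)) = 0"
  proof (rule eq_zero_at_right_end[of r0 "\<lambda>r. integral {0..1} (\<lambda>t. h r t * w (r, t))"])
    have "continuous_on ({r0..1} \<times> cbox 0 1) (\<lambda>(r, t). h r t * w (r, t))"
      using continuous_on_mult[OF hc wc] by (simp add: T_def split_beta)
    from integral_continuous_on_param[OF this]
    show "continuous_on {r0..1} (\<lambda>r. integral {0..1} (\<lambda>t. h r t * w (r, t)))" by simp
    fix r assume r: "r0 \<le> r" "r < 1"
    have "integral {0..1} (\<lambda>t. h r t * w (r, t)) = integral {0..1}
        (\<lambda>t. O' (circle_path q r t) * (1 / (root_in q (of_real r * circ t) * root_out q (of_real r * circ t))))"
      by (rule integral_cong) (use hO r in \<open>simp add: w_def\<close>)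
    also have "\<dots> = 0" by (rule integral_unique[OF int0]) (use r r0 in auto)
    finally show "integral {0..1} (\<lambda>t. h r t * w (r, t)) = 0" .
  qed (use r0 in auto)
  moreover have "h 1 1 - h 1 0 = 0"
  proof (rule eq_zero_at_right_end[of r0 "\<lambda>r. h r 1 - h r 0"])
    have "continuous_on {r0..1} (\<lambda>r. h r t)" if "t \<in> {0..1}" for t
    proof -
      have "continuous_on {r0..1} (\<lambda>r. (r, t))" by (intro continuous_intros)
      from continuous_on_compose2[OF hc this] that show ?thesis by (auto simp: T_def image_subset_iff)
    qed
    thus "continuous_on {r0..1} (\<lambda>r. h r 1 - h r 0)" by (intro continuous_intros) auto
    fix r assume r: "r0 \<le> r" "r < 1"
    have "O' (circle_path q r 1) = O' (circle_path q r 0)"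
      using circle_path_period[of q r] Oper[OF zS[of r 0]] r r0 q by simp
    thus "h r 1 - h r 0 = 0" using hO[OF r] by simp
  qed (use r0 in auto)
  moreover have "continuous_on {0..1} (h 1)"
  proof -
    have "continuous_on {0..1} (\<lambda>t. (1::real, t::real))" by (intro continuous_intros)
    from continuous_on_compose2[OF hc this] r0 show ?thesis by (auto simp: T_def image_subset_iff)
  qed
  moreover have "\<Phi> (circle_path q 1 t) / \<Phi> (- circle_path q 1 t) = exp (h 1 t + 4 * of_int a * circle_path q 1 t)"
    if t: "t \<in> {0..1}" for t
  proof -
    have "exp (h 1 t) = E (1, t)"
    proof -
      have "exp (of_int n * (2 * of_real pi * \<i>)) = (1 :: complex)"
        using exp_integer_2pi[of "of_int n"] by (simp add: mult_ac)
      thus ?thesis using g(2)[of "(1, t)"] t r0 by (simp add: h_def exp_diff T_def)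
    qed
    thus ?thesis by (simp add: E_def exp_add exp_minus)
  qed
  ultimately show ?thesis using that[of "h 1" a] by (simp add: w1)
qed

section \<open>The weighted mean of the boundary path\<close>

lemma cosh_ln_ratio:
  assumes q: "0 < q" "q < 1"
  defines "X \<equiv> ln ((1 + sqrt (1 - q)) / sqrt q)"
  shows "cosh X = 1 / sqrt q" "X > 0"
proof -
  have e1: "1 + sqrt (1 - q) > 0" using q by (simp add: add_pos_nonneg)
  have eX: "exp X = (1 + sqrt (1 - q)) / sqrt q" unfolding X_def using e1 q by simp
  have "(1 + sqrt (1 - q)) * (1 - sqrt (1 - q)) = q" using q by (simp add: algebra_simps)
  hence "((1 + sqrt (1 - q)) / sqrt q) * ((1 - sqrt (1 - q)) / sqrt q) = 1" using q by simp
  hence "exp (- X) = (1 - sqrt (1 - q)) / sqrt q" unfolding exp_minus eX by (metis inverse_unique)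
  thus "cosh X = 1 / sqrt q" by (simp add: cosh_field_def eX add_divide_distrib[symmetric])
  have "sqrt q < 1" "sqrt (1 - q) > 0" using q by auto
  hence "sqrt q < 1 + sqrt (1 - q)" by linarith
  hence "1 < exp X" unfolding eX using q by (simp add: less_divide_eq)
  thus "X > 0" by simp
qed

text \<open>
  The primitive M of z/\<surd>(1 - q\<zeta>) is even, and the path ends at X \<plusminus>
  \<pi>i/2. The difference of the values of M there vanishes at X = 0, and its derivative in X is
  elementary since both points give the same real \<zeta>. Because the strip of holomorphy for the
  root is larger than the half surface, the boundary path can be used directly.
\<close>
lemma circle_path_weight_integral:
  assumes q: "0 < q" "q < 1"
  defines "X \<equiv> ln ((1 + sqrt (1 - q)) / sqrt q)"
  shows "integral {0..1} (\<lambda>t. circle_path q 1 t * of_real (weight q t))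
     = of_real (integral {0..X} (\<lambda>x. 1 / sqrt (1 - (q * cosh x)\<^sup>2)))"
proof -
  \<comment> \<open>The root is holomorphic for |sinh z| < 1/q, a strip containing the boundary path, on which
    |sinh z| = 1/\<surd>q.\<close>
  define R where "R = 1 / q"
  have R: "R > 1" using q by (simp add: R_def)
  have S: "norm (of_real q * zeta_of q z) < 1" if "z \<in> sinh_strip R" for z
  proof -
    have "norm (sinh z) * q < 1" using that q by (simp add: sinh_strip_def R_def field_simps)
    hence "(norm (sinh z) * q)\<^sup>2 < 1" using q by (intro abs_square_less_1[THEN iffD2]) (simp add: abs_mult)
    thus ?thesis using q by (simp add: zeta_of_def norm_mult norm_power power_mult_distrib power2_eq_square mult_ac)
  qed
  define \<Omega> where "\<Omega> z = z / root_in q (zeta_of q z)" for z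
  have ri0: "root_in q (zeta_of q z) \<noteq> 0" if "z \<in> sinh_strip R" for z
    using root_in_pos[OF S[OF that]] by auto
  have "\<Omega> holomorphic_on sinh_strip R"
  proof -
    have "zeta_of q holomorphic_on sinh_strip R" by (rule zeta_of_holomorphic)
    thus ?thesis unfolding \<Omega>_def using ri0 S
      by (intro holomorphic_intros root_in_holomorphic) auto
  qed
  then obtain M where M: "\<And>z. z \<in> sinh_strip R \<Longrightarrow> (M has_field_derivative \<Omega> z) (at z)"
    "\<And>z. z \<in> sinh_strip R \<Longrightarrow> M (- z) = M z"
    by (rule even_primitive[OF R]) (auto simp: \<Omega>_def)
  have zS: "circle_path q 1 t \<in> sinh_strip R" for t
  proof -
    have "norm (sinh (circle_path q 1 t)) = 1 / sqrt q"
      using circle_path_norm_sinh[of q 1 t] q by (simp add: real_sqrt_divide)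
    also have "\<dots> < 1 / q"
    proof -
      have "q < sqrt q" using q by (intro real_less_rsqrt) (simp add: power2_eq_square)
      thus ?thesis using q by (intro divide_strict_left_mono) auto
    qed
    finally show ?thesis by (simp add: sinh_strip_def R_def)
  qed
  have zp: "zeta_of q (circle_path q 1 t) = circ t" for t
    using circle_path_sinh_cosh(1)[of q 1 t] q by simp
  have "((\<lambda>t. \<Omega> (circle_path q 1 t) / root_out q (of_real 1 * circ t)) has_integral
        (M (circle_path q 1 1) - M (circle_path q 1 0)) / (\<i> * of_real pi)) {0..1}"
    by (rule path_integral_primitive) (use q zS M in auto)
  moreover have "\<Omega> (circle_path q 1 t) / root_out q (of_real 1 * circ t) = circle_path q 1 t * of_real (weight q t)" for t
    by (simp add: \<Omega>_def zp weight_eq[OF q])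
  ultimately have I: "integral {0..1} (\<lambda>t. circle_path q 1 t * of_real (weight q t))
      = (M (circle_path q 1 1) - M (circle_path q 1 0)) / (\<i> * of_real pi)"
    by (simp add: integral_unique)
  \<comment> \<open>The path runs from X - p to X + p.\<close>
  define p where "p = \<i> * of_real (pi / 2)"
  have e1: "1 + sqrt (1 - q) > 0" using q by (simp add: add_pos_nonneg)
  have z0: "circle_path q 1 0 = of_real X - p"
  proof -
    have "root_out q 1 = of_real (sqrt (1 - q))"
      unfolding root_out_def using q csqrt_of_real_nonneg[of "1 - q"] by simp
    hence "Ln (1 + root_out q 1) = of_real (ln (1 + sqrt (1 - q)))"
      using Ln_of_real[OF e1] by simp
    moreover have "X = - ln q / 2 + ln (1 + sqrt (1 - q))"
      unfolding X_def using q e1 by (simp add: ln_div ln_sqrt)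
    moreover from this have "complex_of_real X = - of_real (ln q) / 2 + of_real (ln (1 + sqrt (1 - q)))"
      by simp
    ultimately show ?thesis using q by (simp add: circle_path_def p_def algebra_simps)
  qed
  have z1: "circle_path q 1 1 = of_real X + p"
    using circle_path_period[of q 1] q by (simp add: z0 p_def)
  note coshX = cosh_ln_ratio(1)[OF q, folded X_def] and X0 = less_imp_le[OF cosh_ln_ratio(2)[OF q, folded X_def]]
  have qc: "q * cosh x < 1" if "x \<in> {0..X}" for x
  proof -
    have "cosh x \<le> cosh X" using that by (simp add: cosh_real_nonneg_le_iff)
    hence "q * cosh x \<le> q * (1 / sqrt q)" unfolding coshX using q by (intro mult_left_mono) auto
    also have "\<dots> = sqrt q" using q by (simp add: real_div_sqrt)
    also have "\<dots> < 1" using q by simp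
    finally show ?thesis .
  qed
  have sp: "sinh (of_real x + p) = \<i> * of_real (cosh x)" "sinh (of_real x - p) = - (\<i> * of_real (cosh x))" for x
  proof -
    have "sinh p = \<i>" "cosh p = 0"
      unfolding p_def by (simp_all only: sinh_conv_sin[of "\<i> * _"] cosh_conv_cos[of "\<i> * _"]) (simp_all flip: sin_of_real cos_of_real mult.assoc)
    thus "sinh (of_real x + p) = \<i> * of_real (cosh x)" "sinh (of_real x - p) = - (\<i> * of_real (cosh x))"
      by (simp_all add: sinh_add sinh_diff cosh_of_real)
  qed
  have pS: "of_real x + p \<in> sinh_strip R" "of_real x - p \<in> sinh_strip R" if "x \<in> {0..X}" for x
  proof -
    have "norm (sinh (of_real x + p)) = cosh x" "norm (sinh (of_real x - p)) = cosh x"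
      unfolding sp by (simp_all add: norm_mult)
    moreover have "cosh x < 1 / q" using qc[OF that] q by (simp add: field_simps)
    ultimately show "of_real x + p \<in> sinh_strip R" "of_real x - p \<in> sinh_strip R"
      by (simp_all add: sinh_strip_def R_def)
  qed
  have \<Omega>p: "\<Omega> (of_real x + p) - \<Omega> (of_real x - p) = \<i> * of_real pi * of_real (1 / sqrt (1 - (q * cosh x)\<^sup>2))"
    if x: "x \<in> {0..X}" for x
  proof -
    have z: "zeta_of q (of_real x + p) = of_real (q * (cosh x)\<^sup>2)" "zeta_of q (of_real x - p) = of_real (q * (cosh x)\<^sup>2)"
      by (simp_all add: zeta_of_def sp power_mult_distrib)
    have "0 \<le> 1 - (q * cosh x)\<^sup>2" using qc[OF x] q by (simp add: power_le_one)
    hence "root_in q (of_real (q * (cosh x)\<^sup>2)) = of_real (sqrt (1 - (q * cosh x)\<^sup>2))"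
      unfolding root_in_def using csqrt_of_real_nonneg[of "1 - (q * cosh x)\<^sup>2"]
      by (simp add: power_mult_distrib power2_eq_square mult_ac)
    thus ?thesis unfolding \<Omega>_def z by (simp add: p_def diff_divide_distrib[symmetric])
  qed
  define m where "m x = M (of_real x + p) - M (of_real x - p)" for x :: real
  have "((\<lambda>x. \<i> * of_real pi * of_real (1 / sqrt (1 - (q * cosh x)\<^sup>2))) has_integral m X - m 0) {0..X}"
  proof (rule fundamental_theorem_of_calculus[OF X0])
    fix x assume x: "x \<in> {0..X}"
    have "((\<lambda>w. M (w + p) - M (w - p)) has_field_derivative \<Omega> (of_real x + p) * 1 - \<Omega> (of_real x - p) * 1) (at (of_real x))"
      by (intro DERIV_diff DERIV_chain2[OF M(1)] pS x) (auto intro!: derivative_eq_intros)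
    hence "((\<lambda>w. M (w + p) - M (w - p)) has_field_derivative \<i> * of_real pi * of_real (1 / sqrt (1 - (q * cosh x)\<^sup>2))) (at (of_real x))"
      using \<Omega>p[OF x] by simp
    from has_vector_derivative_real_field[OF this]
    show "(m has_vector_derivative \<i> * of_real pi * of_real (1 / sqrt (1 - (q * cosh x)\<^sup>2))) (at x within {0..X})"
      unfolding m_def by (rule has_vector_derivative_at_within)
  qed
  moreover have "m 0 = 0" using M(2)[OF pS(1)[of 0]] X0 by (simp add: m_def)
  ultimately have mX: "((\<lambda>x. \<i> * of_real pi * of_real (1 / sqrt (1 - (q * cosh x)\<^sup>2))) has_integral m X) {0..X}" by simp
  have "continuous_on {0..X} (\<lambda>x. 1 / sqrt (1 - (q * cosh x)\<^sup>2))"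
  proof (intro continuous_intros ballI)
    fix x assume x: "x \<in> {0..X}"
    have "(q * cosh x)\<^sup>2 < 1" using qc[OF x] q by (intro abs_square_less_1[THEN iffD2]) (simp add: abs_mult)
    thus "sqrt (1 - (q * cosh x)\<^sup>2) \<noteq> 0" by simp
  qed
  hence "((\<lambda>x. 1 / sqrt (1 - (q * cosh x)\<^sup>2)) has_integral integral {0..X} (\<lambda>x. 1 / sqrt (1 - (q * cosh x)\<^sup>2))) {0..X}"
    by (intro integrable_integral integrable_continuous_real)
  hence "((\<lambda>x. complex_of_real (1 / sqrt (1 - (q * cosh x)\<^sup>2))) has_integral of_real (integral {0..X} (\<lambda>x. 1 / sqrt (1 - (q * cosh x)\<^sup>2)))) {0..X}"
    by (rule has_integral_of_real)
  from has_integral_unique[OF mX has_integral_mult_right[OF this, of "\<i> * of_real pi"]]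
  have "m X = \<i> * of_real pi * of_real (integral {0..X} (\<lambda>x. 1 / sqrt (1 - (q * cosh x)\<^sup>2)))" .
  thus ?thesis unfolding I z0 z1 by (simp add: m_def)
qed

section \<open>The topology of the surface\<close>

lemma aff_point_eq_iff: "aff_point z = aff_point w \<longleftrightarrow> z = w"
  by (auto simp: aff_point_def prod_eq_iff)

lemma inf_point_eq_aff: "fst w \<noteq> 0 \<Longrightarrow> inf_point w = aff_point (1 / fst w, snd w / (fst w)\<^sup>2)"
  by (simp add: inf_point_def aff_point_def Let_def)

lemma inf_point_inject:
  assumes "w \<in> infinity_curve k" "w' \<in> infinity_curve k" "inf_point w = inf_point w'"
  shows "w = w'"
proof -
  have z: "snd w = 1 \<or> snd w = -1" if "w \<in> infinity_curve k" "fst w = 0" for w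
  proof -
    have "(snd w)\<^sup>2 = 1" using that by (auto simp: infinity_curve_def curve_poly_rev_def)
    thus ?thesis by (simp add: power2_eq_1_iff)
  qed
  show ?thesis
    using assms z[of w] z[of w']
    by (auto simp: inf_point_def Let_def prod_eq_iff divide_simps split: if_splits)
qed

lemma affine_to_infinity:
  assumes "z \<in> affine_curve k" "fst z \<noteq> 0"
  shows "(1 / fst z, snd z / (fst z)\<^sup>2) \<in> infinity_curve k"
    "inf_point (1 / fst z, snd z / (fst z)\<^sup>2) = aff_point z"
proof -
  show "inf_point (1 / fst z, snd z / (fst z)\<^sup>2) = aff_point z"
    using assms by (simp add: inf_point_def aff_point_def Let_def power_divide)
  have "curve_poly k (1 / (1 / fst z)) = curve_poly_rev k (1 / fst z) / (1 / fst z) ^ 4"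
    using assms by (intro curve_poly_rev_inverse) simp
  hence "curve_poly_rev k (1 / fst z) = curve_poly k (fst z) / (fst z) ^ 4"
    using assms by (simp add: power_divide)
  thus "(1 / fst z, snd z / (fst z)\<^sup>2) \<in> infinity_curve k"
    using assms by (auto simp: infinity_curve_def affine_curve_def power_divide simp flip: power_mult)
qed

lemma infinity_to_affine:
  assumes "w \<in> infinity_curve k" "fst w \<noteq> 0"
  shows "(1 / fst w, snd w / (fst w)\<^sup>2) \<in> affine_curve k"
  using assms curve_poly_rev_inverse[of "fst w" k]
  by (auto simp: affine_curve_def infinity_curve_def power_divide simp flip: power_mult)

text \<open>
  The affine chart is an open map; in the chart at infinity the image is read off through (u, v)
  \<mapsto> (1/u, v/u^2).
\<close>
lemma surface_open_aff_image:
  assumes "open A"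
  shows "surface_open k (aff_point ` (affine_curve k \<inter> A))"
  unfolding surface_open_def
proof (intro conjI)
  show "aff_point ` (affine_curve k \<inter> A) \<subseteq> surface k" by (auto simp: surface_def)
  have "{z \<in> affine_curve k. aff_point z \<in> aff_point ` (affine_curve k \<inter> A)} = affine_curve k \<inter> A"
    by (auto simp: aff_point_eq_iff)
  thus "openin (top_of_set (affine_curve k)) {z \<in> affine_curve k. aff_point z \<in> aff_point ` (affine_curve k \<inter> A)}"
    using assms by (auto intro: openin_open_Int)
  let ?g = "\<lambda>w::complex \<times> complex. (1 / fst w, snd w / (fst w)\<^sup>2)"
  let ?U = "infinity_curve k \<inter> {w. fst w \<noteq> 0}"
  have "{w \<in> infinity_curve k. inf_point w \<in> aff_point ` (affine_curve k \<inter> A)} = ?U \<inter> ?g -` A"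
  proof (intro set_eqI iffI)
    fix w assume w: "w \<in> {w \<in> infinity_curve k. inf_point w \<in> aff_point ` (affine_curve k \<inter> A)}"
    hence "fst w \<noteq> 0" by (auto simp: inf_point_def aff_point_def Let_def split: if_splits)
    thus "w \<in> ?U \<inter> ?g -` A" using w by (auto simp: inf_point_eq_aff aff_point_eq_iff)
  next
    fix w assume w: "w \<in> ?U \<inter> ?g -` A"
    thus "w \<in> {w \<in> infinity_curve k. inf_point w \<in> aff_point ` (affine_curve k \<inter> A)}"
      using infinity_to_affine[of w k] by (auto simp: inf_point_eq_aff)
  qed
  moreover have "openin (top_of_set ?U) (?U \<inter> ?g -` A)"
    by (rule continuous_openin_preimage_gen[OF _ assms]) (auto intro!: continuous_intros)
  moreover have "openin (top_of_set (infinity_curve k)) ?U"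
    by (intro openin_open_Int open_Collect_neq continuous_intros)
  ultimately show "openin (top_of_set (infinity_curve k))
      {w \<in> infinity_curve k. inf_point w \<in> aff_point ` (affine_curve k \<inter> A)}"
    using openin_trans by fastforce
qed

lemma surface_open_inf_image:
  assumes "open B"
  shows "surface_open k (inf_point ` (infinity_curve k \<inter> B))"
  unfolding surface_open_def
proof (intro conjI)
  show "inf_point ` (infinity_curve k \<inter> B) \<subseteq> surface k" using inf_point_in_surface by auto
  have "{w \<in> infinity_curve k. inf_point w \<in> inf_point ` (infinity_curve k \<inter> B)} = infinity_curve k \<inter> B"
    using inf_point_inject by blast
  thus "openin (top_of_set (infinity_curve k)) {w \<in> infinity_curve k. inf_point w \<in> inf_point ` (infinity_curve k \<inter> B)}"
    using assms by (auto intro: openin_open_Int)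
  let ?g = "\<lambda>w::complex \<times> complex. (1 / fst w, snd w / (fst w)\<^sup>2)"
  let ?U = "affine_curve k \<inter> {w. fst w \<noteq> 0}"
  have "{z \<in> affine_curve k. aff_point z \<in> inf_point ` (infinity_curve k \<inter> B)} = ?U \<inter> ?g -` B"
  proof (intro set_eqI iffI)
    fix z assume z: "z \<in> {z \<in> affine_curve k. aff_point z \<in> inf_point ` (infinity_curve k \<inter> B)}"
    then obtain w where w: "w \<in> infinity_curve k" "w \<in> B" "aff_point z = inf_point w" by auto
    hence nz: "fst w \<noteq> 0" by (auto simp: inf_point_def aff_point_def Let_def split: if_splits)
    hence "z = (1 / fst w, snd w / (fst w)\<^sup>2)" using w by (simp add: inf_point_eq_aff aff_point_eq_iff)
    thus "z \<in> ?U \<inter> ?g -` B" using w nz z by (auto simp: power_divide)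
  next
    fix z assume z: "z \<in> ?U \<inter> ?g -` B"
    thus "z \<in> {z \<in> affine_curve k. aff_point z \<in> inf_point ` (infinity_curve k \<inter> B)}"
      using affine_to_infinity[of z k] by (auto intro!: image_eqI[of _ inf_point "?g z"])
  qed
  moreover have "openin (top_of_set ?U) (?U \<inter> ?g -` B)"
    by (rule continuous_openin_preimage_gen[OF _ assms]) (auto intro!: continuous_intros)
  moreover have "openin (top_of_set (affine_curve k)) ?U"
    by (intro openin_open_Int open_Collect_neq continuous_intros)
  ultimately show "openin (top_of_set (affine_curve k))
      {z \<in> affine_curve k. aff_point z \<in> inf_point ` (infinity_curve k \<inter> B)}"
    using openin_trans by fastforce
qed

lemma Infty_eq_inf_point: "Infty j = inf_point (0, sheet_sign j)" "(0, sheet_sign j) \<in> infinity_curve k"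
  by (cases j) (auto simp: inf_point_def infinity_curve_def curve_poly_rev_def)

text \<open>
  Continuity can be checked in the two affine charts, since both are open embeddings.
\<close>
lemma continuous_map_from_surface:
  assumes T: "T \<subseteq> surface k"
    and cA: "continuous_on {z \<in> affine_curve k. aff_point z \<in> T} (\<lambda>z. F (aff_point z) :: complex)"
    and cB: "continuous_on {w \<in> infinity_curve k. inf_point w \<in> T} (\<lambda>w. F (inf_point w))"
  shows "continuous_map (subtopology (surface_top k) T) euclidean F"
  unfolding continuous_map_def
proof (intro conjI allI impI)
  fix V :: "complex set" assume "openin euclidean V"
  hence V: "open V" by simp
  obtain A where A: "open A" "A \<inter> {z \<in> affine_curve k. aff_point z \<in> T}
      = (\<lambda>z. F (aff_point z)) -` V \<inter> {z \<in> affine_curve k. aff_point z \<in> T}"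
    using cA V unfolding continuous_on_open_invariant by blast
  obtain B where B: "open B" "B \<inter> {w \<in> infinity_curve k. inf_point w \<in> T}
      = (\<lambda>w. F (inf_point w)) -` V \<inter> {w \<in> infinity_curve k. inf_point w \<in> T}"
    using cB V unfolding continuous_on_open_invariant by blast
  define U where "U = aff_point ` (affine_curve k \<inter> A) \<union> inf_point ` (infinity_curve k \<inter> B)"
  have "openin (surface_top k) U"
    unfolding U_def by (intro openin_Un) (simp_all add: openin_surface_top surface_open_aff_image surface_open_inf_image A B)
  moreover have "{x \<in> topspace (subtopology (surface_top k) T). F x \<in> V} = U \<inter> T"
  proof (intro set_eqI iffI)
    fix x assume "x \<in> {x \<in> topspace (subtopology (surface_top k) T). F x \<in> V}"
    hence x: "x \<in> surface k" "x \<in> T" "F x \<in> V" by auto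
    from x(1) consider z where "z \<in> affine_curve k" "x = aff_point z" | j where "x = Infty j"
      by (auto simp: surface_def)
    thus "x \<in> U \<inter> T"
    proof cases
      case 1
      hence "z \<in> A" using A(2) x by blast
      thus ?thesis using 1 x by (auto simp: U_def)
    next
      case 2
      hence "(0, sheet_sign j) \<in> B" using B(2) x Infty_eq_inf_point(1)[of j] Infty_eq_inf_point(2)[of j k] by auto
      hence "Infty j \<in> inf_point ` (infinity_curve k \<inter> B)"
        using Infty_eq_inf_point(1)[of j] Infty_eq_inf_point(2)[of j k] by blast
      thus ?thesis using 2 x by (auto simp: U_def)
    qed
  next
    fix x assume x: "x \<in> U \<inter> T"
    hence "x \<in> surface k" using T by auto
    moreover have "F x \<in> V" using x A(2) B(2) unfolding U_def by blast
    ultimately show "x \<in> {x \<in> topspace (subtopology (surface_top k) T). F x \<in> V}" using x by auto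
  qed
  ultimately show "openin (subtopology (surface_top k) T) {x \<in> topspace (subtopology (surface_top k) T). F x \<in> V}"
    unfolding openin_subtopology by blast
qed auto

lemma continuous_map_into_surface:
  assumes "continuous_on S c" "c ` S \<subseteq> affine_curve k"
  shows "continuous_map (top_of_set S) (surface_top k) (\<lambda>x. aff_point (c x))"
  unfolding continuous_map_def
proof (intro conjI allI impI)
  show "(\<lambda>x. aff_point (c x)) \<in> topspace (top_of_set S) \<rightarrow> topspace (surface_top k)"
    using assms(2) by (auto simp: surface_def)
  fix U assume "openin (surface_top k) U"
  hence "openin (top_of_set (affine_curve k)) {z \<in> affine_curve k. aff_point z \<in> U}"
    by (simp add: openin_surface_top surface_open_def)
  hence "openin (top_of_set S) (S \<inter> c -` {z \<in> affine_curve k. aff_point z \<in> U})"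
    using assms by (intro continuous_openin_preimage[of S c "affine_curve k"]) auto
  moreover have "S \<inter> c -` {z \<in> affine_curve k. aff_point z \<in> U} = {x \<in> topspace (top_of_set S). aff_point (c x) \<in> U}"
    using assms(2) by auto
  ultimately show "openin (top_of_set S) {x \<in> topspace (top_of_set S). aff_point (c x) \<in> U}" by simp
qed

lemma continuous_map_into_surface_inf:
  assumes "continuous_on S c" "c ` S \<subseteq> infinity_curve k"
  shows "continuous_map (top_of_set S) (surface_top k) (\<lambda>x. inf_point (c x))"
  unfolding continuous_map_def
proof (intro conjI allI impI)
  show "(\<lambda>x. inf_point (c x)) \<in> topspace (top_of_set S) \<rightarrow> topspace (surface_top k)"
    using assms(2) by (auto intro!: inf_point_in_surface)
  fix U assume "openin (surface_top k) U"
  hence "openin (top_of_set (infinity_curve k)) {z \<in> infinity_curve k. inf_point z \<in> U}"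
    by (simp add: openin_surface_top surface_open_def)
  hence "openin (top_of_set S) (S \<inter> c -` {z \<in> infinity_curve k. inf_point z \<in> U})"
    using assms by (intro continuous_openin_preimage[of S c "infinity_curve k"]) auto
  moreover have "S \<inter> c -` {z \<in> infinity_curve k. inf_point z \<in> U} = {x \<in> topspace (top_of_set S). inf_point (c x) \<in> U}"
    using assms(2) by auto
  ultimately show "openin (top_of_set S) {x \<in> topspace (top_of_set S). inf_point (c x) \<in> U}" by simp
qed

section \<open>The symmetry exchanging the two halves\<close>

text \<open>
  The symmetry \<xi> \<mapsto> -\<xi> that keeps \<tau>. It fixes the two points at infinity and
  maps each component of the contour to itself, reversing its orientation.
\<close>
fun reflect :: "curve_point \<Rightarrow> curve_point" where
  "reflect (Aff \<xi> \<tau>) = Aff (- \<xi>) \<tau>"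
| "reflect (Infty j) = Infty j"

lemma curve_poly_minus [simp]: "curve_poly k (- \<xi>) = curve_poly k \<xi>"
  by (simp add: curve_poly_def)

lemma curve_poly_rev_minus [simp]: "curve_poly_rev k (- \<xi>) = curve_poly_rev k \<xi>"
  by (simp add: curve_poly_rev_def)

lemma affine_curve_iff: "z \<in> affine_curve k \<longleftrightarrow> (snd z)\<^sup>2 = curve_poly k (fst z)"
  and infinity_curve_iff: "z \<in> infinity_curve k \<longleftrightarrow> (snd z)\<^sup>2 = curve_poly_rev k (fst z)"
  by (auto simp: affine_curve_def infinity_curve_def)

lemma reflect_aff: "reflect (aff_point z) = aff_point (- fst z, snd z)"
  by (simp add: aff_point_def)

lemma reflect_inf: "reflect (inf_point z) = inf_point (- fst z, snd z)"
  by (simp add: inf_point_def Let_def)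

lemma continuous_map_reflect: "continuous_map (surface_top k) (surface_top k) reflect"
  unfolding continuous_map_def
proof (intro conjI allI impI)
  show m: "reflect \<in> topspace (surface_top k) \<rightarrow> topspace (surface_top k)"
    by (auto simp: surface_def reflect_aff affine_curve_iff)
  fix U assume U: "openin (surface_top k) U"
  let ?g = "\<lambda>w::complex \<times> complex. (- fst w, snd w)"
  show "openin (surface_top k) {x \<in> topspace (surface_top k). reflect x \<in> U}"
    unfolding openin_surface_top surface_open_def
  proof (intro conjI)
    have "{z \<in> affine_curve k. aff_point z \<in> {x \<in> topspace (surface_top k). reflect x \<in> U}}
        = affine_curve k \<inter> ?g -` {z \<in> affine_curve k. aff_point z \<in> U}"
      by (auto simp: reflect_aff surface_def affine_curve_iff)
    moreover have "openin (top_of_set (affine_curve k)) \<dots>"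
      by (rule continuous_openin_preimage[of _ _ "affine_curve k"])
        (use U in \<open>auto intro!: continuous_intros simp: affine_curve_iff openin_surface_top surface_open_def\<close>)
    ultimately show "openin (top_of_set (affine_curve k)) {z \<in> affine_curve k. aff_point z \<in> {x \<in> topspace (surface_top k). reflect x \<in> U}}"
      by simp
    have "{z \<in> infinity_curve k. inf_point z \<in> {x \<in> topspace (surface_top k). reflect x \<in> U}}
        = infinity_curve k \<inter> ?g -` {z \<in> infinity_curve k. inf_point z \<in> U}"
      by (auto simp: reflect_inf inf_point_in_surface infinity_curve_iff)
    moreover have "openin (top_of_set (infinity_curve k)) \<dots>"
      by (rule continuous_openin_preimage[of _ _ "infinity_curve k"])
        (use U in \<open>auto intro!: continuous_intros simp: infinity_curve_iff openin_surface_top surface_open_def\<close>)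
    ultimately show "openin (top_of_set (infinity_curve k)) {z \<in> infinity_curve k. inf_point z \<in> {x \<in> topspace (surface_top k). reflect x \<in> U}}"
      by simp
  qed auto
qed

lemma analytic_at_reflect:
  assumes "analytic_at_point k F (Aff (- \<xi>0) \<tau>0)"
  shows "analytic_at_point k (\<lambda>P. F (reflect P)) (Aff \<xi>0 \<tau>0)"
proof (cases "\<tau>0 = 0")
  case False
  then obtain U s where U: "open U" "- \<xi>0 \<in> U" "s holomorphic_on U" "s (- \<xi>0) = \<tau>0"
    "\<forall>\<xi>\<in>U. (s \<xi>)\<^sup>2 = curve_poly k \<xi>" "(\<lambda>\<xi>. F (Aff \<xi> (s \<xi>))) holomorphic_on U"
    using assms by auto
  have o: "open (uminus ` U)" using U(1) by (simp add: open_negations)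
  have h: "(\<lambda>\<xi>. G (- \<xi>)) holomorphic_on uminus ` U" if "G holomorphic_on U" for G :: "complex \<Rightarrow> complex"
  proof -
    have "uminus holomorphic_on uminus ` U" by (intro holomorphic_intros)
    from holomorphic_on_compose_gen[OF this that] show ?thesis by (simp add: o_def image_image)
  qed
  have "\<exists>U s. open U \<and> \<xi>0 \<in> U \<and> s holomorphic_on U \<and> s \<xi>0 = \<tau>0
      \<and> (\<forall>\<xi>\<in>U. (s \<xi>)\<^sup>2 = curve_poly k \<xi>) \<and> (\<lambda>\<xi>. F (reflect (Aff \<xi> (s \<xi>)))) holomorphic_on U"
  proof (intro exI conjI)
    show "\<xi>0 \<in> uminus ` U" using U(2) by (intro image_eqI[of _ uminus "- \<xi>0"]) auto
    show "\<forall>\<xi>\<in>uminus ` U. (s (- \<xi>))\<^sup>2 = curve_poly k \<xi>" using U(5) by auto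
    show "(\<lambda>\<xi>. F (reflect (Aff \<xi> (s (- \<xi>))))) holomorphic_on uminus ` U"
      using h[OF U(6)] by simp
  qed (use o U(4) h[OF U(3)] in auto)
  thus ?thesis using False by simp
next
  case True
  then obtain U s where U: "open U" "0 \<in> U" "s holomorphic_on U" "s 0 = - \<xi>0"
    "\<forall>\<tau>\<in>U. \<tau>\<^sup>2 = curve_poly k (s \<tau>)" "(\<lambda>\<tau>. F (Aff (s \<tau>) \<tau>)) holomorphic_on U"
    using assms by auto
  have "\<exists>U s. open U \<and> 0 \<in> U \<and> s holomorphic_on U \<and> s 0 = \<xi>0
      \<and> (\<forall>\<tau>\<in>U. \<tau>\<^sup>2 = curve_poly k (s \<tau>)) \<and> (\<lambda>\<tau>. F (reflect (Aff (s \<tau>) \<tau>))) holomorphic_on U"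
  proof (intro exI conjI)
    show "(\<lambda>\<tau>. - s \<tau>) holomorphic_on U" by (intro holomorphic_intros U(3))
  qed (use U in auto)
  thus ?thesis using True by simp
qed

lemma cayley_uminus: "cayley (map_option uminus x) = 1 / cayley x"
proof (cases x)
  case (Some y)
  have nz: "complex_of_real y + \<i> \<noteq> 0" "complex_of_real y - \<i> \<noteq> 0" by (auto simp: complex_eq_iff)
  have "- complex_of_real y + \<i> \<noteq> 0" using nz(2) by (simp add: add_eq_0_iff2)
  thus ?thesis using Some nz by (simp add: divide_simps) (simp add: algebra_simps)
qed simp

lemma norm_cayley [simp]: "norm (cayley x) = 1"
proof (cases x)
  case (Some y)
  have "norm (complex_of_real y - \<i>) = norm (cnj (complex_of_real y - \<i>))" by (simp only: complex_mod_cnj)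
  also have "cnj (complex_of_real y - \<i>) = of_real y + \<i>" by simp
  finally show ?thesis using Some by (simp add: norm_divide complex_eq_iff)
qed simp

lemma holder_line_uminus:
  assumes "g \<in> holder_line \<mu>"
  shows "(\<lambda>x. g (map_option uminus x)) \<in> holder_line \<mu>"
proof -
  obtain M where M: "\<And>x y. norm (g x - g y) \<le> M * norm (cayley x - cayley y) powr \<mu>"
    using assms by (auto simp: holder_line_def)
  have "norm (g (map_option uminus x) - g (map_option uminus y)) \<le> M * norm (cayley x - cayley y) powr \<mu>" for x y
    using M[of "map_option uminus x" "map_option uminus y"]
    by (simp add: cayley_uminus norm_inverse_diff_circle)
  thus ?thesis by (auto simp: holder_line_def)
qed

lemma reflect_contour_point:
  assumes k: "k > 1"
  shows "reflect (contour_point k j x) = contour_point k j (map_option uminus x)"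
proof (cases x)
  case (Some y)
  have "rho k (of_real (- y)) = rho k (of_real y)" unfolding rho_of_real[OF k k] by simp
  thus ?thesis unfolding Some by simp
qed simp

lemma reflect_in_Gamma:
  assumes k: "k > 1" and "P \<in> Gamma_curve k"
  shows "reflect P \<in> Gamma_curve k"
proof -
  obtain j x where "P = contour_point k j x"
    using assms(2) unfolding Gamma_curve_def contour_eq[OF k] by blast
  hence "reflect P \<in> range (contour_point k j)" by (simp add: reflect_contour_point[OF k])
  thus ?thesis unfolding Gamma_curve_def contour_eq[OF k] by (cases j) auto
qed

lemma holder_Gamma_reflect:
  assumes k: "k > 1" and "f \<in> holder_Gamma k \<mu>"
  shows "(\<lambda>P. f (reflect P)) \<in> holder_Gamma k \<mu>"
  unfolding holder_Gamma_def mem_Collect_eq reflect_contour_point[OF k]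
proof
  fix j
  have "(\<lambda>x. f (contour_point k j x)) \<in> holder_line \<mu>" using assms(2) by (simp add: holder_Gamma_def)
  thus "(\<lambda>x. f (contour_point k j (map_option uminus x))) \<in> holder_line \<mu>" by (rule holder_line_uminus)
qed

lemma surface_halves_iff [simp]:
  "Aff \<xi> \<tau> \<in> surface_plus k \<longleftrightarrow> \<tau>\<^sup>2 = curve_poly k \<xi> \<and> Im \<xi> > 0" "Infty j \<notin> surface_plus k"
  "Aff \<xi> \<tau> \<in> surface_minus k \<longleftrightarrow> \<tau>\<^sup>2 = curve_poly k \<xi> \<and> Im \<xi> < 0" "Infty j \<notin> surface_minus k"
  by (auto simp: surface_plus_def surface_minus_def affine_curve_def)

lemma reflect_surface_plus [simp]:
  "reflect P \<in> surface_plus k \<longleftrightarrow> P \<in> surface_minus k" "reflect P \<in> surface_minus k \<longleftrightarrow> P \<in> surface_plus k"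
  by (cases P; simp)+

lemma extendable_reflect:
  assumes k: "k > 1" and f: "f \<in> extendable k \<mu> D"
    and D: "\<And>P. P \<in> D' \<Longrightarrow> reflect P \<in> D" "\<And>P. P \<in> D' \<Longrightarrow> \<exists>\<xi> \<tau>. P = Aff \<xi> \<tau>"
  shows "(\<lambda>P. f (reflect P)) \<in> extendable k \<mu> D'"
proof -
  obtain F where F: "\<forall>P\<in>Gamma_curve k. F P = f P"
    "continuous_map (subtopology (surface_top k) (D \<union> Gamma_curve k)) euclidean F"
    "analytic_on_surface k D F" and fh: "f \<in> holder_Gamma k \<mu>"
    using f unfolding extendable_def by blast
  have "continuous_map (subtopology (surface_top k) (D' \<union> Gamma_curve k)) (subtopology (surface_top k) (D \<union> Gamma_curve k)) reflect"
    unfolding continuous_map_in_subtopology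
    using continuous_map_from_subtopology[OF continuous_map_reflect] D(1) reflect_in_Gamma[OF k] by auto
  from continuous_map_compose[OF this F(2)]
  have "continuous_map (subtopology (surface_top k) (D' \<union> Gamma_curve k)) euclidean (\<lambda>P. F (reflect P))"
    by (simp add: o_def)
  moreover have "analytic_on_surface k D' (\<lambda>P. F (reflect P))"
    unfolding analytic_on_surface_def
  proof
    fix P assume P: "P \<in> D'"
    then obtain \<xi> \<tau> where e: "P = Aff \<xi> \<tau>" using D(2) by blast
    have "analytic_at_point k F (reflect P)" using F(3) D(1)[OF P] unfolding analytic_on_surface_def by blast
    thus "analytic_at_point k (\<lambda>P. F (reflect P)) P" unfolding e by (intro analytic_at_reflect) simp
  qed
  moreover have "\<forall>P\<in>Gamma_curve k. F (reflect P) = f (reflect P)"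
    using F(1) reflect_in_Gamma[OF k] by simp
  ultimately show ?thesis unfolding extendable_def mem_Collect_eq
    by (intro conjI exI[of _ "\<lambda>P. F (reflect P)"] holder_Gamma_reflect[OF k fh])
qed

lemma holder_plus_minus_reflect:
  assumes k: "k > 1"
  shows "f \<in> holder_plus k \<mu> \<Longrightarrow> (\<lambda>P. f (reflect P)) \<in> holder_minus k \<mu>"
    and "f \<in> holder_minus k \<mu> \<Longrightarrow> (\<lambda>P. f (reflect P)) \<in> holder_plus k \<mu>"
proof -
  have A: "P \<in> surface_plus k \<or> P \<in> surface_minus k \<Longrightarrow> \<exists>\<xi> \<tau>. P = Aff \<xi> \<tau>" for P
    by (auto simp: surface_plus_def surface_minus_def)
  show "f \<in> holder_plus k \<mu> \<Longrightarrow> (\<lambda>P. f (reflect P)) \<in> holder_minus k \<mu>"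
    unfolding holder_plus_def holder_minus_def by (erule extendable_reflect[OF k]) (simp_all add: A)
  show "f \<in> holder_minus k \<mu> \<Longrightarrow> (\<lambda>P. f (reflect P)) \<in> holder_plus k \<mu>"
    unfolding holder_plus_def holder_minus_def by (erule extendable_reflect[OF k]) (simp_all add: A)
qed

lemma invertibles_reflect:
  assumes k: "k > 1"
  shows "f \<in> invertibles k (holder_plus k \<mu>) \<Longrightarrow> (\<lambda>P. f (reflect P)) \<in> invertibles k (holder_minus k \<mu>)"
    and "f \<in> invertibles k (holder_minus k \<mu>) \<Longrightarrow> (\<lambda>P. f (reflect P)) \<in> invertibles k (holder_plus k \<mu>)"
proof -
  show "(\<lambda>P. f (reflect P)) \<in> invertibles k (holder_minus k \<mu>)" if f: "f \<in> invertibles k (holder_plus k \<mu>)"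
  proof -
    obtain g where "g \<in> holder_plus k \<mu>" "\<forall>P\<in>Gamma_curve k. f P * g P = 1"
      using f by (auto simp: invertibles_def)
    hence g: "(\<lambda>P. g (reflect P)) \<in> holder_minus k \<mu>" "\<forall>P\<in>Gamma_curve k. f (reflect P) * g (reflect P) = 1"
      using holder_plus_minus_reflect(1)[OF k] reflect_in_Gamma[OF k] by simp_all
    have "(\<lambda>P. f (reflect P)) \<in> holder_minus k \<mu>"
      using f by (intro holder_plus_minus_reflect(1)[OF k]) (simp add: invertibles_def)
    thus ?thesis unfolding invertibles_def using g(2) by (intro CollectI conjI bexI[OF _ g(1)])
  qed
  show "(\<lambda>P. f (reflect P)) \<in> invertibles k (holder_plus k \<mu>)" if f: "f \<in> invertibles k (holder_minus k \<mu>)"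
  proof -
    obtain g where "g \<in> holder_minus k \<mu>" "\<forall>P\<in>Gamma_curve k. f P * g P = 1"
      using f by (auto simp: invertibles_def)
    hence g: "(\<lambda>P. g (reflect P)) \<in> holder_plus k \<mu>" "\<forall>P\<in>Gamma_curve k. f (reflect P) * g (reflect P) = 1"
      using holder_plus_minus_reflect(2)[OF k] reflect_in_Gamma[OF k] by simp_all
    have "(\<lambda>P. f (reflect P)) \<in> holder_plus k \<mu>"
      using f by (intro holder_plus_minus_reflect(2)[OF k]) (simp add: invertibles_def)
    thus ?thesis unfolding invertibles_def using g(2) by (intro CollectI conjI bexI[OF _ g(1)])
  qed
qed

section \<open>The circle coordinate on the contour\<close>

text \<open>
  The inverse Cayley transform on the circle. The real part is taken because the values are real
  only on the circle.
\<close>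
definition line_pt :: "complex \<Rightarrow> real option" where
  "line_pt \<zeta> = (if \<zeta> = 1 then None else Some (Re (\<i> * (1 + \<zeta>) / (1 - \<zeta>))))"

lemma line_pt_cayley [simp]: "line_pt (cayley x) = x"
proof (cases x)
  case (Some y)
  have nz: "complex_of_real y + \<i> \<noteq> 0" by (auto simp: complex_eq_iff)
  have "(of_real y - \<i>) / (of_real y + \<i>) \<noteq> 1"
  proof
    assume "(of_real y - \<i>) / (of_real y + \<i>) = 1"
    hence "of_real y - \<i> = of_real y + \<i>" using nz by (simp only: divide_eq_1_iff)
    thus False by (simp add: complex_eq_iff)
  qed
  moreover have "\<i> * (1 + (of_real y - \<i>) / (of_real y + \<i>)) / (1 - (of_real y - \<i>) / (of_real y + \<i>)) = of_real y"
    using nz by (simp add: divide_simps)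
  ultimately show ?thesis using Some by (simp add: line_pt_def)
qed (simp add: line_pt_def)

lemma line_pt_circ: "t \<in> {0..1} \<Longrightarrow> line_pt (circ t) = line_loop t"
  using cayley_line_loop[of t] line_pt_cayley[of "line_loop t"] by simp

lemma cayley_line_pt:
  assumes "norm \<zeta> = 1"
  shows "cayley (line_pt \<zeta>) = \<zeta>"
proof -
  obtain t where t: "0 \<le> t" "t \<le> 1" "\<zeta> = circ t" by (rule ex_circ[OF assms])
  thus ?thesis using line_pt_circ[of t] cayley_line_loop[of t] by simp
qed

lemma cayley_surj: obtains t where "t \<in> {0..1}" "cayley x = circ t" "x = line_loop t"
proof -
  obtain t where t: "0 \<le> t" "t \<le> 1" "cayley x = circ t" by (rule ex_circ[OF norm_cayley])
  moreover from this have "x = line_loop t" using line_pt_cayley[of x] line_pt_circ[of t] by simp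
  ultimately show ?thesis using that[of t] by simp
qed

definition side :: "real \<Rightarrow> sheet \<Rightarrow> (curve_point \<Rightarrow> complex) \<Rightarrow> complex \<Rightarrow> complex" where
  "side k j f \<zeta> = f (contour_point k j (line_pt \<zeta>))"

lemma side_cayley: "side k j f (cayley x) = f (contour_point k j x)"
  by (simp add: side_def)

lemma holder_Gamma_iff_side:
  "f \<in> holder_Gamma k \<mu> \<longleftrightarrow> (\<forall>j. hoelder_on \<mu> (sphere 0 1) (side k j f))"
proof -
  have "(\<lambda>x. f (contour_point k j x)) \<in> holder_line \<mu> \<longleftrightarrow> hoelder_on \<mu> (sphere 0 1) (side k j f)" for j
  proof
    assume "(\<lambda>x. f (contour_point k j x)) \<in> holder_line \<mu>"
    then obtain M where M: "\<And>x y. norm (f (contour_point k j x) - f (contour_point k j y)) \<le> M * norm (cayley x - cayley y) powr \<mu>"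
      by (auto simp: holder_line_def)
    show "hoelder_on \<mu> (sphere 0 1) (side k j f)"
    proof (rule hoelder_onI[where M = M])
      fix x y :: complex assume "x \<in> sphere 0 1" "y \<in> sphere 0 1"
      thus "norm (side k j f x - side k j f y) \<le> M * norm (x - y) powr \<mu>"
        using M[of "line_pt x" "line_pt y"] by (simp add: side_def cayley_line_pt)
    qed
  next
    assume "hoelder_on \<mu> (sphere 0 1) (side k j f)"
    then obtain M where M: "\<And>x y. x \<in> sphere 0 1 \<Longrightarrow> y \<in> sphere 0 1 \<Longrightarrow> norm (side k j f x - side k j f y) \<le> M * norm (x - y) powr \<mu>"
      by (rule hoelder_onE) blast
    have "norm (f (contour_point k j x) - f (contour_point k j y)) \<le> M * norm (cayley x - cayley y) powr \<mu>" for x y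
      using M[of "cayley x" "cayley y"] by (simp add: side_cayley)
    thus "(\<lambda>x. f (contour_point k j x)) \<in> holder_line \<mu>" by (auto simp: holder_line_def)
  qed
  thus ?thesis by (simp add: holder_Gamma_def)
qed

lemma in_Gamma_iff:
  assumes k: "k > 1"
  shows "(\<forall>P\<in>Gamma_curve k. Q P) \<longleftrightarrow> (\<forall>j. \<forall>\<zeta>\<in>sphere 0 1. Q (contour_point k j (line_pt \<zeta>)))"
proof
  assume "\<forall>P\<in>Gamma_curve k. Q P"
  moreover have "contour_point k j x \<in> Gamma_curve k" for j x
    unfolding Gamma_curve_def contour_eq[OF k] by (cases j) auto
  ultimately show "\<forall>j. \<forall>\<zeta>\<in>sphere 0 1. Q (contour_point k j (line_pt \<zeta>))" by blast
next
  assume A: "\<forall>j. \<forall>\<zeta>\<in>sphere 0 1. Q (contour_point k j (line_pt \<zeta>))"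
  show "\<forall>P\<in>Gamma_curve k. Q P"
  proof
    fix P assume "P \<in> Gamma_curve k"
    then obtain j x where "P = contour_point k j x" unfolding Gamma_curve_def contour_eq[OF k] by blast
    thus "Q P" using A[rule_format, of "cayley x" j] by simp
  qed
qed

text \<open>The position of the branch point \<xi> = ik in the coordinate \<zeta>.\<close>
definition modq :: "real \<Rightarrow> real" where
  "modq k = (k - 1) / (k + 1)"

lemma modq: "k > 1 \<Longrightarrow> 0 < modq k" "k > 1 \<Longrightarrow> modq k < 1" "k > 1 \<Longrightarrow> 1 - modq k = 2 / (1 + k)"
  by (auto simp: modq_def field_simps)

fun curve_zeta :: "curve_point \<Rightarrow> complex" where
  "curve_zeta (Aff \<xi> \<tau>) = (\<xi> - \<i>) / (\<xi> + \<i>)"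
| "curve_zeta (Infty j) = 1"

text \<open>
  The function \<surd>(\<zeta>(\<zeta> - q)) of the upper half of the surface, expressed by
  \<tau>: it changes sign under the exchange of sheets and generates the odd functions over those
  of \<zeta>.
\<close>
fun curve_odd :: "real \<Rightarrow> curve_point \<Rightarrow> complex" where
  "curve_odd k (Aff \<xi> \<tau>) = 2 * \<tau> / (of_real (1 + k) * (\<xi> + \<i>)\<^sup>2 * root_in (modq k) ((\<xi> - \<i>) / (\<xi> + \<i>)))"
| "curve_odd k (Infty j) = 2 * sheet_sign j / (of_real (1 + k) * root_in (modq k) 1)"

lemma curve_zeta_contour: "curve_zeta (contour_point k j x) = cayley x"
  by (cases x) auto

lemma root_out_one:
  assumes k: "k > 1"
  shows "root_out (modq k) 1 = of_real (sqrt (1 - modq k))" "root_in (modq k) 1 = of_real (sqrt (1 - modq k))"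
  using modq(1,2)[OF k] csqrt_of_real_nonneg[of "1 - modq k"] by (simp_all add: root_out_def root_in_def)

lemma one_minus_modq_cayley:
  assumes k: "k > 1"
  shows "1 - of_real (modq k) * cayley (Some y) = 2 * (of_real y + \<i> * of_real k) / (of_real (1 + k) * (of_real y + \<i>))"
    "1 - of_real (modq k) / cayley (Some y) = 2 * (of_real y - \<i> * of_real k) / (of_real (1 + k) * (of_real y - \<i>))"
proof -
  have nz: "complex_of_real y + \<i> \<noteq> 0" "complex_of_real y - \<i> \<noteq> 0" by (auto simp: complex_eq_iff)
  have k1: "complex_of_real (1 + k) \<noteq> 0" using k by (metis add_pos_pos less_irrefl of_real_eq_0_iff zero_less_one order_less_trans)
  have q: "complex_of_real (modq k) = (of_real k - 1) / of_real (1 + k)" by (simp add: modq_def add.commute)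
  have A: "1 - (a - 1) / b * (x / y) = (b * y - (a - 1) * x) / (b * y)" if "b \<noteq> 0" "y \<noteq> 0" for a b x y :: complex
    using that by (simp add: field_simps)
  show "1 - of_real (modq k) * cayley (Some y) = 2 * (of_real y + \<i> * of_real k) / (of_real (1 + k) * (of_real y + \<i>))"
    unfolding q cayley.simps A[OF k1 nz(1)] by (simp add: algebra_simps)
  have "1 - of_real (modq k) / cayley (Some y) = 1 - (of_real k - 1) / of_real (1 + k) * ((of_real y + \<i>) / (of_real y - \<i>))"
    unfolding q cayley.simps using nz by simp
  also have "\<dots> = 2 * (of_real y - \<i> * of_real k) / (of_real (1 + k) * (of_real y - \<i>))"
    unfolding A[OF k1 nz(2)] by (simp add: algebra_simps)
  finally show "1 - of_real (modq k) / cayley (Some y) = 2 * (of_real y - \<i> * of_real k) / (of_real (1 + k) * (of_real y - \<i>))" .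
qed

lemma norm_real_plus_i: "norm (complex_of_real y + \<i> * of_real k) = sqrt (k\<^sup>2 + y\<^sup>2)" "norm (complex_of_real y + \<i>) = sqrt (1 + y\<^sup>2)"
  by (simp_all add: cmod_def add.commute)

text \<open>
  On the circle the product of the inner and the outer root is |1 - q\<zeta>|, which equals \<rho>
  up to elementary factors.
\<close>
lemma curve_odd_contour:
  assumes k: "k > 1"
  shows "curve_odd k (contour_point k j x) = sheet_sign j * (cayley x * root_out (modq k) (cayley x))"
proof (cases x)
  case None
  have "2 / (1 + k) / sqrt (1 - modq k) = sqrt (1 - modq k)"
    unfolding modq(3)[OF k, symmetric] using modq(2)[OF k] by (simp add: real_div_sqrt)
  hence "complex_of_real (2 / (1 + k) / sqrt (1 - modq k)) = of_real (sqrt (1 - modq k))" by (rule arg_cong)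
  from arg_cong[OF this, of "\<lambda>x. sheet_sign j * x"]
  show ?thesis using None by (simp add: root_out_one[OF k] mult.commute)
next
  case (Some y)
  define \<zeta> where "\<zeta> = cayley (Some y)"
  define e where "e = complex_of_real y + \<i>"
  have nz: "e \<noteq> 0" by (auto simp: e_def complex_eq_iff)
  obtain t where t: "\<zeta> = circ t" unfolding \<zeta>_def by (rule cayley_surj)
  have n: "root_in (modq k) \<zeta> * root_out (modq k) \<zeta> = of_real (norm (1 - of_real (modq k) * \<zeta>))"
    unfolding t by (rule root_in_out_circle[OF modq(1,2)[OF k]])
  have r0: "root_in (modq k) \<zeta> \<noteq> 0"
    using root_in_pos[of "modq k" \<zeta>] modq[OF k] by (auto simp: t norm_mult)
  have "norm (1 - of_real (modq k) * \<zeta>) = 2 * sqrt (k\<^sup>2 + y\<^sup>2) / ((1 + k) * sqrt (1 + y\<^sup>2))"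
    unfolding \<zeta>_def one_minus_modq_cayley[OF k] using k
    by (simp only: norm_mult norm_divide norm_real_plus_i norm_of_real) simp
  moreover have "rho k (of_real y) = of_real (sqrt (1 + y\<^sup>2) * sqrt (k\<^sup>2 + y\<^sup>2))"
    unfolding rho_of_real[OF k k] by (simp add: real_sqrt_mult)
  moreover have "\<zeta> = (of_real (sqrt (1 + y\<^sup>2)))\<^sup>2 / e\<^sup>2"
  proof -
    have "(sqrt (1 + y\<^sup>2))\<^sup>2 = 1 + y\<^sup>2" by (simp add: add_nonneg_nonneg)
    hence "(complex_of_real (sqrt (1 + y\<^sup>2)))\<^sup>2 = 1 + (of_real y)\<^sup>2"
      by (metis of_real_1 of_real_add of_real_power)
    also have "\<dots> = (of_real y - \<i>) * e" by (simp add: e_def algebra_simps power2_eq_square)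
    finally show ?thesis using nz by (simp add: \<zeta>_def e_def power2_eq_square)
  qed
  ultimately have "\<zeta> * (root_in (modq k) \<zeta> * root_out (modq k) \<zeta>) = 2 * rho k (of_real y) / (of_real (1 + k) * e\<^sup>2)"
    unfolding n by (simp add: power2_eq_square add_pos_nonneg less_imp_neq[THEN not_sym] mult_ac)
  moreover have "contour_point k j x = Aff (of_real y) (sheet_sign j * rho k (of_real y))" using Some by simp
  moreover have "cayley x = \<zeta>" using Some by (simp add: \<zeta>_def)
  moreover have "(of_real y - \<i>) / (of_real y + \<i>) = \<zeta>" by (simp add: \<zeta>_def)
  moreover have "2 * (s * \<rho>) / (N * I) = s * (\<zeta> * O')" if "\<zeta> * (I * O') = 2 * \<rho> / N" "I \<noteq> 0" for s \<rho> N I O'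
  proof -
    have "2 * (s * \<rho>) / (N * I) = s * (2 * \<rho> / N) / I" by simp
    thus ?thesis unfolding that(1)[symmetric] using that(2) by simp
  qed
  ultimately show ?thesis using r0 by (simp only: curve_odd.simps e_def[symmetric])
qed

lemma same_square_Re_pos:
  assumes "a\<^sup>2 = b\<^sup>2" "Re a > 0" "Re b > 0"
  shows "a = b"
  using assms by (auto simp: power2_eq_iff)

lemma Re_inverse_pos: "Re w > 0 \<Longrightarrow> Re (1 / w) > 0"
  unfolding inverse_eq_divide[symmetric] by (simp add: add_pos_nonneg)

text \<open>
  Two square roots of the same number with positive real parts agree; this identifies the explicit
  branches of the roots in the multipliers.
\<close>
lemma alpha_branch:
  assumes k: "k > 1" and a: "a \<noteq> 0" "b \<noteq> 0" and Re: "Re (a / b) > 0"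
    and X: "b / a = of_real ((1 + k) / 2) * X\<^sup>2" and Xp: "Re X > 0"
  shows "b / a * csqrt (a / b) = alpha_const k * X"
proof (rule same_square_Re_pos)
  have C: "alpha_const k = of_real (sqrt ((1 + k) / 2))" by (simp add: alpha_const_def)
  have C2: "(alpha_const k)\<^sup>2 = of_real ((1 + k) / 2)"
    unfolding C of_real_power[symmetric] using k by simp
  have "(alpha_const k * X)\<^sup>2 = b / a" by (simp only: power_mult_distrib X C2)
  moreover have "(b / a * csqrt (a / b))\<^sup>2 = (b / a)\<^sup>2 * (a / b)" by (simp only: power_mult_distrib power2_csqrt)
  moreover have "(b / a)\<^sup>2 * (a / b) = b / a" using a by (simp add: power2_eq_square)
  ultimately show "(b / a * csqrt (a / b))\<^sup>2 = (alpha_const k * X)\<^sup>2" by simp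
  show "Re (alpha_const k * X) > 0" unfolding C using k Xp by simp
  have c0: "csqrt (a / b) \<noteq> 0" using a by simp
  have "b / a = 1 / (csqrt (a / b) * csqrt (a / b))"
    using a power2_csqrt[of "a / b"] by (simp add: power2_eq_square[symmetric])
  hence "b / a * csqrt (a / b) = 1 / csqrt (a / b)" using c0 by simp
  moreover have "Re (1 / csqrt (a / b)) > 0"
    by (rule Re_inverse_pos[OF Re_csqrt_pos[OF Re]])
  ultimately show "Re (b / a * csqrt (a / b)) > 0" by simp
qed

lemma alpha_contour:
  assumes k: "k > 1"
  shows "alpha_plus k (contour_point k j x) = alpha_const k * (1 + sheet_sign j * root_out (modq k) (cayley x))"
    and "alpha_minus k (contour_point k j x) = alpha_const k * (1 + sheet_sign j * root_in (modq k) (cayley x))"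
proof -
  have "sqrt ((1 + k) / 2) * sqrt (1 - modq k) = 1"
    using k unfolding modq(3)[OF k] real_sqrt_mult[symmetric] by simp
  hence N: "alpha_const k * of_real (sqrt (1 - modq k)) = 1"
    unfolding alpha_const_def of_real_mult[symmetric] by simp
  have S: "alpha_plus k (contour_point k j x) = alpha_const k * (1 + sheet_sign j * root_out (modq k) (cayley x))
    \<and> alpha_minus k (contour_point k j x) = alpha_const k * (1 + sheet_sign j * root_in (modq k) (cayley x))"
    if x: "x = Some y" for y
  proof -
    let ?y = "complex_of_real y" and ?k = "\<i> * complex_of_real k"
    have nr: "rho k ?y = rho_plus_expl k ?y * rho_minus_expl k ?y"
      using is_rho_of_real[OF k is_rho_expl[OF k]] rho_of_real[OF k k] by simp
    have pl: "rho_plus k ?y = rho_plus_expl k ?y"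
      using rho_plus_unique[OF k is_rho_plus_rho_plus[OF k]] lower_slit_Im[OF k, of ?y] by auto
    have mi: "rho_minus k ?y = rho_minus_expl k ?y"
      using rho_minus_unique[OF k is_rho_minus_rho_minus[OF k]] upper_slit_Im[OF k, of ?y] by auto
    have "rho k ?y \<noteq> 0"
      using is_rho_rho[OF k] unfolding is_rho_def by (metis less_irrefl of_real_eq_0_iff)
    hence nz: "rho_plus_expl k ?y \<noteq> 0" "rho_minus_expl k ?y \<noteq> 0" using nr by auto
    have e0: "?y - \<i> \<noteq> 0" "?y + \<i> \<noteq> 0" "?y - ?k \<noteq> 0" "?y + ?k \<noteq> 0" using k by (auto simp: complex_eq_iff)
    obtain t where t: "cayley x = circ t" by (rule cayley_surj)
    have q: "0 < modq k" "modq k < 1" using modq[OF k] by auto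
    have p: "Re (root_out (modq k) (cayley x)) > 0" "Re (root_in (modq k) (cayley x)) > 0"
      unfolding t using q by (auto intro!: root_in_pos root_out_pos simp: norm_mult norm_divide)
    have "y\<^sup>2 + k\<^sup>2 > 0" using k by (simp add: add_nonneg_pos)
    hence R: "Re ((?y - \<i>) / (?y - ?k)) > 0" "Re ((?y + \<i>) / (?y + ?k)) > 0"
      using k by (simp_all add: Re_divide add_nonneg_pos)
    have k1: "complex_of_real (1 + k) \<noteq> 0" using k by (metis add_pos_pos less_irrefl of_real_eq_0_iff zero_less_one order_less_trans)
    have X: "(?y - ?k) / (?y - \<i>) = of_real ((1 + k) / 2) * (root_out (modq k) (cayley x))\<^sup>2"
      "(?y + ?k) / (?y + \<i>) = of_real ((1 + k) / 2) * (root_in (modq k) (cayley x))\<^sup>2"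
    proof -
      have G: "c \<noteq> 0 \<Longrightarrow> a / b = c / 2 * (2 * a / (c * b))" for a b c :: complex by simp
      have h: "complex_of_real ((1 + k) / 2) = of_real (1 + k) / 2" by (simp only: of_real_divide of_real_numeral)
      show "(?y - ?k) / (?y - \<i>) = of_real ((1 + k) / 2) * (root_out (modq k) (cayley x))\<^sup>2"
        "(?y + ?k) / (?y + \<i>) = of_real ((1 + k) / 2) * (root_in (modq k) (cayley x))\<^sup>2"
        unfolding root_out_square root_in_square x one_minus_modq_cayley[OF k] h by (rule G[OF k1])+
    qed
    have "alpha_plus k (contour_point k j x) = alpha_const k + sheet_sign j * (rho_minus_expl k ?y / (?y - \<i>))"
      using x nz by (simp add: nr pl)
    also have "rho_minus_expl k ?y / (?y - \<i>) = (?y - ?k) / (?y - \<i>) * csqrt ((?y - \<i>) / (?y - ?k))"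
      by (simp add: rho_minus_expl_def)
    also have "\<dots> = alpha_const k * root_out (modq k) (cayley x)"
      by (rule alpha_branch[OF k e0(1,3) R(1) X(1) p(1)])
    finally have 1: "alpha_plus k (contour_point k j x) = alpha_const k * (1 + sheet_sign j * root_out (modq k) (cayley x))"
      by (simp add: algebra_simps)
    have "alpha_minus k (contour_point k j x) = alpha_const k + sheet_sign j * (rho_plus_expl k ?y / (?y + \<i>))"
      using x nz by (simp add: nr mi)
    also have "rho_plus_expl k ?y / (?y + \<i>) = (?y + ?k) / (?y + \<i>) * csqrt ((?y + \<i>) / (?y + ?k))"
      by (simp add: rho_plus_expl_def)
    also have "\<dots> = alpha_const k * root_in (modq k) (cayley x)"
      by (rule alpha_branch[OF k e0(2,4) R(2) X(2) p(2)])
    finally have 2: "alpha_minus k (contour_point k j x) = alpha_const k * (1 + sheet_sign j * root_in (modq k) (cayley x))"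
      by (simp add: algebra_simps)
    show ?thesis using 1 2 by blast
  qed
  have "alpha_plus k (contour_point k j None) = alpha_const k * (1 + sheet_sign j * root_out (modq k) (cayley None))
    \<and> alpha_minus k (contour_point k j None) = alpha_const k * (1 + sheet_sign j * root_in (modq k) (cayley None))"
    using N by (simp add: root_out_one[OF k] algebra_simps)
  thus "alpha_plus k (contour_point k j x) = alpha_const k * (1 + sheet_sign j * root_out (modq k) (cayley x))"
    "alpha_minus k (contour_point k j x) = alpha_const k * (1 + sheet_sign j * root_in (modq k) (cayley x))"
    using S by (cases x; blast)+
qed

section \<open>Functions on the closed upper half built from functions on the disc\<close>

definition closed_half :: "real \<Rightarrow> curve_point set" where
  "closed_half k = surface_plus k \<union> Gamma_curve k"

lemma closed_half_iff:
  assumes k: "k > 1"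
  shows "Aff \<xi> \<tau> \<in> closed_half k \<longleftrightarrow> \<tau>\<^sup>2 = curve_poly k \<xi> \<and> Im \<xi> \<ge> 0" "Infty j \<in> closed_half k"
  unfolding closed_half_def Gamma_curve_eq[OF k]
  by (auto simp: affine_curve_def complex_is_Real_iff)

lemma closed_half_subset:
  assumes k: "k > 1"
  shows "closed_half k \<subseteq> surface k"
proof
  fix P assume P: "P \<in> closed_half k"
  show "P \<in> surface k"
  proof (cases P)
    case (Aff \<xi> \<tau>)
    hence "P = aff_point (\<xi>, \<tau>)" "(\<xi>, \<tau>) \<in> affine_curve k"
      using P by (auto simp: closed_half_iff[OF k] aff_point_def affine_curve_iff)
    thus ?thesis by (auto simp: surface_def)
  qed (simp add: surface_def)
qed

lemma continuous_map_times:
  fixes F G :: "'a \<Rightarrow> complex"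
  assumes "continuous_map X euclidean F" "continuous_map X euclidean G"
  shows "continuous_map X euclidean (\<lambda>P. F P * G P)"
proof -
  have "continuous_map X (prod_topology euclidean euclidean) (\<lambda>P. (F P, G P))"
    using assms by (subst continuous_map_pairwise) (simp add: o_def)
  moreover have "continuous_map (prod_topology euclidean euclidean) euclidean (\<lambda>x::complex \<times> complex. fst x * snd x)"
    by (simp add: euclidean_product_topology) (intro continuous_intros)
  ultimately have "continuous_map X euclidean ((\<lambda>x. fst x * snd x) \<circ> (\<lambda>P. (F P, G P)))"
    by (rule continuous_map_compose)
  thus ?thesis by (simp only: o_def fst_conv snd_conv)
qed

text \<open>
  The last condition asks for holomorphy along every pair of holomorphic functions \<xi>, \<tau>
  with \<xi> in the upper half-plane. Unlike analyticity in the charts of the surface it is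
  visibly stable under products and exponentials.
\<close>
definition disc_class :: "real \<Rightarrow> real \<Rightarrow> (curve_point \<Rightarrow> complex) set" where
  "disc_class k \<mu> = {F \<in> holder_Gamma k \<mu>.
     continuous_map (subtopology (surface_top k) (closed_half k)) euclidean F \<and>
     (\<forall>U X Y. open U \<longrightarrow> X holomorphic_on U \<longrightarrow> Y holomorphic_on U \<longrightarrow> (\<forall>t\<in>U. Im (X t) > 0) \<longrightarrow>
        (\<lambda>t. F (Aff (X t) (Y t))) holomorphic_on U)}"

lemma disc_class_mult:
  assumes "F \<in> disc_class k \<mu>" "G \<in> disc_class k \<mu>" "0 < \<mu>"
  shows "(\<lambda>P. F P * G P) \<in> disc_class k \<mu>"
  using assms unfolding disc_class_def
  by (auto simp: holder_Gamma_iff_side side_def[abs_def] intro!: hoelder_on_mult continuous_map_times holomorphic_on_mult)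

lemma disc_class_const: "(\<lambda>P. c) \<in> disc_class k \<mu>"
  unfolding disc_class_def by (auto simp: holder_Gamma_iff_side side_def[abs_def] intro: hoelder_on_const)

lemma disc_class_power:
  assumes "F \<in> disc_class k \<mu>" "0 < \<mu>"
  shows "(\<lambda>P. F P ^ n) \<in> disc_class k \<mu>"
  by (induction n) (use assms in \<open>auto intro: disc_class_const disc_class_mult\<close>)

lemma disc_class_exp:
  assumes "F \<in> disc_class k \<mu>" "0 < \<mu>"
  shows "(\<lambda>P. exp (F P)) \<in> disc_class k \<mu>"
proof -
  have "continuous_map (subtopology (surface_top k) (closed_half k)) euclidean (\<lambda>P. exp (F P))"
    if "continuous_map (subtopology (surface_top k) (closed_half k)) euclidean F"
    using continuous_map_compose[OF that, of euclidean exp] continuous_on_exp[OF continuous_on_id, of UNIV]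
    by (simp add: o_def)
  thus ?thesis
    using assms unfolding disc_class_def
    by (auto simp: holder_Gamma_iff_side side_def[abs_def] intro!: hoelder_on_exp holomorphic_on_exp[THEN holomorphic_on_compose_gen[unfolded o_def]] holomorphic_intros)
qed

lemma csqrt_analytic_at:
  assumes "f analytic_on {a}" "f a \<notin> \<real>\<^sub>\<le>\<^sub>0"
  shows "(\<lambda>z. csqrt (f z)) analytic_on {a}"
proof -
  have "csqrt analytic_on - \<real>\<^sub>\<le>\<^sub>0"
    by (subst analytic_on_open) (auto intro: holomorphic_on_csqrt)
  hence "csqrt analytic_on f ` {a}" using assms(2) by (rule_tac analytic_on_subset) auto
  from analytic_on_compose[OF assms(1) this] show ?thesis by (simp add: o_def)
qed

text \<open>
  Away from the branch points the root \<tau> is a local holomorphic function of \<xi>; at a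
  branch point \<xi> is a local holomorphic function of \<tau>, obtained by solving the
  biquadratic equation.
\<close>
lemma analytic_at_plus_point:
  assumes k: "k > 1" and P: "Aff \<xi>0 \<tau>0 \<in> surface_plus k"
    and F: "\<And>U X Y. open U \<Longrightarrow> X holomorphic_on U \<Longrightarrow> Y holomorphic_on U \<Longrightarrow> (\<And>t. t \<in> U \<Longrightarrow> Im (X t) > 0) \<Longrightarrow>
        (\<lambda>t. F (Aff (X t) (Y t))) holomorphic_on U"
  shows "analytic_at_point k F (Aff \<xi>0 \<tau>0)"
proof -
  have P: "\<tau>0\<^sup>2 = curve_poly k \<xi>0" "Im \<xi>0 > 0" using P by simp_all
  show ?thesis
  proof (cases "\<tau>0 = 0")
    case False
    hence c0: "curve_poly k \<xi>0 \<noteq> 0" using P(1) by auto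
    define U where "U = {\<xi>. Im \<xi> > 0 \<and> Re (curve_poly k \<xi> / curve_poly k \<xi>0) > 0}"
    define s where "s \<xi> = \<tau>0 * csqrt (curve_poly k \<xi> / curve_poly k \<xi>0)" for \<xi>
    have "open U" unfolding U_def using c0
      by (intro open_Collect_conj open_Collect_less continuous_intros) (auto simp: curve_poly_def intro!: continuous_intros)
    moreover have "\<xi>0 \<in> U" using P c0 by (simp add: U_def)
    moreover have sh: "s holomorphic_on U" unfolding s_def curve_poly_def
      by (intro holomorphic_intros) (use c0 in \<open>auto simp: U_def curve_poly_def intro!: Re_pos_not_nonpos\<close>)
    moreover have "s \<xi>0 = \<tau>0" using c0 by (simp add: s_def)
    moreover have "\<forall>\<xi>\<in>U. (s \<xi>)\<^sup>2 = curve_poly k \<xi>" using c0 P(1) by (simp add: s_def power_mult_distrib)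
    moreover have "(\<lambda>\<xi>. F (Aff \<xi> (s \<xi>))) holomorphic_on U"
      by (rule F[OF \<open>open U\<close> _ sh]) (auto intro: holomorphic_intros simp: U_def)
    ultimately show ?thesis using False by auto
  next
    case True
    hence z: "(1 + \<xi>0\<^sup>2) * ((of_real k)\<^sup>2 + \<xi>0\<^sup>2) = 0" using P(1) by (simp add: curve_poly_def)
    define \<epsilon> :: complex where "\<epsilon> = (if \<xi>0 = \<i> then 1 else -1)"
    have xi: "\<xi>0 = \<i> \<or> \<xi>0 = \<i> * of_real k"
    proof -
      have "(\<xi>0 - \<i>) * (\<xi>0 + \<i>) * ((\<xi>0 - \<i> * of_real k) * (\<xi>0 + \<i> * of_real k)) = 0"
        using z by (simp add: algebra_simps power2_eq_square)
      moreover have "\<xi>0 + \<i> \<noteq> 0" "\<xi>0 + \<i> * of_real k \<noteq> 0" using P(2) k by (auto simp: complex_eq_iff)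
      ultimately show ?thesis by simp
    qed
    have e2: "\<epsilon>\<^sup>2 = 1" by (simp add: \<epsilon>_def)
    define D where "D t = (of_real (k\<^sup>2 - 1))\<^sup>2 + 4 * t\<^sup>2" for t :: complex
    \<comment> \<open>V is the solution of (1 - V)(k^2 - V) = t^2 with the value 1 or k^2 at t = 0 according
      to the sign \<epsilon>, and \<xi> = i\<surd>V.\<close>
    define V where "V t = (of_real (1 + k\<^sup>2) - \<epsilon> * csqrt (D t)) / 2" for t
    define s where "s t = \<i> * csqrt (V t)" for t
    have k2: "k\<^sup>2 - 1 > 0" using k by (simp add: one_less_power)
    have D0: "csqrt (D 0) = of_real (k\<^sup>2 - 1)" using k2 by (simp add: D_def csqrt_square del: of_real_diff)
    have V0: "V 0 = (if \<xi>0 = \<i> then 1 else of_real (k\<^sup>2))" by (simp add: V_def D0 \<epsilon>_def)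
    have s0: "s 0 = \<xi>0"
      using xi k csqrt_of_real_nonneg[of "k\<^sup>2"] by (auto simp: s_def V0)
    have "D 0 = of_real ((k\<^sup>2 - 1)\<^sup>2)" by (simp add: D_def)
    hence Dn: "D 0 \<notin> \<real>\<^sub>\<le>\<^sub>0" using k2 by (simp only: nonpos_Reals_of_real_iff) simp
    have "V 0 = of_real (if \<xi>0 = \<i> then 1 else k\<^sup>2)" by (simp add: V0)
    hence Vn: "V 0 \<notin> \<real>\<^sub>\<le>\<^sub>0" using k by (simp only: nonpos_Reals_of_real_iff) simp
    have "s analytic_on {0}"
      unfolding s_def V_def D_def
      by (intro analytic_intros csqrt_analytic_at) (use Dn Vn in \<open>auto simp: V_def D_def\<close>)
    then obtain e where e: "e > 0" "s holomorphic_on ball 0 e" by (auto simp: analytic_on_def)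
    define U where "U = {t \<in> ball 0 e. s t \<in> {z. Im z > 0}}"
    have "open U" unfolding U_def
      using continuous_open_preimage[OF holomorphic_on_imp_continuous_on[OF e(2)] open_ball, of "{z. Im z > 0}"]
      by (simp add: open_halfspace_Im_gt vimage_def Int_def)
    moreover have "0 \<in> U" using e(1) s0 P(2) by (simp add: U_def)
    moreover have sU: "s holomorphic_on U" by (rule holomorphic_on_subset[OF e(2)]) (auto simp: U_def)
    moreover have "\<forall>t\<in>U. t\<^sup>2 = curve_poly k (s t)"
    proof
      fix t assume "t \<in> U"
      have "(s t)\<^sup>2 = - V t" by (simp add: s_def power_mult_distrib)
      moreover have "(1 - V t) * ((of_real k)\<^sup>2 - V t) = t\<^sup>2"
      proof -
        have "4 * ((1 - V t) * ((of_real k)\<^sup>2 - V t)) = (\<epsilon> * csqrt (D t))\<^sup>2 - (of_real (k\<^sup>2 - 1))\<^sup>2"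
          unfolding V_def by (simp add: field_simps power2_eq_square)
        also have "\<dots> = 4 * t\<^sup>2" by (simp add: power_mult_distrib e2) (simp add: D_def)
        finally show ?thesis by simp
      qed
      ultimately show "t\<^sup>2 = curve_poly k (s t)" by (simp add: curve_poly_def)
    qed
    moreover have "(\<lambda>t. F (Aff (s t) t)) holomorphic_on U"
      by (rule F[OF \<open>open U\<close> sU]) (auto intro: holomorphic_intros simp: U_def)
    ultimately show ?thesis using True s0 by auto
  qed
qed

lemma disc_class_holder_plus:
  assumes k: "k > 1" and F: "F \<in> disc_class k \<mu>"
  shows "F \<in> holder_plus k \<mu>"
proof -
  have "analytic_on_surface k (surface_plus k) F"
    unfolding analytic_on_surface_def
  proof
    fix P assume P: "P \<in> surface_plus k"
    then obtain \<xi> \<tau> where e: "P = Aff \<xi> \<tau>" by (cases P) auto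
    show "analytic_at_point k F P"
      unfolding e by (rule analytic_at_plus_point[OF k]) (use F P e in \<open>auto simp: disc_class_def\<close>)
  qed
  thus ?thesis using F unfolding holder_plus_def extendable_def disc_class_def closed_half_def by auto
qed

lemma norm_cayley_le:
  assumes "Im \<xi> \<ge> 0"
  shows "norm ((\<xi> - \<i>) / (\<xi> + \<i>)) \<le> 1" "\<xi> + \<i> \<noteq> 0"
proof -
  show nz: "\<xi> + \<i> \<noteq> 0" using assms by (auto simp: complex_eq_iff)
  have "(norm (\<xi> - \<i>))\<^sup>2 \<le> (norm (\<xi> + \<i>))\<^sup>2"
    unfolding cmod_power2 using assms by (simp add: power2_eq_square algebra_simps)
  hence "norm (\<xi> - \<i>) \<le> norm (\<xi> + \<i>)" by (rule power2_le_imp_le) simp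
  thus "norm ((\<xi> - \<i>) / (\<xi> + \<i>)) \<le> 1" using nz by (simp add: norm_divide)
qed

lemma norm_cayley_less:
  assumes "Im \<xi> > 0"
  shows "norm ((\<xi> - \<i>) / (\<xi> + \<i>)) < 1"
proof -
  have nz: "\<xi> + \<i> \<noteq> 0" using assms by (auto simp: complex_eq_iff)
  have "(norm (\<xi> - \<i>))\<^sup>2 < (norm (\<xi> + \<i>))\<^sup>2"
    unfolding cmod_power2 using assms by (simp add: power2_eq_square algebra_simps)
  hence "norm (\<xi> - \<i>) < norm (\<xi> + \<i>)" by (rule power2_less_imp_less) simp
  thus ?thesis using nz by (simp add: norm_divide)
qed

lemma modq_small:
  assumes k: "k > 1" and z: "norm \<zeta> \<le> 1"
  shows "norm (of_real (modq k) * \<zeta>) < 1" "root_in (modq k) \<zeta> \<noteq> 0"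
proof -
  have "norm (of_real (modq k) * \<zeta>) \<le> modq k * 1"
    unfolding norm_mult using modq[OF k] z by (intro mult_mono) auto
  thus s: "norm (of_real (modq k) * \<zeta>) < 1" using modq[OF k] by simp
  show "root_in (modq k) \<zeta> \<noteq> 0" using root_in_pos[OF s] by auto
qed

text \<open>
  The general function on the upper half: A is its even part, and the odd part is the product of g
  with the root.
\<close>
definition disc_fun :: "real \<Rightarrow> (complex \<Rightarrow> complex) \<Rightarrow> (complex \<Rightarrow> complex) \<Rightarrow> curve_point \<Rightarrow> complex" where
  "disc_fun k A g P = A (curve_zeta P) + curve_odd k P * g (curve_zeta P)"

lemma root_in_hoelder:
  assumes k: "k > 1" and m: "0 < \<mu>" "\<mu> \<le> 1"
  shows "hoelder_on \<mu> (cball 0 1) (root_in (modq k))"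
proof -
  have q: "0 < modq k" "modq k < 1" using modq[OF k] by auto
  have "root_in (modq k) holomorphic_on ball 0 (1 / modq k)"
    by (rule root_in_holomorphic) (use q in \<open>auto simp: norm_mult field_simps intro: holomorphic_intros\<close>)
  then obtain L where "L-lipschitz_on (cball 0 1) (root_in (modq k))"
  proof (rule holomorphic_imp_lipschitz_on[of _ _ "cball 0 1"])
    have "1 < 1 / modq k" using q by simp
    thus "cball 0 1 \<subseteq> ball (0::complex) (1 / modq k)" by auto
  qed auto
  thus ?thesis by (rule lipschitz_imp_hoelder_on) (use m in auto)
qed

lemma root_out_inverse: "root_out q \<zeta> = root_in q (1 / \<zeta>)"
  by (simp add: root_out_def root_in_def)

lemma id_hoelder: "0 < \<mu> \<Longrightarrow> \<mu> \<le> 1 \<Longrightarrow> bounded S \<Longrightarrow> hoelder_on \<mu> S (\<lambda>z. z)"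
  by (rule lipschitz_imp_hoelder_on[of 1]) (auto intro: lipschitz_intros)

lemma root_out_hoelder:
  assumes k: "k > 1" and m: "0 < \<mu>" "\<mu> \<le> 1"
  shows "hoelder_on \<mu> (sphere 0 1) (root_out (modq k))"
  unfolding root_out_inverse[abs_def]
  by (rule hoelder_on_circle_inverse) (rule hoelder_on_subset[OF root_in_hoelder[OF k m]], auto)

lemma side_disc_fun:
  assumes k: "k > 1" and z: "\<zeta> \<in> sphere 0 1"
  shows "side k j (disc_fun k A g) \<zeta> = A \<zeta> + sheet_sign j * (\<zeta> * root_out (modq k) \<zeta>) * g \<zeta>"
  using z by (simp add: side_def disc_fun_def curve_zeta_contour curve_odd_contour[OF k] cayley_line_pt)

lemma disc_fun_in_class:
  assumes k: "k > 1" and m: "0 < \<mu>" "\<mu> \<le> 1"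
    and A: "A holomorphic_on ball 0 1" "continuous_on (cball 0 1) A" "hoelder_on \<mu> (sphere 0 1) A"
    and g: "g holomorphic_on ball 0 1" "continuous_on (cball 0 1) g" "hoelder_on \<mu> (sphere 0 1) g"
  shows "disc_fun k A g \<in> disc_class k \<mu>"
  unfolding disc_class_def
proof (intro CollectI conjI allI impI)
  show "disc_fun k A g \<in> holder_Gamma k \<mu>"
    unfolding holder_Gamma_iff_side
  proof
    fix j
    have "hoelder_on \<mu> (sphere 0 1) (\<lambda>\<zeta>. A \<zeta> + sheet_sign j * (\<zeta> * root_out (modq k) \<zeta>) * g \<zeta>)"
      by (intro hoelder_on_add hoelder_on_mult hoelder_on_const id_hoelder root_out_hoelder[OF k m]
          A(3) g(3)) (use m in auto)
    thus "hoelder_on \<mu> (sphere 0 1) (side k j (disc_fun k A g))"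
      by (subst hoelder_on_cong[OF side_disc_fun[OF k]])
  qed
  have k1: "complex_of_real (1 + k) \<noteq> 0"
    using k by (metis add_pos_pos less_irrefl of_real_eq_0_iff zero_less_one order_less_trans)
  note cA = A(2) and cg = g(2)
  show "continuous_map (subtopology (surface_top k) (closed_half k)) euclidean (disc_fun k A g)"
  proof (rule continuous_map_from_surface[OF closed_half_subset[OF k]])
    let ?S = "{z \<in> affine_curve k. aff_point z \<in> closed_half k}"
    have S: "Im (fst z) \<ge> 0" if "z \<in> ?S" for z using that by (auto simp: aff_point_def closed_half_iff[OF k])
    let ?\<zeta> = "\<lambda>z::complex\<times>complex. (fst z - \<i>) / (fst z + \<i>)"
    have b: "?\<zeta> z \<in> cball 0 1" if "z \<in> ?S" for z using norm_cayley_le(1)[OF S[OF that]] by simp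
    have cz: "continuous_on ?S ?\<zeta>" using norm_cayley_le(2)[OF S] by (intro continuous_intros) auto
    let ?d = "\<lambda>z. of_real (1 + k) * (fst z + \<i>)\<^sup>2 * root_in (modq k) (?\<zeta> z)"
    have cd: "continuous_on ?S ?d"
      by (intro continuous_intros root_in_continuous cz modq_small(1)[OF k]) (use b in simp)
    have "?d z \<noteq> 0" if "z \<in> ?S" for z
      using norm_cayley_le(2)[OF S[OF that]] modq_small(2)[OF k, of "?\<zeta> z"] b[OF that] k1 by simp
    hence "continuous_on ?S (\<lambda>z. 2 * snd z / ?d z)"
      by (intro continuous_on_divide[OF _ cd] continuous_intros) blast
    hence "continuous_on ?S (\<lambda>z. A (?\<zeta> z) + 2 * snd z / ?d z * g (?\<zeta> z))"
      by (intro continuous_on_add continuous_on_mult continuous_on_compose2[OF cA cz] continuous_on_compose2[OF cg cz])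
        (use b in auto)
    thus "continuous_on ?S (\<lambda>z. disc_fun k A g (aff_point z))"
      by (simp add: disc_fun_def aff_point_def)
  next
    let ?S = "{w \<in> infinity_curve k. inf_point w \<in> closed_half k}"
    have S: "Im (fst w) \<le> 0" if w: "w \<in> ?S" for w
    proof (cases "fst w = 0")
      case False
      have "Im (1 / fst w) = - Im (fst w) / (norm (fst w))\<^sup>2"
        using complex_inverse[of "Re (fst w)" "Im (fst w)"]
        by (simp add: inverse_eq_divide[symmetric] cmod_power2)
      moreover have "Im (1 / fst w) \<ge> 0" using w False by (auto simp: inf_point_eq_aff aff_point_def closed_half_iff[OF k])
      ultimately show ?thesis using False by (auto simp: divide_le_0_iff)
    qed simp
    have nz: "1 + \<i> * fst w \<noteq> 0" if "w \<in> ?S" for w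
    proof
      assume "1 + \<i> * fst w = 0"
      hence "Im (fst w) = 1" by (simp add: complex_eq_iff)
      thus False using S[OF that] by simp
    qed
    let ?\<zeta> = "\<lambda>w::complex\<times>complex. (1 - \<i> * fst w) / (1 + \<i> * fst w)"
    have conv: "(1 / u - \<i>) / (1 / u + \<i>) = (1 - \<i> * u) / (1 + \<i> * u)" "1 / u + \<i> = (1 + \<i> * u) / u" if "u \<noteq> 0" for u :: complex
    proof -
      have "1 / u - \<i> = (1 - \<i> * u) / u" "1 / u + \<i> = (1 + \<i> * u) / u" using that by (simp_all add: field_simps)
      thus "(1 / u - \<i>) / (1 / u + \<i>) = (1 - \<i> * u) / (1 + \<i> * u)" "1 / u + \<i> = (1 + \<i> * u) / u" using that by simp_all
    qed
    have b: "?\<zeta> w \<in> cball 0 1" if w: "w \<in> ?S" for w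
    proof (cases "fst w = 0")
      case False
      hence "Im (1 / fst w) \<ge> 0" using w by (auto simp: inf_point_eq_aff aff_point_def closed_half_iff[OF k])
      from norm_cayley_le(1)[OF this] show ?thesis unfolding conv(1)[OF False] by simp
    qed simp
    have cz: "continuous_on ?S ?\<zeta>" using nz by (intro continuous_intros) auto
    let ?d = "\<lambda>w. of_real (1 + k) * (1 + \<i> * fst w)\<^sup>2 * root_in (modq k) (?\<zeta> w)"
    have cd: "continuous_on ?S ?d"
      by (intro continuous_intros root_in_continuous cz modq_small(1)[OF k]) (use b in simp)
    have "?d w \<noteq> 0" if "w \<in> ?S" for w
      using nz[OF that] modq_small(2)[OF k, of "?\<zeta> w"] b[OF that] k1 by simp
    hence "continuous_on ?S (\<lambda>w. 2 * snd w / ?d w)"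
      by (intro continuous_on_divide[OF _ cd] continuous_intros) blast
    hence "continuous_on ?S (\<lambda>w. A (?\<zeta> w) + 2 * snd w / ?d w * g (?\<zeta> w))"
      by (intro continuous_on_add continuous_on_mult continuous_on_compose2[OF cA cz] continuous_on_compose2[OF cg cz])
        (use b in auto)
    moreover have "disc_fun k A g (inf_point w) = A (?\<zeta> w) + 2 * snd w / (of_real (1 + k) * (1 + \<i> * fst w)\<^sup>2 * root_in (modq k) (?\<zeta> w)) * g (?\<zeta> w)"
      if w: "w \<in> ?S" for w
    proof (cases "fst w = 0")
      case True
      have "(snd w)\<^sup>2 = 1" using w True by (auto simp: infinity_curve_def curve_poly_rev_def)
      hence "snd w = 1 \<or> snd w = -1" by (simp add: power2_eq_1_iff)
      thus ?thesis using True by (auto simp: disc_fun_def inf_point_def)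
    next
      case False
      have "disc_fun k A g (inf_point w) = A ((1 / fst w - \<i>) / (1 / fst w + \<i>))
          + 2 * (snd w / (fst w)\<^sup>2) / (of_real (1 + k) * (1 / fst w + \<i>)\<^sup>2 * root_in (modq k) ((1 / fst w - \<i>) / (1 / fst w + \<i>)))
            * g ((1 / fst w - \<i>) / (1 / fst w + \<i>))"
        unfolding disc_fun_def inf_point_eq_aff[OF False] by (simp only: aff_point_def fst_conv snd_conv curve_zeta.simps curve_odd.simps)
      thus ?thesis unfolding conv(1)[OF False] unfolding conv(2)[OF False] using False by (simp add: power_divide)
    qed
    ultimately show "continuous_on ?S (\<lambda>w. disc_fun k A g (inf_point w))"
      by (subst continuous_on_cong[OF refl])
  qed
  fix U :: "complex set" and X Y :: "complex \<Rightarrow> complex"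
  assume U: "open U" "X holomorphic_on U" "Y holomorphic_on U" "\<forall>t\<in>U. Im (X t) > 0"
  let ?\<zeta> = "\<lambda>t. (X t - \<i>) / (X t + \<i>)"
  have b: "?\<zeta> t \<in> ball 0 1" if "t \<in> U" for t using norm_cayley_less[of "X t"] U(4) that by simp
  have nz: "X t + \<i> \<noteq> 0" if "t \<in> U" for t using norm_cayley_le(2)[of "X t"] U(4) that by fastforce
  have hz: "?\<zeta> holomorphic_on U" using nz by (intro holomorphic_intros U) auto
  have hA: "(\<lambda>t. A (?\<zeta> t)) holomorphic_on U" and hg: "(\<lambda>t. g (?\<zeta> t)) holomorphic_on U"
    using holomorphic_on_compose_gen[OF hz A(1)] holomorphic_on_compose_gen[OF hz g(1)] b
    by (auto simp: o_def image_subset_iff)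
  let ?d = "\<lambda>t. of_real (1 + k) * (X t + \<i>)\<^sup>2 * root_in (modq k) (?\<zeta> t)"
  have cd: "?d holomorphic_on U"
    by (intro holomorphic_intros root_in_holomorphic hz U modq_small(1)[OF k]) (use b in \<open>simp add: less_imp_le\<close>)
  have "?d t \<noteq> 0" if "t \<in> U" for t
    using nz[OF that] modq_small(2)[OF k, of "?\<zeta> t"] b[OF that] k1 by (simp add: less_imp_le)
  hence "(\<lambda>t. 2 * Y t / ?d t) holomorphic_on U"
    by (intro holomorphic_on_divide[OF _ cd] holomorphic_intros U) blast
  hence "(\<lambda>t. A (?\<zeta> t) + 2 * Y t / ?d t * g (?\<zeta> t)) holomorphic_on U"
    by (intro holomorphic_on_add holomorphic_on_mult hA hg)
  thus "(\<lambda>t. disc_fun k A g (Aff (X t) (Y t))) holomorphic_on U" by (simp add: disc_fun_def)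
qed

section \<open>Uniformising the closed upper half\<close>

text \<open>
  The odd function that becomes the second coordinate after division by (1 - \<zeta>)^2 in the
  affine chart and by -(1 + \<zeta>)^2 at infinity.
\<close>
definition lift_odd :: "real \<Rightarrow> complex \<Rightarrow> complex" where
  "lift_odd k z = 2 * of_real (1 + k) * of_real (modq k) * (sinh z * cosh z) * root_in (modq k) (zeta_of (modq k) z)"

text \<open>
  The uniformisation of the closed upper half by the strip. The point at infinity lies over
  \<zeta> = 1, where the coordinates are u = 0 and v = -T/4 with T the value of
  \<open>lift_odd\<close>.
\<close>
definition lift :: "real \<Rightarrow> complex \<Rightarrow> curve_point" where
  "lift k z = (let \<zeta> = zeta_of (modq k) z in
     if \<zeta> = 1 then inf_point (0, - lift_odd k z / 4)
     else Aff (\<i> * (1 + \<zeta>) / (1 - \<zeta>)) (lift_odd k z / (1 - \<zeta>)\<^sup>2))"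

lemma lift_odd_square:
  assumes k: "k > 1"
  defines "q \<equiv> complex_of_real (modq k)"
  shows "(lift_odd k z)\<^sup>2 = 4 * (of_real (1 + k))\<^sup>2 * (zeta_of (modq k) z * (zeta_of (modq k) z - q) * (1 - q * zeta_of (modq k) z))"
proof -
  define S where "S = (sinh z)\<^sup>2"
  have z: "zeta_of (modq k) z = - q * S" by (simp add: zeta_of_def q_def S_def)
  have "(lift_odd k z)\<^sup>2 = 4 * (of_real (1 + k))\<^sup>2 * (q\<^sup>2 * (S * (cosh z)\<^sup>2) * (1 - q * zeta_of (modq k) z))"
    unfolding lift_odd_def power_mult_distrib root_in_square q_def S_def by (simp add: mult_ac)
  also have "(cosh z)\<^sup>2 = S + 1" by (simp add: cosh_square_eq S_def)
  also have "q\<^sup>2 * (S * (S + 1)) = zeta_of (modq k) z * (zeta_of (modq k) z - q)"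
    by (simp add: z algebra_simps power2_eq_square)
  finally show ?thesis .
qed

lemma curve_factor_identity:
  assumes k: "k > 1"
  defines "q \<equiv> complex_of_real (modq k)"
  shows "(- 4 * \<zeta>) * ((of_real k)\<^sup>2 * (1 - \<zeta>)\<^sup>2 - (1 + \<zeta>)\<^sup>2)
     = 4 * (of_real (1 + k))\<^sup>2 * (\<zeta> * (\<zeta> - q) * (1 - q * \<zeta>))"
proof -
  define c where "c = complex_of_real (1 + k)"
  have "c \<noteq> 0"
    using k unfolding c_def by (metis add_pos_pos less_irrefl of_real_eq_0_iff zero_less_one order_less_trans)
  hence q: "c * q = of_real k - 1" by (simp add: q_def modq_def c_def add.commute)
  have "c\<^sup>2 * ((\<zeta> - q) * (1 - q * \<zeta>)) = (c * \<zeta> - c * q) * (c - c * q * \<zeta>)"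
    by (simp add: algebra_simps power2_eq_square)
  also have "\<dots> = ((1 + of_real k) * \<zeta> - (of_real k - 1)) * ((1 + of_real k) - (of_real k - 1) * \<zeta>)"
    unfolding q by (simp add: c_def)
  also have "\<dots> = - ((of_real k)\<^sup>2 * (1 - \<zeta>)\<^sup>2 - (1 + \<zeta>)\<^sup>2)"
    by (simp add: algebra_simps power2_eq_square)
  finally have *: "c\<^sup>2 * ((\<zeta> - q) * (1 - q * \<zeta>)) = - ((of_real k)\<^sup>2 * (1 - \<zeta>)\<^sup>2 - (1 + \<zeta>)\<^sup>2)" .
  have "4 * c\<^sup>2 * (\<zeta> * (\<zeta> - q) * (1 - q * \<zeta>)) = 4 * \<zeta> * (c\<^sup>2 * ((\<zeta> - q) * (1 - q * \<zeta>)))"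
    by (simp only: mult_ac)
  also have "\<dots> = (- 4 * \<zeta>) * ((of_real k)\<^sup>2 * (1 - \<zeta>)\<^sup>2 - (1 + \<zeta>)\<^sup>2)" unfolding * by (simp only: mult_minus_left mult_minus_right)
  finally show ?thesis unfolding c_def by (rule sym)
qed

text \<open>
  Near every point one of the two charts applies, as \<zeta> cannot be both 1 and -1.
\<close>
lemma lift_charts:
  assumes k: "k > 1"
  shows "zeta_of (modq k) z \<noteq> 1 \<Longrightarrow>
      (\<i> * (1 + zeta_of (modq k) z) / (1 - zeta_of (modq k) z), lift_odd k z / (1 - zeta_of (modq k) z)\<^sup>2) \<in> affine_curve k"
    and "zeta_of (modq k) z \<noteq> -1 \<Longrightarrow>
      ((1 - zeta_of (modq k) z) / (\<i> * (1 + zeta_of (modq k) z)), - lift_odd k z / (1 + zeta_of (modq k) z)\<^sup>2) \<in> infinity_curve k"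
    and "zeta_of (modq k) z \<noteq> 1 \<Longrightarrow> lift k z = aff_point
      (\<i> * (1 + zeta_of (modq k) z) / (1 - zeta_of (modq k) z), lift_odd k z / (1 - zeta_of (modq k) z)\<^sup>2)"
    and "zeta_of (modq k) z \<noteq> -1 \<Longrightarrow> lift k z = inf_point
      ((1 - zeta_of (modq k) z) / (\<i> * (1 + zeta_of (modq k) z)), - lift_odd k z / (1 + zeta_of (modq k) z)\<^sup>2)"
proof -
  define \<zeta> T where "\<zeta> = zeta_of (modq k) z" and "T = lift_odd k z"
  have T2: "T\<^sup>2 = (- 4 * \<zeta>) * ((of_real k)\<^sup>2 * (1 - \<zeta>)\<^sup>2 - (1 + \<zeta>)\<^sup>2)"
    unfolding T_def \<zeta>_def lift_odd_square[OF k] by (rule curve_factor_identity[OF k, symmetric])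
  have e: "1 + (\<i> * (1 + \<zeta>) / (1 - \<zeta>))\<^sup>2 = (- 4 * \<zeta>) / (1 - \<zeta>)\<^sup>2"
    "(of_real k)\<^sup>2 + (\<i> * (1 + \<zeta>) / (1 - \<zeta>))\<^sup>2 = ((of_real k)\<^sup>2 * (1 - \<zeta>)\<^sup>2 - (1 + \<zeta>)\<^sup>2) / (1 - \<zeta>)\<^sup>2" if "\<zeta> \<noteq> 1"
  proof -
    have n: "(1 - \<zeta>)\<^sup>2 \<noteq> 0" using that by simp
    have s: "(\<i> * (1 + \<zeta>) / (1 - \<zeta>))\<^sup>2 = - ((1 + \<zeta>)\<^sup>2) / (1 - \<zeta>)\<^sup>2" by (simp add: power_divide power_mult_distrib)
    have c: "a + - x / y = (a * y - x) / y" if "y \<noteq> 0" for a x y :: complex using that by (simp add: field_simps)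
    show "1 + (\<i> * (1 + \<zeta>) / (1 - \<zeta>))\<^sup>2 = (- 4 * \<zeta>) / (1 - \<zeta>)\<^sup>2"
      unfolding s c[OF n] by (simp add: algebra_simps power2_eq_square)
    show "(of_real k)\<^sup>2 + (\<i> * (1 + \<zeta>) / (1 - \<zeta>))\<^sup>2 = ((of_real k)\<^sup>2 * (1 - \<zeta>)\<^sup>2 - (1 + \<zeta>)\<^sup>2) / (1 - \<zeta>)\<^sup>2"
      unfolding s c[OF n] ..
  qed
  have 1: "(\<i> * (1 + \<zeta>) / (1 - \<zeta>), T / (1 - \<zeta>)\<^sup>2) \<in> affine_curve k" if "\<zeta> \<noteq> 1"
  proof -
    have "(T / (1 - \<zeta>)\<^sup>2)\<^sup>2 = T\<^sup>2 / ((1 - \<zeta>)\<^sup>2 * (1 - \<zeta>)\<^sup>2)"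
      by (simp only: power_divide power2_eq_square[of "(1 - \<zeta>)\<^sup>2"])
    also have "\<dots> = curve_poly k (\<i> * (1 + \<zeta>) / (1 - \<zeta>))"
      unfolding T2 curve_poly_def e[OF that] by (simp only: times_divide_times_eq)
    finally show ?thesis unfolding affine_curve_iff by simp
  qed
  have 3: "lift k z = aff_point (\<i> * (1 + \<zeta>) / (1 - \<zeta>), T / (1 - \<zeta>)\<^sup>2)" if "\<zeta> \<noteq> 1"
    using that by (simp add: lift_def Let_def aff_point_def \<zeta>_def T_def)
  have 4: "lift k z = inf_point ((1 - \<zeta>) / (\<i> * (1 + \<zeta>)), - T / (1 + \<zeta>)\<^sup>2)" if m1: "\<zeta> \<noteq> -1"
  proof (cases "\<zeta> = 1")
    case True
    thus ?thesis by (simp add: lift_def Let_def \<zeta>_def T_def)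
  next
    case False
    have n: "1 - \<zeta> \<noteq> 0" "1 + \<zeta> \<noteq> 0" using False m1 by (auto simp: add_eq_0_iff)
    have "T / (1 - \<zeta>)\<^sup>2 = - T / (1 + \<zeta>)\<^sup>2 / ((1 - \<zeta>) / (\<i> * (1 + \<zeta>)))\<^sup>2"
      using n by (simp add: power_divide power_mult_distrib)
    hence "aff_point (\<i> * (1 + \<zeta>) / (1 - \<zeta>), T / (1 - \<zeta>)\<^sup>2) = aff_point (1 / ((1 - \<zeta>) / (\<i> * (1 + \<zeta>))),
        - T / (1 + \<zeta>)\<^sup>2 / ((1 - \<zeta>) / (\<i> * (1 + \<zeta>)))\<^sup>2)" by (simp only: divide_divide_eq_right mult_1_left)
    also have "\<dots> = inf_point ((1 - \<zeta>) / (\<i> * (1 + \<zeta>)), - T / (1 + \<zeta>)\<^sup>2)"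
      using n inf_point_eq_aff[of "((1 - \<zeta>) / (\<i> * (1 + \<zeta>)), - T / (1 + \<zeta>)\<^sup>2)"] by (simp only: fst_conv snd_conv) simp
    finally show ?thesis unfolding 3[OF False] .
  qed
  have 2: "((1 - \<zeta>) / (\<i> * (1 + \<zeta>)), - T / (1 + \<zeta>)\<^sup>2) \<in> infinity_curve k" if m1: "\<zeta> \<noteq> -1"
  proof -
    have n: "(1 + \<zeta>)\<^sup>2 \<noteq> 0" using m1 by (auto simp: add_eq_0_iff)
    have s: "((1 - \<zeta>) / (\<i> * (1 + \<zeta>)))\<^sup>2 = - ((1 - \<zeta>)\<^sup>2) / (1 + \<zeta>)\<^sup>2" by (simp add: power_divide power_mult_distrib)
    have c: "1 + - x / y = (y - x) / y" "1 + a * (- x / y) = (y - a * x) / y" if "y \<noteq> 0" for a x y :: complex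
      using that by (simp_all add: field_simps)
    have "curve_poly_rev k ((1 - \<zeta>) / (\<i> * (1 + \<zeta>)))
        = ((1 + \<zeta>)\<^sup>2 - (1 - \<zeta>)\<^sup>2) / (1 + \<zeta>)\<^sup>2 * (((1 + \<zeta>)\<^sup>2 - (of_real k)\<^sup>2 * (1 - \<zeta>)\<^sup>2) / (1 + \<zeta>)\<^sup>2)"
      unfolding curve_poly_rev_def s c(1)[OF n] c(2)[OF n] ..
    also have "\<dots> = ((1 + \<zeta>)\<^sup>2 - (1 - \<zeta>)\<^sup>2) * ((1 + \<zeta>)\<^sup>2 - (of_real k)\<^sup>2 * (1 - \<zeta>)\<^sup>2) / ((1 + \<zeta>)\<^sup>2)\<^sup>2"
      unfolding times_divide_times_eq by (simp only: power2_eq_square[of "(1 + \<zeta>)\<^sup>2"])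
    also have "(1 + \<zeta>)\<^sup>2 - (1 - \<zeta>)\<^sup>2 = 4 * \<zeta>" by (simp add: algebra_simps power2_eq_square)
    also have "4 * \<zeta> * ((1 + \<zeta>)\<^sup>2 - (of_real k)\<^sup>2 * (1 - \<zeta>)\<^sup>2) = T\<^sup>2"
      unfolding T2 by (simp add: right_diff_distrib)
    finally show ?thesis unfolding infinity_curve_iff by (simp add: power_divide)
  qed
  show "zeta_of (modq k) z \<noteq> 1 \<Longrightarrow>
      (\<i> * (1 + zeta_of (modq k) z) / (1 - zeta_of (modq k) z), lift_odd k z / (1 - zeta_of (modq k) z)\<^sup>2) \<in> affine_curve k"
    "zeta_of (modq k) z \<noteq> -1 \<Longrightarrow>
      ((1 - zeta_of (modq k) z) / (\<i> * (1 + zeta_of (modq k) z)), - lift_odd k z / (1 + zeta_of (modq k) z)\<^sup>2) \<in> infinity_curve k"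
    "zeta_of (modq k) z \<noteq> 1 \<Longrightarrow> lift k z = aff_point
      (\<i> * (1 + zeta_of (modq k) z) / (1 - zeta_of (modq k) z), lift_odd k z / (1 - zeta_of (modq k) z)\<^sup>2)"
    "zeta_of (modq k) z \<noteq> -1 \<Longrightarrow> lift k z = inf_point
      ((1 - zeta_of (modq k) z) / (\<i> * (1 + zeta_of (modq k) z)), - lift_odd k z / (1 + zeta_of (modq k) z)\<^sup>2)"
    using 1 2 3 4 unfolding \<zeta>_def T_def by blast+
qed

lemma lift_shift [simp]: "lift k (z + \<i> * of_real pi) = lift k z"
proof -
  have "lift_odd k (z + \<i> * of_real pi) = lift_odd k z" by (simp add: lift_odd_def)
  thus ?thesis by (simp only: lift_def zeta_of_shift)
qed

lemma Im_inverse_cayley: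
  "Im (\<i> * (1 + \<zeta>) / (1 - \<zeta>)) = (1 - (norm \<zeta>)\<^sup>2) / (norm (1 - \<zeta>))\<^sup>2"
proof -
  have "Im (\<i> * (1 + \<zeta>) / (1 - \<zeta>)) = Im (\<i> * (1 + \<zeta>) * cnj (1 - \<zeta>)) / (norm (1 - \<zeta>))\<^sup>2"
    by (subst complex_div_cnj) (simp only: of_real_power[symmetric] Im_divide_of_real)
  also have "Im (\<i> * (1 + \<zeta>) * cnj (1 - \<zeta>)) = 1 - (norm \<zeta>)\<^sup>2"
    unfolding cmod_power2 by (simp add: power2_eq_square algebra_simps)
  finally show ?thesis .
qed

lemma lift_in_closed_half:
  assumes k: "k > 1"
  shows "norm (zeta_of (modq k) z) < 1 \<Longrightarrow> lift k z \<in> surface_plus k"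
    and "norm (zeta_of (modq k) z) \<le> 1 \<Longrightarrow> lift k z \<in> closed_half k"
    and "norm (zeta_of (modq k) z) = 1 \<Longrightarrow> lift k z \<in> Gamma_curve k"
proof -
  define \<zeta> where "\<zeta> = zeta_of (modq k) z"
  have A: "lift k z = Aff (\<i> * (1 + \<zeta>) / (1 - \<zeta>)) (lift_odd k z / (1 - \<zeta>)\<^sup>2)"
    "(lift_odd k z / (1 - \<zeta>)\<^sup>2)\<^sup>2 = curve_poly k (\<i> * (1 + \<zeta>) / (1 - \<zeta>))" if "\<zeta> \<noteq> 1"
    using that lift_charts(1,3)[OF k, of z] by (auto simp: \<zeta>_def aff_point_def affine_curve_iff)
  have 1: "\<exists>j. lift k z = Infty j" if "\<zeta> = 1"
    using that by (auto simp: lift_def Let_def inf_point_def \<zeta>_def)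
  show "lift k z \<in> surface_plus k" if "norm (zeta_of (modq k) z) < 1"
  proof -
    have n: "norm \<zeta> < 1" using that by (simp add: \<zeta>_def)
    hence z1: "\<zeta> \<noteq> 1" by auto
    have "(norm \<zeta>)\<^sup>2 < 1" using n by (simp add: power_less_one_iff abs_square_less_1)
    hence "Im (\<i> * (1 + \<zeta>) / (1 - \<zeta>)) > 0" unfolding Im_inverse_cayley using z1 by simp
    thus ?thesis using A[OF z1] by simp
  qed
  show "lift k z \<in> closed_half k" if "norm (zeta_of (modq k) z) \<le> 1"
  proof (cases "\<zeta> = 1")
    case False
    have "(norm \<zeta>)\<^sup>2 \<le> 1" using that by (simp add: \<zeta>_def power_le_one)
    hence "Im (\<i> * (1 + \<zeta>) / (1 - \<zeta>)) \<ge> 0" unfolding Im_inverse_cayley by simp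
    thus ?thesis using A[OF False] closed_half_iff[OF k] by simp
  qed (use 1 closed_half_iff[OF k] in auto)
  show "lift k z \<in> Gamma_curve k" if "norm (zeta_of (modq k) z) = 1"
  proof (cases "\<zeta> = 1")
    case False
    have "Im (\<i> * (1 + \<zeta>) / (1 - \<zeta>)) = 0" unfolding Im_inverse_cayley using that by (simp add: \<zeta>_def)
    thus ?thesis using A[OF False] unfolding Gamma_curve_eq[OF k] affine_curve_def by (auto simp: complex_is_Real_iff)
  qed (use 1 Gamma_curve_eq[OF k] in auto)
qed

lemma lift_odd_continuous:
  assumes k: "k > 1" and S: "\<And>z. z \<in> S \<Longrightarrow> norm (zeta_of (modq k) z) \<le> 1"
  shows "continuous_on S (lift_odd k)"
proof -
  have "continuous_on S (zeta_of (modq k))" unfolding zeta_of_def by (intro continuous_intros)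
  thus ?thesis unfolding lift_odd_def
    by (intro continuous_intros root_in_continuous modq_small(1)[OF k] S)
qed

lemma lift_continuous:
  assumes k: "k > 1"
  shows "continuous_map (top_of_set {z. norm (zeta_of (modq k) z) \<le> 1}) (subtopology (surface_top k) (closed_half k)) (lift k)"
  unfolding continuous_map_in_subtopology
proof
  let ?S = "{z. norm (zeta_of (modq k) z) \<le> 1}"
  have cz: "continuous_on A (zeta_of (modq k))" for A unfolding zeta_of_def by (intro continuous_intros)
  define S1 where "S1 = ?S \<inter> {z. zeta_of (modq k) z \<noteq> 1}"
  define S2 where "S2 = ?S \<inter> {z. zeta_of (modq k) z \<noteq> -1}"
  have o: "openin (top_of_set ?S) S1" "openin (top_of_set ?S) S2"
    unfolding S1_def S2_def by (intro openin_open_Int open_Collect_neq cz continuous_intros)+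
  have 1: "continuous_map (top_of_set S1) (surface_top k) (lift k)"
  proof -
    have "continuous_map (top_of_set S1) (surface_top k) (\<lambda>z. aff_point
        (\<i> * (1 + zeta_of (modq k) z) / (1 - zeta_of (modq k) z), lift_odd k z / (1 - zeta_of (modq k) z)\<^sup>2))"
      by (intro continuous_map_into_surface continuous_intros cz lift_odd_continuous[OF k])
        (use lift_charts(1)[OF k] in \<open>auto simp: S1_def\<close>)
    thus ?thesis by (rule continuous_map_eq) (use lift_charts(3)[OF k] in \<open>auto simp: S1_def\<close>)
  qed
  have 2: "continuous_map (top_of_set S2) (surface_top k) (lift k)"
  proof -
    have "continuous_map (top_of_set S2) (surface_top k) (\<lambda>z. inf_point
        ((1 - zeta_of (modq k) z) / (\<i> * (1 + zeta_of (modq k) z)), - lift_odd k z / (1 + zeta_of (modq k) z)\<^sup>2))"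
      by (intro continuous_map_into_surface_inf continuous_intros cz lift_odd_continuous[OF k])
        (use lift_charts(2)[OF k] in \<open>auto simp: S2_def add_eq_0_iff\<close>)
    thus ?thesis by (rule continuous_map_eq) (use lift_charts(4)[OF k] in \<open>auto simp: S2_def\<close>)
  qed
  have U: "S1 \<union> S2 = ?S" by (auto simp: S1_def S2_def)
  show "continuous_map (top_of_set ?S) (surface_top k) (lift k)"
    unfolding continuous_map_def
  proof (intro conjI allI impI)
    show "lift k \<in> topspace (top_of_set ?S) \<rightarrow> topspace (surface_top k)"
      using lift_in_closed_half(2)[OF k] closed_half_subset[OF k] by auto
    fix V assume V: "openin (surface_top k) V"
    have "openin (top_of_set S1) {z \<in> S1. lift k z \<in> V}" "openin (top_of_set S2) {z \<in> S2. lift k z \<in> V}"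
      using 1 2 V unfolding continuous_map_def by auto
    hence "openin (top_of_set ?S) {z \<in> S1. lift k z \<in> V}" "openin (top_of_set ?S) {z \<in> S2. lift k z \<in> V}"
      using o openin_trans by blast+
    hence "openin (top_of_set ?S) ({z \<in> S1. lift k z \<in> V} \<union> {z \<in> S2. lift k z \<in> V})" by (rule openin_Un)
    also have "{z \<in> S1. lift k z \<in> V} \<union> {z \<in> S2. lift k z \<in> V} = {z \<in> topspace (top_of_set ?S). lift k z \<in> V}"
      using U by auto
    finally show "openin (top_of_set ?S) {z \<in> topspace (top_of_set ?S). lift k z \<in> V}" .
  qed
  show "lift k \<in> topspace (top_of_set ?S) \<rightarrow> closed_half k"
    using lift_in_closed_half(2)[OF k] by auto
qed

text \<open>
  The path and its negative run over the two components of the contour, because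
  \<open>curve_odd\<close> pulls back to the odd function -q sinh z cosh z.
\<close>
lemma lift_circle_path:
  assumes k: "k > 1" and t: "t \<in> {0..1}"
  shows "lift k (circle_path (modq k) 1 t) = contour_point k S1 (line_loop t)"
    and "lift k (- circle_path (modq k) 1 t) = contour_point k S2 (line_loop t)"
proof -
  have q: "0 < modq k" "modq k < 1" using modq[OF k] by auto
  define x where "x = line_loop t"
  have cx: "cayley x = circ t" using cayley_line_loop[of t] t by (simp add: x_def)
  have *: "lift k z = contour_point k j x"
    if z: "zeta_of (modq k) z = circ t" and odd: "- of_real (modq k) * (sinh z * cosh z) = sheet_sign j * (circ t * root_out (modq k) (circ t))" for z j
  proof -
    define \<zeta> where "\<zeta> = circ t"
    have r0: "root_in (modq k) \<zeta> \<noteq> 0" by (rule modq_small(2)[OF k]) (simp add: \<zeta>_def)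
    have T: "lift_odd k z = - 2 * of_real (1 + k) * curve_odd k (contour_point k j x) * root_in (modq k) \<zeta>"
    proof -
      have "lift_odd k z = - 2 * of_real (1 + k) * (- of_real (modq k) * (sinh z * cosh z)) * root_in (modq k) \<zeta>"
        by (simp only: lift_odd_def z \<zeta>_def mult_minus_left mult_minus_right minus_minus mult_ac)
      thus ?thesis unfolding odd curve_odd_contour[OF k] cx .
    qed
    have k1: "complex_of_real (1 + k) \<noteq> 0"
      using k by (metis add_pos_pos less_irrefl of_real_eq_0_iff zero_less_one order_less_trans)
    show ?thesis
    proof (cases x)
      case None
      hence z1: "\<zeta> = 1" using cx by (simp add: \<zeta>_def)
      have "lift_odd k z = - 4 * sheet_sign j"
      proof -
        have "- 2 * c * (2 * s / (c * r)) * r = - 4 * s" if "c \<noteq> 0" "r \<noteq> 0" for c r s :: complex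
          using that by simp
        from this[OF k1 r0] show ?thesis unfolding T None contour_point.simps curve_odd.simps z1 .
      qed
      thus ?thesis using None z1 z Infty_eq_inf_point(1)[of j] by (simp add: lift_def Let_def \<zeta>_def)
    next
      case (Some y)
      define e where "e = complex_of_real y + \<i>"
      have e0: "e \<noteq> 0" by (auto simp: e_def complex_eq_iff)
      have zy: "\<zeta> = (of_real y - \<i>) / e" using cx Some by (simp add: \<zeta>_def e_def)
      have m: "1 - \<zeta> = 2 * \<i> / e" "1 + \<zeta> = 2 * of_real y / e"
      proof -
        have "1 - a / e = (e - a) / e" "1 + a / e = (e + a) / e" for a using e0 by (simp_all add: field_simps)
        thus "1 - \<zeta> = 2 * \<i> / e" "1 + \<zeta> = 2 * of_real y / e" unfolding zy by (simp_all add: e_def)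
      qed
      hence z1: "\<zeta> \<noteq> 1" using e0 by auto
      have "\<i> * (1 + \<zeta>) / (1 - \<zeta>) = of_real y" unfolding m using e0 by simp
      moreover have "lift_odd k z / (1 - \<zeta>)\<^sup>2 = sheet_sign j * rho k (of_real y)"
      proof -
        have "curve_odd k (contour_point k j x) = 2 * (sheet_sign j * rho k (of_real y)) / (of_real (1 + k) * e\<^sup>2 * root_in (modq k) \<zeta>)"
          using Some zy by (simp add: e_def)
        have "lift_odd k z = - 4 * (sheet_sign j * rho k (of_real y)) / e\<^sup>2"
        proof -
          have "- 2 * c * (2 * s / (c * n * r)) * r = - 4 * s / n" if "c \<noteq> 0" "r \<noteq> 0" for c r s n :: complex
            using that by simp
          from this[OF k1 r0] \<open>curve_odd k _ = _\<close> show ?thesis unfolding T by (simp only:)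
        qed
        thus ?thesis unfolding m using e0 by (simp add: power_divide power_mult_distrib)
      qed
      ultimately show ?thesis using z1 z Some by (simp add: lift_def Let_def \<zeta>_def)
    qed
  qed
  have cp1: "zeta_of (modq k) (circle_path (modq k) 1 t) = circ t"
    using circle_path_sinh_cosh(1)[of "modq k" 1 t] q by simp
  have cp2: "- of_real (modq k) * (sinh (circle_path (modq k) 1 t) * cosh (circle_path (modq k) 1 t))
      = circ t * root_out (modq k) (circ t)"
    using circle_path_sinh_cosh(2)[of "modq k" 1 t] q by simp
  show "lift k (circle_path (modq k) 1 t) = contour_point k S1 (line_loop t)"
    unfolding x_def[symmetric] by (rule *[OF cp1]) (simp only: cp2 sheet_sign.simps mult_1_left)
  have "- of_real (modq k) * (sinh (- circle_path (modq k) 1 t) * cosh (- circle_path (modq k) 1 t))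
      = - (- of_real (modq k) * (sinh (circle_path (modq k) 1 t) * cosh (circle_path (modq k) 1 t)))" by simp
  also have "\<dots> = sheet_sign S2 * (circ t * root_out (modq k) (circ t))" unfolding cp2 by simp
  finally show "lift k (- circle_path (modq k) 1 t) = contour_point k S2 (line_loop t)"
    unfolding x_def[symmetric] by (intro *) (simp_all only: zeta_of_minus cp1)
qed

section \<open>The ratio of the two boundary branches of an invertible function\<close>

text \<open>
  All four zeros are simple. At a branch point this identifies \<xi> with the local inverse that
  the definition of analyticity provides.
\<close>
lemma curve_poly_locally_injective:
  assumes k: "k > 1" and z: "curve_poly k \<xi>0 = 0"
  obtains r where "r > 0" "inj_on (curve_poly k) (ball \<xi>0 r)"
proof -
  have h: "curve_poly k holomorphic_on UNIV" unfolding curve_poly_def by (intro holomorphic_intros)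
  have "(curve_poly k has_field_derivative 2 * \<xi>0 * (1 + (of_real k)\<^sup>2 + 2 * \<xi>0\<^sup>2)) (at \<xi>0)"
    unfolding curve_poly_def by (auto intro!: derivative_eq_intros simp: algebra_simps power2_eq_square)
  hence d: "deriv (curve_poly k) \<xi>0 = 2 * \<xi>0 * (1 + (of_real k)\<^sup>2 + 2 * \<xi>0\<^sup>2)" by (rule DERIV_imp_deriv)
  have "\<xi>0\<^sup>2 = -1 \<or> \<xi>0\<^sup>2 = - ((of_real k)\<^sup>2)"
    using z by (simp add: curve_poly_def add_eq_0_iff add_eq_0_iff2)
  moreover have "complex_of_real (k\<^sup>2) \<noteq> 1" "complex_of_real (k\<^sup>2) \<noteq> 0"
    using k one_less_power[OF k, of 2] by (metis of_real_eq_1_iff less_irrefl zero_less_numeral, simp)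
  ultimately have "2 * \<xi>0 * (1 + (of_real k)\<^sup>2 + 2 * \<xi>0\<^sup>2) \<noteq> 0" by (auto simp: algebra_simps)
  thus ?thesis
    using has_complex_derivative_locally_injective[OF h UNIV_I open_UNIV] d that by metis
qed

text \<open>
  The local section s in the definition of analyticity agrees with the coordinates of the lift
  near the point: by uniqueness of continuous square roots where \<tau> is nonzero, by local
  injectivity of the polynomial at a branch point.
\<close>
lemma analytic_lift_holomorphic:
  assumes k: "k > 1" and F: "analytic_on_surface k (surface_plus k) F"
  shows "(\<lambda>z. F (lift k z)) holomorphic_on {z. norm (zeta_of (modq k) z) < 1}"
proof -
  define \<Omega> where "\<Omega> = {z. norm (zeta_of (modq k) z) < 1}"
  define X where "X z = \<i> * (1 + zeta_of (modq k) z) / (1 - zeta_of (modq k) z)" for z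
  define Y where "Y z = lift_odd k z / (1 - zeta_of (modq k) z)\<^sup>2" for z
  have zh: "zeta_of (modq k) holomorphic_on S" for S by (rule zeta_of_holomorphic)
  have "continuous_on UNIV (zeta_of (modq k))" by (rule holomorphic_on_imp_continuous_on[OF zh])
  hence o: "open \<Omega>" unfolding \<Omega>_def by (intro open_Collect_less continuous_intros)
  have n1: "zeta_of (modq k) z \<noteq> 1" if "z \<in> \<Omega>" for z using that by (auto simp: \<Omega>_def)
  have L: "lift k z = Aff (X z) (Y z)" "(Y z)\<^sup>2 = curve_poly k (X z)" if "z \<in> \<Omega>" for z
    using lift_charts(1,3)[OF k n1[OF that]] by (simp_all add: X_def Y_def aff_point_def affine_curve_iff)
  have Xh: "X holomorphic_on \<Omega>" unfolding X_def using n1 by (intro holomorphic_intros zh) auto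
  have "lift_odd k holomorphic_on \<Omega>" unfolding lift_odd_def sinh_field_def cosh_field_def
    by (intro holomorphic_intros root_in_holomorphic zh modq_small(1)[OF k]) (auto simp: \<Omega>_def)
  hence Yh: "Y holomorphic_on \<Omega>" unfolding Y_def using n1 by (intro holomorphic_intros zh) auto
  note Xc = holomorphic_on_imp_continuous_on[OF Xh] and Yc = holomorphic_on_imp_continuous_on[OF Yh]
  have pre: "open {z \<in> \<Omega>. G z \<in> V}" if "continuous_on \<Omega> G" "open V" for G V
    using continuous_open_preimage[OF that(1) o that(2)] by (simp add: vimage_def Int_def)
  have "(\<lambda>z. F (lift k z)) field_differentiable (at z0)" if z0: "z0 \<in> \<Omega>" for z0
  proof -
    have "lift k z0 \<in> surface_plus k" using lift_in_closed_half(1)[OF k] z0 by (simp add: \<Omega>_def)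
    hence a: "analytic_at_point k F (Aff (X z0) (Y z0))"
      using F L(1)[OF z0] unfolding analytic_on_surface_def by metis
    have conclude: ?thesis
      if "open V" "z0 \<in> V" "V \<subseteq> \<Omega>" "G holomorphic_on V" "\<And>z. z \<in> V \<Longrightarrow> F (lift k z) = G z" for V G
    proof -
      have "(\<lambda>z. F (lift k z)) holomorphic_on V" by (rule holomorphic_transform[OF that(4)]) (simp add: that(5))
      thus ?thesis using that(1,2) holomorphic_on_imp_differentiable_at by blast
    qed
    show ?thesis
    proof (cases "Y z0 = 0")
      case False
      then obtain U s where U: "open U" "X z0 \<in> U" "s holomorphic_on U" "s (X z0) = Y z0"
        "\<And>\<xi>. \<xi> \<in> U \<Longrightarrow> (s \<xi>)\<^sup>2 = curve_poly k \<xi>" "(\<lambda>\<xi>. F (Aff \<xi> (s \<xi>))) holomorphic_on U"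
        using a by auto
      have "open ({z \<in> \<Omega>. X z \<in> U} \<inter> {z \<in> \<Omega>. Y z \<in> - {0}})"
        by (intro open_Int pre Xc Yc U(1)) auto
      moreover have "z0 \<in> {z \<in> \<Omega>. X z \<in> U} \<inter> {z \<in> \<Omega>. Y z \<in> - {0}}" using z0 U(2) False by auto
      ultimately obtain e where e: "e > 0" "ball z0 e \<subseteq> {z \<in> \<Omega>. X z \<in> U} \<inter> {z \<in> \<Omega>. Y z \<in> - {0}}"
        by (meson openE)
      have eq: "s (X z) = Y z" if "z \<in> ball z0 e" for z
      proof (rule square_roots_agree[where S = "ball z0 e" and ?z0.0 = z0 and f = "\<lambda>z. s (X z)" and g = Y])
        show "continuous_on (ball z0 e) (\<lambda>z. s (X z))"
          by (rule continuous_on_compose2[OF holomorphic_on_imp_continuous_on[OF U(3)] continuous_on_subset[OF Xc]])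
            (use e(2) in auto)
        show "continuous_on (ball z0 e) Y" by (rule continuous_on_subset[OF Yc]) (use e(2) in auto)
        show "(s (X z))\<^sup>2 = (Y z)\<^sup>2" "Y z \<noteq> 0" if "z \<in> ball z0 e" for z
          using e(2) that U(5) L(2) by auto
      qed (use e(1) U(4) that in auto)
      have "((\<lambda>\<xi>. F (Aff \<xi> (s \<xi>))) \<circ> X) holomorphic_on ball z0 e"
        by (rule holomorphic_on_compose_gen[OF holomorphic_on_subset[OF Xh] U(6)]) (use e(2) in auto)
      thus ?thesis
        by (rule conclude[of "ball z0 e", rotated 3]) (use e eq L(1) in auto)
    next
      case True
      then obtain U s where U: "open U" "0 \<in> U" "s holomorphic_on U" "s 0 = X z0"
        "\<And>\<tau>. \<tau> \<in> U \<Longrightarrow> \<tau>\<^sup>2 = curve_poly k (s \<tau>)" "(\<lambda>\<tau>. F (Aff (s \<tau>) \<tau>)) holomorphic_on U"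
        using a by auto
      have "curve_poly k (X z0) = 0" using L(2)[OF z0] True by simp
      then obtain r where r: "r > 0" "inj_on (curve_poly k) (ball (X z0) r)"
        by (rule curve_poly_locally_injective[OF k])
      have "open {\<tau> \<in> U. s \<tau> \<in> ball (X z0) r}"
        using continuous_open_preimage[OF holomorphic_on_imp_continuous_on[OF U(3)] U(1) open_ball]
        by (simp add: vimage_def Int_def)
      hence "open ({z \<in> \<Omega>. X z \<in> ball (X z0) r} \<inter> {z \<in> \<Omega>. Y z \<in> {\<tau> \<in> U. s \<tau> \<in> ball (X z0) r}})"
        by (intro open_Int pre Xc Yc) auto
      moreover have "z0 \<in> {z \<in> \<Omega>. X z \<in> ball (X z0) r} \<inter> {z \<in> \<Omega>. Y z \<in> {\<tau> \<in> U. s \<tau> \<in> ball (X z0) r}}"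
        using z0 U(2,4) True r(1) by simp
      ultimately obtain e where e: "e > 0"
        "ball z0 e \<subseteq> {z \<in> \<Omega>. X z \<in> ball (X z0) r} \<inter> {z \<in> \<Omega>. Y z \<in> {\<tau> \<in> U. s \<tau> \<in> ball (X z0) r}}"
        by (meson openE)
      have eq: "s (Y z) = X z" if "z \<in> ball z0 e" for z
      proof -
        have z: "z \<in> \<Omega>" "X z \<in> ball (X z0) r" "Y z \<in> U" "s (Y z) \<in> ball (X z0) r" using e(2) that by auto
        have "curve_poly k (s (Y z)) = curve_poly k (X z)" using U(5)[OF z(3)] L(2)[OF z(1)] by simp
        thus ?thesis using inj_onD[OF r(2) _ z(4,2)] by simp
      qed
      have "((\<lambda>\<tau>. F (Aff (s \<tau>) \<tau>)) \<circ> Y) holomorphic_on ball z0 e"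
        by (rule holomorphic_on_compose_gen[OF holomorphic_on_subset[OF Yh] U(6)]) (use e(2) in auto)
      thus ?thesis
        by (rule conclude[of "ball z0 e", rotated 3]) (use e eq L(1) in auto)
    qed
  qed
  thus ?thesis using o unfolding \<Omega>_def[symmetric] by (simp add: holomorphic_on_open field_differentiable_def)
qed

text \<open>
  The extension of F has no zeros: its product with the extension of the inverse is 1 on the
  boundary, hence everywhere by the maximum principle. The lift therefore has a logarithm on the
  strip.
\<close>
lemma invertible_ratio:
  assumes k: "k > 1" and F: "F \<in> invertibles k (holder_plus k \<mu>)"
  obtains a :: int and D where "continuous_on {0..1} D" "D 0 = D 1"
    "integral {0..1} (\<lambda>t. D t * of_real (weight (modq k) t)) = 0"
    "\<And>t. t \<in> {0..1} \<Longrightarrow> F (contour_point k S1 (line_loop t)) / F (contour_point k S2 (line_loop t))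
       = exp (D t + 4 * of_int a * circle_path (modq k) 1 t)"
proof -
  define q where "q = modq k"
  have q: "0 < q" "q < 1" using modq[OF k] by (auto simp: q_def)
  have ext: "\<exists>E. (\<forall>P\<in>Gamma_curve k. E P = f P) \<and> (\<lambda>z. E (lift k z)) holomorphic_on {z. norm (zeta_of q z) < 1}
      \<and> continuous_on {z. norm (zeta_of q z) \<le> 1} (\<lambda>z. E (lift k z))" if f: "f \<in> holder_plus k \<mu>" for f
  proof -
    obtain E where E: "\<forall>P\<in>Gamma_curve k. E P = f P"
      "continuous_map (subtopology (surface_top k) (closed_half k)) euclidean E" "analytic_on_surface k (surface_plus k) E"
      using f unfolding holder_plus_def extendable_def closed_half_def by blast
    have "continuous_map (top_of_set {z. norm (zeta_of q z) \<le> 1}) euclidean (E \<circ> lift k)"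
      using continuous_map_compose[OF lift_continuous[OF k] E(2)] by (simp add: q_def)
    hence "continuous_on {z. norm (zeta_of q z) \<le> 1} (\<lambda>z. E (lift k z))" by (simp add: o_def)
    thus ?thesis using E(1) analytic_lift_holomorphic[OF k E(3)] by (auto simp: q_def)
  qed
  obtain G where G: "F \<in> holder_plus k \<mu>" "G \<in> holder_plus k \<mu>" "\<forall>P\<in>Gamma_curve k. F P * G P = 1"
    using F unfolding invertibles_def by blast
  obtain E where E: "\<forall>P\<in>Gamma_curve k. E P = F P" "(\<lambda>z. E (lift k z)) holomorphic_on {z. norm (zeta_of q z) < 1}"
    "continuous_on {z. norm (zeta_of q z) \<le> 1} (\<lambda>z. E (lift k z))" using ext[OF G(1)] by blast
  obtain E' where E': "\<forall>P\<in>Gamma_curve k. E' P = G P" "(\<lambda>z. E' (lift k z)) holomorphic_on {z. norm (zeta_of q z) < 1}"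
    "continuous_on {z. norm (zeta_of q z) \<le> 1} (\<lambda>z. E' (lift k z))" using ext[OF G(2)] by blast
  define R where "R = 1 / sqrt q"
  have R: "R > 1" using q by (simp add: R_def)
  have S: "sinh_strip R = {z. norm (zeta_of q z) < 1}" "{z. norm (sinh z) \<le> R} = {z. norm (zeta_of q z) \<le> 1}"
    unfolding sinh_strip_def sinh_bound_zeta[OF q(1) R_def] by auto
  have bd: "norm (zeta_of q z) = 1" if "norm (sinh z) = R" for z
    using sinh_bound_zeta[OF q(1) R_def, of z] that by linarith
  have one: "E (lift k z) * E' (lift k z) = 1" if z: "norm (zeta_of q z) \<le> 1" for z
  proof (cases "norm (zeta_of q z) = 1")
    case True
    thus ?thesis using lift_in_closed_half(3)[OF k] E(1) E'(1) G(3) by (auto simp: q_def)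
  next
    case False
    have "E (lift k z) * E' (lift k z) - 1 = 0"
    proof (rule periodic_boundary_zero[OF R, of "\<lambda>z. E (lift k z) * E' (lift k z) - 1"])
      show "(\<lambda>z. E (lift k z) * E' (lift k z) - 1) holomorphic_on sinh_strip R"
        unfolding S by (intro holomorphic_intros E E')
      show "continuous_on {z. norm (sinh z) \<le> R} (\<lambda>z. E (lift k z) * E' (lift k z) - 1)"
        unfolding S by (intro continuous_intros E E')
      show "E (lift k z) * E' (lift k z) - 1 = 0" if "norm (sinh z) = R" for z
        using bd[OF that] lift_in_closed_half(3)[OF k] E(1) E'(1) G(3) by (auto simp: q_def)
      show "z \<in> sinh_strip R" using z False by (simp add: S)
    qed simp
    thus ?thesis by simp
  qed
  have nz: "E (lift k z) \<noteq> 0" if "norm (zeta_of q z) \<le> 1" for z using one[OF that] by auto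
  obtain a :: int and D where D: "continuous_on {0..1} D" "D 0 = D 1"
    "integral {0..1} (\<lambda>t. D t * of_real (weight q t)) = 0"
    "\<And>t. t \<in> {0..1} \<Longrightarrow> E (lift k (circle_path q 1 t)) / E (lift k (- circle_path q 1 t)) = exp (D t + 4 * of_int a * circle_path q 1 t)"
    by (rule ratio_logarithm[OF q E(2,3) nz]) auto
  have c: "contour_point k j x \<in> Gamma_curve k" for j x
    unfolding Gamma_curve_def contour_eq[OF k] by (cases j) auto
  show ?thesis
  proof (rule that[OF D(1,2)])
    show "integral {0..1} (\<lambda>t. D t * of_real (weight (modq k) t)) = 0" using D(3) by (simp add: q_def)
    show "F (contour_point k S1 (line_loop t)) / F (contour_point k S2 (line_loop t))
       = exp (D t + 4 * of_int a * circle_path (modq k) 1 t)" if "t \<in> {0..1}" for t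
      using D(4)[OF that] lift_circle_path[OF k that] E(1) c by (simp add: q_def)
  qed
qed

section \<open>Complete elliptic integrals as periods\<close>

text \<open>
  The substitution rule in the form needed for elliptic integrals: f may be singular at the end
  points, where only the transformed integrand is continuous.
\<close>
lemma integral_substitution_decreasing:
  fixes f g g' w :: "real \<Rightarrow> real"
  assumes ab: "a < b" and cont: "continuous_on {a..b} g"
    and der: "\<And>t. a < t \<Longrightarrow> t < b \<Longrightarrow> (g has_real_derivative g' t) (at t)"
    and neg: "\<And>t. a < t \<Longrightarrow> t < b \<Longrightarrow> g' t < 0"
    and w: "continuous_on {a..b} w" "\<And>t. a < t \<Longrightarrow> t < b \<Longrightarrow> \<bar>g' t\<bar> * f (g t) = w t"
  shows "integral {g b..g a} f = integral {a..b} w"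
proof -
  have dec: "g y < g x" if "a \<le> x" "x < y" "y \<le> b" for x y
  proof (rule DERIV_neg_imp_decreasing_open[OF that(2)])
    show "continuous_on {x..y} g" by (rule continuous_on_subset[OF cont]) (use that in auto)
    show "\<exists>m. (g has_real_derivative m) (at t) \<and> m < 0" if "x < t" "t < y" for t
    proof -
      have "a < t" "t < b" using that \<open>a \<le> x\<close> \<open>y \<le> b\<close> by linarith+
      thus ?thesis using der neg by blast
    qed
  qed
  have im: "g ` {a<..<b} = {g b<..<g a}"
  proof
    show "g ` {a<..<b} \<subseteq> {g b<..<g a}"
    proof
      fix y assume "y \<in> g ` {a<..<b}"
      then obtain t where t: "a < t" "t < b" "y = g t" by auto
      have "g b < g t" "g t < g a" by (rule dec; use t in linarith)+
      thus "y \<in> {g b<..<g a}" by (simp add: t(3))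
    qed
    show "{g b<..<g a} \<subseteq> g ` {a<..<b}"
    proof
      fix y assume y: "y \<in> {g b<..<g a}"
      then obtain x where x: "a \<le> x" "x \<le> b" "g x = y"
        using IVT2'[of g b y a, OF _ _ less_imp_le[OF ab] cont] y by (metis greaterThanLessThan_iff less_imp_le)
      have "x \<noteq> a" "x \<noteq> b" using y x(3) by force+
      hence "x \<in> {a<..<b}" using x by simp
      thus "y \<in> g ` {a<..<b}" using x(3) by blast
    qed
  qed
  have inj: "inj_on g {a<..<b}"
  proof (rule linorder_inj_onI)
    show "g x \<noteq> g y" if "x < y" "x \<in> {a<..<b}" "y \<in> {a<..<b}" for x y
      using dec[of x y] that by auto
  qed auto
  have "w absolutely_integrable_on {a..b}" by (rule absolutely_integrable_continuous_real[OF w(1)])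
  hence wa: "w absolutely_integrable_on {a<..<b}"
    by (rule set_integrable_subset) auto
  have e: "\<bar>g' t\<bar> * f (g t) = w t" if "t \<in> {a<..<b}" for t using w(2) that by auto
  have "(\<lambda>t. \<bar>g' t\<bar> * f (g t)) absolutely_integrable_on {a<..<b}"
    using set_integrable_cong[OF refl refl, of "{a<..<b}" "\<lambda>t. \<bar>g' t\<bar> * f (g t)" w lebesgue] e wa by blast
  moreover have "integral {a<..<b} (\<lambda>t. \<bar>g' t\<bar> * f (g t)) = integral {a<..<b} w"
    by (rule integral_cong) (rule e)
  moreover have "(g has_field_derivative g' t) (at t within {a<..<b})" if "t \<in> {a<..<b}" for t
    by (rule has_field_derivative_at_within) (use der that in auto)
  moreover have "{a<..<b} \<in> sets lebesgue" by simp
  ultimately have "integral (g ` {a<..<b}) f = integral {a<..<b} w"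
    using has_absolute_integral_change_of_variables_1'[of "{a<..<b}" g g' f "integral {a<..<b} w"] inj by blast
  thus ?thesis unfolding im by (simp add: integral_open_interval_real)
qed

lemma norm_circ_modulus: "(norm (1 - of_real q * circ t))\<^sup>2 = 1 + q\<^sup>2 - 2 * q * cos (2 * pi * t)"
proof -
  have "(norm (1 - of_real q * circ t))\<^sup>2 = (1 - q * cos (2 * pi * t))\<^sup>2 + (q * sin (2 * pi * t))\<^sup>2"
    unfolding circ_cis cmod_power2 by simp
  also have "\<dots> = 1 - 2 * q * cos (2 * pi * t) + q\<^sup>2 * ((sin (2 * pi * t))\<^sup>2 + (cos (2 * pi * t))\<^sup>2)"
    by (simp only: power2_diff power_mult_distrib distrib_left) simp
  finally show ?thesis by simp
qed

lemma weight_half_integral: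
  assumes q: "0 < q" "q < 1"
  shows "integral {0..1} (weight q) = 2 * integral {0..1/2} (weight q)"
proof -
  have i: "weight q integrable_on {a..b}" for a b :: real
    by (intro integrable_continuous_real weight_continuous[OF q])
  have "integral {0..1} (weight q) = integral {0..1/2} (weight q) + integral {1/2..1} (weight q)"
    by (subst Henstock_Kurzweil_Integration.integral_combine[symmetric, of 0 "1/2" 1]) (auto intro: i)
  also have "integral {1/2..1} (weight q) = integral {0..1/2} (weight q)"
  proof -
    have "((\<lambda>x. weight q (-1 * x + 1)) has_integral integral {1/2..1} (weight q) /\<^sub>R \<bar>-1\<bar> ^ DIM(real))
        ((\<lambda>x. (1 / -1) *\<^sub>R x + - ((1 / -1) *\<^sub>R 1)) ` cbox (1/2) 1)"
      using has_integral_affinity[of "weight q" "integral {1/2..1} (weight q)" "1/2" 1 "-1" 1] i by auto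
    moreover have "(\<lambda>x. (1 / -1) *\<^sub>R x + - ((1 / -1) *\<^sub>R 1)) ` cbox (1/2) 1 = {0..1/2::real}"
    proof -
      have "(\<lambda>x. (1 / -1) *\<^sub>R x + - ((1 / -1) *\<^sub>R 1)) = (\<lambda>x::real. 1 - x)" by auto
      thus ?thesis by (simp add: image_diff_atLeastAtMost)
    qed
    moreover have "weight q (-1 * x + 1) = weight q x" for x using weight_flip[of q x] by simp
    ultimately have "(weight q has_integral integral {1/2..1} (weight q)) {0..1/2}" by simp
    thus ?thesis by (simp add: integral_unique)
  qed
  finally show ?thesis by simp
qed

lemma modq_relations:
  assumes k: "k > 1"
  shows "1 + modq k = 2 * k / (1 + k)" "k * (1 - modq k) = 1 + modq k" "k\<^sup>2 * (1 - modq k)\<^sup>2 = (1 + modq k)\<^sup>2"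
proof -
  show "1 + modq k = 2 * k / (1 + k)" using k by (simp add: modq_def field_simps)
  show *: "k * (1 - modq k) = 1 + modq k" using k by (simp add: modq_def field_simps)
  show "k\<^sup>2 * (1 - modq k)\<^sup>2 = (1 + modq k)\<^sup>2" unfolding *[symmetric] by (simp add: power_mult_distrib)
qed

text \<open>
  On the upper semicircle x = (1 + q)/|1 - q\<zeta>| decreases from k to 1, and it turns the
  weight into the integrand of K'.
\<close>
lemma weight_integral:
  assumes k: "k > 1"
  shows "integral {0..1} (weight (modq k)) = (1 + k) * ell_K' k / (pi * k)"
proof -
  define q where "q = modq k"
  have q: "0 < q" "q < 1" using modq[OF k] by (auto simp: q_def)
  define c where "c = 1 + q"
  have c: "c > 0" "k * (1 - q) = c" "k\<^sup>2 * (1 - q)\<^sup>2 = c\<^sup>2" using q modq_relations[OF k] by (auto simp: c_def q_def)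
  define N where "N t = 1 + q\<^sup>2 - 2 * q * cos (2 * pi * t)" for t
  have N: "N t > 0" for t
  proof -
    have "1 - of_real q * circ t \<noteq> 0"
    proof
      assume "1 - of_real q * circ t = 0"
      hence "norm (of_real q * circ t) = 1" by (metis eq_iff_diff_eq_0 norm_one)
      thus False using q by (simp add: norm_mult)
    qed
    hence "(norm (1 - of_real q * circ t))\<^sup>2 > 0" by simp
    thus ?thesis unfolding norm_circ_modulus N_def .
  qed
  have W: "weight q t = 1 / sqrt (N t)" for t
    unfolding weight_def N_def norm_circ_modulus[symmetric] by simp
  define g where "g t = c / sqrt (N t)" for t
  define g' where "g' t = - (c * (2 * pi * q * sin (2 * pi * t)) / (N t * sqrt (N t)))" for t
  define f where "f x = 1 / sqrt ((x\<^sup>2 - 1) * (1 - x\<^sup>2 / k\<^sup>2))" for x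
  have sp: "sin (2 * pi * t) > 0" if "0 < t" "t < 1/2" for t
    using that by (intro sin_gt_zero) auto
  have "integral {g (1/2)..g 0} f = integral {0..1/2} (\<lambda>t. c * pi * weight q t)"
  proof (rule integral_substitution_decreasing)
    show "continuous_on {0..1/2} g" unfolding g_def using N
      by (intro continuous_intros) (auto simp: N_def less_imp_neq[THEN not_sym] intro!: continuous_intros)
    show "continuous_on {0..1/2} (\<lambda>t. c * pi * weight q t)" by (intro continuous_intros weight_continuous[OF q])
    fix t :: real assume t: "0 < t" "t < 1/2"
    have "(N has_real_derivative 4 * pi * q * sin (2 * pi * t)) (at t)"
      unfolding N_def by (auto intro!: derivative_eq_intros)
    from DERIV_divide[OF DERIV_const DERIV_chain2[OF DERIV_real_sqrt[OF N] this], of c] N[of t]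
    show "(g has_real_derivative g' t) (at t)"
      unfolding g_def g'_def by (auto elim!: DERIV_cong simp: divide_simps)
    show "g' t < 0" using N[of t] sp[OF t] q c(1) by (simp add: g'_def)
    show "\<bar>g' t\<bar> * f (g t) = c * pi * weight q t"
    proof -
      define C S where "C = cos (2 * pi * t)" and "S = sin (2 * pi * t)"
      have S: "S > 0" using sp[OF t] by (simp add: S_def)
      have SC: "(1 + C) * (1 - C) = S\<^sup>2"
        using sin_cos_squared_add[of "2 * pi * t"] by (simp add: C_def S_def algebra_simps power2_eq_square)
      have x2: "(g t)\<^sup>2 = c\<^sup>2 / N t" using N[of t] by (simp add: g_def power_divide)
      have n1: "c\<^sup>2 - N t = 2 * q * (1 + C)" by (simp add: c_def N_def C_def power2_eq_square algebra_simps)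
      have n2: "k\<^sup>2 * N t - c\<^sup>2 = k\<^sup>2 * (2 * q * (1 - C))"
        unfolding c(3)[symmetric] by (simp add: N_def C_def power2_eq_square algebra_simps)
      have "((g t)\<^sup>2 - 1) * (1 - (g t)\<^sup>2 / k\<^sup>2) = (c\<^sup>2 - N t) / N t * ((k\<^sup>2 * N t - c\<^sup>2) / (k\<^sup>2 * N t))"
        unfolding x2 using N[of t] k by (simp add: diff_divide_distrib)
      also have "\<dots> = (2 * q)\<^sup>2 * ((1 + C) * (1 - C)) / (N t)\<^sup>2"
        unfolding n1 n2 using N[of t] k by (simp add: power2_eq_square)
      also have "\<dots> = (2 * q * S / N t)\<^sup>2" unfolding SC by (simp add: power_divide power_mult_distrib)
      finally have "sqrt (((g t)\<^sup>2 - 1) * (1 - (g t)\<^sup>2 / k\<^sup>2)) = 2 * q * S / N t"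
        using q S N[of t] by simp
      hence f: "f (g t) = N t / (2 * q * S)" by (simp add: f_def)
      have "\<bar>g' t\<bar> = c * (2 * pi * q * S) / (N t * sqrt (N t))"
        using N[of t] S q c(1) by (simp add: g'_def S_def abs_mult)
      thus ?thesis unfolding f W using q S N[of t] by (simp add: divide_simps)
    qed
  qed simp
  moreover have "g 0 = k"
  proof -
    have "N 0 = (1 - q)\<^sup>2" by (simp add: N_def power2_eq_square algebra_simps)
    thus ?thesis using q c(2) by (simp add: g_def field_simps)
  qed
  moreover have "g (1/2) = 1"
  proof -
    have "N (1/2) = (1 + q)\<^sup>2" by (simp add: N_def power2_eq_square algebra_simps)
    thus ?thesis using q by (simp add: g_def c_def)
  qed
  ultimately have "ell_K' k = c * pi * integral {0..1/2} (weight q)" by (simp add: ell_K'_def f_def[abs_def])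
  moreover have "integral {0..1} (weight q) = 2 * integral {0..1/2} (weight q)" by (rule weight_half_integral[OF q])
  moreover have "c = 2 * k / (1 + k)" using modq_relations(1)[OF k] by (simp add: c_def q_def)
  ultimately show ?thesis using k by (simp add: q_def field_simps)
qed

text \<open>
  The substitution x = k(1 - \<zeta>)/(1 + \<zeta>) with \<zeta> = q cosh^2 u, that is x =
  ik/\<xi>: on the imaginary axis beyond the branch point ik the holomorphic differential becomes
  the integrand of K.
\<close>
lemma ell_K_substitution:
  assumes k: "k > 1"
  defines "q \<equiv> modq k"
  defines "X \<equiv> ln ((1 + sqrt (1 - q)) / sqrt q)"
  shows "integral {0..X} (\<lambda>x. 1 / sqrt (1 - (q * cosh x)\<^sup>2)) = (1 + k) * ell_K k / (2 * k)"
proof -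
  have q: "0 < q" "q < 1" using modq[OF k] by (auto simp: q_def)
  note X = cosh_ln_ratio[OF q, folded X_def]
  define z where "z u = q * (cosh u)\<^sup>2" for u
  have z0: "z u > 0" for u using q by (simp add: z_def)
  have zX: "z X = 1" using q by (simp add: z_def X(1) power_divide)
  define g where "g u = k * (1 - z u) / (1 + z u)" for u
  define g' where "g' u = - (2 * k * (2 * q * cosh u * sinh u) / (1 + z u)\<^sup>2)" for u
  define f where "f x = 1 / sqrt ((1 - x\<^sup>2) * (1 - x\<^sup>2 / k\<^sup>2))" for x
  have qc: "(q * cosh u)\<^sup>2 < 1" if "0 \<le> u" "u \<le> X" for u
  proof -
    have "cosh u \<le> cosh X" using that by (simp add: cosh_real_nonneg_le_iff)
    hence "q * cosh u \<le> q * (1 / sqrt q)" unfolding X(1) using q by (intro mult_left_mono) auto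
    also have "\<dots> = sqrt q" using q by (simp add: real_div_sqrt)
    also have "\<dots> < 1" using q by simp
    finally show ?thesis using q by (intro abs_square_less_1[THEN iffD2]) (simp add: abs_mult)
  qed
  have "integral {g X..g 0} f = integral {0..X} (\<lambda>u. 2 * k / (1 + k) * (1 / sqrt (1 - (q * cosh u)\<^sup>2)))"
  proof (rule integral_substitution_decreasing[OF X(2)])
    show "continuous_on {0..X} g" unfolding g_def using z0
      by (intro continuous_intros) (auto simp: z_def intro!: continuous_intros simp: add_pos_pos less_imp_neq[THEN not_sym])
    show "continuous_on {0..X} (\<lambda>u. 2 * k / (1 + k) * (1 / sqrt (1 - (q * cosh u)\<^sup>2)))"
      using qc k by (intro continuous_intros) (auto simp: less_imp_neq)
    fix u :: real assume u: "0 < u" "u < X"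
    have s: "sinh u > 0" using u by simp
    have zd: "(z has_real_derivative 2 * q * cosh u * sinh u) (at u)"
      unfolding z_def by (auto intro!: derivative_eq_intros)
    have n: "1 + z u \<noteq> 0" using z0[of u] by linarith
    have "(g has_real_derivative ((k * (0 - 2 * q * cosh u * sinh u)) * (1 + z u) - (k * (1 - z u)) * (0 + 2 * q * cosh u * sinh u)) / ((1 + z u) * (1 + z u))) (at u)"
      unfolding g_def by (intro DERIV_divide DERIV_cmult DERIV_diff DERIV_add DERIV_const zd n)
    also have "((k * (0 - 2 * q * cosh u * sinh u)) * (1 + z u) - (k * (1 - z u)) * (0 + 2 * q * cosh u * sinh u)) / ((1 + z u) * (1 + z u)) = g' u"
    proof -
      have "(k * (0 - d)) * (1 + x) - (k * (1 - x)) * (0 + d) = - (2 * k * d)" for d x by (simp add: algebra_simps)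
      thus ?thesis by (simp add: g'_def power2_eq_square)
    qed
    finally show "(g has_real_derivative g' u) (at u)" .
    show "g' u < 0" using s q k z0[of u] by (simp add: g'_def add_pos_pos)
    show "\<bar>g' u\<bar> * f (g u) = 2 * k / (1 + k) * (1 / sqrt (1 - (q * cosh u)\<^sup>2))"
    proof -
      define M where "M = (1 + z u)\<^sup>2"
      have M: "M > 0" using n by (simp add: M_def)
      have x2: "(g u)\<^sup>2 = k\<^sup>2 * (1 - z u)\<^sup>2 / M" by (simp add: g_def M_def power_divide power_mult_distrib)
      have a: "1 - (g u)\<^sup>2 / k\<^sup>2 = 4 * z u / M"
      proof -
        have "1 - (g u)\<^sup>2 / k\<^sup>2 = (M - (1 - z u)\<^sup>2) / M" unfolding x2 using M k by (simp add: field_simps)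
        also have "M - (1 - z u)\<^sup>2 = 4 * z u" by (simp add: M_def power2_eq_square algebra_simps)
        finally show ?thesis .
      qed
      have kq: "(1 + k) * q = k - 1" using k by (simp add: q_def modq_def add.commute)
      have b: "1 - (g u)\<^sup>2 = (1 + k)\<^sup>2 * (q * (sinh u)\<^sup>2) * (1 - (q * cosh u)\<^sup>2) / M"
      proof -
        have "1 - (g u)\<^sup>2 = (M - k\<^sup>2 * (1 - z u)\<^sup>2) / M" unfolding x2 using M by (simp add: field_simps)
        also have "M - k\<^sup>2 * (1 - z u)\<^sup>2 = ((1 + k) * z u - (k - 1)) * ((1 + k) - (k - 1) * z u)"
          by (simp add: M_def power2_eq_square algebra_simps)
        also have "\<dots> = (1 + k)\<^sup>2 * (z u - q) * (1 - q * z u)"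
          unfolding kq[symmetric] by (simp add: power2_eq_square algebra_simps)
        also have "z u - q = q * (sinh u)\<^sup>2" by (simp add: z_def cosh_square_eq algebra_simps)
        also have "q * z u = (q * cosh u)\<^sup>2" by (simp add: z_def power2_eq_square)
        finally show ?thesis .
      qed
      have "(1 - (g u)\<^sup>2) * (1 - (g u)\<^sup>2 / k\<^sup>2) = (2 * (1 + k) * q * sinh u * cosh u / M)\<^sup>2 * (1 - (q * cosh u)\<^sup>2)"
      proof -
        have "K\<^sup>2 * (q * S\<^sup>2) * r / M * (4 * (q * C\<^sup>2) / M) = (2 * K * q * S * C / M)\<^sup>2 * r" for K S C r
          by (simp add: power2_eq_square)
        thus ?thesis unfolding a b z_def .
      qed
      hence "sqrt ((1 - (g u)\<^sup>2) * (1 - (g u)\<^sup>2 / k\<^sup>2)) = 2 * (1 + k) * q * sinh u * cosh u / M * sqrt (1 - (q * cosh u)\<^sup>2)"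
        using q k s M by (simp add: real_sqrt_mult)
      hence f: "f (g u) = 1 / (2 * (1 + k) * q * sinh u * cosh u / M * sqrt (1 - (q * cosh u)\<^sup>2))" by (simp add: f_def)
      have g: "\<bar>g' u\<bar> = 2 * k * (2 * q * cosh u * sinh u) / M"
        using s q k by (simp add: g'_def M_def abs_mult)
      have "2 * k * (2 * q * C * S) / M * (1 / (2 * K * q * S * C / M * r)) = 2 * k / K * (1 / r)"
        if "q \<noteq> 0" "C \<noteq> 0" "S \<noteq> 0" "M \<noteq> 0" for C S K r using that by (simp add: divide_simps)
      thus ?thesis unfolding f g by this (use q s M in auto)
    qed
  qed
  moreover have "g X = 0" by (simp add: g_def zX)
  moreover have "g 0 = 1" using modq_relations(2)[OF k] q by (simp add: g_def z_def q_def)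
  moreover have "integral {0..X} (\<lambda>u. 2 * k / (1 + k) * (1 / sqrt (1 - (q * cosh u)\<^sup>2)))
      = 2 * k / (1 + k) * integral {0..X} (\<lambda>x. 1 / sqrt (1 - (q * cosh x)\<^sup>2))" by (rule integral_mult_right)
  ultimately have "ell_K k = 2 * k / (1 + k) * integral {0..X} (\<lambda>x. 1 / sqrt (1 - (q * cosh x)\<^sup>2))"
    by (simp only: ell_K_def f_def[abs_def])
  thus ?thesis using k by simp
qed

text \<open>The substitution \<xi> = -cot(\<pi>t), where \<zeta> = exp(2\<pi>it).\<close>
lemma Gamma_integral_circle:
  fixes h :: "real \<Rightarrow> complex"
  assumes k: "k > 1" and H: "continuous_on {0..1} H" "\<And>t. 0 < t \<Longrightarrow> t < 1 \<Longrightarrow> h (- cot (pi * t)) = H t"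
  shows "integral UNIV (\<lambda>x. h x / rho k (of_real x))
     = of_real (2 * pi / (1 + k)) * integral {0..1} (\<lambda>t. H t * of_real (weight (modq k) t))"
proof -
  have q: "0 < modq k" "modq k < 1" using modq[OF k] by auto
  let ?S = "{0<..<1::real}"
  define g where "g t = - cot (pi * t)" for t
  define w where "w t = of_real (2 * pi / (1 + k)) * (H t * of_real (weight (modq k) t))" for t
  define f where "f x = h x / rho k (of_real x)" for x
  have sp: "sin (pi * t) > 0" if "t \<in> ?S" for t using that by (intro sin_gt_zero) auto
  have der: "(g has_field_derivative pi / (sin (pi * t))\<^sup>2) (at t within ?S)" if t: "t \<in> ?S" for t
  proof -
    have "(g has_field_derivative - (- inverse ((sin (pi * t))\<^sup>2) * pi)) (at t)"
      unfolding g_def by (rule DERIV_minus, rule DERIV_chain2[OF DERIV_cot]) (use sp[OF t] in \<open>auto intro!: derivative_eq_intros\<close>)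
    moreover have "- (- inverse ((sin (pi * t))\<^sup>2) * pi) = pi / (sin (pi * t))\<^sup>2" by (simp add: field_simps)
    ultimately have "(g has_field_derivative pi / (sin (pi * t))\<^sup>2) (at t)" by (simp only:)
    thus ?thesis by (rule has_field_derivative_at_within)
  qed
  have ll: "line_loop t = Some (g t)" if "t \<in> ?S" for t using that by (simp add: line_loop_def g_def)
  have inj: "inj_on g ?S"
  proof
    fix s t assume st: "s \<in> ?S" "t \<in> ?S" "g s = g t"
    hence "circ s = circ t" using cayley_line_loop[of s] cayley_line_loop[of t] ll by simp
    hence s0: "sin (pi * (s - t)) = 0" using norm_circ_diff[of s t] by simp
    have "sin (pi * \<bar>s - t\<bar>) = 0"
    proof (cases "s \<ge> t")
      case False
      hence "pi * \<bar>s - t\<bar> = - (pi * (s - t))" by (simp add: algebra_simps)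
      thus ?thesis using s0 by (simp only: sin_minus)
    qed (use s0 in simp)
    moreover have "sin (pi * \<bar>s - t\<bar>) > 0" if "s \<noteq> t"
      using st that by (intro sin_gt_zero) auto
    ultimately show "s = t" by fastforce
  qed
  have im: "g ` ?S = UNIV"
  proof -
    have "x \<in> g ` ?S" for x
    proof -
      define t where "t = (pi / 2 + arctan x) / pi"
      have "t \<in> ?S" using arctan_bounded[of x] by (auto simp: t_def field_simps)
      moreover have "g t = x"
        using tan_arctan[of x] by (simp add: g_def t_def cot_def sin_add cos_add tan_def)
      ultimately show ?thesis by blast
    qed
    thus ?thesis by blast
  qed
  have fw: "\<bar>pi / (sin (pi * t))\<^sup>2\<bar> *\<^sub>R f (g t) = w t" if t: "t \<in> ?S" for t
  proof -
    define y where "y = g t"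
    have y1: "1 + y\<^sup>2 = 1 / (sin (pi * t))\<^sup>2"
      using sp[OF t] sin_cos_squared_add[of "pi * t"] by (simp add: y_def g_def cot_def power_divide field_simps)
    have ct: "circ t = cayley (Some y)" using cayley_line_loop[of t] ll[OF t] t by (simp add: y_def)
    have W: "weight (modq k) t = (1 + k) * sqrt (1 + y\<^sup>2) / (2 * sqrt (k\<^sup>2 + y\<^sup>2))"
      unfolding weight_def ct one_minus_modq_cayley[OF k] using k
      by (simp only: norm_mult norm_divide norm_real_plus_i norm_of_real) simp
    have p: "sqrt (1 + y\<^sup>2) > 0" "sqrt (k\<^sup>2 + y\<^sup>2) > 0" using k by (auto simp: add_pos_nonneg)
    have "rho k (of_real y) = of_real (sqrt (1 + y\<^sup>2) * sqrt (k\<^sup>2 + y\<^sup>2))"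
      unfolding rho_of_real[OF k k] by (simp add: real_sqrt_mult)
    moreover have "\<bar>pi / (sin (pi * t))\<^sup>2\<bar> = pi * (sqrt (1 + y\<^sup>2) * sqrt (1 + y\<^sup>2))"
      using y1 by (simp add: add_nonneg_nonneg)
    ultimately have "\<bar>pi / (sin (pi * t))\<^sup>2\<bar> *\<^sub>R f y
        = of_real (pi * (sqrt (1 + y\<^sup>2) * sqrt (1 + y\<^sup>2)) / (sqrt (1 + y\<^sup>2) * sqrt (k\<^sup>2 + y\<^sup>2))) * h y"
      by (simp add: f_def scaleR_conv_of_real)
    also have "pi * (sqrt (1 + y\<^sup>2) * sqrt (1 + y\<^sup>2)) / (sqrt (1 + y\<^sup>2) * sqrt (k\<^sup>2 + y\<^sup>2)) = 2 * pi / (1 + k) * weight (modq k) t"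
    proof -
      have "pi * (A * A) / (A * B) = 2 * pi / K * (K * A / (2 * B))" if "A \<noteq> 0" "B \<noteq> 0" "K \<noteq> 0" for A B K :: real
        using that by (simp add: divide_simps)
      thus ?thesis unfolding W by this (use p k in auto)
    qed
    also have "of_real (2 * pi / (1 + k) * weight (modq k) t) * h y = w t"
      using H(2)[of t] t by (simp add: w_def y_def g_def mult_ac)
    finally show ?thesis by (simp add: y_def)
  qed
  have cw: "continuous_on {0..1} w" unfolding w_def
    by (intro continuous_intros H weight_continuous[OF q])
  have "w absolutely_integrable_on ?S"
    by (rule set_integrable_subset[OF absolutely_integrable_continuous_real[OF cw]]) auto
  hence "(\<lambda>t. \<bar>pi / (sin (pi * t))\<^sup>2\<bar> *\<^sub>R f (g t)) absolutely_integrable_on ?S"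
    using set_integrable_cong[OF refl refl, of ?S "\<lambda>t. \<bar>pi / (sin (pi * t))\<^sup>2\<bar> *\<^sub>R f (g t)" w lebesgue] fw by blast
  moreover have "integral ?S (\<lambda>t. \<bar>pi / (sin (pi * t))\<^sup>2\<bar> *\<^sub>R f (g t)) = integral ?S w"
    by (rule integral_cong) (rule fw)
  moreover have "?S \<in> sets lebesgue" by simp
  ultimately have "integral (g ` ?S) f = integral ?S w"
    using has_absolute_integral_change_of_variables_real[OF _ der inj, of f "integral ?S w"] by blast
  also have "integral ?S w = integral {0..1} w" by (simp add: integral_open_interval_real)
  also have "\<dots> = of_real (2 * pi / (1 + k)) * integral {0..1} (\<lambda>t. H t * of_real (weight (modq k) t))"
    unfolding w_def by (rule integral_mult_right)
  finally show ?thesis unfolding im f_def .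
qed

section \<open>Logarithms of Hoelder functions on the circle\<close>

lemma closed_path_to_circle:
  fixes e :: "real \<Rightarrow> complex"
  assumes c: "continuous_on {0..1} e" and e: "e 0 = e 1"
  obtains E where "continuous_on (sphere 0 1) E" "\<And>t. t \<in> {0..1} \<Longrightarrow> E (circ t) = e t"
proof -
  define E where "E \<zeta> = e (Arg2pi \<zeta> / (2 * pi))" for \<zeta>
  have Ec: "E (circ t) = e t" if t: "t \<in> {0..1}" for t
  proof (cases "t = 1")
    case True
    have "circ t = 1" using True by simp
    moreover have "Arg2pi 1 = 0" by (rule Arg2pi_unique[of 1]) auto
    ultimately show ?thesis using True e by (simp add: E_def)
  next
    case False
    have "Arg2pi (circ t) = 2 * pi * t"
      by (rule Arg2pi_unique[of 1]) (use t False in \<open>auto simp: mult_ac\<close>)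
    thus ?thesis by (simp add: E_def)
  qed
  have "continuous_on (sphere 0 1) E"
    unfolding continuous_on_closed_invariant
  proof (intro allI impI)
    fix B :: "complex set" assume B: "closed B"
    define T where "T = {t \<in> {0..1}. e t \<in> B}"
    have "closed T" unfolding T_def using continuous_closed_preimage[OF c closed_atLeastAtMost B] by (simp add: vimage_def Int_def)
    hence "compact T" using compact_Int_closed[OF compact_Icc[of 0 "1::real"], of T] by (simp add: T_def Int_def) (metis (no_types, lifting) Collect_cong)
    hence "compact (circ ` T)" by (intro compact_continuous_image continuous_intros)
    moreover have "circ ` T = E -` B \<inter> sphere 0 1"
    proof (intro set_eqI iffI)
      fix z assume "z \<in> circ ` T"
      thus "z \<in> E -` B \<inter> sphere 0 1" using Ec by (auto simp: T_def)
    next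
      fix z assume z: "z \<in> E -` B \<inter> sphere 0 1"
      then obtain t where t: "0 \<le> t" "t \<le> 1" "z = circ t" using ex_circ[of z] by auto
      thus "z \<in> circ ` T" using z Ec[of t] by (auto simp: T_def)
    qed
    ultimately show "\<exists>A. closed A \<and> A \<inter> sphere 0 1 = E -` B \<inter> sphere 0 1"
      by (intro exI[of _ "circ ` T"]) (auto dest: compact_imp_closed)
  qed
  thus ?thesis using Ec that by blast
qed

lemma norm_le_exp_minus_one:
  fixes z :: complex
  assumes z: "norm z \<le> 1 / 4"
  shows "norm z \<le> 2 * norm (exp z - 1)"
proof -
  have "norm (exp z - (\<Sum>i\<le>1. z ^ i / fact i)) \<le> exp \<bar>Re z\<bar> * (norm z) ^ Suc 1 / fact 1"
    by (rule Taylor_exp)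
  hence T: "norm (exp z - (1 + z)) \<le> exp \<bar>Re z\<bar> * (norm z)\<^sup>2" by (simp add: numeral_2_eq_2)
  have "\<bar>Re z\<bar> \<le> 1 / 2" using abs_Re_le_cmod[of z] z by linarith
  hence "exp \<bar>Re z\<bar> \<le> exp (1 / 2)" by (rule exp_le_cancel_iff[THEN iffD2])
  also have "\<dots> \<le> 2" by (rule exp_half_le2)
  finally have "exp \<bar>Re z\<bar> * (norm z)\<^sup>2 \<le> 2 * (norm z)\<^sup>2" by (intro mult_right_mono) auto
  also have "\<dots> \<le> 2 * (1 / 4 * norm z)"
    unfolding power2_eq_square using z by (intro mult_left_mono mult_right_mono) auto
  finally have "norm (exp z - (1 + z)) \<le> norm z / 2" using T by simp
  moreover have "norm z \<le> norm (exp z - 1) + norm (exp z - (1 + z))"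
    using norm_triangle_ineq4[of "exp z - 1" "exp z - (1 + z)"] by simp
  ultimately show ?thesis by simp
qed

lemma compact_nonzero_bound:
  fixes \<phi> :: "complex \<Rightarrow> complex"
  assumes "compact S" "continuous_on S \<phi>" "\<And>x. x \<in> S \<Longrightarrow> \<phi> x \<noteq> 0"
  obtains c where "c > 0" "\<And>x. x \<in> S \<Longrightarrow> c \<le> norm (\<phi> x)"
proof (cases "S = {}")
  case False
  have "continuous_on S (\<lambda>x. norm (\<phi> x))" by (intro continuous_intros assms)
  from continuous_attains_inf[OF assms(1) False this]
  obtain x0 where "x0 \<in> S" "\<forall>y\<in>S. norm (\<phi> x0) \<le> norm (\<phi> y)" by blast
  thus ?thesis using that[of "norm (\<phi> x0)"] assms(3) by auto
qed (use that[of 1] in auto)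

lemma hoelder_on_inverse:
  assumes S: "compact S" "\<mu> > 0" and h: "hoelder_on \<mu> S \<phi>" and nz: "\<And>x. x \<in> S \<Longrightarrow> \<phi> x \<noteq> 0"
  shows "hoelder_on \<mu> S (\<lambda>x. inverse (\<phi> x))"
proof -
  obtain c where c: "c > 0" "\<And>x. x \<in> S \<Longrightarrow> c \<le> norm (\<phi> x)"
    using compact_nonzero_bound[OF S(1) hoelder_on_continuous[OF h S(2)] nz] by blast
  obtain M where M: "M \<ge> 0" "\<And>x y. x \<in> S \<Longrightarrow> y \<in> S \<Longrightarrow> norm (\<phi> x - \<phi> y) \<le> M * norm (x - y) powr \<mu>"
    by (rule hoelder_onE[OF h]) blast
  show ?thesis
  proof (rule hoelder_onI[where M = "M / (c * c)"])
    fix x y assume xy: "x \<in> S" "y \<in> S"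
    have "inverse (\<phi> x) - inverse (\<phi> y) = - (\<phi> x - \<phi> y) / (\<phi> x * \<phi> y)"
      using nz[OF xy(1)] nz[OF xy(2)] by (simp add: field_simps)
    hence "norm (inverse (\<phi> x) - inverse (\<phi> y)) = norm (\<phi> x - \<phi> y) / (norm (\<phi> x) * norm (\<phi> y))"
      by (simp only: norm_divide norm_mult norm_minus_cancel)
    also have "\<dots> \<le> (M * norm (x - y) powr \<mu>) / (c * c)"
      using M(2)[OF xy] c(1) c(2)[OF xy(1)] c(2)[OF xy(2)] M(1)
      by (intro frac_le mult_mono mult_nonneg_nonneg) auto
    finally show "norm (inverse (\<phi> x) - inverse (\<phi> y)) \<le> M / (c * c) * norm (x - y) powr \<mu>" by simp
  qed
qed

lemma hoelder_on_power_int: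
  assumes S: "compact S" "\<mu> > 0" and h: "hoelder_on \<mu> S \<phi>" and nz: "\<And>x. x \<in> S \<Longrightarrow> \<phi> x \<noteq> 0"
  shows "hoelder_on \<mu> S (\<lambda>x. \<phi> x powi n)"
proof -
  have p: "hoelder_on \<mu> S (\<lambda>x. \<psi> x ^ m)" if "hoelder_on \<mu> S \<psi>" for \<psi> and m :: nat
  proof (induction m)
    case (Suc m)
    show ?case unfolding power_Suc by (intro hoelder_on_mult that Suc compact_imp_bounded S)
  qed (simp add: hoelder_on_const)
  show ?thesis
    using p[OF h, of "nat n"] p[OF hoelder_on_inverse[OF S h nz], of "nat (- n)"]
    by (cases "n \<ge> 0") (simp_all add: power_int_def)
qed

text \<open>
  Near the diagonal the exponential has a Lipschitz inverse; away from it the modulus of the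
  distance is bounded below.
\<close>
lemma hoelder_on_log:
  assumes S: "compact S" "\<mu> > 0" and c: "continuous_on S E" and h: "hoelder_on \<mu> S (\<lambda>x. exp (E x))"
  shows "hoelder_on \<mu> S E"
proof -
  obtain c where c': "c > 0" "\<And>x. x \<in> S \<Longrightarrow> c \<le> norm (exp (E x))"
    using compact_nonzero_bound[OF S(1) hoelder_on_continuous[OF h S(2)]] by auto
  obtain M where M: "M \<ge> 0" "\<And>x y. x \<in> S \<Longrightarrow> y \<in> S \<Longrightarrow> norm (exp (E x) - exp (E y)) \<le> M * norm (x - y) powr \<mu>"
    by (rule hoelder_onE[OF h]) blast
  have "uniformly_continuous_on S E" by (rule compact_uniformly_continuous[OF c S(1)])
  then obtain d where d: "d > 0" "\<And>x y. x \<in> S \<Longrightarrow> y \<in> S \<Longrightarrow> dist x y < d \<Longrightarrow> dist (E x) (E y) < 1 / 4"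
    unfolding uniformly_continuous_on_def
    by (metis zero_less_divide_1_iff zero_less_numeral)
  have "bounded (E ` S)" by (intro compact_imp_bounded compact_continuous_image c S)
  then obtain B where B: "\<And>x. x \<in> S \<Longrightarrow> norm (E x) \<le> B" unfolding bounded_iff by blast
  define N where "N = max (2 * M / c) (2 * \<bar>B\<bar> / d powr \<mu>)"
  show ?thesis
  proof (rule hoelder_onI[where M = N])
    fix x y assume xy: "x \<in> S" "y \<in> S"
    show "norm (E x - E y) \<le> N * norm (x - y) powr \<mu>"
    proof (cases "dist x y < d")
      case True
      have "norm (E x - E y) \<le> 1 / 4" using d(2)[OF xy True] by (simp add: dist_norm)
      hence "norm (E x - E y) \<le> 2 * norm (exp (E x - E y) - 1)" by (rule norm_le_exp_minus_one)
      also have "exp (E x - E y) - 1 = (exp (E x) - exp (E y)) / exp (E y)"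
        by (simp add: exp_diff diff_divide_distrib)
      also have "2 * norm ((exp (E x) - exp (E y)) / exp (E y)) \<le> 2 * (M * norm (x - y) powr \<mu> / c)"
        unfolding norm_divide using M(2)[OF xy] M(1) c'(1) c'(2)[OF xy(2)]
        by (intro mult_left_mono frac_le) auto
      also have "\<dots> = 2 * M / c * norm (x - y) powr \<mu>" by simp
      also have "\<dots> \<le> N * norm (x - y) powr \<mu>" by (intro mult_right_mono) (auto simp: N_def)
      finally show ?thesis .
    next
      case False
      have "norm (E x - E y) \<le> 2 * \<bar>B\<bar>"
        using norm_triangle_ineq4[of "E x" "E y"] B[OF xy(1)] B[OF xy(2)] by linarith
      also have "\<dots> = 2 * \<bar>B\<bar> / d powr \<mu> * d powr \<mu>" using d(1) by simp
      also have "\<dots> \<le> 2 * \<bar>B\<bar> / d powr \<mu> * norm (x - y) powr \<mu>"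
        using False d(1) S(2) by (intro mult_left_mono powr_mono2) (auto simp: dist_norm)
      also have "\<dots> \<le> N * norm (x - y) powr \<mu>" by (intro mult_right_mono) (auto simp: N_def)
      finally show ?thesis .
    qed
  qed
qed

section \<open>The class of the logarithmic integral in the circle coordinate\<close>

lemma period_lattice_iff:
  "z \<in> period_lattice k \<longleftrightarrow> (\<exists>m n :: int. z = 4 * of_real (ell_K k) * of_int m + 2 * \<i> * of_real (ell_K' k) * of_int n)"
  by (auto simp: period_lattice_def)

lemma period_lattice_diff:
  assumes "z \<in> period_lattice k" "w \<in> period_lattice k"
  shows "z - w \<in> period_lattice k"
proof -
  obtain m n m' n' :: int where
    "z = 4 * of_real (ell_K k) * of_int m + 2 * \<i> * of_real (ell_K' k) * of_int n"
    "w = 4 * of_real (ell_K k) * of_int m' + 2 * \<i> * of_real (ell_K' k) * of_int n'"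
    using assms unfolding period_lattice_iff by blast
  hence "z - w = 4 * of_real (ell_K k) * of_int (m - m') + 2 * \<i> * of_real (ell_K' k) * of_int (n - n')"
    by (simp add: algebra_simps)
  thus ?thesis unfolding period_lattice_iff by blast
qed

lemma period_lattice_zero: "0 \<in> period_lattice k"
  unfolding period_lattice_iff by (intro exI[of _ 0]) simp

lemma mod_lattice_eq_iff: "mod_lattice k a = mod_lattice k b \<longleftrightarrow> a - b \<in> period_lattice k"
proof
  assume "mod_lattice k a = mod_lattice k b"
  moreover have "a \<in> mod_lattice k a" using period_lattice_zero[of k] by (force simp: mod_lattice_def)
  ultimately obtain w where "w \<in> period_lattice k" "a = b + w" by (auto simp: mod_lattice_def)
  thus "a - b \<in> period_lattice k" by simp
next
  have sub: "mod_lattice k a \<subseteq> mod_lattice k b" if "b - a \<in> period_lattice k" for a b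
  proof
    fix z assume "z \<in> mod_lattice k a"
    then obtain w where w: "w \<in> period_lattice k" "z = a + w" by (auto simp: mod_lattice_def)
    have "w - (b - a) \<in> period_lattice k" by (rule period_lattice_diff[OF w(1) that])
    moreover have "z = b + (w - (b - a))" using w(2) by simp
    ultimately show "z \<in> mod_lattice k b" unfolding mod_lattice_def by blast
  qed
  assume ab: "a - b \<in> period_lattice k"
  moreover have "b - a \<in> period_lattice k" using period_lattice_diff[OF period_lattice_zero ab] by simp
  ultimately show "mod_lattice k a = mod_lattice k b" using sub by blast
qed

lemma line_loop_arctan: "line_loop (1 / 2 + arctan x / pi) = Some x" "1 / 2 + arctan x / pi \<in> {0<..<1}"
proof -
  show "1 / 2 + arctan x / pi \<in> {0<..<1}"
    using arctan_lbound[of x] arctan_ubound[of x] by (auto simp: field_simps)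
  moreover have "- cot (pi * (1 / 2 + arctan x / pi)) = x"
  proof -
    have "pi * (1 / 2 + arctan x / pi) = pi / 2 + arctan x" by (simp add: field_simps)
    moreover have "- cot (pi / 2 + arctan x) = tan (arctan x)"
      by (simp add: cot_def tan_def cos_add sin_add)
    ultimately show ?thesis by (simp add: tan_arctan)
  qed
  ultimately show "line_loop (1 / 2 + arctan x / pi) = Some x" by (simp add: line_loop_def)
qed

lemma contour_minus_infinity:
  assumes k: "k > 1"
  shows "contour k j - {Infty j} = range (\<lambda>x. contour_point k j (Some x))"
proof
  show "contour k j - {Infty j} \<subseteq> range (\<lambda>x. contour_point k j (Some x))"
  proof
    fix P assume "P \<in> contour k j - {Infty j}"
    then obtain x where "P = contour_point k j x" "P \<noteq> Infty j" unfolding contour_eq[OF k] by blast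
    thus "P \<in> range (\<lambda>x. contour_point k j (Some x))" by (cases x) auto
  qed
  show "range (\<lambda>x. contour_point k j (Some x)) \<subseteq> contour k j - {Infty j}"
    unfolding contour_eq[OF k] by auto (metis contour_point.simps(2) rangeI)
qed

lemma continuous_contour_path:
  assumes k: "k > 1" and l: "continuous_map (subtopology (surface_top k) (contour k j - {Infty j})) euclidean l"
  shows "continuous_on {0<..<1} (\<lambda>t. l (contour_point k j (line_loop t)) :: complex)"
proof -
  define c where "c t = (complex_of_real (- cot (pi * t)), sheet_sign j * of_real (sqrt ((1 + (cot (pi * t))\<^sup>2) * (k\<^sup>2 + (cot (pi * t))\<^sup>2))))" for t
  have s: "sin (pi * t) \<noteq> 0" if "t \<in> {0<..<1}" for t
    using sin_gt_zero[of "pi * t"] that by auto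
  have "continuous_on {0<..<1} (\<lambda>t. cot (pi * t))"
    unfolding cot_def by (intro continuous_intros) (use s in auto)
  hence "continuous_on {0<..<1} c" unfolding c_def using s by (intro continuous_intros) auto
  moreover have cp: "aff_point (c t) = contour_point k j (line_loop t)" if "t \<in> {0<..<1}" for t
    using that by (simp add: c_def aff_point_def line_loop_def rho_of_real[OF k k] del: of_real_minus)
  moreover have "c t \<in> affine_curve k" for t
    unfolding affine_curve_iff c_def using rho_of_real_square[OF k, of "- cot (pi * t)"]
    by (simp add: power_mult_distrib rho_of_real[OF k k] del: of_real_minus)
  ultimately have "continuous_map (top_of_set {0<..<1}) (surface_top k) (\<lambda>t. aff_point (c t))"
    by (intro continuous_map_into_surface) auto
  moreover have "(\<lambda>t. aff_point (c t)) ` {0<..<1} \<subseteq> contour k j - {Infty j}"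
    unfolding contour_minus_infinity[OF k] using cp by (auto simp: line_loop_def)
  ultimately have "continuous_map (top_of_set {0<..<1}) (subtopology (surface_top k) (contour k j - {Infty j})) (\<lambda>t. aff_point (c t))"
    by (simp add: continuous_map_in_subtopology image_subset_iff_funcset)
  from continuous_map_compose[OF this l]
  have "continuous_on {0<..<1} (\<lambda>t. l (aff_point (c t)))" by (simp add: o_def)
  thus ?thesis by (simp add: cp cong: continuous_on_cong_simp)
qed

lemma continuous_on_line_parameter:
  fixes e :: "real \<Rightarrow> complex"
  assumes "continuous_on {0..1} e"
  shows "continuous_on S (\<lambda>x. e (1 / 2 + arctan x / pi))"
proof (rule continuous_on_compose2[OF assms])
  show "continuous_on S (\<lambda>x. 1 / 2 + arctan x / pi)" by (intro continuous_intros) auto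
  show "(\<lambda>x. 1 / 2 + arctan x / pi) ` S \<subseteq> {0..1}"
  proof
    fix y assume "y \<in> (\<lambda>x. 1 / 2 + arctan x / pi) ` S"
    then obtain x where "y = 1 / 2 + arctan x / pi" by blast
    thus "y \<in> {0..1}" using line_loop_arctan(2)[of x] by simp
  qed
qed

text \<open>
  The sheet of a point of the contour is the sign of \<tau>, since \<rho> is positive; so the two
  paths combine to a function on the surface without reference to the parametrisation.
\<close>
lemma log_branch_from_path:
  assumes k: "k > 1" and c: "\<And>j. continuous_on {0..1} (e j)"
    and e: "\<And>j t. t \<in> {0<..<1} \<Longrightarrow> exp (e j t) = f (contour_point k j (line_loop t))"
  obtains l where "log_branch k f l"
proof -
  define l where "l P = (case P of Aff \<xi> \<tau> \<Rightarrow> e (if Re \<tau> > 0 then S1 else S2) (1 / 2 + arctan (Re \<xi>) / pi) | Infty j \<Rightarrow> 0)" for P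
  have r: "sheet_sign j * rho k (of_real x) = of_real ((if j = S1 then 1 else -1) * sqrt ((1 + x\<^sup>2) * (k\<^sup>2 + x\<^sup>2)))"
    and p: "sqrt ((1 + x\<^sup>2) * (k\<^sup>2 + x\<^sup>2)) > 0" for j and x :: real
  proof -
    have "(1 + x\<^sup>2) * (k\<^sup>2 + x\<^sup>2) > 0" using k by (intro mult_pos_pos add_pos_nonneg) auto
    thus "sqrt ((1 + x\<^sup>2) * (k\<^sup>2 + x\<^sup>2)) > 0" by simp
    show "sheet_sign j * rho k (of_real x) = of_real ((if j = S1 then 1 else -1) * sqrt ((1 + x\<^sup>2) * (k\<^sup>2 + x\<^sup>2)))"
      by (cases j) (simp_all add: rho_of_real[OF k k])
  qed
  have lc: "l (contour_point k j (Some x)) = e j (1 / 2 + arctan x / pi)" for j x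
    unfolding l_def contour_point.simps r using p[of x] by (cases j) auto
  have T: "contour k j - {Infty j} \<subseteq> surface k" for j
    unfolding contour_minus_infinity[OF k] using contour_point_in_surface[OF k] by blast
  have "continuous_map (subtopology (surface_top k) (contour k j - {Infty j})) euclidean l" for j
  proof (rule continuous_map_from_surface[OF T])
    have "l (aff_point z) = e j (1 / 2 + arctan (Re (fst z)) / pi)" if "aff_point z \<in> contour k j - {Infty j}" for z
    proof -
      obtain x where x: "aff_point z = contour_point k j (Some x)" using \<open>aff_point z \<in> _\<close> unfolding contour_minus_infinity[OF k] by blast
      hence "fst z = of_real x" by (simp add: aff_point_def)
      thus ?thesis using x lc by simp
    qed
    moreover have "continuous_on S (\<lambda>z. e j (1 / 2 + arctan (Re (fst z)) / pi))" for S :: "(complex \<times> complex) set"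
      by (rule continuous_on_compose2[OF continuous_on_line_parameter[OF c, of UNIV]]) (auto intro!: continuous_intros)
    ultimately show "continuous_on {z \<in> affine_curve k. aff_point z \<in> contour k j - {Infty j}} (\<lambda>z. l (aff_point z))"
      by (subst continuous_on_cong[OF refl]) auto
  next
    let ?S = "{w \<in> infinity_curve k. inf_point w \<in> contour k j - {Infty j}}"
    have w: "fst w \<noteq> 0 \<and> l (inf_point w) = e j (1 / 2 + arctan (Re (1 / fst w)) / pi)" if w: "w \<in> ?S" for w
    proof -
      obtain x where x: "inf_point w = contour_point k j (Some x)" using w unfolding contour_minus_infinity[OF k] by blast
      hence "fst w \<noteq> 0" "1 / fst w = of_real x" by (auto simp: inf_point_def Let_def split: if_splits)
      thus ?thesis using x lc by simp
    qed
    have "continuous_on ?S (\<lambda>w. Re (1 / fst w))"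
      by (intro continuous_intros) (use w in blast)
    hence "continuous_on ?S (\<lambda>w. e j (1 / 2 + arctan (Re (1 / fst w)) / pi))"
      by (rule continuous_on_compose2[OF continuous_on_line_parameter[OF c, of UNIV]]) auto
    thus "continuous_on ?S (\<lambda>w. l (inf_point w))"
      by (rule continuous_on_eq) (use w in auto)
  qed
  moreover have "exp (l P) = f P" if P: "P \<in> contour k j - {Infty j}" for P j
  proof -
    obtain x where x: "P = contour_point k j (Some x)" using P unfolding contour_minus_infinity[OF k] by blast
    show ?thesis unfolding x lc using e[OF line_loop_arctan(2), of j x] line_loop_arctan(1)[of x] by simp
  qed
  ultimately have "log_branch k f l" unfolding log_branch_def by blast
  thus ?thesis by (rule that)
qed

text \<open>
  Any branch differs from the given logarithms by integers times 2\<pi>i on the two components; by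
  the value of the weighted mean of 1 the integral changes by a multiple of 2iK'.
\<close>
lemma beta_class_eq:
  assumes k: "k > 1" and c: "\<And>j. continuous_on {0..1} (e j)"
    and e: "\<And>j t. t \<in> {0<..<1} \<Longrightarrow> exp (e j t) = f (contour_point k j (line_loop t))"
  shows "beta_class k f = mod_lattice k (of_real (k / (1 + k)) *
     integral {0..1} (\<lambda>t. (e S1 t - e S2 t) * of_real (weight (modq k) t)))"
    (is "_ = mod_lattice k ?\<beta>")
proof -
  have q: "0 < modq k" "modq k < 1" using modq[OF k] by auto
  have "mod_lattice k (of_real (k / (2 * pi)) * Gamma_integral k l) = mod_lattice k ?\<beta>" if l: "log_branch k f l" for l
  proof -
    define g where "g j t = l (contour_point k j (line_loop t))" for j t
    have "\<exists>n::int. \<forall>t\<in>{0<..<1}. g j t - e j t = of_int n * (2 * of_real pi * \<i>)" for j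
    proof -
      have "continuous_on {0<..<1} (\<lambda>t. g j t - e j t)"
        unfolding g_def using l unfolding log_branch_def
        by (intro continuous_on_diff continuous_contour_path[OF k] continuous_on_subset[OF c]) auto
      moreover have "exp (g j t - e j t) = 1" if t: "t \<in> {0<..<1}" for t
      proof -
        have "contour_point k j (line_loop t) \<in> contour k j - {Infty j}"
          unfolding contour_minus_infinity[OF k] line_loop_def using t by (simp del: contour_point.simps of_real_minus)
        hence "exp (g j t) = f (contour_point k j (line_loop t))" using l unfolding log_branch_def g_def by blast
        thus ?thesis unfolding exp_diff e[OF t, symmetric] by simp
      qed
      ultimately obtain n :: int where "\<And>t. t \<in> {0<..<1} \<Longrightarrow> g j t - e j t = of_int n * (2 * of_real pi * \<i>)"
        using continuous_2pi_multiple_const[of "{0<..<1}" "\<lambda>t. g j t - e j t"] by auto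
      thus ?thesis by blast
    qed
    then obtain n :: "sheet \<Rightarrow> int" where n: "\<And>j t. t \<in> {0<..<1} \<Longrightarrow> g j t - e j t = of_int (n j) * (2 * of_real pi * \<i>)"
      by metis
    define m where "m = n S1 - n S2"
    let ?W = "\<lambda>t. complex_of_real (weight (modq k) t)"
    define H where "H t = (e S1 t - e S2 t) + of_int m * (2 * of_real pi * \<i>)" for t
    have cH: "continuous_on {0..1} H" unfolding H_def by (intro continuous_intros c)
    have "l (contour_point k S1 (Some (- cot (pi * t)))) - l (contour_point k S2 (Some (- cot (pi * t)))) = H t"
      if "0 < t" "t < 1" for t
    proof -
      have "line_loop t = Some (- cot (pi * t))" using that by (simp add: line_loop_def)
      hence "l (contour_point k S1 (Some (- cot (pi * t)))) - l (contour_point k S2 (Some (- cot (pi * t)))) = g S1 t - g S2 t"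
        unfolding g_def by (simp only:)
      also have "\<dots> = H t" using n[of t S1] n[of t S2] that by (simp add: H_def m_def algebra_simps)
      finally show ?thesis .
    qed
    from Gamma_integral_circle[OF k cH this]
    have G: "Gamma_integral k l = of_real (2 * pi / (1 + k)) * integral {0..1} (\<lambda>t. H t * ?W t)"
      unfolding Gamma_integral_def by simp
    have cW: "continuous_on {0..1} ?W"
      by (intro continuous_on_of_real weight_continuous) (use q in auto)
    have "integral {0..1} (\<lambda>t. H t * ?W t) = integral {0..1} (\<lambda>t. (e S1 t - e S2 t) * ?W t)
        + of_int m * (2 * of_real pi * \<i>) * integral {0..1} ?W"
    proof -
      have "integral {0..1} (\<lambda>t. (e S1 t - e S2 t) * ?W t + of_int m * (2 * of_real pi * \<i>) * ?W t)
        = integral {0..1} (\<lambda>t. (e S1 t - e S2 t) * ?W t) + integral {0..1} (\<lambda>t. of_int m * (2 * of_real pi * \<i>) * ?W t)"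
        by (intro Henstock_Kurzweil_Integration.integral_add integrable_continuous_real continuous_intros c cW)
      thus ?thesis unfolding H_def by (simp add: distrib_right)
    qed
    also have "integral {0..1} ?W = of_real ((1 + k) * ell_K' k / (pi * k))"
    proof -
      have "(weight (modq k) has_integral (1 + k) * ell_K' k / (pi * k)) {0..1}"
        unfolding weight_integral[OF k, symmetric]
        by (intro integrable_integral integrable_continuous_real weight_continuous q)
      thus ?thesis by (intro integral_unique has_integral_of_real)
    qed
    finally have IH: "integral {0..1} (\<lambda>t. H t * ?W t) = integral {0..1} (\<lambda>t. (e S1 t - e S2 t) * ?W t)
        + of_int m * (2 * of_real pi * \<i>) * of_real ((1 + k) * ell_K' k / (pi * k))" .
    have alg: "c * (u * (J + M * (2 * p * \<i>) * v)) - w * J = 2 * \<i> * E * M"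
      if "c * u = w" "w * (p * v) = E" for c u J M p v w E :: complex
      unfolding that[symmetric] by (simp add: algebra_simps)
    have "of_real (k / (2 * pi)) * Gamma_integral k l - ?\<beta> = 2 * \<i> * of_real (ell_K' k) * of_int m"
      unfolding G IH
    proof (rule alg)
      have "k / (2 * pi) * (2 * pi / (1 + k)) = k / (1 + k)" by simp
      thus "complex_of_real (k / (2 * pi)) * of_real (2 * pi / (1 + k)) = of_real (k / (1 + k))"
        by (simp only: of_real_mult[symmetric])
      have "k / (1 + k) * (pi * ((1 + k) * ell_K' k / (pi * k))) = ell_K' k" using k by simp
      thus "complex_of_real (k / (1 + k)) * (of_real pi * of_real ((1 + k) * ell_K' k / (pi * k))) = of_real (ell_K' k)"
        by (simp only: of_real_mult[symmetric])
    qed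
    hence "of_real (k / (2 * pi)) * Gamma_integral k l - ?\<beta> \<in> period_lattice k"
      unfolding period_lattice_iff by (intro exI[of _ 0] exI[of _ m]) simp
    thus ?thesis unfolding mod_lattice_eq_iff .
  qed
  moreover obtain l where "log_branch k f l" by (rule log_branch_from_path[OF k c e])
  ultimately show ?thesis unfolding beta_class_def by blast
qed

section \<open>Logarithms along the contour\<close>

lemma logarithm_along_contour:
  assumes k: "k > 1" and m: "0 < \<mu>" and f: "f \<in> invertibles k (holder_Gamma k \<mu>)"
  obtains e where "\<And>j. continuous_on {0..1} (e j)"
    "\<And>j t. t \<in> {0..1} \<Longrightarrow> exp (e j t) = f (contour_point k j (line_loop t))"
    "\<And>j. e j 1 - e j 0 = 2 * of_real pi * \<i> * ind_contour k j f"
proof -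
  obtain g where g: "\<forall>P\<in>Gamma_curve k. f P * g P = 1" and fh: "f \<in> holder_Gamma k \<mu>"
    using f by (auto simp: invertibles_def)
  have G: "contour_point k j x \<in> Gamma_curve k" for j x
    unfolding Gamma_curve_def contour_eq[OF k] by (cases j) auto
  have "\<exists>e. continuous_on {0..1} e \<and> (\<forall>t\<in>{0..1}. exp (e t) = f (contour_point k j (line_loop t)))
    \<and> e 1 - e 0 = 2 * of_real pi * \<i> * ind_contour k j f" for j
  proof -
    define p where "p t = f (contour_point k j (line_loop t))" for t
    have "continuous_on (sphere 0 1) (side k j f)"
      using fh m unfolding holder_Gamma_iff_side by (blast intro: hoelder_on_continuous)
    hence "continuous_on {0..1} (\<lambda>t. side k j f (circ t))"
      by (rule continuous_on_compose2) (auto intro!: continuous_intros)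
    moreover have "side k j f (circ t) = p t" if "t \<in> {0..1}" for t
      using line_pt_circ[OF that] by (simp add: side_def p_def)
    ultimately have "path p" unfolding path_def by (simp cong: continuous_on_cong_simp)
    moreover have "p t \<noteq> 0" for t using g G[of j "line_loop t"] by (auto simp: p_def)
    hence "0 \<notin> path_image p" by (auto simp: path_image_def)
    ultimately obtain q where q: "path q" "pathfinish q - pathstart q = 2 * of_real pi * \<i> * winding_number p 0"
      "\<And>t. t \<in> {0..1} \<Longrightarrow> p t = 0 + exp (q t)"
      using winding_number_as_continuous_log[of p 0] by metis
    show ?thesis
      using q by (intro exI[of _ q]) (auto simp: path_def pathfinish_def pathstart_def ind_contour_def p_def[abs_def])
  qed
  then obtain e where "\<And>j. continuous_on {0..1} (e j) \<and> (\<forall>t\<in>{0..1}. exp (e j t) = f (contour_point k j (line_loop t)))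
    \<and> e j 1 - e j 0 = 2 * of_real pi * \<i> * ind_contour k j f" by metis
  thus ?thesis using that[of e] by blast
qed

lemma circle_path_continuous_time:
  assumes q: "0 < q" "q < 1"
  shows "continuous_on {0..1} (circle_path q 1)"
proof -
  have "continuous_on {0..1} (\<lambda>t. case (1, t) of (r, t) \<Rightarrow> circle_path q r t)"
    by (rule continuous_on_compose2[OF circle_path_continuous[of q "(1 + q) / 2"]])
      (use q in \<open>auto intro!: continuous_intros\<close>)
  thus ?thesis by simp
qed

lemma continuous_on_flip01:
  fixes D :: "real \<Rightarrow> complex"
  shows "continuous_on {0..1} D \<Longrightarrow> continuous_on {0..1} (\<lambda>t. D (1 - t))"
  by (erule continuous_on_compose2) (auto intro!: continuous_intros)

lemma circle_path_mean:
  assumes k: "k > 1"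
  shows "of_real (k / (1 + k)) * integral {0..1} (\<lambda>t. circle_path (modq k) 1 t * of_real (weight (modq k) t))
    = of_real (ell_K k / 2)"
proof -
  have "k / (1 + k) * ((1 + k) * ell_K k / (2 * k)) = ell_K k / 2" using k by simp
  thus ?thesis
    unfolding circle_path_weight_integral[OF modq(1)[OF k] modq(2)[OF k]] ell_K_substitution[OF k] of_real_mult[symmetric]
    by (simp only:)
qed

text \<open>
  The constants in the class \<beta> are the means of the boundary path and of 1, namely K/2 and
  K'/\<pi> after normalisation; the weight is symmetric, so running backwards does not change a
  mean.
\<close>
lemma weighted_integral_of_logarithm:
  fixes D D' :: "real \<Rightarrow> complex" and x y :: complex and m :: int
  assumes k: "k > 1" and c: "continuous_on {0..1} D" "continuous_on {0..1} D'"
    and z: "integral {0..1} (\<lambda>t. D t * of_real (weight (modq k) t)) = 0"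
      "integral {0..1} (\<lambda>t. D' t * of_real (weight (modq k) t)) = 0"
  shows "of_real (k / (1 + k)) * integral {0..1} (\<lambda>t. (D t + x * circle_path (modq k) 1 t + D' (1 - t)
      + y * circle_path (modq k) 1 (1 - t) + of_int m * (2 * of_real pi * \<i>)) * of_real (weight (modq k) t))
    = (x + y) / 2 * of_real (ell_K k) + 2 * \<i> * of_real (ell_K' k) * of_int m"
proof -
  have q: "0 < modq k" "modq k < 1" using modq[OF k] by auto
  let ?W = "\<lambda>t. complex_of_real (weight (modq k) t)" and ?c = "circle_path (modq k) 1"
  define \<kappa> where "\<kappa> = complex_of_real (k / (1 + k))"
  define J where "J g = \<kappa> * integral {0..1} (\<lambda>t. g t * ?W t)" for g
  have cW: "continuous_on {0..1} ?W"
    by (intro continuous_on_of_real weight_continuous) (use q in auto)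
  have cc: "continuous_on {0..1} ?c" by (rule circle_path_continuous_time[OF q])
  note cs = c cc continuous_on_flip01[OF c(2)] continuous_on_flip01[OF cc]
  have add: "J (\<lambda>t. g t + h t) = J g + J h" if "continuous_on {0..1} g" "continuous_on {0..1} h" for g h
  proof -
    have "integral {0..1} (\<lambda>t. g t * ?W t + h t * ?W t) = integral {0..1} (\<lambda>t. g t * ?W t) + integral {0..1} (\<lambda>t. h t * ?W t)"
      by (intro Henstock_Kurzweil_Integration.integral_add integrable_continuous_real continuous_intros that cW)
    thus ?thesis by (simp add: J_def distrib_right distrib_left)
  qed
  have scale: "J (\<lambda>t. a * g t) = a * J g" for a g
    by (simp add: J_def mult.assoc)
  have flip: "J (\<lambda>t. g (1 - t)) = J g" if "continuous_on {0..1} g" for g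
  proof -
    have "integral {0..1} (\<lambda>t. g t * ?W t) = integral {0..1} (\<lambda>t. g (1 - t) * ?W (1 - t))"
      by (rule integral_flip01(1)[symmetric]) (intro integrable_continuous_real continuous_intros that cW)
    thus ?thesis by (simp add: J_def weight_flip)
  qed
  have const: "J (\<lambda>t. of_int m * (2 * of_real pi * \<i>)) = 2 * \<i> * of_real (ell_K' k) * of_int m"
  proof -
    have "(weight (modq k) has_integral (1 + k) * ell_K' k / (pi * k)) {0..1}"
      unfolding weight_integral[OF k, symmetric]
      by (intro integrable_integral integrable_continuous_real weight_continuous q)
    hence "integral {0..1} ?W = of_real ((1 + k) * ell_K' k / (pi * k))"
      by (intro integral_unique has_integral_of_real)
    moreover have "k / (1 + k) * (pi * ((1 + k) * ell_K' k / (pi * k))) = ell_K' k" using k by simp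
    hence "\<kappa> * (of_real pi * of_real ((1 + k) * ell_K' k / (pi * k))) = of_real (ell_K' k)"
      unfolding \<kappa>_def by (simp only: of_real_mult[symmetric])
    moreover have "\<kappa> * (M * (2 * p * \<i>) * v) = 2 * \<i> * E * M" if "\<kappa> * (p * v) = E" for M p v E :: complex
      unfolding that[symmetric] by (simp add: mult_ac)
    ultimately show ?thesis unfolding J_def by (simp only: integral_mult_right)
  qed
  have mean: "J ?c = of_real (ell_K k) / 2"
    using circle_path_mean[OF k] by (simp add: J_def \<kappa>_def)
  have zD: "J D = 0" "J D' = 0" using z by (simp_all add: J_def)
  have "J (\<lambda>t. D t + x * ?c t + D' (1 - t) + y * ?c (1 - t) + of_int m * (2 * of_real pi * \<i>))
    = J D + x * J ?c + J D' + y * J ?c + 2 * \<i> * of_real (ell_K' k) * of_int m"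
    by (subst add, (intro continuous_intros cs)+)+ (simp only: const, simp only: scale flip[OF c(2)] flip[OF cc])
  also have "\<dots> = (x + y) / 2 * of_real (ell_K k) + 2 * \<i> * of_real (ell_K' k) * of_int m"
    unfolding zD mean by (simp add: field_simps)
  finally show ?thesis unfolding J_def \<kappa>_def .
qed

text \<open>
  With \<sigma> the outer root, (1 + \<sigma>)(1 - \<sigma>) = q/\<zeta>, so (1 + \<sigma>)/(1 -
  \<sigma>) = (1 + \<sigma>)^2\<zeta>/q. Hence each multiplier contributes one turn of the
  boundary path.
\<close>
lemma alpha_ratio:
  assumes k: "k > 1" and t: "t \<in> {0..1}"
  shows "alpha_plus k (contour_point k S1 (line_loop t)) / alpha_plus k (contour_point k S2 (line_loop t))
      = - exp (2 * circle_path (modq k) 1 t)"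
    and "alpha_minus k (contour_point k S1 (line_loop t)) / alpha_minus k (contour_point k S2 (line_loop t))
      = - exp (2 * circle_path (modq k) 1 (1 - t))"
    and "alpha_plus k (contour_point k S2 (line_loop t)) \<noteq> 0"
    and "alpha_minus k (contour_point k S2 (line_loop t)) \<noteq> 0"
proof -
  define q where "q = modq k"
  have q: "0 < q" "q < 1" using modq[OF k] by (auto simp: q_def)
  have C: "alpha_const k \<noteq> 0" using k by (simp add: alpha_const_def)
  have E: "(1 + root_out q z) / (1 - root_out q z) = - (- (z / of_real q) * (1 + root_out q z)\<^sup>2)"
    "1 - root_out q z \<noteq> 0" if z: "norm z = 1" for z
  proof -
    have z0: "z \<noteq> 0" using z by auto
    have p: "(1 + root_out q z) * (1 - root_out q z) = of_real q / z"
      using root_out_square[of q z] by (simp add: algebra_simps power2_eq_square)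
    have "of_real q / z \<noteq> 0" using q z0 by simp
    with p show n: "1 - root_out q z \<noteq> 0" by auto
    have "(1 + root_out q z)\<^sup>2 * (z / of_real q) * (1 - root_out q z)
       = (1 + root_out q z) * ((1 + root_out q z) * (1 - root_out q z)) * (z / of_real q)"
      by (simp add: power2_eq_square mult_ac)
    also have "\<dots> = 1 + root_out q z" unfolding p using q z0 by simp
    finally have "(1 + root_out q z) / (1 - root_out q z) = (1 + root_out q z)\<^sup>2 * (z / of_real q)"
      by (metis n nonzero_mult_div_cancel_right)
    thus "(1 + root_out q z) / (1 - root_out q z) = - (- (z / of_real q) * (1 + root_out q z)\<^sup>2)"
      by (simp add: mult_ac)
  qed
  have cpe: "exp (2 * circle_path q 1 t) = - (circ t / of_real q) * (1 + root_out q (circ t))\<^sup>2" for t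
    using circle_path_exp[of q 1 t] q by simp
  have cay: "cayley (line_loop t) = circ t" using cayley_line_loop[of t] t by simp
  have ri: "root_in q (circ t) = root_out q (circ (1 - t))"
    unfolding root_out_inverse circ_flip by simp
  show "alpha_plus k (contour_point k S1 (line_loop t)) / alpha_plus k (contour_point k S2 (line_loop t))
      = - exp (2 * circle_path (modq k) 1 t)"
    unfolding alpha_contour[OF k] cay q_def[symmetric] cpe using C E(1)[of "circ t"] by simp
  show "alpha_minus k (contour_point k S1 (line_loop t)) / alpha_minus k (contour_point k S2 (line_loop t))
      = - exp (2 * circle_path (modq k) 1 (1 - t))"
    unfolding alpha_contour[OF k] cay q_def[symmetric] cpe ri using C E(1)[of "circ (1 - t)"] by simp
  show "alpha_plus k (contour_point k S2 (line_loop t)) \<noteq> 0"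
    "alpha_minus k (contour_point k S2 (line_loop t)) \<noteq> 0"
    unfolding alpha_contour[OF k] cay q_def[symmetric] ri using C E(2)[of "circ t"] E(2)[of "circ (1 - t)"] by simp_all
qed

lemma line_loop_flip: "line_loop (1 - t) = map_option uminus (line_loop t)"
proof (cases "0 < t \<and> t < 1")
  case True
  have "pi * (1 - t) = pi - pi * t" by (simp add: algebra_simps)
  hence "cot (pi * (1 - t)) = - cot (pi * t)" by (simp add: cot_def)
  thus ?thesis using True by (simp add: line_loop_def)
qed (auto simp: line_loop_def)

section \<open>Necessity\<close>

text \<open>
  The lower factor is reflected to the upper half, which reverses its path. Comparing the
  increments of the logarithms along the contour gives n = a - b, and integrating them gives
  \<beta>.
\<close>
lemma factorization_imp_beta:
  assumes k: "k > 1" and m: "0 < \<mu>" and f: "f \<in> invertibles k (holder_Gamma k \<mu>)"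
    and ind: "ind_Gamma k f = 0" and F: "M_special_factorization k \<mu> f Fp Fm"
  shows "beta_class k f = mod_lattice k (2 * (ind_contour k S1 f + 1) * of_real (ell_K k))"
proof -
  define q where "q = modq k"
  define c where "c = circle_path q 1"
  have q: "0 < q" "q < 1" using modq[OF k] by (auto simp: q_def)
  have G: "contour_point k j x \<in> Gamma_curve k" for j x
    unfolding Gamma_curve_def contour_eq[OF k] by (cases j) auto
  have Fp: "Fp \<in> invertibles k (holder_plus k \<mu>)" and Fm: "Fm \<in> invertibles k (holder_minus k \<mu>)"
    and fac: "\<And>j x. f (contour_point k j x) = (Fp (contour_point k j x) * alpha_plus k (contour_point k j x))
        * (alpha_minus k (contour_point k j x) * Fm (contour_point k j x))"
    using F G unfolding M_special_factorization_def by blast+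
  obtain e where ec: "\<And>j. continuous_on {0..1} (e j)"
    and ee: "\<And>j t. t \<in> {0..1} \<Longrightarrow> exp (e j t) = f (contour_point k j (line_loop t))"
    and ei: "\<And>j. e j 1 - e j 0 = 2 * of_real pi * \<i> * ind_contour k j f"
    by (rule logarithm_along_contour[OF k m f]) blast
  obtain a :: int and D where D: "continuous_on {0..1} D" "D 0 = D 1"
    "integral {0..1} (\<lambda>t. D t * of_real (weight (modq k) t)) = 0"
    "\<And>t. t \<in> {0..1} \<Longrightarrow> Fp (contour_point k S1 (line_loop t)) / Fp (contour_point k S2 (line_loop t))
       = exp (D t + 4 * of_int a * circle_path (modq k) 1 t)"
    by (rule invertible_ratio[OF k Fp]) blast
  obtain b :: int and D' where D': "continuous_on {0..1} D'" "D' 0 = D' 1"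
    "integral {0..1} (\<lambda>t. D' t * of_real (weight (modq k) t)) = 0"
    "\<And>t. t \<in> {0..1} \<Longrightarrow> Fm (reflect (contour_point k S1 (line_loop t))) / Fm (reflect (contour_point k S2 (line_loop t)))
       = exp (D' t + 4 * of_int b * circle_path (modq k) 1 t)"
    by (rule invertible_ratio[OF k invertibles_reflect(2)[OF k Fm]]) blast
  have Fm': "Fm (contour_point k S1 (line_loop t)) / Fm (contour_point k S2 (line_loop t))
      = exp (D' (1 - t) + 4 * of_int b * c (1 - t))" if t: "t \<in> {0..1}" for t
  proof -
    have "reflect (contour_point k j (line_loop (1 - t))) = contour_point k j (line_loop t)" for j
      unfolding reflect_contour_point[OF k] line_loop_flip[symmetric] by simp
    thus ?thesis using D'(4)[of "1 - t"] t by (simp add: c_def q_def)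
  qed
  define H where "H t = D t + (4 * of_int a + 2) * c t + D' (1 - t) + (4 * of_int b + 2) * c (1 - t)" for t
  have cc: "continuous_on {0..1} c" unfolding c_def by (rule circle_path_continuous_time[OF q])
  have cH: "continuous_on {0..1} H"
    unfolding H_def by (intro continuous_intros D D' cc continuous_on_flip01)
  have ratio: "exp (e S1 t - e S2 t - H t) = 1" if t: "t \<in> {0..1}" for t
  proof -
    have "exp (e S1 t - e S2 t) = f (contour_point k S1 (line_loop t)) / f (contour_point k S2 (line_loop t))"
      unfolding exp_diff ee[OF t] ..
    also have "\<dots> = (Fp (contour_point k S1 (line_loop t)) / Fp (contour_point k S2 (line_loop t)))
       * (alpha_plus k (contour_point k S1 (line_loop t)) / alpha_plus k (contour_point k S2 (line_loop t)))
       * (alpha_minus k (contour_point k S1 (line_loop t)) / alpha_minus k (contour_point k S2 (line_loop t)))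
       * (Fm (contour_point k S1 (line_loop t)) / Fm (contour_point k S2 (line_loop t)))"
      unfolding fac by (simp only: times_divide_times_eq mult_ac)
    also have "\<dots> = exp (D t + 4 * of_int a * c t) * - exp (2 * c t) * - exp (2 * c (1 - t))
        * exp (D' (1 - t) + 4 * of_int b * c (1 - t))"
      unfolding D(4)[OF t] Fm'[OF t] alpha_ratio(1,2)[OF k t] c_def q_def ..
    also have "\<dots> = exp (H t)"
      unfolding H_def by (simp add: exp_add[symmetric] algebra_simps)
    finally show ?thesis by (simp add: exp_diff)
  qed
  have "continuous_on {0..1} (\<lambda>t. e S1 t - e S2 t - H t)" by (intro continuous_intros ec cH)
  then obtain p :: int where p: "\<And>t. t \<in> {0..1} \<Longrightarrow> e S1 t - e S2 t - H t = of_int p * (2 * of_real pi * \<i>)"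
    by (rule continuous_2pi_multiple_const[OF connected_Icc _ ratio]) blast+
  have e12: "e S1 t - e S2 t = H t + of_int p * (2 * of_real pi * \<i>)" if "t \<in> {0..1}" for t
    using p[OF that] by (simp add: algebra_simps)
  have n: "ind_contour k S1 f = of_int (a - b)"
  proof -
    have per: "c 1 = c 0 + \<i> * of_real pi" unfolding c_def by (rule circle_path_period) (use q in auto)
    have "2 * of_real pi * \<i> * (2 * ind_contour k S1 f) = (e S1 1 - e S1 0) - (e S2 1 - e S2 0)"
      using ind unfolding ei ind_Gamma_def by (simp add: add_eq_0_iff algebra_simps)
    also have "\<dots> = H 1 - H 0" using e12[of 1] e12[of 0] by (simp add: algebra_simps)
    also have "\<dots> = 2 * of_real pi * \<i> * (2 * of_int (a - b))"
      unfolding H_def by (simp add: per D(2) D'(2) algebra_simps)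
    finally have "2 * of_real pi * \<i> * (2 * ind_contour k S1 f) = 2 * of_real pi * \<i> * (2 * of_int (a - b))" .
    moreover have "2 * of_real pi * \<i> \<noteq> 0" by simp
    ultimately have "2 * ind_contour k S1 f = 2 * of_int (a - b)" using mult_left_cancel by blast
    thus ?thesis by (rule mult_left_cancel[THEN iffD1, rotated]) simp
  qed
  have "integral {0..1} (\<lambda>t. (e S1 t - e S2 t) * of_real (weight (modq k) t))
    = integral {0..1} (\<lambda>t. (H t + of_int p * (2 * of_real pi * \<i>)) * of_real (weight (modq k) t))"
    by (rule integral_cong) (simp only: e12)
  hence "beta_class k f = mod_lattice k (((4 * of_int a + 2) + (4 * of_int b + 2)) / 2 * of_real (ell_K k)
      + 2 * \<i> * of_real (ell_K' k) * of_int p)"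
    using beta_class_eq[OF k ec, where f = f] ee weighted_integral_of_logarithm[OF k D(1) D'(1) D(3) D'(3)]
    by (simp add: H_def c_def q_def)
  also have "\<dots> = mod_lattice k (2 * (ind_contour k S1 f + 1) * of_real (ell_K k))"
    unfolding mod_lattice_eq_iff period_lattice_iff n
    by (intro exI[of _ b] exI[of _ p]) (simp add: algebra_simps add_divide_distrib)
  finally show ?thesis .
qed

section \<open>Sufficiency\<close>

text \<open>
  A removable singularity; on the circle the quotient stays Hoelder since 1/\<zeta> is smooth
  there.
\<close>
lemma divide_by_coordinate:
  assumes A: "A holomorphic_on ball 0 1" "hoelder_on \<mu> (cball 0 1) A" "A 0 = 0" and m: "0 < \<mu>" "\<mu> \<le> 1"
  obtains A' where "A' holomorphic_on ball 0 1" "continuous_on (cball 0 1) A'" "hoelder_on \<mu> (sphere 0 1) A'"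
    "\<And>z. z \<in> cball 0 1 \<Longrightarrow> A z = z * A' z"
proof -
  define A' where "A' z = (if z = 0 then deriv A 0 else A z / z)" for z
  have hol: "A' holomorphic_on ball 0 1"
    using pole_lemma_open[OF A(1) open_ball, of 0] A(3) unfolding A'_def[abs_def] by (simp cong: if_cong)
  have out: "continuous_on (cball 0 1 - {0}) A'"
  proof -
    have "continuous_on (cball 0 1 - {0}) (\<lambda>z. A z / z)"
      by (intro continuous_intros continuous_on_subset[OF hoelder_on_continuous[OF A(2) m(1)]]) auto
    thus ?thesis by (rule continuous_on_eq) (auto simp: A'_def)
  qed
  have "continuous_on (cball 0 1) A'"
    unfolding continuous_on_eq_continuous_within
  proof
    fix x :: complex assume x: "x \<in> cball 0 1"
    show "continuous (at x within cball 0 1) A'"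
    proof (cases "x = 0")
      case True
      hence "isCont A' x" using holomorphic_on_imp_continuous_on[OF hol] by (simp add: continuous_on_eq_continuous_at)
      thus ?thesis by (rule continuous_at_imp_continuous_at_within)
    next
      case False
      have "continuous (at x within cball 0 1 - {0}) A'"
        using out x False by (simp add: continuous_on_eq_continuous_within)
      moreover have "at x within cball 0 1 - {0} = at x within cball 0 1"
        by (rule at_within_nhd[of x "- {0}"]) (use False in auto)
      ultimately show ?thesis by simp
    qed
  qed
  moreover have "hoelder_on \<mu> (sphere 0 1) A'"
  proof -
    have "hoelder_on \<mu> (sphere 0 1) (\<lambda>z. A z * inverse z)"
      by (intro hoelder_on_mult hoelder_on_subset[OF A(2)] hoelder_on_inverse id_hoelder) (use m in auto)
    moreover have "A' z = A z * inverse z" if "z \<in> sphere 0 1" for z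
      using that by (auto simp: A'_def divide_inverse)
    ultimately show ?thesis by (subst hoelder_on_cong[where \<psi> = "\<lambda>z. A z * inverse z"])
  qed
  ultimately show ?thesis using that[OF hol] A(3) by (auto simp: A'_def)
qed

text \<open>
  The boundary values of exp(2z), which is a function on the upper half: on the two components z
  is the boundary path and its negative. It has no zeros and no logarithm there.
\<close>
definition sheet_unit :: "real \<Rightarrow> sheet \<Rightarrow> complex \<Rightarrow> complex" where
  "sheet_unit k j \<zeta> = - (\<zeta> / of_real (modq k)) * (1 + sheet_sign j * root_out (modq k) \<zeta>)\<^sup>2"

lemma sheet_sign_square [simp]: "(sheet_sign j)\<^sup>2 = 1"
  by (cases j) auto

lemma sheet_unit_eq:
  assumes k: "k > 1" and z: "\<zeta> \<noteq> 0"
  shows "sheet_unit k j \<zeta> = 1 - 2 * \<zeta> / of_real (modq k) + sheet_sign j * (\<zeta> * root_out (modq k) \<zeta>) * (- 2 / of_real (modq k))"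
proof -
  have q: "complex_of_real (modq k) \<noteq> 0" using modq(1)[OF k] by simp
  have "(1 + s * r)\<^sup>2 = 2 - w + 2 * s * r" if "s\<^sup>2 = 1" "r\<^sup>2 = 1 - w" for s r w :: complex
  proof -
    have "(1 + s * r)\<^sup>2 = 1 + 2 * s * r + s\<^sup>2 * r\<^sup>2" by (simp add: power2_eq_square algebra_simps)
    thus ?thesis by (simp add: that)
  qed
  from this[OF sheet_sign_square root_out_square]
  have "sheet_unit k j \<zeta> = - (\<zeta> / of_real (modq k)) * (2 - of_real (modq k) / \<zeta> + 2 * sheet_sign j * root_out (modq k) \<zeta>)"
    by (simp only: sheet_unit_def)
  also have "\<dots> = 1 - 2 * \<zeta> / of_real (modq k) + sheet_sign j * (\<zeta> * root_out (modq k) \<zeta>) * (- 2 / of_real (modq k))"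
    using q z by (simp add: field_simps)
  finally show ?thesis .
qed

lemma sheet_unit_mult:
  assumes k: "k > 1" and z: "\<zeta> \<noteq> 0"
  shows "sheet_unit k S1 \<zeta> * sheet_unit k S2 \<zeta> = 1"
proof -
  define q where "q = complex_of_real (modq k)"
  define r where "r = root_out (modq k) \<zeta>"
  have q: "q \<noteq> 0" using modq(1)[OF k] by (simp add: q_def)
  have r: "r\<^sup>2 = 1 - q / \<zeta>" unfolding r_def q_def by (rule root_out_square)
  have "sheet_unit k S1 \<zeta> * sheet_unit k S2 \<zeta> = (\<zeta> / q)\<^sup>2 * (1 - r\<^sup>2)\<^sup>2"
    unfolding sheet_unit_def q_def[symmetric] r_def[symmetric] by (simp add: power2_eq_square algebra_simps)
  also have "\<dots> = 1" unfolding r using q z by (simp add: power2_eq_square)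
  finally show ?thesis .
qed

lemma sheet_unit_nonzero:
  assumes k: "k > 1" and z: "\<zeta> \<noteq> 0"
  shows "sheet_unit k j \<zeta> \<noteq> 0"
  using sheet_unit_mult[OF assms] by (cases j) auto

text \<open>
  The expansion \<open>sheet_unit_eq\<close> shows that the unit and its inverse, which belongs to
  the other sign, both have the form \<open>disc_fun\<close>.
\<close>
lemma sheet_unit_power_in_class:
  assumes k: "k > 1" and m: "0 < \<mu>" "\<mu> \<le> 1"
  obtains U where "U \<in> disc_class k \<mu>" "\<And>j \<zeta>. \<zeta> \<in> sphere 0 1 \<Longrightarrow> side k j U \<zeta> = sheet_unit k j \<zeta> powi a"
proof -
  define u where "u s = disc_fun k (\<lambda>\<zeta>. 1 - 2 * \<zeta> / of_real (modq k)) (\<lambda>_. s * (- 2 / of_real (modq k)))" for s :: complex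
  have u: "u s \<in> disc_class k \<mu>" for s
  proof -
    have "hoelder_on \<mu> (sphere 0 1) (\<lambda>\<zeta>. 1 + (- (2 / of_real (modq k))) * \<zeta>)"
      by (intro hoelder_on_add hoelder_on_const hoelder_on_mult id_hoelder) (use m in auto)
    hence "hoelder_on \<mu> (sphere 0 1) (\<lambda>\<zeta>. 1 - 2 * \<zeta> / of_real (modq k))" by simp
    moreover have "complex_of_real (modq k) \<noteq> 0" using modq(1)[OF k] by simp
    ultimately show ?thesis unfolding u_def
      by (intro disc_fun_in_class[OF k m] hoelder_on_const) (auto intro!: holomorphic_intros continuous_intros)
  qed
  have s1: "side k j (u 1) \<zeta> = sheet_unit k j \<zeta>" and s2: "side k j (u (- 1)) \<zeta> = inverse (sheet_unit k j \<zeta>)" if z: "\<zeta> \<in> sphere 0 1" for j \<zeta>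
  proof -
    have z0: "\<zeta> \<noteq> 0" using z by auto
    show "side k j (u 1) \<zeta> = sheet_unit k j \<zeta>"
      unfolding u_def side_disc_fun[OF k z] sheet_unit_eq[OF k z0] by simp
    define j' where "j' = (if j = S1 then S2 else S1)"
    have "side k j (u (- 1)) \<zeta> = sheet_unit k j' \<zeta>"
      unfolding u_def side_disc_fun[OF k z] sheet_unit_eq[OF k z0] j'_def by (cases j) auto
    also have "\<dots> = inverse (sheet_unit k j \<zeta>)"
      using sheet_unit_mult[OF k z0] unfolding j'_def
      by (cases j) (auto simp: inverse_unique mult.commute[of "sheet_unit k S2 \<zeta>"] intro: inverse_unique[symmetric])
    finally show "side k j (u (- 1)) \<zeta> = inverse (sheet_unit k j \<zeta>)" .
  qed
  show ?thesis
  proof (cases "a \<ge> 0")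
    case True
    show ?thesis
      by (rule that[OF disc_class_power[OF u[of 1] m(1), of "nat a"]])
        (use s1 True in \<open>simp add: side_def power_int_def\<close>)
  next
    case False
    show ?thesis
      by (rule that[OF disc_class_power[OF u[of "-1"] m(1), of "nat (- a)"]])
        (use s2 False in \<open>simp add: side_def power_int_def\<close>)
  qed
qed

text \<open>
  Factors of this form are closed under inversion: negate both functions in the exponent and the
  power of the unit.
\<close>
lemma factor_with_sides:
  assumes k: "k > 1" and m: "0 < \<mu>" "\<mu> \<le> 1"
    and A: "A holomorphic_on ball 0 1" "continuous_on (cball 0 1) A" "hoelder_on \<mu> (sphere 0 1) A"
    and g: "g holomorphic_on ball 0 1" "continuous_on (cball 0 1) g" "hoelder_on \<mu> (sphere 0 1) g"
  obtains F where "F \<in> invertibles k (holder_plus k \<mu>)"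
    "\<And>j \<zeta>. \<zeta> \<in> sphere 0 1 \<Longrightarrow> side k j F \<zeta>
       = exp (A \<zeta> + sheet_sign j * (\<zeta> * root_out (modq k) \<zeta>) * g \<zeta>) * sheet_unit k j \<zeta> powi a"
proof -
  obtain U where U: "U \<in> disc_class k \<mu>" "\<And>j \<zeta>. \<zeta> \<in> sphere 0 1 \<Longrightarrow> side k j U \<zeta> = sheet_unit k j \<zeta> powi a"
    by (rule sheet_unit_power_in_class[OF k m, of a]) blast
  obtain V where V: "V \<in> disc_class k \<mu>" "\<And>j \<zeta>. \<zeta> \<in> sphere 0 1 \<Longrightarrow> side k j V \<zeta> = sheet_unit k j \<zeta> powi (- a)"
    by (rule sheet_unit_power_in_class[OF k m, of "- a"]) blast
  let ?F = "disc_fun k A g" and ?G = "disc_fun k (\<lambda>\<zeta>. - 1 * A \<zeta>) (\<lambda>\<zeta>. - 1 * g \<zeta>)"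
  have F: "?F \<in> disc_class k \<mu>" by (rule disc_fun_in_class[OF k m A g])
  have G: "?G \<in> disc_class k \<mu>"
    by (rule disc_fun_in_class[OF k m]; intro holomorphic_intros continuous_intros hoelder_on_mult hoelder_on_const A g)
      (use m in auto)
  have "(\<lambda>P. exp (?F P) * U P) \<in> holder_plus k \<mu>" "(\<lambda>P. exp (?G P) * V P) \<in> holder_plus k \<mu>"
    by (intro disc_class_holder_plus[OF k] disc_class_mult disc_class_exp F G U V m)+
  moreover have inv: "exp (?F P) * U P * (exp (?G P) * V P) = 1" if "P = contour_point k j (line_pt \<zeta>)" "\<zeta> \<in> sphere 0 1" for P j \<zeta>
  proof -
    have z0: "\<zeta> \<noteq> 0" using that(2) by auto
    have "U P * V P = 1"
      using U(2)[OF that(2), of j] V(2)[OF that(2), of j] sheet_unit_nonzero[OF k z0, of j]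
      unfolding that(1) by (simp add: side_def power_int_minus)
    moreover have "exp (?F P) * exp (?G P) = 1" by (simp add: disc_fun_def exp_add[symmetric])
    ultimately show ?thesis by (metis mult.assoc mult.left_commute mult_1)
  qed
  moreover have "\<forall>P\<in>Gamma_curve k. exp (?F P) * U P * (exp (?G P) * V P) = 1"
    unfolding in_Gamma_iff[OF k] using inv[OF refl] by blast
  ultimately have "(\<lambda>P. exp (?F P) * U P) \<in> invertibles k (holder_plus k \<mu>)"
    unfolding invertibles_def by (intro CollectI conjI bexI[of _ "\<lambda>P. exp (?G P) * V P"])
  moreover have "side k j (\<lambda>P. exp (?F P) * U P) \<zeta>
       = exp (A \<zeta> + sheet_sign j * (\<zeta> * root_out (modq k) \<zeta>) * g \<zeta>) * sheet_unit k j \<zeta> powi a"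
    if "\<zeta> \<in> sphere 0 1" for j \<zeta>
    using side_disc_fun[OF k that, of j A g] U(2)[OF that, of j] unfolding side_def by (simp only:)
  ultimately show ?thesis by (rule that)
qed

text \<open>The reflection is \<zeta> \<mapsto> 1/\<zeta> on the circle.\<close>
lemma side_reflect:
  assumes k: "k > 1" and z: "\<zeta> \<in> sphere 0 1"
  shows "side k j (\<lambda>P. F (reflect P)) \<zeta> = side k j F (1 / \<zeta>)"
proof -
  have "cayley (map_option uminus (line_pt \<zeta>)) = 1 / \<zeta>"
    using z by (simp add: cayley_uminus cayley_line_pt)
  hence "line_pt (1 / \<zeta>) = map_option uminus (line_pt \<zeta>)" by (metis line_pt_cayley)
  thus ?thesis by (simp add: side_def reflect_contour_point[OF k])
qed

text \<open>
  The congruence for \<beta> provides the integers b and p, and a = n + b makes both paths close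
  up. The mean of d vanishes by the choice of b and p.
\<close>
lemma closed_logarithms_on_circle:
  assumes k: "k > 1" and m: "0 < \<mu>" and f: "f \<in> invertibles k (holder_Gamma k \<mu>)"
    and ind: "ind_Gamma k f = 0"
    and beta: "beta_class k f = mod_lattice k (2 * (ind_contour k S1 f + 1) * of_real (ell_K k))"
  obtains E d and a b :: int where "continuous_on (sphere 0 1) E" "continuous_on (sphere 0 1) d"
    "integral {0..1} (\<lambda>t. d (circ t) * of_real (weight (modq k) t)) = 0"
    "\<And>j \<zeta>. \<zeta> \<in> sphere 0 1 \<Longrightarrow> side k j f \<zeta> = exp (E \<zeta> + sheet_sign j * d \<zeta>)
       * sheet_unit k j \<zeta> powi a * sheet_unit k j (1 / \<zeta>) powi b
       * (alpha_const k * (1 + sheet_sign j * root_out (modq k) \<zeta>))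
       * (alpha_const k * (1 + sheet_sign j * root_in (modq k) \<zeta>))"
proof -
  define q where "q = modq k"
  define c where "c = circle_path q 1"
  have q: "0 < q" "q < 1" using modq[OF k] by (auto simp: q_def)
  obtain e where ec: "\<And>j. continuous_on {0..1} (e j)"
    and ee: "\<And>j t. t \<in> {0..1} \<Longrightarrow> exp (e j t) = f (contour_point k j (line_loop t))"
    and ei: "\<And>j. e j 1 - e j 0 = 2 * of_real pi * \<i> * ind_contour k j f"
    by (rule logarithm_along_contour[OF k m f]) blast
  have cc: "continuous_on {0..1} c" unfolding c_def by (rule circle_path_continuous_time[OF q])
  note cs = ec cc continuous_on_flip01[OF cc]
  let ?W = "\<lambda>t. complex_of_real (weight (modq k) t)"
  define \<beta> where "\<beta> = of_real (k / (1 + k)) * integral {0..1} (\<lambda>t. (e S1 t - e S2 t) * ?W t)"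
  have "exp (e S1 1 - e S1 0) = 1"
  proof -
    have "exp (e S1 1) = exp (e S1 0)" using ee[of 1 S1] ee[of 0 S1] by (simp add: line_loop_def)
    thus ?thesis by (simp add: exp_diff)
  qed
  then obtain N :: int where N: "e S1 1 - e S1 0 = of_int N * (2 * of_real pi * \<i>)"
    using continuous_2pi_multiple_const[of "{0::real}" "\<lambda>_. e S1 1 - e S1 0"] by auto
  have n: "ind_contour k S1 f = of_int N"
  proof -
    have "2 * of_real pi * \<i> * ind_contour k S1 f = 2 * of_real pi * \<i> * of_int N"
      using N ei[of S1] by (simp only: mult_ac)
    moreover have "2 * of_real pi * \<i> \<noteq> 0" by simp
    ultimately show ?thesis using mult_left_cancel by blast
  qed
  have "mod_lattice k \<beta> = mod_lattice k (2 * (of_int N + 1) * of_real (ell_K k))"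
    using beta beta_class_eq[OF k ec, where f = f] ee unfolding n \<beta>_def by simp
  then obtain b p :: int where bp: "\<beta> - 2 * (of_int N + 1) * of_real (ell_K k)
      = 4 * of_real (ell_K k) * of_int b + 2 * \<i> * of_real (ell_K' k) * of_int p"
    unfolding mod_lattice_eq_iff period_lattice_iff by blast
  \<comment> \<open>The choice forced by n = a - b.\<close>
  define a where "a = N + b"
  define h where "h t = 0 + (4 * of_int a + 2) * c t + 0 + (4 * of_int b + 2) * c (1 - t) + of_int p * (2 * of_real pi * \<i>)" for t
  \<comment> \<open>The logarithm of the constant that the product of the multipliers leaves over.\<close>
  define l where "l = ln ((1 + k) / 2 * q)"
  define d0 where "d0 t = (e S1 t - e S2 t - h t) / 2" for t
  \<comment> \<open>The term \<pi>ip compensates the one in d on the first component; on the second the two add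
    up to 2\<pi>ip.\<close>
  define E0 where "E0 t = (e S1 t + e S2 t) / 2 - of_real l + of_int p * (of_real pi * \<i>)" for t
  have ch: "continuous_on {0..1} h" unfolding h_def by (intro continuous_intros cs)
  have cd: "continuous_on {0..1} d0" unfolding d0_def by (intro continuous_intros ch ec) simp
  have cE: "continuous_on {0..1} E0" unfolding E0_def by (intro continuous_intros ec) simp
  have per: "c 1 = c 0 + \<i> * of_real pi" unfolding c_def by (rule circle_path_period) (use q in auto)
  have e1: "e S1 1 = e S1 0 + of_int N * (2 * of_real pi * \<i>)" using N by (simp add: algebra_simps)
  have e2: "e S2 1 = e S2 0 - of_int N * (2 * of_real pi * \<i>)"
  proof -
    have "ind_contour k S2 f = - of_int N" using ind n unfolding ind_Gamma_def by (simp add: add_eq_0_iff)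
    thus ?thesis using ei[of S2] by (simp add: algebra_simps)
  qed
  have per_d: "d0 0 = d0 1"
    unfolding d0_def h_def e1 e2 by (simp add: per a_def algebra_simps)
  have per_E: "E0 0 = E0 1" unfolding E0_def e1 e2 by simp
  obtain d where d: "continuous_on (sphere 0 1) d" "\<And>t. t \<in> {0..1} \<Longrightarrow> d (circ t) = d0 t"
    by (rule closed_path_to_circle[OF cd per_d]) blast
  obtain E where E: "continuous_on (sphere 0 1) E" "\<And>t. t \<in> {0..1} \<Longrightarrow> E (circ t) = E0 t"
    by (rule closed_path_to_circle[OF cE per_E]) blast
  have int: "integral {0..1} (\<lambda>t. d (circ t) * ?W t) = 0"
  proof -
    have cW: "continuous_on {0..1} ?W"
      by (intro continuous_on_of_real weight_continuous) (use q in \<open>auto simp: q_def\<close>)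
    have "of_real (k / (1 + k)) * integral {0..1} (\<lambda>t. h t * ?W t) = ((4 * of_int a + 2) + (4 * of_int b + 2)) / 2 * of_real (ell_K k)
        + 2 * \<i> * of_real (ell_K' k) * of_int p"
      using weighted_integral_of_logarithm[OF k, of "\<lambda>_. 0" "\<lambda>_. 0" "4 * of_int a + 2" "4 * of_int b + 2" p]
      unfolding h_def c_def q_def by simp
    also have "\<dots> = \<beta>" using bp unfolding a_def by (simp add: field_simps)
    finally have "of_real (k / (1 + k)) * integral {0..1} (\<lambda>t. h t * ?W t) = of_real (k / (1 + k)) * integral {0..1} (\<lambda>t. (e S1 t - e S2 t) * ?W t)"
      by (simp only: \<beta>_def)
    moreover have "complex_of_real (k / (1 + k)) \<noteq> 0" using k by (simp only: of_real_eq_0_iff) simp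
    ultimately have eq: "integral {0..1} (\<lambda>t. h t * ?W t) = integral {0..1} (\<lambda>t. (e S1 t - e S2 t) * ?W t)"
      using mult_left_cancel by blast
    have "integral {0..1} (\<lambda>t. d (circ t) * ?W t) = integral {0..1} (\<lambda>t. (1 / 2) * ((e S1 t - e S2 t) * ?W t - h t * ?W t))"
    proof (rule integral_cong)
      fix t :: real assume "t \<in> {0..1}"
      thus "d (circ t) * ?W t = (1 / 2) * ((e S1 t - e S2 t) * ?W t - h t * ?W t)"
        unfolding d(2)[OF \<open>t \<in> {0..1}\<close>] d0_def by (simp only: left_diff_distrib[symmetric]) simp
    qed
    also have "\<dots> = (1 / 2) * integral {0..1} (\<lambda>t. (e S1 t - e S2 t) * ?W t - h t * ?W t)"
      by (rule integral_mult_right)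
    also have "integral {0..1} (\<lambda>t. (e S1 t - e S2 t) * ?W t - h t * ?W t)
        = integral {0..1} (\<lambda>t. (e S1 t - e S2 t) * ?W t) - integral {0..1} (\<lambda>t. h t * ?W t)"
      by (intro Henstock_Kurzweil_Integration.integral_diff integrable_continuous_real continuous_intros ec ch cW)
    finally show ?thesis by (simp add: eq)
  qed
  have fac: "side k j f \<zeta> = exp (E \<zeta> + sheet_sign j * d \<zeta>)
       * sheet_unit k j \<zeta> powi a * sheet_unit k j (1 / \<zeta>) powi b
       * (alpha_const k * (1 + sheet_sign j * root_out (modq k) \<zeta>))
       * (alpha_const k * (1 + sheet_sign j * root_in (modq k) \<zeta>))" if z: "\<zeta> \<in> sphere 0 1" for j \<zeta>
  proof -
    obtain t where t: "t \<in> {0..1}" "\<zeta> = circ t" using ex_circ[of \<zeta>] z by auto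
    define s where "s = sheet_sign j"
    have s: "s = 1 \<or> s = -1" by (cases j) (auto simp: s_def)
    define r where "r = root_out q \<zeta>"
    define r' where "r' = root_in q \<zeta>"
    have r': "r' = root_out q (circ (1 - t))" unfolding r'_def t(2) root_out_inverse circ_flip by simp
    have z0: "\<zeta> \<noteq> 0" using z by auto
    have g1: "sheet_unit k j' (circ t) = exp (sheet_sign j' * (2 * c t))" for j' t
    proof -
      have 1: "sheet_unit k S1 (circ t) = exp (2 * c t)"
        using circle_path_exp[of q 1 t] q by (simp add: sheet_unit_def c_def q_def)
      have "sheet_unit k S2 (circ t) = inverse (sheet_unit k S1 (circ t))"
        using sheet_unit_mult[OF k, of "circ t"] by (simp add: inverse_unique)
      thus ?thesis using 1 by (cases j') (auto simp: exp_minus)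
    qed
    have pr: "Re r > 0" "Re r' > 0"
      unfolding r_def r'_def t(2) using q by (auto intro!: root_in_pos root_out_pos simp: norm_mult norm_divide)
    have nz: "1 + r \<noteq> 0" "1 + r' \<noteq> 0" using pr by (auto simp: complex_eq_iff)
    have M1: "(1 + r) * (1 + r') = of_real q * exp (c t + c (1 - t))"
    proof -
      have "c t + c (1 - t) = of_real (- ln q) + (Ln (1 + r) + Ln (1 + r'))"
        unfolding c_def circle_path_def r_def t(2) r' by (simp add: algebra_simps)
      also have "exp \<dots> = of_real (inverse q) * ((1 + r) * (1 + r'))"
        using nz q by (simp only: exp_add exp_of_real exp_minus exp_ln) (simp add: exp_Ln)
      finally show ?thesis using q by simp
    qed
    have M2: "(1 - r) * (1 - r') = of_real q * exp (- (c t + c (1 - t)))"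
    proof -
      have "(1 - r) * (1 - r') * ((1 + r) * (1 + r')) = (1 - r\<^sup>2) * (1 - r'\<^sup>2)"
        by (simp add: power2_eq_square algebra_simps)
      also have "\<dots> = of_real q * of_real q"
        unfolding r_def r'_def root_out_square root_in_square using z0 by simp
      finally have P: "(1 - r) * (1 - r') * (of_real q * exp (c t + c (1 - t))) = of_real q * of_real q"
        unfolding M1 .
      have "x = Q * exp (- u)" if "x * (Q * exp u) = Q * Q" "Q \<noteq> 0" for x Q u :: complex
        using that by (simp add: exp_minus field_simps)
      from this[OF P] show ?thesis using q by simp
    qed
    have M: "(1 + s * r) * (1 + s * r') = of_real q * exp (s * (c t + c (1 - t)))"
      using s M1 M2 by auto
    have C: "alpha_const k * alpha_const k * of_real q = exp (of_real l)"
    proof -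
      have "alpha_const k * alpha_const k = of_real ((1 + k) / 2)"
        unfolding alpha_const_def of_real_mult[symmetric] using k by (subst real_sqrt_mult_self) simp
      moreover have "exp l = (1 + k) / 2 * q" unfolding l_def using k q by (intro exp_ln) auto
      ultimately show ?thesis by (simp only: exp_of_real of_real_mult)
    qed
    have "exp (E \<zeta> + s * d \<zeta>) * sheet_unit k j \<zeta> powi a * sheet_unit k j (1 / \<zeta>) powi b
       * (alpha_const k * (1 + s * r)) * (alpha_const k * (1 + s * r'))
      = exp (E0 t + s * d0 t) * exp (s * (2 * c t)) powi a * exp (s * (2 * c (1 - t))) powi b
        * (alpha_const k * alpha_const k * ((1 + s * r) * (1 + s * r')))"
      unfolding t(2) circ_flip[symmetric] g1 d(2)[OF t(1)] E(2)[OF t(1)] s_def by (simp only: mult_ac)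
    also have "\<dots> = exp (E0 t + s * d0 t) * exp (of_int a * (s * (2 * c t))) * exp (of_int b * (s * (2 * c (1 - t))))
        * (exp (of_real l) * exp (s * (c t + c (1 - t))))"
      unfolding exp_power_int M C[symmetric] by (simp only: mult_ac)
    also have "\<dots> = exp (E0 t + s * d0 t + of_int a * (s * (2 * c t)) + of_int b * (s * (2 * c (1 - t)))
        + (of_real l + s * (c t + c (1 - t))))"
      by (simp only: exp_add)
    also have "\<dots> = exp (e j t)"
    proof (cases j)
      case S1
      show ?thesis unfolding s_def S1 d0_def E0_def h_def by (simp add: field_simps)
    next
      case S2
      have "E0 t + s * d0 t + of_int a * (s * (2 * c t)) + of_int b * (s * (2 * c (1 - t)))
        + (of_real l + s * (c t + c (1 - t))) = e j t + 2 * of_int p * of_real pi * \<i>"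
        unfolding s_def S2 d0_def E0_def h_def by (simp add: field_simps)
      moreover have "exp (2 * of_int p * of_real pi * \<i>) = 1"
        using exp_two_pi_i exp_integer_2pi[of "of_int p"] by (simp add: mult_ac)
      ultimately show ?thesis by (simp only: exp_add mult_1_right)
    qed
    also have "\<dots> = side k j f \<zeta>"
      unfolding ee[OF t(1)] side_def t(2) line_pt_circ[OF t(1)] ..
    finally show ?thesis unfolding s_def r_def r'_def q_def by simp
  qed
  show ?thesis by (rule that[OF E(1) d(1) int fac])
qed

text \<open>
  Exponentials of E \<plusminus> d are quotients of Hoelder functions, so E and d are Hoelder. The
  additive splitting of E gives the even parts of the logarithms of the factors; the splitting of
  d divided by both roots gives the odd parts.
\<close>
lemma beta_imp_factorization:
  assumes k: "k > 1" and m: "0 < \<mu>" "\<mu> < 1" and f: "f \<in> invertibles k (holder_Gamma k \<mu>)"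
    and ind: "ind_Gamma k f = 0"
    and beta: "beta_class k f = mod_lattice k (2 * (ind_contour k S1 f + 1) * of_real (ell_K k))"
  obtains Fp Fm where "M_special_factorization k \<mu> f Fp Fm"
proof -
  define q where "q = modq k"
  have q: "0 < q" "q < 1" using modq[OF k] by (auto simp: q_def)
  let ?o = "root_out q" and ?i = "root_in q"
  obtain E d and a b :: int where E: "continuous_on (sphere 0 1) E" and d: "continuous_on (sphere 0 1) d"
    and int: "integral {0..1} (\<lambda>t. d (circ t) * of_real (weight q t)) = 0"
    and fac: "\<And>j \<zeta>. \<zeta> \<in> sphere 0 1 \<Longrightarrow> side k j f \<zeta> = exp (E \<zeta> + sheet_sign j * d \<zeta>)
       * sheet_unit k j \<zeta> powi a * sheet_unit k j (1 / \<zeta>) powi b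
       * (alpha_const k * (1 + sheet_sign j * ?o \<zeta>)) * (alpha_const k * (1 + sheet_sign j * ?i \<zeta>))"
    by (rule closed_logarithms_on_circle[OF k m(1) f ind beta]) (unfold q_def, blast)
  have m': "\<mu> \<le> 1" using m by simp
  have ho: "hoelder_on \<mu> (sphere 0 1) ?o" unfolding q_def by (rule root_out_hoelder[OF k m(1) m'])
  have hi: "hoelder_on \<mu> (sphere 0 1) ?i"
    unfolding q_def by (rule hoelder_on_subset[OF root_in_hoelder[OF k m(1) m']]) auto
  have rp: "Re (?o \<zeta>) > 0" "Re (?i \<zeta>) > 0" if "\<zeta> \<in> sphere 0 1" for \<zeta>
    using q that by (auto intro!: root_in_pos root_out_pos simp: norm_mult norm_divide)
  have rnz: "?o \<zeta> \<noteq> 0" "?i \<zeta> \<noteq> 0" if "\<zeta> \<in> sphere 0 1" for \<zeta>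
    using rp[OF that] by auto
  have hs: "hoelder_on \<mu> (sphere 0 1) (\<lambda>\<zeta>. E \<zeta> + sheet_sign j * d \<zeta>)" for j
  proof (rule hoelder_on_log)
    define B where "B \<zeta> = sheet_unit k j \<zeta> powi a * sheet_unit k j (1 / \<zeta>) powi b
       * (alpha_const k * (1 + sheet_sign j * ?o \<zeta>)) * (alpha_const k * (1 + sheet_sign j * ?i \<zeta>))" for \<zeta>
    have hg: "hoelder_on \<mu> (sphere 0 1) (\<lambda>\<zeta>. sheet_unit k j \<zeta> powi n)" for n
    proof (rule hoelder_on_power_int)
      have "hoelder_on \<mu> (sphere 0 1) (\<lambda>\<zeta>. (- 1 / of_real q) * \<zeta> * ((1 + sheet_sign j * ?o \<zeta>) * (1 + sheet_sign j * ?o \<zeta>)))"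
        by (intro hoelder_on_mult hoelder_on_add hoelder_on_const id_hoelder ho) (use m in auto)
      thus "hoelder_on \<mu> (sphere 0 1) (sheet_unit k j)"
        unfolding sheet_unit_def[abs_def] q_def by (simp add: power2_eq_square)
      show "sheet_unit k j x \<noteq> 0" if "x \<in> sphere 0 1" for x by (rule sheet_unit_nonzero[OF k]) (use that in auto)
    qed (use m in auto)
    have hB: "hoelder_on \<mu> (sphere 0 1) B"
      unfolding B_def
      by (intro hoelder_on_mult hoelder_on_add hoelder_on_const ho hi hg hoelder_on_circle_inverse[OF hg]) (use m in auto)
    have hf: "hoelder_on \<mu> (sphere 0 1) (side k j f)"
      using f unfolding invertibles_def by (auto simp: holder_Gamma_iff_side)
    have eq: "side k j f \<zeta> = exp (E \<zeta> + sheet_sign j * d \<zeta>) * B \<zeta>" if "\<zeta> \<in> sphere 0 1" for \<zeta>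
      unfolding fac[OF that] B_def by (simp only: mult.assoc)
    have B0: "B \<zeta> \<noteq> 0" if z: "\<zeta> \<in> sphere 0 1" for \<zeta>
    proof
      assume "B \<zeta> = 0"
      hence "side k j f \<zeta> = 0" using eq[OF z] by simp
      moreover obtain g where g: "\<forall>P\<in>Gamma_curve k. f P * g P = 1" using f by (auto simp: invertibles_def)
      hence "f (contour_point k j (line_pt \<zeta>)) * g (contour_point k j (line_pt \<zeta>)) = 1"
        using z unfolding in_Gamma_iff[OF k] by blast
      ultimately show False by (simp add: side_def)
    qed
    have "hoelder_on \<mu> (sphere 0 1) (\<lambda>\<zeta>. side k j f \<zeta> * inverse (B \<zeta>))"
      by (intro hoelder_on_mult hoelder_on_inverse hB hf B0) (use m in auto)
    thus "hoelder_on \<mu> (sphere 0 1) (\<lambda>\<zeta>. exp (E \<zeta> + sheet_sign j * d \<zeta>))"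
      by (subst (asm) hoelder_on_cong[where \<psi> = "\<lambda>\<zeta>. exp (E \<zeta> + sheet_sign j * d \<zeta>)"]) (auto simp: eq B0)
    show "continuous_on (sphere 0 1) (\<lambda>\<zeta>. E \<zeta> + sheet_sign j * d \<zeta>)" by (intro continuous_intros E d)
  qed (use m in auto)
  have hE: "hoelder_on \<mu> (sphere 0 1) E"
  proof -
    have "hoelder_on \<mu> (sphere 0 1) (\<lambda>\<zeta>. (1 / 2) * ((E \<zeta> + sheet_sign S1 * d \<zeta>) + (E \<zeta> + sheet_sign S2 * d \<zeta>)))"
      by (intro hoelder_on_mult hoelder_on_const hoelder_on_add hs) (use m in auto)
    thus ?thesis by simp
  qed
  have hd: "hoelder_on \<mu> (sphere 0 1) d"
  proof -
    have "hoelder_on \<mu> (sphere 0 1) (\<lambda>\<zeta>. (1 / 2) * ((E \<zeta> + sheet_sign S1 * d \<zeta>) + (- 1) * (E \<zeta> + sheet_sign S2 * d \<zeta>)))"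
      by (intro hoelder_on_mult hoelder_on_const hoelder_on_add hs) (use m in auto)
    thus ?thesis by simp
  qed
  have h\<psi>: "hoelder_on \<mu> (sphere 0 1) (\<lambda>\<zeta>. d \<zeta> * (inverse (?o \<zeta>) * inverse (?i \<zeta>)))"
    by (intro hoelder_on_mult hoelder_on_inverse hd ho hi rnz) (use m in auto)
  obtain A B where A: "A holomorphic_on ball 0 1" "hoelder_on \<mu> (cball 0 1) A"
    and B: "B holomorphic_on ball 0 1" "hoelder_on \<mu> (cball 0 1) B"
    and AB: "\<And>w. w \<in> sphere 0 1 \<Longrightarrow> E w = A w + B (1 / w)"
    by (rule plemelj_privalov[OF hE m]) blast
  obtain A2 B2 where A2: "A2 holomorphic_on ball 0 1" "hoelder_on \<mu> (cball 0 1) A2"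
    and B2: "B2 holomorphic_on ball 0 1" "hoelder_on \<mu> (cball 0 1) B2"
    and A20: "A2 0 = integral {0..1} (\<lambda>t. d (circ t) * (inverse (?o (circ t)) * inverse (?i (circ t))))" and B20: "B2 0 = 0"
    and AB2: "\<And>w. w \<in> sphere 0 1 \<Longrightarrow> d w * (inverse (?o w) * inverse (?i w)) = A2 w + B2 (1 / w)"
    by (rule plemelj_privalov[OF h\<psi> m]) blast
  have "inverse (?o (circ t)) * inverse (?i (circ t)) = of_real (weight q t)" for t
    unfolding weight_eq[OF q] by (simp add: field_simps)
  hence A20': "A2 0 = 0" using A20 int by simp
  obtain A3 where A3: "A3 holomorphic_on ball 0 1" "continuous_on (cball 0 1) A3" "hoelder_on \<mu> (sphere 0 1) A3"
    "\<And>z. z \<in> cball 0 1 \<Longrightarrow> A2 z = z * A3 z"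
    by (rule divide_by_coordinate[OF A2 A20' m(1) m']) blast
  obtain B3 where B3: "B3 holomorphic_on ball 0 1" "continuous_on (cball 0 1) B3" "hoelder_on \<mu> (sphere 0 1) B3"
    "\<And>z. z \<in> cball 0 1 \<Longrightarrow> B2 z = z * B3 z"
    by (rule divide_by_coordinate[OF B2 B20 m(1) m']) blast
  have i: "?i holomorphic_on ball 0 1" "continuous_on (cball 0 1) ?i"
  proof -
    show "continuous_on (cball 0 1) ?i"
      unfolding q_def by (rule hoelder_on_continuous[OF root_in_hoelder[OF k m(1) m'] m(1)])
    have "norm (of_real q * \<zeta>) < 1" if "norm \<zeta> < 1" for \<zeta> :: complex
      unfolding q_def by (rule modq_small(1)[OF k]) (use that in simp)
    thus "?i holomorphic_on ball 0 1" by (intro root_in_holomorphic holomorphic_intros) auto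
  qed
  \<comment> \<open>The inner and the outer root are exchanged by \<zeta> \<mapsto> 1/\<zeta>, so that both
    terms have the form of an odd function on the upper half.\<close>
  have d_eq: "d \<zeta> = \<zeta> * ?o \<zeta> * (A3 \<zeta> * ?i \<zeta>) + (1 / \<zeta>) * ?o (1 / \<zeta>) * (B3 (1 / \<zeta>) * ?i (1 / \<zeta>))"
    if z: "\<zeta> \<in> sphere 0 1" for \<zeta>
  proof -
    have "d \<zeta> = ?o \<zeta> * ?i \<zeta> * (d \<zeta> * (inverse (?o \<zeta>) * inverse (?i \<zeta>)))"
      using rnz[OF z] by (simp add: field_simps)
    also have "\<dots> = ?o \<zeta> * ?i \<zeta> * (\<zeta> * A3 \<zeta> + (1 / \<zeta>) * B3 (1 / \<zeta>))"
      unfolding AB2[OF z] using A3(4)[of \<zeta>] B3(4)[of "1 / \<zeta>"] z by (simp add: norm_divide)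
    also have "?o (1 / \<zeta>) = ?i \<zeta>" "?i (1 / \<zeta>) = ?o \<zeta>"
      by (simp_all add: root_out_def root_in_def)
    ultimately show ?thesis by (simp add: algebra_simps)
  qed
  note hcs = hoelder_on_continuous[OF _ m(1)] hoelder_on_subset[where S = "cball 0 1" and T = "sphere 0 1"]
  obtain F where F: "F \<in> invertibles k (holder_plus k \<mu>)"
    "\<And>j \<zeta>. \<zeta> \<in> sphere 0 1 \<Longrightarrow> side k j F \<zeta>
       = exp (A \<zeta> + sheet_sign j * (\<zeta> * ?o \<zeta>) * (A3 \<zeta> * ?i \<zeta>)) * sheet_unit k j \<zeta> powi a"
    unfolding q_def
    by (rule factor_with_sides[OF k m(1) m' A(1) hcs(1)[OF A(2)] hcs(2)[OF A(2)]
        holomorphic_on_mult[OF A3(1) i(1)] continuous_on_mult[OF A3(2) i(2)] hoelder_on_mult[OF A3(3) hi], where a = a])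
      (use m in \<open>auto simp: q_def\<close>)
  obtain H where H: "H \<in> invertibles k (holder_plus k \<mu>)"
    "\<And>j \<zeta>. \<zeta> \<in> sphere 0 1 \<Longrightarrow> side k j H \<zeta>
       = exp (B \<zeta> + sheet_sign j * (\<zeta> * ?o \<zeta>) * (B3 \<zeta> * ?i \<zeta>)) * sheet_unit k j \<zeta> powi b"
    unfolding q_def
    by (rule factor_with_sides[OF k m(1) m' B(1) hcs(1)[OF B(2)] hcs(2)[OF B(2)]
        holomorphic_on_mult[OF B3(1) i(1)] continuous_on_mult[OF B3(2) i(2)] hoelder_on_mult[OF B3(3) hi], where a = b])
      (use m in \<open>auto simp: q_def\<close>)
  have "f P = (F P * alpha_plus k P) * (alpha_minus k P * H (reflect P))"
    if z: "\<zeta> \<in> sphere 0 1" and P: "P = contour_point k j (line_pt \<zeta>)" for P j \<zeta>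
  proof -
    let ?s = "sheet_sign j"
    have z': "1 / \<zeta> \<in> sphere 0 1" using z by (simp add: norm_divide)
    have cz: "cayley (line_pt \<zeta>) = \<zeta>" using z by (intro cayley_line_pt) simp
    have "f P = side k j f \<zeta>" by (simp add: side_def P)
    also have "\<dots> = exp ((A \<zeta> + ?s * (\<zeta> * ?o \<zeta>) * (A3 \<zeta> * ?i \<zeta>))
        + (B (1 / \<zeta>) + ?s * (1 / \<zeta> * ?o (1 / \<zeta>)) * (B3 (1 / \<zeta>) * ?i (1 / \<zeta>))))
       * sheet_unit k j \<zeta> powi a * sheet_unit k j (1 / \<zeta>) powi b
       * (alpha_const k * (1 + ?s * ?o \<zeta>)) * (alpha_const k * (1 + ?s * ?i \<zeta>))"
    proof -
      have "E \<zeta> + ?s * d \<zeta> = (A \<zeta> + ?s * (\<zeta> * ?o \<zeta>) * (A3 \<zeta> * ?i \<zeta>))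
        + (B (1 / \<zeta>) + ?s * (1 / \<zeta> * ?o (1 / \<zeta>)) * (B3 (1 / \<zeta>) * ?i (1 / \<zeta>)))"
        unfolding AB[OF z] d_eq[OF z] by (simp only: distrib_left add_ac mult.assoc)
      thus ?thesis unfolding fac[OF z] by (simp only:)
    qed
    also have "\<dots> = (side k j F \<zeta> * (alpha_const k * (1 + ?s * ?o \<zeta>)))
        * ((alpha_const k * (1 + ?s * ?i \<zeta>)) * side k j H (1 / \<zeta>))"
      unfolding F(2)[OF z] H(2)[OF z'] exp_add[of "A \<zeta> + ?s * (\<zeta> * ?o \<zeta>) * (A3 \<zeta> * ?i \<zeta>)"] by (simp only: mult_ac)
    also have "side k j H (1 / \<zeta>) = H (reflect P)"
      unfolding side_reflect[OF k z, symmetric] by (simp add: side_def P)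
    also have "side k j F \<zeta> = F P" by (simp add: side_def P)
    finally show ?thesis unfolding P alpha_contour[OF k] cz q_def .
  qed
  hence "\<forall>P\<in>Gamma_curve k. f P = (F P * alpha_plus k P) * (alpha_minus k P * H (reflect P))"
    unfolding in_Gamma_iff[OF k] by blast
  hence "M_special_factorization k \<mu> f F (\<lambda>P. H (reflect P))"
    unfolding M_special_factorization_def using F(1) invertibles_reflect(1)[OF k H(1)] by blast
  thus ?thesis by (rule that)
qed

theorem theorem5p5:
  fixes k0 \<mu> :: real and f :: "curve_point \<Rightarrow> complex"
  assumes "k0 > 1" and "0 < \<mu>" and "\<mu> < 1"
    and "f \<in> invertibles k0 (holder_Gamma k0 \<mu>)"
    and "ind_Gamma k0 f = 0"
  shows "(\<exists>Fp Fm. M_special_factorization k0 \<mu> f Fp Fm) \<longleftrightarrow>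
    (let n = ind_contour k0 S1 f
     in beta_class k0 f = mod_lattice k0 (2 * (n + 1) * of_real (ell_K k0)))"
  unfolding Let_def
proof
  assume "\<exists>Fp Fm. M_special_factorization k0 \<mu> f Fp Fm"
  thus "beta_class k0 f = mod_lattice k0 (2 * (ind_contour k0 S1 f + 1) * of_real (ell_K k0))"
    using factorization_imp_beta[OF assms(1,2,4,5)] by blast
next
  assume "beta_class k0 f = mod_lattice k0 (2 * (ind_contour k0 S1 f + 1) * of_real (ell_K k0))"
  thus "\<exists>Fp Fm. M_special_factorization k0 \<mu> f Fp Fm"
    using beta_imp_factorization[OF assms] by blast
qed

end
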